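(* Let $d=2$ and let $G=\Sigma\rtimes H\in\mathcal{E}$ with $1\le\dim\Sigma\le 2$. Then there exists $g\in Sp(2,\mathbb{R})$ such that $gGg^{-1}$ is one of the following groups, each of which is in $\mathcal{E}$ and none of which is conjugate (within $Sp(2,\mathbb{R})$) to any other. Two-dimensional groups: (2.1) $\Sigma_1\rtimes H_\alpha(\sigma_1)$, $\alpha\in[0,+\infty]$; (2.2) $\Sigma_2\rtimes H_\alpha(\sigma_2)$, $\alpha\in[0,+\infty]$; (2.3) $\Sigma_3\rtimes H_0(\sigma_3)$; (2.4) $\Sigma_3\rtimes H_1(\sigma_3)$; (2.5) $\Sigma_3\rtimes H_{\alpha,0}(\sigma_3)$, $\alpha\in[-1,0]$. Three-dimensional groups: (3.1) $\Sigma_1\rtimes H^0(\sigma_1)$; (3.2) $\Sigma_2\rtimes H^0(\sigma_2)$; (3.3) $\Sigma_3\rtimes K_0(\sigma_3)$; (3.4) $\Sigma_3\rtimes K_\infty(\sigma_3)$; (3.5) $\Sigma_3\rtimes L_\gamma(\sigma_3)$, $\gamma\in\mathbb{R}$; (3.6) $\Sigma_1^\perp\rtimes H_\alpha(\sigma_1)$, $\alpha\in[0,+\infty]$; (3.7) $\Sigma_2^\perp\rtimes H_\alpha(\sigma_2)$, $\alpha\in[0,+\infty]$; (3.8) $\Sigma_3^\perp\rtimes{}^tH_0(\sigma_3)$; (3.9) $\Sigma_3^\perp\rtimes{}^tH_1(\sigma_3)$. Four-dimensional groups: (4.1) $\Sigma_3\rtimes H^0(\sigma_3)$; (4.2) $\Sigma_1^\perp\rtimes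 H^0(\sigma_1)$; (4.3) $\Sigma_2^\perp\rtimes H^0(\sigma_2)$; (4.4) $\Sigma_3^\perp\rtimes{}^tL_\gamma(\sigma_3)$, $\gamma\in[-1,0]$. Five-dimensional groups: (5.1) $\Sigma_3^\perp\rtimes{}^tH^0(\sigma_3)$.
   Context: $Sp(d,\mathbb{R})=\{g\in GL(2d,\mathbb{R}): {}^tgJg=J\}$ with $J=\begin{bmatrix}0&I\\ -I&0\end{bmatrix}$; ${}^t$ denotes transposition. $\mathrm{Sym}(d,\mathbb{R})$ is the space of real symmetric $d\times d$ matrices with inner product $\langle\sigma,\tau\rangle=\mathrm{tr}(\sigma\tau)$, and $\perp$ denotes orthogonal complement in it. For $h\in GL(d,\mathbb{R})$ put $h^\sharp={}^th^{-1}$, and for $\sigma\in\mathrm{Sym}(d,\mathbb{R})$ put $g(\sigma,h)=\begin{bmatrix}h&0\\ \sigma h&h^\sharp\end{bmatrix}\in Sp(d,\mathbb{R})$. Class $\mathcal{E}$: a group $G$ is in $\mathcal{E}$ if there are a non-zero vector subspace $\Sigma$ of $\mathrm{Sym}(d,\mathbb{R})$ and a connected nontrivial Lie subgroup $H$ of $GL(d,\mathbb{R})$ such that $G=\{g(\sigma,h):\sigma\in\Sigma,\ h\in H\}$ (being a group amounts to ${}^th^{-1}\sigma h^{-1}\in\Sigma$ for all $h\in H,\sigma\in\Sigma$). Then one writes $G=\Sigma\rtimes H$. For a subgroup $H$, ${}^tH=\{{}^th:h\in H\}$. Case $d=2$: $\sigma_1=\begin{bmatrix}1&0\\ 0&1\end{bmatrix}$,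 $\sigma_2=\begin{bmatrix}1&0\\ 0&-1\end{bmatrix}$, $\sigma_3=\begin{bmatrix}1&0\\ 0&0\end{bmatrix}$, and $\Sigma_i=\mathrm{span}\{\sigma_i\}$ for $i=1,2,3$. Thus $\Sigma_1^\perp=\{\begin{bmatrix}u&v\\ v&-u\end{bmatrix}\}$, $\Sigma_2^\perp=\{\begin{bmatrix}u&v\\ v&u\end{bmatrix}\}$, $\Sigma_3^\perp=\{\begin{bmatrix}0&v\\ v&u\end{bmatrix}\}$ with $u,v\in\mathbb{R}$. For $t\in\mathbb{R}$: $R_t=\begin{bmatrix}\cos t&\sin t\\ -\sin t&\cos t\end{bmatrix}$, $A_t=\begin{bmatrix}\cosh t&\sinh t\\ \sinh t&\cosh t\end{bmatrix}$. The following are connected Lie subgroups of $GL(2,\mathbb{R})$ ($\mathbb{R}_+$ denotes positive scalar matrices): - $H^0(\sigma_1)=SO(2)\times\mathbb{R}_+$; $H_\infty(\sigma_1)=SO(2)=\{R_\theta:\theta\in\mathbb R\}$; $H_\alpha(\sigma_1)=\{e^tR_{\alpha t}:t\in\mathbb{R}\}$ for $\alpha\in\mathbb{R}$. - $H^0(\sigma_2)=SO^0(1,1)\times\mathbb{R}_+$; $H_\infty(\sigma_2)=SO^0(1,1)=\{A_t:t\in\mathbb{R}\}$; $H_\alpha(\sigma_2)=\{e^tA_{\alpha t}:t\in\mathbb{R}\}$ for $\alpha\in\mathbb{R}$. - $H^0(\sigma_3)=T^0$, the identity component of the group $T=\{\begin{bmatrix}c&0\\ b&a\end{bmatrix}:a,b,c\in\mathbb{R},\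 ac\ne0\}$. - $H_0(\sigma_3)=\{\begin{bmatrix}1&0\\ t&1\end{bmatrix}:t\in\mathbb{R}\}$; $H_1(\sigma_3)=\{e^t\begin{bmatrix}1&0\\ t&1\end{bmatrix}:t\in\mathbb{R}\}$. - $H_{\gamma,0}(\sigma_3)=\{\begin{bmatrix}e^{\gamma t}&0\\ 0&e^{(\gamma+1)t}\end{bmatrix}:t\in\mathbb{R}\}$ for $\gamma\in\mathbb{R}$. - $K_0(\sigma_3)=\{\begin{bmatrix}e^t&0\\ 0&e^s\end{bmatrix}:s,t\in\mathbb{R}\}$; $K_\infty(\sigma_3)=\{\begin{bmatrix}e^t&0\\ s&e^t\end{bmatrix}:s,t\in\mathbb{R}\}$. - $L_\gamma(\sigma_3)=\{\begin{bmatrix}e^{\gamma t}&0\\ s&e^{(\gamma+1)t}\end{bmatrix}:s,t\in\mathbb{R}\}$ for $\gamma\in\mathbb{R}$. *)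

theory Defs
  imports "HOL-Analysis.Analysis" "HOL-Algebra.Group"
begin

section \<open>The general linear group and its Lie subgroups\<close>

definition GL :: "(real^'n^'n) monoid" where
  "GL = \<lparr>carrier = {A. invertible A}, mult = (**), one = mat 1\<rparr>"

lemma group_GL: "group (GL :: (real^'n^'n) monoid)"
proof (rule groupI)
  fix x :: "real^'n^'n" assume "x \<in> carrier GL"
  then show "\<exists>y\<in>carrier GL. y \<otimes>\<^bsub>GL\<^esub> x = \<one>\<^bsub>GL\<^esub>"
    unfolding GL_def by (auto simp: invertible_def)
next
  show "\<one>\<^bsub>GL\<^esub> \<in> carrier (GL :: (real^'n^'n) monoid)"
    unfolding GL_def by (auto simp: invertible_def intro: exI[of _ "mat 1"])
qed (auto simp: GL_def invertible_mult matrix_mul_assoc)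

text \<open>\<open>C_k_on k W V f\<close>: on the relatively open subset \<open>V\<close> of the subspace \<open>W\<close>, the map \<open>f\<close> is of
  class \<open>C\<^sup>k\<close>, i.e. all iterated derivatives of order at most \<open>k\<close> in directions of \<open>W\<close> exist and are
  continuous.\<close>

primrec C_k_on ::
  "nat \<Rightarrow> 'a::real_normed_vector set \<Rightarrow> 'a set \<Rightarrow> ('a \<Rightarrow> 'b::real_normed_vector) \<Rightarrow> bool" where
  "C_k_on 0 W V f \<longleftrightarrow> continuous_on V f"
| "C_k_on (Suc k) W V f \<longleftrightarrow> continuous_on V f \<and>
     (\<forall>v\<in>W. \<exists>f'. (\<forall>x\<in>V. ((\<lambda>t. f (x + t *\<^sub>R v)) has_vector_derivative f' x) (at 0)) \<and>
                 C_k_on k W V f')"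

definition smooth_immersion_on ::
  "'a::real_normed_vector set \<Rightarrow> 'a set \<Rightarrow> ('a \<Rightarrow> 'b::real_normed_vector) \<Rightarrow> bool" where
  "smooth_immersion_on W V f \<longleftrightarrow> (\<forall>k. C_k_on k W V f) \<and>
     (\<forall>x\<in>V. \<exists>D. (f has_derivative D) (at x within V) \<and> inj_on D W)"

text \<open>\<open>lie_subgroup n H T\<close>: with the topology \<open>T\<close>, which may be finer than the subspace topology, \<open>H\<close> is
  an \<open>n\<close>-dimensional (immersed) Lie subgroup of \<open>GL\<close>. The local parametrizations \<open>f\<close> are defined on
  open subsets \<open>V\<close> of an \<open>n\<close>-dimensional vector space \<open>W\<close>, which, as \<open>f\<close> is an immersion, may be taken
  inside the matrix space. A map into \<open>H\<close> is smooth iff it is continuous for \<open>T\<close> and smooth as a map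
  into the matrix space, since each \<open>f\<close> is an immersion and a homeomorphism onto a \<open>T\<close>-open set; hence
  smoothness of the coordinate changes and of the group operations need not be required
  separately.\<close>

definition lie_subgroup :: "nat \<Rightarrow> (real^'n^'n) set \<Rightarrow> (real^'n^'n) topology \<Rightarrow> bool" where
  "lie_subgroup n H T \<longleftrightarrow>
     subgroup H GL \<and> topspace T = H \<and> Hausdorff_space T \<and> second_countable T \<and>
     continuous_map (prod_topology T T) T (\<lambda>(a, b). a ** b) \<and> continuous_map T T matrix_inv \<and>
     (\<forall>p\<in>H. \<exists>(W :: (real^'n^'n) set) V f.
        subspace W \<and> dim W = n \<and> openin (top_of_set W) V \<and> smooth_immersion_on W V f \<and>
        openin T (f ` V) \<and> p \<in> f ` V \<and>
        homeomorphic_map (top_of_set V) (subtopology T (f ` V)) f)"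

definition connected_lie_subgroup :: "(real^'n^'n) set \<Rightarrow> bool" where
  "connected_lie_subgroup H \<longleftrightarrow> (\<exists>n T. lie_subgroup n H T \<and> connected_space T)"


section \<open>The symplectic group and the class \<open>\<E>\<close>\<close>

definition block_matrix ::
  "real^'d^'d \<Rightarrow> real^'d^'d \<Rightarrow> real^'d^'d \<Rightarrow> real^'d^'d \<Rightarrow> real^('d::finite + 'd)^('d + 'd)" where
  "block_matrix A B C D = (\<chi> i j.
     case i of
       Inl a \<Rightarrow> (case j of Inl b \<Rightarrow> A $ a $ b | Inr b \<Rightarrow> B $ a $ b)
     | Inr a \<Rightarrow> (case j of Inl b \<Rightarrow> C $ a $ b | Inr b \<Rightarrow> D $ a $ b))"

definition Jmat :: "real^('d::finite + 'd)^('d + 'd)" where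
  "Jmat = block_matrix 0 (mat 1) (- mat 1) 0"

definition Sp :: "(real^('d::finite + 'd)^('d + 'd)) set" where
  "Sp = {g. invertible g \<and> transpose g ** Jmat ** g = Jmat}"

definition Sym :: "(real^'d^'d) set" where
  "Sym = {\<sigma>. transpose \<sigma> = \<sigma>}"

definition sym_perp :: "(real^'d^'d) set \<Rightarrow> (real^'d^'d) set" where
  "sym_perp \<Sigma> = {\<tau> \<in> Sym. \<forall>\<sigma>\<in>\<Sigma>. trace (\<sigma> ** \<tau>) = 0}"

definition sharp :: "real^'d^'d \<Rightarrow> real^'d^'d" where
  "sharp h = matrix_inv (transpose h)"

definition gmat :: "real^'d^'d \<Rightarrow> real^'d^'d \<Rightarrow> real^('d::finite + 'd)^('d + 'd)" where
  "gmat \<sigma> h = block_matrix h 0 (\<sigma> ** h) (sharp h)"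

definition semidirect ::
  "(real^'d^'d) set \<Rightarrow> (real^'d^'d) set \<Rightarrow> (real^('d::finite + 'd)^('d + 'd)) set"  (infixl "\<rtimes>" 70) where
  "\<Sigma> \<rtimes> H = {gmat \<sigma> h | \<sigma> h. \<sigma> \<in> \<Sigma> \<and> h \<in> H}"

text \<open>\<open>class_E_pair \<Sigma> H\<close>: the pair \<open>(\<Sigma>, H)\<close> exhibits \<open>\<Sigma> \<rtimes> H\<close> as a member of the class \<open>\<E>\<close>.\<close>

definition class_E_pair :: "(real^'d^'d) set \<Rightarrow> (real^'d^'d) set \<Rightarrow> bool" where
  "class_E_pair \<Sigma> H \<longleftrightarrow>
     subspace \<Sigma> \<and> \<Sigma> \<subseteq> Sym \<and> \<Sigma> \<noteq> {0} \<and>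
     connected_lie_subgroup H \<and> H \<noteq> {mat 1} \<and>
     subgroup (\<Sigma> \<rtimes> H) GL"

definition class_E :: "(real^('d::finite + 'd)^('d + 'd)) set set" where
  "class_E = {\<Sigma> \<rtimes> H | \<Sigma> H. class_E_pair \<Sigma> H}"

definition conj_set :: "real^'n^'n \<Rightarrow> (real^'n^'n) set \<Rightarrow> (real^'n^'n) set" where
  "conj_set g G = (\<lambda>x. g ** x ** matrix_inv g) ` G"


section \<open>The subgroups and subspaces for \<open>d = 2\<close>\<close>

definition mat2 :: "real \<Rightarrow> real \<Rightarrow> real \<Rightarrow> real \<Rightarrow> real^2^2" where
  "mat2 a b c d = vector [vector [a, b], vector [c, d]]"

definition \<Sigma>\<^sub>1 :: "(real^2^2) set" where "\<Sigma>\<^sub>1 = span {mat2 1 0 0 1}"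
definition \<Sigma>\<^sub>2 :: "(real^2^2) set" where "\<Sigma>\<^sub>2 = span {mat2 1 0 0 (-1)}"
definition \<Sigma>\<^sub>3 :: "(real^2^2) set" where "\<Sigma>\<^sub>3 = span {mat2 1 0 0 0}"

definition Rmat :: "real \<Rightarrow> real^2^2" where
  "Rmat t = mat2 (cos t) (sin t) (- sin t) (cos t)"

definition Amat :: "real \<Rightarrow> real^2^2" where
  "Amat t = mat2 (cosh t) (sinh t) (sinh t) (cosh t)"

text \<open>The parameter \<open>\<alpha>\<close> ranges over \<open>\<real> \<union> {\<infinity>}\<close>; only \<open>0 \<le> \<alpha> \<le> \<infinity>\<close> is used below.\<close>

definition H\<sigma>1 :: "ereal \<Rightarrow> (real^2^2) set" where
  "H\<sigma>1 \<alpha> = (if \<alpha> = \<infinity> then range Rmat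
            else {exp t *\<^sub>R Rmat (real_of_ereal \<alpha> * t) | t. True})"

definition H\<sigma>2 :: "ereal \<Rightarrow> (real^2^2) set" where
  "H\<sigma>2 \<alpha> = (if \<alpha> = \<infinity> then range Amat
            else {exp t *\<^sub>R Amat (real_of_ereal \<alpha> * t) | t. True})"

definition H0\<sigma>1 :: "(real^2^2) set" where
  "H0\<sigma>1 = {r *\<^sub>R Rmat t | r t. r > 0}"

definition H0\<sigma>2 :: "(real^2^2) set" where
  "H0\<sigma>2 = {r *\<^sub>R Amat t | r t. r > 0}"

definition H0\<sigma>3 :: "(real^2^2) set" where
  "H0\<sigma>3 = connected_component_set {mat2 c 0 b a | a b c. a * c \<noteq> 0} (mat 1)"

definition H_zero\<sigma>3 :: "(real^2^2) set" where
  "H_zero\<sigma>3 = {mat2 1 0 t 1 | t. True}"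

definition H_one\<sigma>3 :: "(real^2^2) set" where
  "H_one\<sigma>3 = {exp t *\<^sub>R mat2 1 0 t 1 | t. True}"

definition H_diag\<sigma>3 :: "real \<Rightarrow> (real^2^2) set" where
  "H_diag\<sigma>3 \<gamma> = {mat2 (exp (\<gamma> * t)) 0 0 (exp ((\<gamma> + 1) * t)) | t. True}"

definition K_zero\<sigma>3 :: "(real^2^2) set" where
  "K_zero\<sigma>3 = {mat2 (exp t) 0 0 (exp s) | s t. True}"

definition K_inf\<sigma>3 :: "(real^2^2) set" where
  "K_inf\<sigma>3 = {mat2 (exp t) 0 s (exp t) | s t. True}"

definition L\<sigma>3 :: "real \<Rightarrow> (real^2^2) set" where
  "L\<sigma>3 \<gamma> = {mat2 (exp (\<gamma> * t)) 0 s (exp ((\<gamma> + 1) * t)) | s t. True}"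


section \<open>The list of groups\<close>

datatype label =
    L21 ereal | L22 ereal | L23 | L24 | L25 real
  | L31 | L32 | L33 | L34 | L35 real | L36 ereal | L37 ereal | L38 | L39
  | L41 | L42 | L43 | L44 real
  | L51

fun admissible :: "label \<Rightarrow> bool" where
  "admissible (L21 \<alpha>) \<longleftrightarrow> \<alpha> \<in> {0..\<infinity>}"
| "admissible (L22 \<alpha>) \<longleftrightarrow> \<alpha> \<in> {0..\<infinity>}"
| "admissible (L25 \<alpha>) \<longleftrightarrow> \<alpha> \<in> {-1..0}"
| "admissible (L36 \<alpha>) \<longleftrightarrow> \<alpha> \<in> {0..\<infinity>}"
| "admissible (L37 \<alpha>) \<longleftrightarrow> \<alpha> \<in> {0..\<infinity>}"
| "admissible (L44 \<gamma>) \<longleftrightarrow> \<gamma> \<in> {-1..0}"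
| "admissible _ \<longleftrightarrow> True"

fun grp :: "label \<Rightarrow> (real^(2 + 2)^(2 + 2)) set" where
  "grp (L21 \<alpha>) = \<Sigma>\<^sub>1 \<rtimes> H\<sigma>1 \<alpha>"
| "grp (L22 \<alpha>) = \<Sigma>\<^sub>2 \<rtimes> H\<sigma>2 \<alpha>"
| "grp L23 = \<Sigma>\<^sub>3 \<rtimes> H_zero\<sigma>3"
| "grp L24 = \<Sigma>\<^sub>3 \<rtimes> H_one\<sigma>3"
| "grp (L25 \<alpha>) = \<Sigma>\<^sub>3 \<rtimes> H_diag\<sigma>3 \<alpha>"
| "grp L31 = \<Sigma>\<^sub>1 \<rtimes> H0\<sigma>1"
| "grp L32 = \<Sigma>\<^sub>2 \<rtimes> H0\<sigma>2"
| "grp L33 = \<Sigma>\<^sub>3 \<rtimes> K_zero\<sigma>3"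
| "grp L34 = \<Sigma>\<^sub>3 \<rtimes> K_inf\<sigma>3"
| "grp (L35 \<gamma>) = \<Sigma>\<^sub>3 \<rtimes> L\<sigma>3 \<gamma>"
| "grp (L36 \<alpha>) = sym_perp \<Sigma>\<^sub>1 \<rtimes> H\<sigma>1 \<alpha>"
| "grp (L37 \<alpha>) = sym_perp \<Sigma>\<^sub>2 \<rtimes> H\<sigma>2 \<alpha>"
| "grp L38 = sym_perp \<Sigma>\<^sub>3 \<rtimes> (transpose ` H_zero\<sigma>3)"
| "grp L39 = sym_perp \<Sigma>\<^sub>3 \<rtimes> (transpose ` H_one\<sigma>3)"
| "grp L41 = \<Sigma>\<^sub>3 \<rtimes> H0\<sigma>3"
| "grp L42 = sym_perp \<Sigma>\<^sub>1 \<rtimes> H0\<sigma>1"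
| "grp L43 = sym_perp \<Sigma>\<^sub>2 \<rtimes> H0\<sigma>2"
| "grp (L44 \<gamma>) = sym_perp \<Sigma>\<^sub>3 \<rtimes> (transpose ` L\<sigma>3 \<gamma>)"
| "grp L51 = sym_perp \<Sigma>\<^sub>3 \<rtimes> (transpose ` H0\<sigma>3)"

fun grp_dim :: "label \<Rightarrow> nat" where
  "grp_dim (L21 _) = 2" | "grp_dim (L22 _) = 2" | "grp_dim L23 = 2" | "grp_dim L24 = 2"
| "grp_dim (L25 _) = 2"
| "grp_dim L31 = 3" | "grp_dim L32 = 3" | "grp_dim L33 = 3" | "grp_dim L34 = 3"
| "grp_dim (L35 _) = 3" | "grp_dim (L36 _) = 3" | "grp_dim (L37 _) = 3" | "grp_dim L38 = 3"
| "grp_dim L39 = 3"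
| "grp_dim L41 = 4" | "grp_dim L42 = 4" | "grp_dim L43 = 4" | "grp_dim (L44 _) = 4"
| "grp_dim L51 = 5"

end

theory Submission
  imports Defs
begin

text \<open>A connected Lie subgroup \<open>H\<close> of \<open>GL\<close> is controlled through its Lie algebra: functions with zero
  derivative along \<open>H\<close> are constant on it, and \<open>H\<close> fills any connected embedded group that contains it
  and has the same Lie algebra. For the classification, a congruence brings \<open>\<Sigma>\<close> (or, if its dimension is
  two, a symmetric matrix orthogonal to it) to normal form; then \<open>H\<close> preserves \<open>\<Sigma>\<close> and so lies in the
  conformal, the diagonal or the triangular group, where the subalgebras can be enumerated. Finally
  a symplectic rotation by a right angle in one of the two planes identifies the remaining duplicates.
  The groups of the list are told apart by invariants of their Lie algebras under symplectic
  conjugation: dimension, the nilpotent elements, those of rank one, semidefiniteness of \<open>J Y\<close>, traces of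
  powers, and the weight with which the algebra acts on a rank one root space compared with the trace
  form.\<close>

section \<open>Smooth maps\<close>

text \<open>The topology of \<open>H\<close> may be finer than the subspace topology, so neither
  closedness of \<open>H\<close> nor continuity of curves in it is visible in the matrix space, and
  agreement with a listed group has to be an equality of bare sets. No exponential map is used.
  Upper bounds for \<open>H\<close> come from explicit first integrals, such as a linear combination
  of the logarithms of the diagonal entries; lower bounds come from an open mapping argument for one
  chart at the identity. Both kinds of information survive conjugation, so a normal form may be
  chosen before they are applied. Light-cone coordinates make the hyperbolic groups diagonal, which
  puts them inside the triangular group. The parameter ranges reflect symmetries: a reflection or a
  swap of axes turns \<alpha> into -\<alpha>, and the symplectic rotation in one plane changes the
  sign of the second diagonal exponent; hence exponents (c, a) may be taken with c a \<le> 0, which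
  after normalising their difference to 1 is the interval [-1, 0]. Conjugate groups have conjugate
  tangent spaces, so distinctness can be decided entirely among Lie algebras.\<close>

lemma bounded_bilinear_matrix_mult:
  "bounded_bilinear ((**) :: real^'n^'m \<Rightarrow> real^'p^'n \<Rightarrow> real^'p^'m)"
  unfolding bilinear_conv_bounded_bilinear[symmetric] bilinear_def
  by (auto intro!: linearI simp: matrix_matrix_mult_def vec_eq_iff sum.distrib algebra_simps sum_distrib_left)

interpretation matrix_mult: bounded_bilinear "(**) :: real^'n^'m \<Rightarrow> real^'p^'n \<Rightarrow> real^'p^'m"
  by (rule bounded_bilinear_matrix_mult)

text \<open>Used by the product rule, where one factor stays undifferentiated while the order drops
  by one.\<close>

lemma C_k_on_SucD: "C_k_on (Suc k) W V f \<Longrightarrow> C_k_on k W V f"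
proof (induction k arbitrary: f)
  case (Suc k)
  show ?case
    unfolding C_k_on.simps(2)[of k]
    using Suc.prems Suc.IH unfolding C_k_on.simps(2)[of "Suc k"] by blast
qed auto

lemma C_k_on_SucE:
  assumes "C_k_on (Suc k) W V f" "v \<in> W"
  obtains f' where "\<And>x. x \<in> V \<Longrightarrow> ((\<lambda>t. f (x + t *\<^sub>R v)) has_vector_derivative f' x) (at 0)"
    "C_k_on k W V f'"
  using assms unfolding C_k_on.simps by blast

lemma C_k_on_const: "C_k_on k W V (\<lambda>x. c)"
  by (induction k arbitrary: c) (auto intro!: exI[of _ "\<lambda>_. 0"])

lemma C_k_on_bounded_linear:
  assumes "bounded_linear L"
  shows "C_k_on k W V L"
proof (cases k)
  case (Suc k')
  have "((\<lambda>t. L (x + t *\<^sub>R v)) has_vector_derivative L v) (at 0)" for x v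
  proof -
    have "((\<lambda>t. L x + t *\<^sub>R L v) has_vector_derivative L v) (at 0)"
      by (auto intro!: derivative_eq_intros)
    then show ?thesis using assms by (simp add: linear_simps)
  qed
  then show ?thesis
    using C_k_on_const assms by (fastforce simp: Suc linear_continuous_on)
qed (simp add: assms linear_continuous_on)

lemma C_k_on_add:
  "C_k_on k W V f \<Longrightarrow> C_k_on k W V g \<Longrightarrow> C_k_on k W V (\<lambda>x. f x + g x)"
proof (induction k arbitrary: f g)
    case (Suc k)
    show ?case unfolding C_k_on.simps
    proof (intro conjI ballI)
      fix v assume v: "v \<in> W"
      obtain f' where
        f': "\<And>x. x \<in> V \<Longrightarrow> ((\<lambda>t. f (x + t *\<^sub>R v)) has_vector_derivative f' x) (at 0)" "C_k_on k W V f'"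
        using C_k_on_SucE[OF Suc.prems(1) v] by metis
      obtain g' where
        g': "\<And>x. x \<in> V \<Longrightarrow> ((\<lambda>t. g (x + t *\<^sub>R v)) has_vector_derivative g' x) (at 0)" "C_k_on k W V g'"
        using C_k_on_SucE[OF Suc.prems(2) v] by metis
      show "\<exists>h. (\<forall>x\<in>V. ((\<lambda>t. f (x + t *\<^sub>R v) + g (x + t *\<^sub>R v)) has_vector_derivative h x) (at 0)) \<and> C_k_on k W V h"
        by (rule exI[of _ "\<lambda>x. f' x + g' x"])
          (use f' g' in \<open>auto intro!: Suc.IH has_vector_derivative_add\<close>)
    qed (use Suc.prems in \<open>auto intro!: continuous_intros\<close>)
  qed (auto intro!: continuous_intros)

text \<open>By the product rule a directional derivative is a sum of two terms of the same bilinear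
  shape, so the induction on the order must generalise over both factors.\<close>

lemma C_k_on_bilinear:
  assumes bl: "bounded_bilinear B"
  shows "C_k_on k W V f \<Longrightarrow> C_k_on k W V g \<Longrightarrow> C_k_on k W V (\<lambda>x. B (f x) (g x))"
proof -
  interpret B: bounded_bilinear B by fact
  show "C_k_on k W V (\<lambda>x. B (f x) (g x))" if "C_k_on k W V f" "C_k_on k W V g"
    using that
  proof (induction k arbitrary: f g)
    case (Suc k)
    show ?case unfolding C_k_on.simps
    proof (intro conjI ballI)
      fix v assume v: "v \<in> W"
      obtain f' where
        f': "\<And>x. x \<in> V \<Longrightarrow> ((\<lambda>t. f (x + t *\<^sub>R v)) has_vector_derivative f' x) (at 0)" "C_k_on k W V f'"
        using C_k_on_SucE[OF Suc.prems(1) v] by metis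
      obtain g' where
        g': "\<And>x. x \<in> V \<Longrightarrow> ((\<lambda>t. g (x + t *\<^sub>R v)) has_vector_derivative g' x) (at 0)" "C_k_on k W V g'"
        using C_k_on_SucE[OF Suc.prems(2) v] by metis
      have "((\<lambda>t. B (f (x + t *\<^sub>R v)) (g (x + t *\<^sub>R v))) has_vector_derivative B (f x) (g' x) + B (f' x) (g x)) (at 0)"
        if "x \<in> V" for x
        using B.has_vector_derivative[of "\<lambda>t. f (x + t *\<^sub>R v)" "f' x" 0 UNIV "\<lambda>t. g (x + t *\<^sub>R v)" "g' x"] f' g' that
        by auto
      then show "\<exists>h. (\<forall>x\<in>V. ((\<lambda>t. B (f (x + t *\<^sub>R v)) (g (x + t *\<^sub>R v))) has_vector_derivative h x) (at 0)) \<and> C_k_on k W V h"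
        using f' g' C_k_on_SucD[OF Suc.prems(1)] C_k_on_SucD[OF Suc.prems(2)]
        by (intro exI[of _ "\<lambda>x. B (f x) (g' x) + B (f' x) (g x)"] conjI C_k_on_add Suc.IH) auto
    qed (use Suc.prems in \<open>auto intro!: B.continuous_on\<close>)
  qed (auto intro!: B.continuous_on)
qed

text \<open>The derivative of 1/f is -(1/f)(1/f) f', a product in which 1/f occurs again; the
  induction hypothesis for 1/f at the lower order therefore closes the step.\<close>

lemma C_k_on_inverse:
  fixes f :: "'a::real_normed_vector \<Rightarrow> real"
  assumes "C_k_on k W V f" "\<And>x. x \<in> V \<Longrightarrow> f x \<noteq> 0"
  shows "C_k_on k W V (\<lambda>x. inverse (f x))"
  using assms(1)
proof (induction k)
  case (Suc k)
  have IH: "C_k_on k W V (\<lambda>x. inverse (f x))"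
    using Suc C_k_on_SucD by blast
  show ?case unfolding C_k_on.simps
  proof (intro conjI ballI)
    fix v assume v: "v \<in> W"
    obtain f' where
      f': "\<And>x. x \<in> V \<Longrightarrow> ((\<lambda>t. f (x + t *\<^sub>R v)) has_vector_derivative f' x) (at 0)" "C_k_on k W V f'"
      using C_k_on_SucE[OF Suc.prems v] by metis
    have "((\<lambda>t. inverse (f (x + t *\<^sub>R v))) has_vector_derivative (- (inverse (f x) * inverse (f x))) * f' x) (at 0)" if "x \<in> V" for x
    proof -
      have d: "((\<lambda>t. f (x + t *\<^sub>R v)) has_real_derivative f' x) (at 0)"
        using f' that by (simp add: has_real_derivative_iff_has_vector_derivative)
      show ?thesis
        unfolding has_real_derivative_iff_has_vector_derivative[symmetric]
        by (rule derivative_eq_intros d)+ (use assms(2) that in \<open>auto simp: power2_eq_square\<close>)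
    qed
    moreover have "C_k_on k W V (\<lambda>x. (- (inverse (f x) * inverse (f x))) * f' x)"
      using C_k_on_bilinear[OF bounded_bilinear_mult C_k_on_bilinear[OF bounded_bilinear_mult
        C_k_on_bilinear[OF bounded_bilinear_mult C_k_on_const[of _ _ _ "-1"] IH] IH] f'(2)] by simp
    ultimately show "\<exists>h. (\<forall>x\<in>V. ((\<lambda>t. inverse (f (x + t *\<^sub>R v))) has_vector_derivative h x) (at 0)) \<and> C_k_on k W V h"
      by (intro exI[of _ "\<lambda>x. (- (inverse (f x) * inverse (f x))) * f' x"]) auto
  qed (use Suc.prems assms(2) in \<open>auto intro!: continuous_intros\<close>)
qed (auto intro!: continuous_intros simp: assms(2))

text \<open>With a linear inner map the directional derivative along v is the one of f along L v,
  composed with L, so no higher chain rule arises.\<close>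

lemma C_k_on_compose_linear:
  assumes L: "bounded_linear L" and "L ` W \<subseteq> W'" "L ` V \<subseteq> V'" "C_k_on k W' V' f"
  shows "C_k_on k W V (\<lambda>x. f (L x))"
  using assms(4)
proof (induction k arbitrary: f)
  case 0
  then show ?case
    using assms(3) continuous_on_compose2[OF _ linear_continuous_on[OF L]] by auto
next
  case (Suc k)
  interpret L: bounded_linear L by fact
  show ?case unfolding C_k_on.simps
  proof (intro conjI ballI)
    fix v assume v: "v \<in> W"
    then have "L v \<in> W'" using assms(2) by auto
    then obtain f' where
      f': "\<And>x. x \<in> V' \<Longrightarrow> ((\<lambda>t. f (x + t *\<^sub>R L v)) has_vector_derivative f' x) (at 0)" "C_k_on k W' V' f'"
      using C_k_on_SucE[OF Suc.prems] by metis
    then show "\<exists>h. (\<forall>x\<in>V. ((\<lambda>t. f (L (x + t *\<^sub>R v))) has_vector_derivative h x) (at 0)) \<and> C_k_on k W V h"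
      using Suc.IH[OF f'(2)] assms(3)
      by (intro exI[of _ "\<lambda>x. f' (L x)"]) (auto simp: L.add L.scaleR)
  next
    show "continuous_on V (\<lambda>x. f (L x))"
      using assms(3) continuous_on_compose2[OF _ linear_continuous_on[OF L]] Suc.prems by auto
  qed
qed

text \<open>The whole sequence of derivatives is given as \<open>g\<close>, since differentiating
  \<open>g n\<close> composed with l along v yields the constant l v times \<open>g (Suc n)\<close>
  composed with l, a function of the same form.\<close>

lemma C_k_on_compose_real:
  fixes g :: "nat \<Rightarrow> real \<Rightarrow> 'b::real_normed_vector"
  assumes l: "bounded_linear l"
    and g: "\<And>n x. (g n has_vector_derivative g (Suc n) x) (at x)"
  shows "C_k_on k W V (\<lambda>x. g n (l x))"
proof (induction k arbitrary: n)
  case 0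
  have "continuous_on UNIV (g n)"
    by (meson continuous_at_imp_continuous_on g has_vector_derivative_continuous)
  then show ?case using continuous_on_compose2[OF _ linear_continuous_on[OF l]] by auto
next
  case (Suc k)
  interpret l: bounded_linear l by fact
  show ?case unfolding C_k_on.simps
  proof (intro conjI ballI)
    fix v assume v: "v \<in> W"
    have "((\<lambda>t. g n (l (x + t *\<^sub>R v))) has_vector_derivative l v *\<^sub>R g (Suc n) (l x)) (at 0)" for x
    proof -
      have 1: "((\<lambda>t. l x + t * l v) has_vector_derivative l v) (at 0)"
        by (auto intro!: derivative_eq_intros)
      have "(g n \<circ> (\<lambda>t. l x + t * l v) has_vector_derivative l v *\<^sub>R g (Suc n) (l x)) (at 0)"
        by (rule vector_diff_chain_at[OF 1]) (use g in simp)
      then show ?thesis by (simp add: l.add l.scaleR o_def)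
    qed
    moreover have "C_k_on k W V (\<lambda>x. l v *\<^sub>R g (Suc n) (l x))"
      by (intro C_k_on_bilinear[OF bounded_bilinear_scaleR] C_k_on_const Suc.IH)
    ultimately show "\<exists>h. (\<forall>x\<in>V. ((\<lambda>t. g n (l (x + t *\<^sub>R v))) has_vector_derivative h x) (at 0)) \<and> C_k_on k W V h"
      by (intro exI[of _ "\<lambda>x. l v *\<^sub>R g (Suc n) (l x)"]) auto
  next
    have "continuous_on UNIV (g n)"
      by (meson continuous_at_imp_continuous_on g has_vector_derivative_continuous)
    then show "continuous_on V (\<lambda>x. g n (l x))" using continuous_on_compose2[OF _ linear_continuous_on[OF l]] by auto
  qed
qed

text \<open>\<open>C_k_on\<close> speaks of directional derivatives, while an immersion has a total
  derivative; total differentiability is carried along instead of being deduced from continuity of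
  the partial derivatives.\<close>

definition smooth_on ::
  "'a::real_normed_vector set \<Rightarrow> 'a set \<Rightarrow> ('a \<Rightarrow> 'b::real_normed_vector) \<Rightarrow> bool" where
  "smooth_on W V f \<longleftrightarrow> (\<forall>k. C_k_on k W V f) \<and> (\<forall>x\<in>V. f differentiable (at x within V))"

lemma smooth_on_const: "smooth_on W V (\<lambda>x. c)"
  by (simp add: smooth_on_def C_k_on_const)

lemma smooth_on_bounded_linear: "bounded_linear L \<Longrightarrow> smooth_on W V L"
  by (simp add: smooth_on_def C_k_on_bounded_linear bounded_linear_imp_differentiable)

lemma smooth_on_bilinear:
  assumes "bounded_bilinear B" "smooth_on W V f" "smooth_on W V g"
  shows "smooth_on W V (\<lambda>x. B (f x) (g x))"
  using assms C_k_on_bilinear[OF assms(1)] bounded_bilinear.FDERIV[OF assms(1)]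
  unfolding smooth_on_def differentiable_def by blast

lemma smooth_on_add:
  assumes "smooth_on W V f" "smooth_on W V g"
  shows "smooth_on W V (\<lambda>x. f x + g x)"
  using assms unfolding smooth_on_def by (auto intro!: derivative_intros C_k_on_add)

lemma smooth_on_inverse:
  fixes f :: "'a::real_normed_vector \<Rightarrow> real"
  assumes "smooth_on W V f" "\<And>x. x \<in> V \<Longrightarrow> f x \<noteq> 0"
  shows "smooth_on W V (\<lambda>x. inverse (f x))"
  using assms unfolding smooth_on_def by (auto intro!: differentiable_inverse C_k_on_inverse)

lemma smooth_on_compose_linear:
  assumes L: "bounded_linear L" "L ` W \<subseteq> W'" "L ` V \<subseteq> V'" "smooth_on W' V' f"
  shows "smooth_on W V (\<lambda>x. f (L x))"
proof -
  have "(f \<circ> L) differentiable (at x within V)" if "x \<in> V" for x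
  proof (rule differentiable_chain_within)
    show "L differentiable at x within V" using L(1) by (rule bounded_linear_imp_differentiable)
    have "f differentiable (at (L x) within V')"
      using L that unfolding smooth_on_def by auto
    then show "f differentiable at (L x) within L ` V"
      using L(3) differentiable_within_subset by blast
  qed
  then show ?thesis
    using L C_k_on_compose_linear[OF L(1-3)] unfolding smooth_on_def o_def by blast
qed

lemma smooth_on_linear_compose:
  assumes L: "bounded_linear L" and f: "smooth_on W V f"
  shows "smooth_on W V (\<lambda>x. L (f x))"
proof -
  \<comment> \<open>A linear map counts as the bilinear map (a, b) to a L b with the scalar factor
    frozen at 1, so the product rule covers it.\<close>
  have bb: "bounded_bilinear (\<lambda>(a::real) b. a *\<^sub>R L b)"
    by (rule bounded_bilinear.comp[OF bounded_bilinear_scaleR bounded_linear_ident L]) 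
  show ?thesis
    using smooth_on_bilinear[OF bb smooth_on_const[of W V 1] f] by simp
qed

lemma smooth_on_compose_real:
  fixes g :: "nat \<Rightarrow> real \<Rightarrow> 'b::real_normed_vector"
  assumes l: "bounded_linear l"
    and g: "\<And>n x. (g n has_vector_derivative g (Suc n) x) (at x)"
  shows "smooth_on W V (\<lambda>x. g 0 (l x))"
proof -
  have "(g 0 \<circ> l) differentiable (at x within V)" for x
    by (rule differentiable_chain_within)
      (use l g in \<open>auto intro: bounded_linear_imp_differentiable differentiableI_vector differentiable_at_withinI\<close>)
  then show ?thesis
    using C_k_on_compose_real[of l g] l g unfolding smooth_on_def o_def by blast
qed

lemma smooth_on_continuous_on: "smooth_on W V f \<Longrightarrow> continuous_on V f"
  unfolding smooth_on_def using C_k_on.simps(1) by blast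

section \<open>Matrix groups with the subspace topology\<close>

lemma matrix_inv:
  fixes A :: "real^'n^'n"
  assumes "invertible A"
  shows "A ** matrix_inv A = mat 1" "matrix_inv A ** A = mat 1"
  using assms someI_ex[of "\<lambda>B. A ** B = mat 1 \<and> B ** A = mat 1"]
  unfolding invertible_def matrix_inv_def by auto

lemma matrix_inv_unique:
  fixes A B :: "real^'n^'n"
  assumes "A ** B = mat 1"
  shows "matrix_inv A = B" "invertible A"
proof -
  show inv: "invertible A" using assms invertible_right_inverse by blast
  show "matrix_inv A = B"
    by (metis assms matrix_inv(2)[OF inv] matrix_mul_assoc matrix_mul_lid matrix_mul_rid)
qed

lemma invertible_matrix_inv: "invertible (A :: real^'n^'n) \<Longrightarrow> invertible (matrix_inv A)"
  using matrix_inv invertible_def by blast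

lemma matrix_inv_matrix_inv: "invertible (A :: real^'n^'n) \<Longrightarrow> matrix_inv (matrix_inv A) = A"
  using matrix_inv matrix_inv_unique by blast

lemma matrix_inv_mult:
  fixes A B :: "real^'n^'n"
  assumes "invertible A" "invertible B"
  shows "matrix_inv (A ** B) = matrix_inv B ** matrix_inv A"
  by (rule matrix_inv_unique(1)) (metis assms matrix_inv(1) matrix_mul_assoc matrix_mul_rid)

lemma matrix_inv_one [simp]: "matrix_inv (mat 1 :: real^'n^'n) = mat 1"
  by (rule matrix_inv_unique(1)) simp

lemma invertible_one [simp]: "invertible (mat 1 :: real^'n^'n)"
  unfolding invertible_def by (auto intro!: exI[of _ "mat 1"])

lemma matrix_inv_cancel:
  fixes A B :: "real^'n^'n"
  assumes "invertible A"
  shows "A ** (matrix_inv A ** B) = B" "matrix_inv A ** (A ** B) = B"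
    "B ** A ** matrix_inv A = B" "B ** matrix_inv A ** A = B"
  using matrix_inv[OF assms] matrix_mul_lid matrix_mul_rid by (metis matrix_mul_assoc)+

lemma transpose_matrix_inv:
  "invertible (A :: real^'n^'n) \<Longrightarrow> transpose (matrix_inv A) = matrix_inv (transpose A)"
  by (rule sym, rule matrix_inv_unique(1)) (metis matrix_inv(2) matrix_transpose_mul transpose_mat)

lemma subgroup_GL_iff:
  "subgroup H (GL :: (real^'n^'n) monoid) \<longleftrightarrow>
     (\<forall>h\<in>H. invertible h) \<and> mat 1 \<in> H \<and> (\<forall>a\<in>H. \<forall>b\<in>H. a ** b \<in> H) \<and> (\<forall>a\<in>H. matrix_inv a \<in> H)"
proof -
  have inv: "inv\<^bsub>GL\<^esub> h = matrix_inv h" if "invertible h" for h :: "real^'n^'n"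
  proof -
    interpret group "GL :: (real^'n^'n) monoid" by (rule group_GL)
    show ?thesis
      by (rule inv_equality) (use that matrix_inv in \<open>auto simp: GL_def invertible_matrix_inv\<close>)
  qed
  show ?thesis
    using inv by (auto simp: subgroup_def GL_def subset_iff)
qed

lemma continuous_on_det: "continuous_on S f \<Longrightarrow> continuous_on S (\<lambda>x. det (f x :: real^'n^'n))"
  unfolding det_def by (intro continuous_intros)

text \<open>Cramer's rule writes each entry of the inverse as a quotient of determinants, which are
  polynomials in the entries.\<close>

lemma continuous_on_matrix_inv: "continuous_on {A :: real^'n^'n. invertible A} matrix_inv"
proof -
  have "matrix_inv A $ k $ j = det (\<chi> i l. if l = k then axis j 1 $ i else A$i$l) / det A"
    if A: "invertible A" for A :: "real^'n^'n" and j k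
  proof -
    have "A *v column j (matrix_inv A) = axis j 1"
      using matrix_inv(1)[OF A]
      by (auto simp: vec_eq_iff matrix_vector_mult_def matrix_matrix_mult_def column_def mat_def axis_def)
    then have "column j (matrix_inv A) = (\<chi> k. det (\<chi> i l. if l = k then axis j 1 $ i else A$i$l) / det A)"
      using cramer A invertible_det_nz by blast
    then show ?thesis by (simp add: column_def vec_eq_iff)
  qed
  then have eq: "matrix_inv A = (\<chi> k j. det (\<chi> i l. if l = k then axis j 1 $ i else A$i$l) / det A)"
    if A: "invertible A" for A :: "real^'n^'n"
    using that by (simp add: vec_eq_iff)
  have "continuous_on {A :: real^'n^'n. invertible A} (\<lambda>A. if l = k then axis j 1 $ i else A$i$l)" for l k j i
    by (cases "l = k") (auto intro!: continuous_intros)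
  then have "continuous_on {A :: real^'n^'n. invertible A}
      (\<lambda>A. \<chi> k j. det (\<chi> i l. if l = k then axis j 1 $ i else A$i$l) / det A)"
    by (auto intro!: continuous_intros continuous_on_det simp: invertible_det_nz)
  then show ?thesis
    by (rule continuous_on_eq) (simp add: eq)
qed

lemma bounded_linear_conj: "bounded_linear (\<lambda>x. (g :: real^'n^'n) ** x ** (g' :: real^'n^'n))"
  by (rule bounded_linear_compose[OF matrix_mult.bounded_linear_left matrix_mult.bounded_linear_right])

text \<open>The derivative of \<open>f\<close> is taken within \<open>V\<close>, so it is determined only in the directions of \<open>W\<close>.\<close>

lemma has_derivative_line:
  fixes V W :: "'a::real_normed_vector set"
  assumes W: "subspace W" and V: "openin (top_of_set W) V" and x: "x \<in> V" and w: "w \<in> W"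
    and f: "(f has_derivative D) (at x within V)"
  shows "((\<lambda>t. f (x + t *\<^sub>R w)) has_vector_derivative D w) (at 0)"
    and "\<exists>S. open S \<and> 0 \<in> S \<and> (\<forall>t\<in>S. x + t *\<^sub>R w \<in> V)"
proof -
  obtain O' where O': "open O'" "V = W \<inter> O'" using V unfolding openin_open by blast
  define S where "S = {t::real. x + t *\<^sub>R w \<in> O'}"
  have "S = (\<lambda>t. x + t *\<^sub>R w) -` O'" by (auto simp: S_def)
  then have S: "open S"
    using O'(1) continuous_open_vimage[of O' "\<lambda>t. x + t *\<^sub>R w"]
    by (auto intro!: continuous_intros open_vimage)
  have 0: "0 \<in> S" using x O' by (auto simp: S_def)
  have sub: "x + t *\<^sub>R w \<in> V" if "t \<in> S" for t
    using that x w W O' by (auto simp: S_def subspace_def)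
  show "\<exists>S. open S \<and> 0 \<in> S \<and> (\<forall>t\<in>S. x + t *\<^sub>R w \<in> V)" using S 0 sub by blast
  have d: "((\<lambda>t. x + t *\<^sub>R w) has_derivative (\<lambda>t. t *\<^sub>R w)) (at 0 within S)"
    by (auto intro!: derivative_eq_intros)
  have "(f has_derivative D) (at (x + 0 *\<^sub>R w) within (\<lambda>t. x + t *\<^sub>R w) ` S)"
    using f by (auto intro: has_derivative_subset sub)
  from diff_chain_within[OF d this]
  have "((\<lambda>t. f (x + t *\<^sub>R w)) has_derivative (\<lambda>t. D (t *\<^sub>R w))) (at 0 within S)"
    by (simp add: o_def)
  moreover have "D (t *\<^sub>R w) = t *\<^sub>R D w" for t
    using f by (simp add: has_derivative_def linear_simps)
  ultimately show "((\<lambda>t. f (x + t *\<^sub>R w)) has_vector_derivative D w) (at 0)"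
    unfolding has_vector_derivative_def using at_within_open[OF 0 S] by simp
qed

definition emb_lie :: "nat \<Rightarrow> (real^'n^'n) set \<Rightarrow> bool" where
  "emb_lie n H \<longleftrightarrow> subgroup H GL \<and>
     (\<exists>(W :: (real^'n^'n) set) V f U \<kappa>. subspace W \<and> dim W = n \<and> openin (top_of_set W) V \<and> smooth_on W V f \<and>
        open U \<and> mat 1 \<in> U \<and> f ` V = H \<inter> U \<and> (\<forall>x\<in>V. \<kappa> (f x) = x) \<and> (\<forall>p\<in>U. \<kappa> differentiable (at p)))"

text \<open>The chain rule is applied to \<kappa> after f along the line in direction w, where the
  composite is the identity. Thus K is a left inverse of D on W.\<close>

lemma inj_on_derivative:
  fixes W V :: "'a::real_normed_vector set" and f :: "'a \<Rightarrow> 'b::real_normed_vector"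
  assumes W: "subspace W" and V: "openin (top_of_set W) V" and x: "x \<in> V"
    and f: "(f has_derivative D) (at x within V)"
    and \<kappa>: "\<And>y. y \<in> V \<Longrightarrow> \<kappa> (f y) = y" and d\<kappa>: "(\<kappa> has_derivative K) (at (f x))"
    and w: "w \<in> W"
  shows "K (D w) = w"
proof -
  from has_derivative_line[OF W V x w f] obtain S where
    d: "((\<lambda>t. f (x + t *\<^sub>R w)) has_vector_derivative D w) (at 0)"
    and S: "open S" "0 \<in> S" "\<And>t. t \<in> S \<Longrightarrow> x + t *\<^sub>R w \<in> V" by blast
  have "(\<kappa> \<circ> (\<lambda>t. f (x + t *\<^sub>R w)) has_derivative K \<circ> (\<lambda>t. t *\<^sub>R D w)) (at 0)"
    by (rule diff_chain_at) (use d d\<kappa> in \<open>auto simp: has_vector_derivative_def\<close>)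
  moreover have "K (t *\<^sub>R D w) = t *\<^sub>R K (D w)" for t
    using d\<kappa> by (simp add: has_derivative_def linear_simps)
  ultimately have "((\<lambda>t. \<kappa> (f (x + t *\<^sub>R w))) has_vector_derivative K (D w)) (at 0)"
    by (simp add: has_vector_derivative_def o_def)
  then have "((\<lambda>t. x + t *\<^sub>R w) has_vector_derivative K (D w)) (at 0)"
    by (rule has_vector_derivative_transform_within_open[OF _ S(1,2)]) (use S(3) \<kappa> in auto)
  moreover have "((\<lambda>t. x + t *\<^sub>R w) has_vector_derivative w) (at 0)"
    by (auto intro!: derivative_eq_intros)
  ultimately show ?thesis using vector_derivative_unique_at by blast
qed

lemma second_countable_euclidean: "second_countable (euclidean :: 'a::second_countable_topology topology)"
proof -
  obtain B :: "'a set set" where "countable B" "\<And>C. C \<in> B \<Longrightarrow> open C"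
    "\<And>S. open S \<Longrightarrow> \<exists>U. U \<subseteq> B \<and> S = \<Union>U"
    using univ_second_countable by blast
  moreover from this(3) have "\<exists>V\<in>B. x \<in> V \<and> V \<subseteq> U" if "open U" "x \<in> U" for U x
    using that by (metis Sup_upper UnionE subsetD)
  ultimately show ?thesis
    unfolding second_countable_def by (intro exI[of _ B]) auto
qed

text \<open>The chart at p is the chart at the identity multiplied by p from the left; its inverse
  is \<kappa> evaluated at \<open>matrix_inv p ** z\<close>.\<close>

lemma emb_lie_imp_lie_subgroup:
  fixes H :: "(real^'n^'n) set"
  assumes "emb_lie n H"
  shows "lie_subgroup n H (top_of_set H)"
proof -
  from assms obtain W :: "(real^'n^'n) set" and V f U \<kappa> where
    sub: "subgroup H GL" and W: "subspace W" "dim W = n" and V: "openin (top_of_set W) V"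
    and f: "smooth_on W V f" and U: "open U" "mat 1 \<in> U" "f ` V = H \<inter> U"
    and \<kappa>: "\<And>x. x \<in> V \<Longrightarrow> \<kappa> (f x) = x" "\<And>p. p \<in> U \<Longrightarrow> \<kappa> differentiable (at p)"
    unfolding emb_lie_def by blast
  note H = sub[unfolded subgroup_GL_iff]
  have chart: "\<exists>(W :: (real^'n^'n) set) V f.
        subspace W \<and> dim W = n \<and> openin (top_of_set W) V \<and> smooth_immersion_on W V f \<and>
        openin (top_of_set H) (f ` V) \<and> p \<in> f ` V \<and>
        homeomorphic_map (top_of_set V) (subtopology (top_of_set H) (f ` V)) f" if p: "p \<in> H" for p
  proof -
    define f' where "f' = (\<lambda>x. p ** f x)"
    define q where "q = matrix_inv p"
    have pq: "p ** (q ** A) = A" "q ** (p ** A) = A" for A :: "real^'n^'n"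
      using matrix_inv_cancel[of p] H p by (auto simp: q_def)
    have sm: "smooth_on W V f'"
      unfolding f'_def by (rule smooth_on_linear_compose[OF _ f]) (rule matrix_mult.bounded_linear_right)
    have im: "f' ` V = H \<inter> (\<lambda>z. q ** z) -` U"
    proof -
      have "f' ` V = (\<lambda>z. p ** z) ` (H \<inter> U)" unfolding f'_def U(3)[symmetric] by auto
      also have "\<dots> = H \<inter> (\<lambda>z. q ** z) -` U"
      proof (safe)
        fix z assume "z \<in> H" "q ** z \<in> U"
        moreover have "q ** z \<in> H" using H p \<open>z \<in> H\<close> by (auto simp: q_def)
        ultimately show "z \<in> (\<lambda>z. p ** z) ` (H \<inter> U)" using pq(1)[of z] by (metis IntI imageI)
      qed (use H p pq in auto)
      finally show ?thesis .
    qed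
    have opn: "open ((\<lambda>z. q ** z) -` U)"
      by (rule open_vimage[OF U(1)]) (intro matrix_mult.continuous_on continuous_intros)
    have op: "openin (top_of_set H) (f' ` V)"
      unfolding im using opn by blast
    have pin: "p \<in> f' ` V" unfolding im using p U(2) H matrix_inv(2)[of p] by (auto simp: q_def)
    have d\<kappa>: "(\<lambda>z. \<kappa> (q ** z)) differentiable (at z)" if "q ** z \<in> U" for z
    proof -
      have "(\<kappa> \<circ> (\<lambda>z. q ** z)) differentiable (at z)"
        by (rule differentiable_chain_at) (use \<kappa>(2)[OF that] in
            \<open>auto intro: bounded_linear_imp_differentiable matrix_mult.bounded_linear_right\<close>)
      then show ?thesis by (simp add: o_def)
    qed
    have immer: "smooth_immersion_on W V f'"
      unfolding smooth_immersion_on_def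
    proof (intro conjI ballI allI)
      fix x assume x: "x \<in> V"
      then obtain D where D: "(f' has_derivative D) (at x within V)"
        using sm unfolding smooth_on_def differentiable_def by blast
      have "q ** f' x \<in> U" using x im by blast
      then obtain K where K: "((\<lambda>z. \<kappa> (q ** z)) has_derivative K) (at (f' x))"
        using d\<kappa> unfolding differentiable_def by blast
      have "K (D w) = w" if "w \<in> W" for w
        by (rule inj_on_derivative[OF W(1) V x D _ K that]) (use \<kappa>(1) pq in \<open>auto simp: f'_def\<close>)
      then show "\<exists>D. (f' has_derivative D) (at x within V) \<and> inj_on D W"
        using D by (metis inj_onI)
    qed (use sm in \<open>auto simp: smooth_on_def\<close>)
    have "homeomorphic_maps (top_of_set V) (top_of_set (f' ` V)) f' (\<lambda>z. \<kappa> (q ** z))"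
      unfolding homeomorphic_maps_def
    proof (intro conjI ballI)
      show "continuous_map (top_of_set V) (top_of_set (f' ` V)) f'"
        using smooth_on_continuous_on[OF sm] by (auto simp: continuous_map_in_subtopology)
      have "continuous_on (f' ` V) (\<lambda>z. \<kappa> (q ** z))"
        using d\<kappa> im by (auto intro!: continuous_at_imp_continuous_on differentiable_imp_continuous_within)
      moreover have "(\<lambda>z. \<kappa> (q ** z)) ` (f' ` V) \<subseteq> V" using \<kappa>(1) pq by (auto simp: f'_def)
      ultimately show "continuous_map (top_of_set (f' ` V)) (top_of_set V) (\<lambda>z. \<kappa> (q ** z))"
        by (auto simp: continuous_map_in_subtopology)
    qed (use \<kappa>(1) pq in \<open>auto simp: f'_def\<close>)
    then have "homeomorphic_map (top_of_set V) (top_of_set (f' ` V)) f'"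
      using homeomorphic_map_maps by blast
    moreover have "subtopology (top_of_set H) (f' ` V) = top_of_set (f' ` V)"
      unfolding subtopology_subtopology using im by (simp add: Int_absorb1)
    ultimately show ?thesis using W V immer op pin by metis
  qed
  have m: "continuous_map (prod_topology (top_of_set H) (top_of_set H)) (top_of_set H) (\<lambda>(a, b). a ** b)"
  proof -
    have "continuous_on (H \<times> H) (\<lambda>x. fst x ** snd x)"
      by (intro matrix_mult.continuous_on continuous_intros)
    then have "continuous_map (top_of_set (H \<times> H)) (top_of_set H) (\<lambda>x. fst x ** snd x)"
      using H by (auto simp: continuous_map_in_subtopology)
    then show ?thesis
      by (auto simp: subtopology_Times case_prod_beta Pi_iff)
  qed
  have i: "continuous_map (top_of_set H) (top_of_set H) matrix_inv"
    using H continuous_on_subset[OF continuous_on_matrix_inv, of H] by (auto simp: continuous_map_in_subtopology)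
  show ?thesis
    unfolding lie_subgroup_def
    using chart sub m i by (auto simp: Hausdorff_space_subtopology second_countable_subtopology second_countable_euclidean)
qed

lemma emb_lie_conj:
  fixes H :: "(real^'n^'n) set"
  assumes "emb_lie n H" and g: "invertible g"
  shows "emb_lie n (conj_set g H)"
proof -
  from assms(1) obtain W :: "(real^'n^'n) set" and V f U \<kappa> where
    sub: "subgroup H GL" and W: "subspace W" "dim W = n" and V: "openin (top_of_set W) V"
    and f: "smooth_on W V f" and U: "open U" "mat 1 \<in> U" "f ` V = H \<inter> U"
    and \<kappa>: "\<And>x. x \<in> V \<Longrightarrow> \<kappa> (f x) = x" "\<And>p. p \<in> U \<Longrightarrow> \<kappa> differentiable (at p)"
    unfolding emb_lie_def by blast
  note H = sub[unfolded subgroup_GL_iff]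
  define c where "c = (\<lambda>x. g ** x ** matrix_inv g)"
  define d where "d = (\<lambda>x. matrix_inv g ** x ** g)"
  have cd: "c (d x) = x" "d (c x) = x" for x
    unfolding c_def d_def by (simp_all add: matrix_mul_assoc[symmetric] matrix_inv[OF g] matrix_inv_cancel[OF g])
  have bl: "bounded_linear c" "bounded_linear d" unfolding c_def d_def by (rule bounded_linear_conj)+
  have cm: "c (a ** b) = c a ** c b" for a b
    unfolding c_def by (simp add: matrix_mul_assoc[symmetric] matrix_inv_cancel[OF g])
  have c1: "c (mat 1) = mat 1" "d (mat 1) = mat 1" by (simp_all add: c_def d_def matrix_inv[OF g])
  have ci: "invertible (c a)" "matrix_inv (c a) = c (matrix_inv a)" if "invertible a" for a
    using matrix_inv_unique[of "c a" "c (matrix_inv a)"] cm c1 matrix_inv(1)[OF that] by metis+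
  have "subgroup (c ` H) GL"
    unfolding subgroup_GL_iff using H ci c1 cm by (auto simp: image_iff) metis+
  moreover have "smooth_on W V (\<lambda>x. c (f x))" by (rule smooth_on_linear_compose[OF bl(1) f])
  moreover have "open (d -` U)" by (rule open_vimage[OF U(1)]) (rule linear_continuous_on[OF bl(2)])
  moreover have "(\<lambda>x. c (f x)) ` V = c ` H \<inter> d -` U"
  proof -
    have "(\<lambda>x. c (f x)) ` V = c ` (H \<inter> U)" unfolding U(3)[symmetric] image_image ..
    also have "\<dots> = c ` H \<inter> d -` U" by (auto simp: cd)
    finally show ?thesis .
  qed
  moreover have "(\<lambda>z. \<kappa> (d z)) differentiable (at z)" if "z \<in> d -` U" for z
  proof -
    have "(\<kappa> \<circ> d) differentiable (at z)"
      by (rule differentiable_chain_at) (use \<kappa>(2) that bl bounded_linear_imp_differentiable in auto)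
    then show ?thesis by (simp add: o_def)
  qed
  ultimately have "emb_lie n (c ` H)"
    unfolding emb_lie_def using W V \<kappa>(1) cd U(2) c1
    by (intro conjI exI[of _ W] exI[of _ V] exI[of _ "\<lambda>x. c (f x)"] exI[of _ "d -` U"] exI[of _ "\<lambda>z. \<kappa> (d z)"]) auto
  then show ?thesis by (simp add: conj_set_def c_def)
qed

section \<open>The Lie algebra of a connected Lie subgroup\<close>

text \<open>Differentiability is asked at 0 only, so a curve given near 0 may be extended by the
  constant \<open>mat 1\<close>. Continuity for a finer topology of H is not part of the notion,
  hence for an immersed group this set can exceed the Lie algebra.\<close>

definition tang :: "(real^'n^'n) set \<Rightarrow> (real^'n^'n) set" where
  "tang H = {X. \<exists>\<gamma>. \<gamma> 0 = mat 1 \<and> (\<forall>t. \<gamma> t \<in> H) \<and> (\<gamma> has_vector_derivative X) (at (0::real))}"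

text \<open>The data of a connected Lie subgroup \<open>H\<close> with Lie algebra \<open>\<hh>\<close> that survive once its topology is
  forgotten. The last two clauses replace the exponential map: the first one bounds \<open>H\<close> from above
  by equations, the second one shows that \<open>H\<close> exhausts an embedded group with the same Lie algebra.\<close>

definition lie_data :: "(real^'n^'n) set \<Rightarrow> (real^'n^'n) set \<Rightarrow> bool" where
  "lie_data H \<hh> \<longleftrightarrow> subgroup H GL \<and> subspace \<hh> \<and> \<hh> \<subseteq> tang H \<and>
     (\<forall>h\<in>H. \<forall>X\<in>\<hh>. h ** X ** matrix_inv h \<in> \<hh>) \<and>
     (\<forall>X\<in>\<hh>. \<forall>Y\<in>\<hh>. X ** Y - Y ** X \<in> \<hh>) \<and>
     (\<forall>F :: real^'n^'n \<Rightarrow> real.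
        (\<forall>h\<in>H. \<exists>F'. (F has_derivative F') (at h) \<and> (\<forall>X\<in>\<hh>. F' (X ** h) = 0)) \<longrightarrow> (\<forall>h\<in>H. F h = F (mat 1))) \<and>
     (\<forall>Q. (\<exists>n. emb_lie n Q \<and> connected Q \<and> H \<subseteq> Q \<and> tang Q \<subseteq> \<hh>) \<longrightarrow> H = Q)"

text \<open>A subgroup containing a neighbourhood of the identity is open in Q by translation, and
  its complement is open too, being a union of cosets; connectedness of Q leaves no other
  possibility.\<close>

lemma subgroup_GL_connected_eq:
  fixes H Q :: "(real^'n^'n) set"
  assumes H: "subgroup H GL" and Q: "subgroup Q GL" and sub: "H \<subseteq> Q" and con: "connected Q"
    and e: "e > 0" "\<And>q. q \<in> Q \<Longrightarrow> dist q (mat 1) < e \<Longrightarrow> q \<in> H"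
  shows "H = Q"
proof -
  note H = H[unfolded subgroup_GL_iff] and Q = Q[unfolded subgroup_GL_iff]
  have nbhd: "\<exists>O'. open O' \<and> p \<in> O' \<and> (\<forall>q\<in>Q \<inter> O'. matrix_inv p ** q \<in> H)" if p: "p \<in> Q" for p
  proof (intro exI conjI ballI)
    show "open ((\<lambda>z. matrix_inv p ** z) -` ball (mat 1) e)"
      by (rule open_vimage[OF open_ball]) (intro matrix_mult.continuous_on continuous_intros)
    show "p \<in> (\<lambda>z. matrix_inv p ** z) -` ball (mat 1) e"
      using p Q e(1) matrix_inv(2)[of p] by auto
    fix q assume q: "q \<in> Q \<inter> (\<lambda>z. matrix_inv p ** z) -` ball (mat 1) e"
    then have "matrix_inv p ** q \<in> Q" using p Q by auto
    then show "matrix_inv p ** q \<in> H" using q e(2) by (auto simp: dist_commute)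
  qed
  have op: "openin (top_of_set Q) H"
    unfolding openin_subopen[of _ H]
  proof
    fix p assume p: "p \<in> H"
    then obtain O' where O': "open O'" "p \<in> O'" "\<forall>q\<in>Q \<inter> O'. matrix_inv p ** q \<in> H"
      using nbhd sub by blast
    have "Q \<inter> O' \<subseteq> H"
    proof
      fix q assume "q \<in> Q \<inter> O'"
      then have "p ** (matrix_inv p ** q) \<in> H" using O' H p by auto
      then show "q \<in> H" using matrix_inv_cancel(1)[of p q] H p by simp
    qed
    then show "\<exists>T. openin (top_of_set Q) T \<and> p \<in> T \<and> T \<subseteq> H"
      using O' p sub by (intro exI[of _ "Q \<inter> O'"]) auto
  qed
  have "openin (top_of_set Q) (Q - H)"
    unfolding openin_subopen[of _ "Q - H"]
  proof
    fix p assume p: "p \<in> Q - H"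
    then obtain O' where O': "open O'" "p \<in> O'" "\<forall>q\<in>Q \<inter> O'. matrix_inv p ** q \<in> H"
      using nbhd by blast
    have "q \<notin> H" if "q \<in> Q \<inter> O'" for q
    proof
      assume "q \<in> H"
      moreover have "matrix_inv p ** q \<in> H" using O' that by auto
      ultimately have "q ** matrix_inv (matrix_inv p ** q) \<in> H" using H by auto
      moreover have "q ** matrix_inv (matrix_inv p ** q) = p"
        using p \<open>q \<in> H\<close> H Q
        by (simp add: matrix_inv_mult invertible_matrix_inv matrix_inv_matrix_inv matrix_inv_cancel)
      ultimately show False using p by auto
    qed
    then show "\<exists>T. openin (top_of_set Q) T \<and> p \<in> T \<and> T \<subseteq> Q - H"
      using O' p by (intro exI[of _ "Q \<inter> O'"]) auto
  qed
  then have "closedin (top_of_set Q) H" using sub by (auto simp: closedin_def)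
  then show ?thesis using op con H unfolding connected_clopen by blast
qed

text \<open>Invertible differential suffices for the image of a chart of \<open>H\<close> to fill a neighbourhood in \<open>Q\<close>; no
  bracket condition enters, since the charts are compared at a single point.\<close>

lemma chart_covers_nbhd:
  fixes H Q :: "(real^'n^'n) set" and W V :: "(real^'n^'n) set"
  assumes Q: "emb_lie m Q" and HQ: "H \<subseteq> Q"
    and W: "subspace W" and V: "openin (top_of_set W) V" and f: "continuous_on V f" "f ` V \<subseteq> H"
    and x0: "x0 \<in> V" "f x0 = mat 1" and D: "(f has_derivative D) (at x0 within V)"
    and tQ: "tang Q \<subseteq> D ` W"
  shows "\<exists>e>0. \<forall>q\<in>Q. dist q (mat 1) < e \<longrightarrow> q \<in> H"
proof -
  from Q obtain W' V' :: "(real^'n^'n) set" and f' U \<kappa> where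
    sub: "subgroup Q GL" and W': "subspace W'" and V': "openin (top_of_set W') V'"
    and f': "smooth_on W' V' f'" and U: "open U" "mat 1 \<in> U" "f' ` V' = Q \<inter> U"
    and \<kappa>: "\<And>x. x \<in> V' \<Longrightarrow> \<kappa> (f' x) = x" "\<And>p. p \<in> U \<Longrightarrow> \<kappa> differentiable (at p)"
    unfolding emb_lie_def by blast
  note Q = sub[unfolded subgroup_GL_iff]
  define y0 where "y0 = \<kappa> (mat 1)"
  have \<kappa>Q: "\<kappa> q \<in> V'" "f' (\<kappa> q) = q" if "q \<in> Q" "q \<in> U" for q
  proof -
    from that have "q \<in> f' ` V'" by (simp add: U(3))
    then obtain x where "x \<in> V'" "q = f' x" by blast
    then show "\<kappa> q \<in> V'" "f' (\<kappa> q) = q" using \<kappa>(1) by simp_all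
  qed
  have V'W': "V' \<subseteq> W'" using V' openin_imp_subset by blast
  have VW: "V \<subseteq> W" using V openin_imp_subset by blast
  have y0: "y0 \<in> V'" "f' y0 = mat 1" using \<kappa>Q[of "mat 1"] Q U(2) by (auto simp: y0_def)
  obtain E where E: "(f' has_derivative E) (at y0 within V')"
    using f' y0 unfolding smooth_on_def differentiable_def by blast
  obtain K where K: "(\<kappa> has_derivative K) (at (mat 1))"
    using \<kappa>(2)[OF U(2)] unfolding differentiable_def by blast
  have KE: "K (E w) = w" if "w \<in> W'" for w
    by (rule inj_on_derivative[OF W'(1) V' y0(1) E _ _ that]) (use \<kappa>(1) K y0 in auto)
  have Etang: "E w \<in> tang Q" if w: "w \<in> W'" for w
  proof -
    from has_derivative_line[OF W'(1) V' y0(1) w E] obtain S where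
      d: "((\<lambda>t. f' (y0 + t *\<^sub>R w)) has_vector_derivative E w) (at 0)"
      and S: "open S" "0 \<in> S" "\<And>t. t \<in> S \<Longrightarrow> y0 + t *\<^sub>R w \<in> V'" by blast
    define \<gamma> where "\<gamma> = (\<lambda>t. if t \<in> S then f' (y0 + t *\<^sub>R w) else mat 1)"
    have "(\<gamma> has_vector_derivative E w) (at 0)"
      by (rule has_vector_derivative_transform_within_open[OF d S(1,2)]) (auto simp: \<gamma>_def)
    moreover have "\<gamma> t \<in> Q" for t using S(3) U(3) Q by (auto simp: \<gamma>_def)
    moreover have "\<gamma> 0 = mat 1" using y0 by (auto simp: \<gamma>_def)
    ultimately show ?thesis unfolding tang_def by blast
  qed
  have blK: "bounded_linear K" and blD: "bounded_linear D"
    using K D by (auto intro: has_derivative_bounded_linear)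
  \<comment> \<open>G is a linear section of K D. It is a right inverse on all of W', because
    tangent vectors of Q are of the form D z by assumption and K undoes E on W'.\<close>
  have "linear (\<lambda>x. K (D x))" using bounded_linear_compose[OF blK blD] bounded_linear.linear by blast
  then obtain G where G: "range G \<subseteq> W" "linear G" "\<And>v. v \<in> (\<lambda>x. K (D x)) ` W \<Longrightarrow> K (D (G v)) = v"
    using linear_exists_right_inverse_on[OF _ W, of "\<lambda>x. K (D x)"] by blast
  have KDG: "K (D (G w)) = w" if "w \<in> W'" for w
  proof (rule G(3))
    have "E w \<in> D ` W" using tQ Etang[OF that] by blast
    then obtain z where "z \<in> W" "D z = E w" by auto
    then show "w \<in> (\<lambda>x. K (D x)) ` W" using KE[OF that] by (metis imageI)
  qed
  obtain P where P: "linear P" "\<And>x. P x \<in> W'" "\<And>w. w \<in> W' \<Longrightarrow> P w = w"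
    using linear_exists_right_inverse_on[OF linear_id W'] by (auto simp: image_subset_iff)
  define A where "A = (\<lambda>y. x0 + G (P y))"
  \<comment> \<open>An open mapping argument wants a self-map of a Euclidean space. In the W'
    component \<Psi> passes through the chart of H and back through \<kappa>; the summand y - P y
    acts as the identity on the complementary kernel of P. The derivative at 0 is P + (id - P), the
    identity.\<close>
  define \<Psi> where "\<Psi> = (\<lambda>y. \<kappa> (f (A y)) + (y - P y))"
  have blP: "bounded_linear P" and blG: "bounded_linear G"
    using P G linear_conv_bounded_linear by blast+
  have contA: "continuous_on UNIV A"
    unfolding A_def by (intro continuous_intros bounded_linear.continuous_on[OF blG] bounded_linear.continuous_on[OF blP])
  have AW: "A y \<in> W" for y
    using G(1) x0 VW W unfolding A_def by (auto intro!: subspace_add)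
  have A0: "A 0 = x0" using G(2) P(1) by (simp add: A_def linear_0)
  obtain O' where O': "open O'" "V = W \<inter> O'" using V unfolding openin_open by blast
  have "openin (top_of_set V) (V \<inter> f -` U)" using f(1) U(1) continuous_openin_preimage_gen by blast
  then obtain O2 where O2: "open O2" "V \<inter> f -` U = V \<inter> O2" unfolding openin_open by blast
  define S where "S = A -` (O' \<inter> O2)"
  have S: "open S" unfolding S_def by (rule open_vimage[OF _ contA]) (use O' O2 in auto)
  have S0: "0 \<in> S" using A0 x0 O' O2 U(2) by (auto simp: S_def)
  have SV: "A y \<in> V" "f (A y) \<in> U" if "y \<in> S" for y
  proof -
    show "A y \<in> V" using that AW O' unfolding S_def by auto
    then show "f (A y) \<in> U" using that O2 unfolding S_def by blast
  qed
  have contPsi: "continuous_on S \<Psi>"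
  proof -
    have "continuous_on U \<kappa>"
      using \<kappa>(2) by (auto intro!: continuous_at_imp_continuous_on differentiable_imp_continuous_within)
    moreover have "continuous_on S (\<lambda>y. f (A y))"
      by (rule continuous_on_compose2[OF f(1) continuous_on_subset[OF contA]]) (use SV in auto)
    ultimately have "continuous_on S (\<lambda>y. \<kappa> (f (A y)))"
      by (rule continuous_on_compose2) (use SV in auto)
    then show ?thesis unfolding \<Psi>_def
      by (intro continuous_intros bounded_linear.continuous_on[OF blP])
  qed
  have dPsi: "(\<Psi> has_derivative id) (at 0)"
  proof -
    have dA: "(A has_derivative (\<lambda>y. G (P y))) (at 0 within S)"
      unfolding A_def
      by (auto intro!: derivative_eq_intros bounded_linear.has_derivative[OF blG] bounded_linear.has_derivative[OF blP])
    have "(f has_derivative D) (at (A 0) within A ` S)"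
      using D SV by (auto simp: A0 intro: has_derivative_subset)
    from diff_chain_within[OF dA this]
    have dfA: "((\<lambda>y. f (A y)) has_derivative (\<lambda>y. D (G (P y)))) (at 0 within S)" by (simp add: o_def)
    have "(\<kappa> has_derivative K) (at (f (A 0)) within (\<lambda>y. f (A y)) ` S)"
      using K by (simp add: A0 x0 has_derivative_at_withinI)
    from diff_chain_within[OF dfA this]
    have "((\<lambda>y. \<kappa> (f (A y))) has_derivative (\<lambda>y. K (D (G (P y))))) (at 0 within S)" by (simp add: o_def)
    then have "((\<lambda>y. \<kappa> (f (A y))) has_derivative P) (at 0)"
      using KDG P(2) at_within_open[OF S0 S] by simp
    moreover have "((\<lambda>y. y - P y) has_derivative (\<lambda>y. y - P y)) (at 0)"
      by (auto intro!: derivative_intros bounded_linear.has_derivative[OF blP])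
    ultimately have "(\<Psi> has_derivative (\<lambda>y. P y + (y - P y))) (at 0)"
      unfolding \<Psi>_def by (rule has_derivative_add)
    then show ?thesis by (simp add: id_def)
  qed
  \<comment> \<open>This open mapping theorem asks only for continuity and for an invertible
    derivative at one point.\<close>
  have "\<Psi> 0 \<in> interior (\<Psi> ` S)"
    by (rule sussmann_open_mapping[OF S contPsi S0 dPsi, of id])
      (use S S0 in \<open>auto simp: interior_open bounded_linear_ident id_def\<close>)
  moreover have "\<Psi> 0 = y0" by (simp add: \<Psi>_def A0 x0 y0_def linear_0[OF P(1)])
  ultimately obtain r where r: "r > 0" "ball y0 r \<subseteq> \<Psi> ` S"
    by (auto simp: mem_interior)
  have "isCont \<kappa> (mat 1)" using K has_derivative_continuous by blast
  then obtain d where d: "d > 0" "\<And>q. dist q (mat 1) < d \<Longrightarrow> dist (\<kappa> q) y0 < r"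
    unfolding continuous_at_eps_delta using r(1) by (auto simp: y0_def)
  obtain d' where d': "d' > 0" "ball (mat 1) d' \<subseteq> U" using U openE by blast
  have "q \<in> H" if q: "q \<in> Q" "dist q (mat 1) < min d d'" for q
  proof -
    have qU: "q \<in> U" using d' q by (auto simp: dist_commute)
    have "\<kappa> q \<in> ball y0 r" using d q by (auto simp: dist_commute)
    then obtain y where y: "y \<in> S" "\<kappa> q = \<Psi> y" using r(2) by blast
    have fA: "f (A y) \<in> Q" "f (A y) \<in> U" "f (A y) \<in> H" using SV[OF y(1)] f(2) HQ by auto
    \<comment> \<open>The vector y - P y lies in W', where P is the identity, and in the kernel of
      the projection P; so it vanishes and \<kappa> q is reached by the chart of H alone.\<close>
    have "y - P y = \<kappa> q - \<kappa> (f (A y))" using y by (simp add: \<Psi>_def)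
    also have "\<dots> \<in> W'" using \<kappa>Q(1) fA q(1) qU V'W' W' by (intro subspace_diff) auto
    finally have "P (y - P y) = y - P y" using P by blast
    then have "y - P y = 0" using P by (simp add: linear_diff)
    then have "\<kappa> q = \<kappa> (f (A y))" using y by (simp add: \<Psi>_def)
    then have "q = f (A y)" using \<kappa>Q(2) fA q(1) qU by metis
    then show "q \<in> H" using fA by simp
  qed
  then show ?thesis using d d' by (intro exI[of _ "min d d'"]) auto
qed

lemma tendsto_difference_quotient:
  assumes "(f has_vector_derivative D) (at (0::real))"
  shows "((\<lambda>t. (f t - f 0) /\<^sub>R t) \<longlongrightarrow> D) (at 0)"
proof -
  have "((\<lambda>t. norm (f t - f 0 - t *\<^sub>R D) / norm t) \<longlongrightarrow> 0) (at 0)"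
    using assms unfolding has_vector_derivative_def has_derivative_at by simp
  then have "((\<lambda>t. norm ((f t - f 0) /\<^sub>R t - D)) \<longlongrightarrow> 0) (at 0)"
  proof (rule Lim_transform_eventually)
    have "norm (f t - f 0 - t *\<^sub>R D) / norm t = norm ((f t - f 0) /\<^sub>R t - D)" if "t \<noteq> 0" for t
    proof -
      have "f t - f 0 - t *\<^sub>R D = t *\<^sub>R ((f t - f 0) /\<^sub>R t - D)"
        using that by (simp add: scaleR_diff_right)
      then show ?thesis using that by simp
    qed
    then show "\<forall>\<^sub>F t in at 0. norm (f t - f 0 - t *\<^sub>R D) / norm t = norm ((f t - f 0) /\<^sub>R t - D)"
      by (auto simp: eventually_at_filter)
  qed
  then show ?thesis by (rule LIM_zero_cancel[OF tendsto_norm_zero_cancel])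
qed

text \<open>Difference quotients at the identity stay in S, and a finite-dimensional subspace is
  closed.\<close>

lemma tang_subset_subspace:
  assumes S: "subspace S" and H: "\<And>h. h \<in> H \<Longrightarrow> h - mat 1 \<in> S"
  shows "tang H \<subseteq> S"
proof
  fix X assume "X \<in> tang H"
  then obtain \<gamma> where \<gamma>: "\<gamma> 0 = mat 1" "\<And>t. \<gamma> t \<in> H" "(\<gamma> has_vector_derivative X) (at (0::real))"
    unfolding tang_def by blast
  show "X \<in> S"
  proof (rule Lim_in_closed_set[OF closed_subspace[OF S]])
    show "((\<lambda>t. (\<gamma> t - \<gamma> 0) /\<^sub>R t) \<longlongrightarrow> X) (at 0)" using tendsto_difference_quotient[OF \<gamma>(3)] .
    show "\<forall>\<^sub>F t in at 0. (\<gamma> t - \<gamma> 0) /\<^sub>R t \<in> S" using H \<gamma>(1,2) S by (simp add: subspace_scale)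
  qed simp
qed

text \<open>Convergence in T is what singles out the Lie algebra. For a dense line in a torus,
  curves in the line that are differentiable at 0 in the matrix space realise every tangent vector
  of the torus, so \<open>tang\<close> would be too large.\<close>

definition top_tang :: "(real^'n^'n) topology \<Rightarrow> (real^'n^'n) set" where
  "top_tang T = {X. \<exists>\<gamma>. \<gamma> 0 = mat 1 \<and> (\<forall>t. \<gamma> t \<in> topspace T) \<and> limitin T \<gamma> (mat 1) (at 0) \<and>
     (\<gamma> has_vector_derivative X) (at (0::real))}"

context
  fixes n :: nat and H :: "(real^'n^'n) set" and T :: "(real^'n^'n) topology"
  assumes lie: "lie_subgroup n H T"
begin

lemma lie_topspace: "topspace T = H" and lie_subgroup_GL: "subgroup H GL"
  using lie by (auto simp: lie_subgroup_def)

lemma lie_group: "h \<in> H \<Longrightarrow> invertible h" "mat 1 \<in> H" "a \<in> H \<Longrightarrow> b \<in> H \<Longrightarrow> a ** b \<in> H"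
  "a \<in> H \<Longrightarrow> matrix_inv a \<in> H"
  using lie_subgroup_GL unfolding subgroup_GL_iff by auto

lemma lie_continuous_mult_right:
  assumes "b \<in> H"
  shows "continuous_map T T (\<lambda>x. x ** b)"
proof -
  have "continuous_map T (prod_topology T T) (\<lambda>x. (x, b))"
    using assms by (intro continuous_map_pairedI) (auto simp: lie_topspace)
  moreover have "continuous_map (prod_topology T T) T (\<lambda>(a, b). a ** b)"
    using lie by (simp add: lie_subgroup_def)
  ultimately show ?thesis using continuous_map_compose by (fastforce simp: o_def)
qed

lemma lie_continuous_mult_left:
  assumes "b \<in> H"
  shows "continuous_map T T (\<lambda>x. b ** x)"
proof -
  have "continuous_map T (prod_topology T T) (\<lambda>x. (b, x))"
    using assms by (intro continuous_map_pairedI) (auto simp: lie_topspace)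
  moreover have "continuous_map (prod_topology T T) T (\<lambda>(a, b). a ** b)"
    using lie by (simp add: lie_subgroup_def)
  ultimately show ?thesis using continuous_map_compose by (fastforce simp: o_def)
qed

lemma lie_chart:
  assumes "p \<in> H"
  obtains W :: "(real^'n^'n) set" and V f x0 where "subspace W" "openin (top_of_set W) V" "smooth_immersion_on W V f"
    "openin T (f ` V)" "x0 \<in> V" "f x0 = p" "homeomorphic_map (top_of_set V) (subtopology T (f ` V)) f"
proof -
  have "\<exists>(W :: (real^'n^'n) set) V f. subspace W \<and> dim W = n \<and> openin (top_of_set W) V \<and> smooth_immersion_on W V f \<and>
        openin T (f ` V) \<and> p \<in> f ` V \<and> homeomorphic_map (top_of_set V) (subtopology T (f ` V)) f"
    using lie assms unfolding lie_subgroup_def by simp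
  then obtain W :: "(real^'n^'n) set" and V f where
    *: "subspace W" "openin (top_of_set W) V" "smooth_immersion_on W V f"
      "openin T (f ` V)" "homeomorphic_map (top_of_set V) (subtopology T (f ` V)) f" and "p \<in> f ` V"
    by (elim exE conjE) simp
  from this(6) obtain x0 where "x0 \<in> V" "f x0 = p" by auto
  with * show thesis by (intro that[of W V f x0])
qed

text \<open>The curve along w is moved back to the identity by right multiplication with the inverse
  of f x, an operation continuous for T. Every chart velocity at a point h thus has the form X h
  with X in the Lie algebra.\<close>

lemma lie_chart_velocity:
  fixes W :: "(real^'n^'n) set"
  assumes W: "subspace W" and V: "openin (top_of_set W) V"
    and opn: "openin T (f ` V)" and hom: "homeomorphic_map (top_of_set V) (subtopology T (f ` V)) f"
    and x: "x \<in> V" and D: "(f has_derivative D) (at x within V)" and w: "w \<in> W"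
  shows "D w ** matrix_inv (f x) \<in> top_tang T"
proof -
  define p where "p = f x"
  have fV: "f ` V \<subseteq> H" using opn openin_subset lie_topspace by blast
  then have p: "p \<in> H" using x by (auto simp: p_def)
  from has_derivative_line[OF W V x w D] obtain S where
    d: "((\<lambda>t. f (x + t *\<^sub>R w)) has_vector_derivative D w) (at 0)"
    and S: "open S" "0 \<in> S" "\<And>t. t \<in> S \<Longrightarrow> x + t *\<^sub>R w \<in> V" by blast
  have ev: "eventually (\<lambda>t. t \<in> S) (at 0)" using S eventually_at_topological by blast
  define \<gamma> where "\<gamma> = (\<lambda>t. if t \<in> S then f (x + t *\<^sub>R w) ** matrix_inv p else mat 1)"
  have "((\<lambda>t. f (x + t *\<^sub>R w) ** matrix_inv p) has_vector_derivative D w ** matrix_inv p) (at 0)"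
    using bounded_linear.has_vector_derivative[OF matrix_mult.bounded_linear_left d] .
  then have "(\<gamma> has_vector_derivative D w ** matrix_inv p) (at 0)"
    by (rule has_vector_derivative_transform_within_open[OF _ S(1,2)]) (auto simp: \<gamma>_def)
  moreover have "\<gamma> t \<in> H" for t
    using S(3) fV p lie_group by (auto simp: \<gamma>_def image_subset_iff)
  moreover have \<gamma>0: "\<gamma> 0 = mat 1" using S(2) p lie_group(1) by (simp add: \<gamma>_def matrix_inv(1) flip: p_def)
  moreover have "limitin T \<gamma> (mat 1) (at 0)"
  proof -
    have "((\<lambda>t. x + t *\<^sub>R w) \<longlongrightarrow> x + 0 *\<^sub>R w) (at 0)" by (intro tendsto_intros)
    then have "limitin (top_of_set V) (\<lambda>t. x + t *\<^sub>R w) x (at 0)"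
      using x eventually_mono[OF ev S(3)] by (simp add: limitin_subtopology)
    moreover have "continuous_map (top_of_set V) T f"
      using homeomorphic_imp_continuous_map[OF hom] continuous_map_into_fulltopology by blast
    ultimately have "limitin T (f \<circ> (\<lambda>t. x + t *\<^sub>R w)) (f x) (at 0)"
      by (rule continuous_map_limit[rotated])
    from continuous_map_limit[OF lie_continuous_mult_right[OF lie_group(4)[OF p]] this]
    have "limitin T (\<lambda>t. f (x + t *\<^sub>R w) ** matrix_inv p) (mat 1) (at 0)"
      using p lie_group(1) by (simp add: o_def matrix_inv(1) flip: p_def)
    then show ?thesis
      by (rule limitin_transform_eventually[rotated]) (rule eventually_mono[OF ev], simp add: \<gamma>_def)
  qed
  ultimately show ?thesis unfolding top_tang_def p_def lie_topspace by blast
qed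

lemma top_tang_subset_chart:
  fixes W :: "(real^'n^'n) set"
  assumes W: "subspace W" and V: "openin (top_of_set W) V"
    and opn: "openin T (f ` V)" and hom: "homeomorphic_map (top_of_set V) (subtopology T (f ` V)) f"
    and x0: "x0 \<in> V" "f x0 = mat 1" and D: "(f has_derivative D) (at x0 within V)" and inj: "inj_on D W"
    and X: "X \<in> top_tang T"
  shows "X \<in> D ` W"
proof -
  from X obtain \<gamma> where \<gamma>: "\<gamma> 0 = mat 1" "limitin T \<gamma> (mat 1) (at 0)"
    "(\<gamma> has_vector_derivative X) (at (0::real))"
    unfolding top_tang_def by blast
  have VW: "V \<subseteq> W" using V openin_imp_subset by blast
  have blD: "bounded_linear D" using D by (rule has_derivative_bounded_linear)
  interpret D: bounded_linear D by fact
  have inj0: "\<forall>x\<in>W. D x = 0 \<longrightarrow> x = 0"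
    using inj D.zero subspace_0[OF W] by (metis inj_on_def)
  obtain c where c: "c > 0" "\<And>w. w \<in> W \<Longrightarrow> norm (D w) \<ge> c * norm w"
    using injective_imp_isometric[OF closed_subspace[OF W] W blD inj0] by (auto simp: mult.commute)
  obtain g where g: "homeomorphic_maps (top_of_set V) (subtopology T (f ` V)) f g"
    using hom homeomorphic_map_maps by blast
  have ev: "eventually (\<lambda>t. \<gamma> t \<in> f ` V) (at 0)"
    using \<gamma>(2) opn x0 unfolding limitin_def by (metis imageI)
  have "limitin (subtopology T (f ` V)) \<gamma> (mat 1) (at 0)"
    using \<gamma>(2) ev x0 imageI[of x0 V f] by (simp add: limitin_subtopology)
  moreover have "continuous_map (subtopology T (f ` V)) (top_of_set V) g"
    using g by (simp add: homeomorphic_maps_def)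
  ultimately have "limitin (top_of_set V) (g \<circ> \<gamma>) (g (mat 1)) (at 0)"
    by (rule continuous_map_limit[rotated])
  moreover have "g (mat 1) = x0" using g x0 unfolding homeomorphic_maps_def by force
  ultimately have lim: "((\<lambda>t. g (\<gamma> t)) \<longlongrightarrow> x0) (at 0)" and evV: "eventually (\<lambda>t. g (\<gamma> t) \<in> V) (at 0)"
    by (auto simp: limitin_subtopology o_def)
  have fg: "f (g y) = y" if "y \<in> f ` V" for y
    using g that openin_subset[OF opn] unfolding homeomorphic_maps_def by auto
  define y where "y = (\<lambda>t. g (\<gamma> t) - x0)"
  have "\<exists>z\<in>D ` W. dist z X < e" if e: "e > 0" for e
  proof -
    \<comment> \<open>The choice \<epsilon> \<le> c/2 lets half of the lower bound c |y| absorb the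
      linearisation error, which gives |y| \<le> M |t|. The choice \<epsilon> \<le> e/(3 M) keeps
      the total error below 2e/3 times |t|.\<close>
    define M where "M = 2 / c * (norm X + 1)"
    define \<epsilon> where "\<epsilon> = min (c / 2) (e / (3 * M))"
    have M: "M > 0" using c by (simp add: M_def add_nonneg_pos)
    have \<epsilon>: "\<epsilon> > 0" "\<epsilon> \<le> c / 2" "\<epsilon> * M \<le> e / 3"
    proof -
      show "\<epsilon> > 0" "\<epsilon> \<le> c / 2" using c e M by (auto simp: \<epsilon>_def)
      have "\<epsilon> * M \<le> e / (3 * M) * M" using M by (intro mult_right_mono) (auto simp: \<epsilon>_def)
      then show "\<epsilon> * M \<le> e / 3" using M by simp
    qed
    from D obtain d where d: "d > 0" "\<And>z. z \<in> V \<Longrightarrow> norm (z - x0) < d \<Longrightarrow>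
        norm (f z - f x0 - D (z - x0)) \<le> \<epsilon> * norm (z - x0)"
      unfolding has_derivative_within_alt using \<epsilon>(1) by blast
    have ev1: "eventually (\<lambda>t. norm (g (\<gamma> t) - x0) < d) (at 0)"
      using tendstoD[OF lim d(1)] by (simp add: dist_norm)
    have ev2: "eventually (\<lambda>t. norm (\<gamma> t - \<gamma> 0 - (t - 0) *\<^sub>R X) \<le> min 1 (e / 3) * norm (t - 0)) (at 0)"
      using \<gamma>(3) e unfolding has_vector_derivative_def has_derivative_within_alt2 by simp
    have "eventually (\<lambda>t. t \<noteq> 0 \<and> \<gamma> t \<in> f ` V \<and> g (\<gamma> t) \<in> V \<and> norm (g (\<gamma> t) - x0) < d \<and>
       norm (\<gamma> t - \<gamma> 0 - (t - 0) *\<^sub>R X) \<le> min 1 (e / 3) * norm (t - 0)) (at (0::real))"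
      by (intro eventually_conj ev ev1 ev2 evV) (simp add: eventually_at_filter)
    from eventually_happens'[OF _ this] obtain t where t: "t \<noteq> 0" "\<gamma> t \<in> f ` V" "g (\<gamma> t) \<in> V" "norm (y t) < d"
      "norm (\<gamma> t - mat 1 - t *\<^sub>R X) \<le> min 1 (e / 3) * \<bar>t\<bar>"
      using \<gamma>(1) unfolding y_def by auto
    have yW: "y t \<in> W" using t VW x0 W by (auto simp: y_def intro: subspace_diff)
    have 1: "norm (\<gamma> t - mat 1 - D (y t)) \<le> \<epsilon> * norm (y t)"
      using d(2)[OF t(3)] t fg[OF t(2)] x0 by (simp add: y_def)
    have 2: "norm (\<gamma> t - mat 1) \<le> (norm X + 1) * \<bar>t\<bar>"
    proof -
      have "norm (\<gamma> t - mat 1) \<le> norm (\<gamma> t - mat 1 - t *\<^sub>R X) + norm (t *\<^sub>R X)"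
        by (metis diff_add_cancel norm_triangle_ineq)
      also have "\<dots> \<le> 1 * \<bar>t\<bar> + \<bar>t\<bar> * norm X"
        using t(5) by (intro add_mono order_trans[OF t(5)] mult_right_mono) auto
      finally show ?thesis by (simp add: algebra_simps)
    qed
    have "c * norm (y t) \<le> norm (D (y t))" using c(2)[OF yW] .
    also have "\<dots> \<le> norm (\<gamma> t - mat 1) + norm (\<gamma> t - mat 1 - D (y t))"
      by (metis norm_triangle_sub add.commute norm_minus_commute)
    also have "\<dots> \<le> (norm X + 1) * \<bar>t\<bar> + c / 2 * norm (y t)"
      by (intro add_mono 2 order_trans[OF 1] mult_right_mono \<epsilon>) simp
    finally have "c / 2 * norm (y t) \<le> (norm X + 1) * \<bar>t\<bar>" by simp
    then have 3: "norm (y t) \<le> M * \<bar>t\<bar>" using c(1) by (simp add: M_def field_simps)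
    have "norm (t *\<^sub>R X - D (y t)) \<le> norm (\<gamma> t - mat 1 - D (y t)) + norm (\<gamma> t - mat 1 - t *\<^sub>R X)"
      using norm_triangle_ineq4[of "\<gamma> t - mat 1 - D (y t)" "\<gamma> t - mat 1 - t *\<^sub>R X"] by simp
    also have "\<dots> \<le> \<epsilon> * (M * \<bar>t\<bar>) + e / 3 * \<bar>t\<bar>"
      using 3 \<epsilon> by (intro add_mono order_trans[OF 1] order_trans[OF t(5)] mult_left_mono mult_right_mono) auto
    also have "\<dots> = (\<epsilon> * M + e / 3) * \<bar>t\<bar>" by (simp add: algebra_simps)
    also have "\<dots> \<le> (e / 3 + e / 3) * \<bar>t\<bar>" using \<epsilon> by (intro mult_right_mono add_mono) auto
    also have "\<dots> < e * \<bar>t\<bar>" using e t(1) by (intro mult_strict_right_mono) auto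
    finally have "norm (t *\<^sub>R X - D (y t)) < e * \<bar>t\<bar>" .
    moreover have "norm (t *\<^sub>R X - D (y t)) = \<bar>t\<bar> * norm (X - D (y t /\<^sub>R t))"
      using t(1) by (simp add: D.scaleR flip: norm_scaleR) (simp add: algebra_simps)
    ultimately have "norm (X - D (y t /\<^sub>R t)) < e" using t(1) by (simp add: mult.commute)
    moreover have "y t /\<^sub>R t \<in> W" using yW W by (simp add: subspace_scale)
    ultimately show ?thesis by (metis dist_norm imageI norm_minus_commute)
  qed
  then have "X \<in> closure (D ` W)" by (simp add: closure_approachable)
  moreover have "subspace (D ` W)" using linear_subspace_image[OF D.linear W] .
  ultimately show ?thesis using closed_subspace closure_closed by blast
qed

lemma top_tang_eq_chart:
  fixes W :: "(real^'n^'n) set"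
  assumes W: "subspace W" and V: "openin (top_of_set W) V"
    and opn: "openin T (f ` V)" and hom: "homeomorphic_map (top_of_set V) (subtopology T (f ` V)) f"
    and x0: "x0 \<in> V" "f x0 = mat 1" and D: "(f has_derivative D) (at x0 within V)" and inj: "inj_on D W"
  shows "top_tang T = D ` W"
  using top_tang_subset_chart[OF assms] lie_chart_velocity[OF W V opn hom x0(1) D] x0(2) by auto

lemma subspace_top_tang: "subspace (top_tang T)"
proof -
  obtain W :: "(real^'n^'n) set" and V f x0 where
    *: "subspace W" "openin (top_of_set W) V" "smooth_immersion_on W V f"
    "openin T (f ` V)" "x0 \<in> V" "f x0 = mat 1" "homeomorphic_map (top_of_set V) (subtopology T (f ` V)) f"
    using lie_chart[OF lie_group(2)] .
  then obtain D where D: "(f has_derivative D) (at x0 within V)" "inj_on D W"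
    unfolding smooth_immersion_on_def by blast
  show ?thesis
    using top_tang_eq_chart[OF *(1,2,4,7,5,6) D] linear_subspace_image[OF _ *(1)]
      has_derivative_bounded_linear[OF D(1)] bounded_linear.linear by metis
qed

lemma top_tang_Ad:
  assumes h: "h \<in> H" and X: "X \<in> top_tang T"
  shows "h ** X ** matrix_inv h \<in> top_tang T"
proof -
  from X obtain \<gamma> where \<gamma>: "\<gamma> 0 = mat 1" "\<forall>t. \<gamma> t \<in> H" "limitin T \<gamma> (mat 1) (at 0)"
    "(\<gamma> has_vector_derivative X) (at (0::real))"
    unfolding top_tang_def lie_topspace by blast
  have "((\<lambda>t. h ** \<gamma> t ** matrix_inv h) has_vector_derivative h ** X ** matrix_inv h) (at 0)"
    using bounded_linear.has_vector_derivative[OF bounded_linear_conj \<gamma>(4)] .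
  moreover have "limitin T (\<lambda>t. h ** \<gamma> t ** matrix_inv h) (mat 1) (at 0)"
    using continuous_map_limit[OF lie_continuous_mult_right[OF lie_group(4)[OF h]]
        continuous_map_limit[OF lie_continuous_mult_left[OF h] \<gamma>(3)]] lie_group(1)[OF h]
    by (simp add: o_def matrix_inv)
  moreover have "h ** \<gamma> 0 ** matrix_inv h = mat 1"
    using lie_group(1)[OF h] \<gamma>(1) by (simp add: matrix_inv)
  moreover have "\<forall>t. h ** \<gamma> t ** matrix_inv h \<in> H" using \<gamma>(2) h lie_group by auto
  ultimately show ?thesis unfolding top_tang_def lie_topspace
    by (intro CollectI exI[of _ "\<lambda>t. h ** \<gamma> t ** matrix_inv h"]) simp
qed

text \<open>The bracket is the limit of (\<gamma>(t) Y \<gamma>(t)^-1 - Y)/t, and these quotients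
  lie in the closed subspace by invariance under conjugation; commutator curves do not
  enter.\<close>

lemma top_tang_bracket:
  assumes X: "X \<in> top_tang T" and Y: "Y \<in> top_tang T"
  shows "X ** Y - Y ** X \<in> top_tang T"
proof -
  from X obtain \<gamma> where \<gamma>: "\<gamma> 0 = mat 1" "\<forall>t. \<gamma> t \<in> H" "(\<gamma> has_vector_derivative X) (at (0::real))"
    unfolding top_tang_def lie_topspace by blast
  have "((\<lambda>t. \<gamma> t ** Y - Y ** \<gamma> t) has_vector_derivative X ** Y - Y ** X) (at 0)"
    by (intro has_vector_derivative_diff bounded_linear.has_vector_derivative[OF matrix_mult.bounded_linear_left \<gamma>(3)]
        bounded_linear.has_vector_derivative[OF matrix_mult.bounded_linear_right \<gamma>(3)])
  from tendsto_difference_quotient[OF this]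
  have 1: "((\<lambda>t. (\<gamma> t ** Y - Y ** \<gamma> t) /\<^sub>R t) \<longlongrightarrow> X ** Y - Y ** X) (at 0)" by (simp add: \<gamma>(1))
  have "isCont \<gamma> 0" using \<gamma>(3) has_vector_derivative_continuous by blast
  then have "(\<gamma> \<longlongrightarrow> mat 1) (at 0)" using \<gamma>(1) by (simp add: isCont_def)
  then have 2: "((\<lambda>t. matrix_inv (\<gamma> t)) \<longlongrightarrow> matrix_inv (mat 1)) (at 0)"
    by (rule continuous_on_tendsto_compose[OF continuous_on_matrix_inv]) (use \<gamma>(2) lie_group(1) in auto)
  have "((\<lambda>t. (\<gamma> t ** Y - Y ** \<gamma> t) /\<^sub>R t ** matrix_inv (\<gamma> t)) \<longlongrightarrow> (X ** Y - Y ** X) ** matrix_inv (mat 1)) (at 0)"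
    by (rule matrix_mult.tendsto[OF 1 2])
  moreover have "(\<gamma> t ** Y - Y ** \<gamma> t) /\<^sub>R t ** matrix_inv (\<gamma> t) \<in> top_tang T" for t
  proof -
    have "(\<gamma> t ** Y - Y ** \<gamma> t) /\<^sub>R t ** matrix_inv (\<gamma> t) = (\<gamma> t ** Y ** matrix_inv (\<gamma> t) - Y) /\<^sub>R t"
      using \<gamma>(2) lie_group(1)
      by (simp add: matrix_mult.scaleR_left matrix_mult.diff_left matrix_mul_assoc[symmetric] matrix_inv(1))
    then show ?thesis
      using top_tang_Ad[OF _ Y] \<gamma>(2) Y subspace_top_tang by (simp add: subspace_diff subspace_scale)
  qed
  ultimately show ?thesis
    using Lim_in_closed_set[OF closed_subspace[OF subspace_top_tang] always_eventually[OF allI] at_neq_bot[of "0::real"],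
        of "\<lambda>t. (\<gamma> t ** Y - Y ** \<gamma> t) /\<^sub>R t ** matrix_inv (\<gamma> t)"]
    by simp
qed

text \<open>On a ball in the chart every point is joined to the centre by a segment inside the ball.
  Along it the velocity at h is X h with X in the Lie algebra, so the pulled back F has zero
  derivative.\<close>

lemma locally_constant_along_tang:
  fixes F :: "real^'n^'n \<Rightarrow> real"
  assumes F: "\<And>h. h \<in> H \<Longrightarrow> \<exists>F'. (F has_derivative F') (at h) \<and> (\<forall>X\<in>top_tang T. F' (X ** h) = 0)"
    and p: "p \<in> H"
  shows "\<exists>O'. openin T O' \<and> p \<in> O' \<and> (\<forall>q\<in>O'. F q = F p)"
proof -
  obtain W :: "(real^'n^'n) set" and V f x0 where
    W: "subspace W" and V: "openin (top_of_set W) V" and imm: "smooth_immersion_on W V f"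
    and opn: "openin T (f ` V)" and x0: "x0 \<in> V" "f x0 = p"
    and hom: "homeomorphic_map (top_of_set V) (subtopology T (f ` V)) f"
    using lie_chart[OF p] .
  have VW: "V \<subseteq> W" using V openin_imp_subset by blast
  have fV: "f ` V \<subseteq> H" using opn openin_subset lie_topspace by blast
  obtain O' where O': "open O'" "V = W \<inter> O'" using V unfolding openin_open by blast
  then obtain r where r: "r > 0" "ball x0 r \<subseteq> O'" using x0 openE by blast
  define B where "B = W \<inter> ball x0 r"
  have BV: "B \<subseteq> V" using O' r by (auto simp: B_def)
  have "openin (top_of_set V) B"
    using VW r O' by (auto simp: B_def openin_open intro!: exI[of _ "ball x0 r"])
  moreover have "open_map (top_of_set V) (subtopology T (f ` V)) f"
    using hom homeomorphic_imp_open_map by blast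
  ultimately have "openin (subtopology T (f ` V)) (f ` B)" unfolding open_map_def by blast
  then have "openin T (f ` B)" using openin_open_subtopology[OF opn] by blast
  moreover have "p \<in> f ` B" using x0 VW r by (auto simp: B_def)
  moreover have "F (f x) = F p" if x: "x \<in> B" for x
  proof -
    define w where "w = x - x0"
    have w: "w \<in> W" using x VW x0 W by (auto simp: w_def B_def intro: subspace_diff)
    have inB: "x0 + t *\<^sub>R w \<in> B" if t: "t \<in> {0..1}" for t
    proof -
      have "x0 + t *\<^sub>R w = (1 - t) *\<^sub>R x0 + t *\<^sub>R x" by (simp add: w_def algebra_simps)
      moreover have "convex B" unfolding B_def using W by (intro convex_Int subspace_imp_convex convex_ball)
      moreover have "x0 \<in> B" using x0 VW r by (auto simp: B_def)
      ultimately show ?thesis using x t unfolding convex_alt by auto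
    qed
    have "((\<lambda>t. F (f (x0 + t *\<^sub>R w))) has_vector_derivative 0) (at s within {0..1})" if s: "s \<in> {0..1}" for s
    proof -
      define y where "y = x0 + s *\<^sub>R w"
      have y: "y \<in> V" using inB[OF s] BV by (auto simp: y_def)
      then obtain D where D: "(f has_derivative D) (at y within V)"
        using imm unfolding smooth_immersion_on_def by blast
      have fy: "f y \<in> H" using y fV by blast
      obtain F' where F': "(F has_derivative F') (at (f y))" "\<forall>X\<in>top_tang T. F' (X ** f y) = 0"
        using F[OF fy] by blast
      have "F' (D w ** matrix_inv (f y) ** f y) = 0"
        using F'(2) lie_chart_velocity[OF W V opn hom y D w] by blast
      then have 0: "F' (D w) = 0"
        using matrix_inv_cancel(4)[of "f y"] lie_group(1)[OF fy] by simp
      have "((\<lambda>t. f (y + t *\<^sub>R w)) has_derivative (\<lambda>t. t *\<^sub>R D w)) (at 0)"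
        using has_derivative_line(1)[OF W V y w D] by (simp add: has_vector_derivative_def)
      from diff_chain_at[OF this, of F F'] F'(1)
      have "((\<lambda>t. F (f (y + t *\<^sub>R w))) has_derivative (\<lambda>t. F' (t *\<^sub>R D w))) (at 0)"
        by (simp add: o_def)
      moreover have "F' (t *\<^sub>R D w) = 0" for t
        using F'(1) 0 by (simp add: has_derivative_def linear_simps)
      ultimately have "((\<lambda>t. F (f (y + t *\<^sub>R w))) has_derivative (\<lambda>t. 0)) (at 0)" by simp
      moreover have "((\<lambda>t. t - s) has_derivative (\<lambda>t. t)) (at s)" by (auto intro!: derivative_eq_intros)
      ultimately have "((\<lambda>t. F (f (y + (t - s) *\<^sub>R w))) has_derivative (\<lambda>t. 0)) (at s)"
        using diff_chain_at[of "\<lambda>t. t - s" "\<lambda>t. t" s "\<lambda>t. F (f (y + t *\<^sub>R w))" "\<lambda>t. 0"] by (simp add: o_def)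
      moreover have "y + (t - s) *\<^sub>R w = x0 + t *\<^sub>R w" for t by (simp add: y_def algebra_simps)
      ultimately show ?thesis by (simp add: has_vector_derivative_def has_derivative_at_withinI)
    qed
    then obtain c where c: "\<And>s. s \<in> {0..1} \<Longrightarrow> F (f (x0 + s *\<^sub>R w)) = c"
      by (rule has_vector_derivative_zero_constant[OF convex_real_interval(5)]) auto
    show ?thesis using c[of 0] c[of 1] x0 by (simp add: w_def)
  qed
  ultimately show ?thesis by blast
qed

text \<open>The level set of F through the identity is open and closed for T, hence all of H. For
  the exhaustion clause the chart at the identity has image of its differential equal to the Lie
  algebra, so it covers a neighbourhood of the identity in Q.\<close>

theorem lie_subgroup_lie_data:
  assumes con: "connected_space T"
  shows "lie_data H (top_tang T)"
  unfolding lie_data_def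
proof (intro conjI allI impI ballI)
  show "top_tang T \<subseteq> tang H" unfolding top_tang_def tang_def lie_topspace by blast
next
  fix F :: "real^'n^'n \<Rightarrow> real" and h
  assume F: "\<forall>h\<in>H. \<exists>F'. (F has_derivative F') (at h) \<and> (\<forall>X\<in>top_tang T. F' (X ** h) = 0)" and h: "h \<in> H"
  define Z where "Z = {q \<in> H. F q = F (mat 1)}"
  have loc: "\<exists>O'. openin T O' \<and> p \<in> O' \<and> (\<forall>q\<in>O'. F q = F p)" if "p \<in> H" for p
    using locally_constant_along_tang[OF bspec[OF F] that] by blast
  have "openin T Z"
    unfolding openin_subopen[of T Z]
  proof
    fix p assume "p \<in> Z"
    then obtain O' where "openin T O'" "p \<in> O'" "\<forall>q\<in>O'. F q = F p"
      using loc[of p] unfolding Z_def by blast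
    moreover have "q \<in> Z" if "q \<in> O'" for q
    proof -
      have "F q = F p" "q \<in> H" using that calculation openin_subset[of T O'] lie_topspace by blast+
      then show ?thesis using \<open>p \<in> Z\<close> by (simp add: Z_def)
    qed
    ultimately show "\<exists>O'. openin T O' \<and> p \<in> O' \<and> O' \<subseteq> Z" by blast
  qed
  moreover have "openin T (H - Z)"
    unfolding openin_subopen[of T "H - Z"]
  proof
    fix p assume "p \<in> H - Z"
    then obtain O' where "openin T O'" "p \<in> O'" "\<forall>q\<in>O'. F q = F p"
      using loc[of p] unfolding Z_def by blast
    moreover have "q \<in> H - Z" if "q \<in> O'" for q
    proof -
      have "F q = F p" "q \<in> H" using that calculation openin_subset[of T O'] lie_topspace by blast+
      then show ?thesis using \<open>p \<in> H - Z\<close> by (simp add: Z_def)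
    qed
    ultimately show "\<exists>O'. openin T O' \<and> p \<in> O' \<and> O' \<subseteq> H - Z" by blast
  qed
  ultimately have "closedin T Z" "openin T Z" by (auto simp: closedin_def lie_topspace Z_def)
  then have "Z = {} \<or> Z = H" using con lie_topspace unfolding connected_space_clopen_in by blast
  moreover have "mat 1 \<in> Z" using lie_group by (auto simp: Z_def)
  ultimately show "F h = F (mat 1)" using h by (auto simp: Z_def)
next
  fix Q assume Q: "\<exists>n. emb_lie n Q \<and> connected Q \<and> H \<subseteq> Q \<and> tang Q \<subseteq> top_tang T"
  then obtain m where m: "emb_lie m Q" by blast
  obtain W :: "(real^'n^'n) set" and V f x0 where
    W: "subspace W" and V: "openin (top_of_set W) V" and imm: "smooth_immersion_on W V f"
    and opn: "openin T (f ` V)" and x0: "x0 \<in> V" "f x0 = mat 1"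
    and hom: "homeomorphic_map (top_of_set V) (subtopology T (f ` V)) f"
    using lie_chart[OF lie_group(2)] .
  obtain D where D: "(f has_derivative D) (at x0 within V)" "inj_on D W"
    using imm x0 unfolding smooth_immersion_on_def by blast
  have fV: "f ` V \<subseteq> H" using opn openin_subset lie_topspace by blast
  have "C_k_on 0 W V f" using imm unfolding smooth_immersion_on_def by blast
  then have "continuous_on V f" by simp
  moreover have "tang Q \<subseteq> D ` W" using Q top_tang_eq_chart[OF W V opn hom x0 D] by blast
  ultimately have "\<exists>e>0. \<forall>q\<in>Q. dist q (mat 1) < e \<longrightarrow> q \<in> H"
    using chart_covers_nbhd[OF m _ W V _ fV x0 D(1)] Q by blast
  then show "H = Q"
    using subgroup_GL_connected_eq[OF lie_subgroup_GL] m Q unfolding emb_lie_def by metis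
qed (use lie_subgroup_GL subspace_top_tang top_tang_Ad top_tang_bracket in auto)

end

corollary connected_lie_subgroup_lie_data:
  "connected_lie_subgroup H \<Longrightarrow> \<exists>\<hh>. lie_data H \<hh>"
  unfolding connected_lie_subgroup_def using lie_subgroup_lie_data by blast

section \<open>Transport of groups, tangent vectors and Lie data by conjugation\<close>

lemma conj_inverse:
  fixes g x y :: "real^'n^'n"
  assumes g: "invertible g"
  shows "g ** (matrix_inv g ** x ** g) ** matrix_inv g = x" "matrix_inv g ** (g ** x ** matrix_inv g) ** g = x"
    "g ** (x ** y) ** matrix_inv g = (g ** x ** matrix_inv g) ** (g ** y ** matrix_inv g)"
  by (simp_all add: matrix_mul_assoc[symmetric] matrix_inv[OF g] matrix_inv_cancel[OF g])

lemma conj_matrix_inv: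
  fixes g x :: "real^'n^'n"
  assumes g: "invertible g" and x: "invertible x"
  shows "matrix_inv (g ** x ** matrix_inv g) = g ** matrix_inv x ** matrix_inv g"
  using assms by (simp add: matrix_inv_mult invertible_mult invertible_matrix_inv matrix_inv_matrix_inv matrix_mul_assoc)

lemma conj_set_conj_set:
  fixes g h :: "real^'n^'n"
  assumes "invertible g" "invertible h"
  shows "conj_set g (conj_set h G) = conj_set (g ** h) G"
  unfolding conj_set_def image_image using assms by (simp add: matrix_inv_mult matrix_mul_assoc)

lemma conj_set_inverse:
  fixes g :: "real^'n^'n"
  assumes "invertible g"
  shows "conj_set (matrix_inv g) (conj_set g G) = G" "conj_set g (conj_set (matrix_inv g) G) = G"
  using assms by (simp_all add: conj_set_conj_set invertible_matrix_inv matrix_inv) (simp_all add: conj_set_def)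

lemma tang_conj_subset:
  fixes g :: "real^'n^'n"
  assumes g: "invertible g"
  shows "conj_set g (tang H) \<subseteq> tang (conj_set g H)"
proof
  fix X assume "X \<in> conj_set g (tang H)"
  then obtain \<gamma> Y where \<gamma>: "\<gamma> 0 = mat 1" "\<And>t. \<gamma> t \<in> H" "(\<gamma> has_vector_derivative Y) (at (0::real))"
    and X: "X = g ** Y ** matrix_inv g"
    unfolding tang_def conj_set_def by blast
  have "((\<lambda>t. g ** \<gamma> t ** matrix_inv g) has_vector_derivative X) (at 0)"
    unfolding X using bounded_linear.has_vector_derivative[OF bounded_linear_conj \<gamma>(3)] .
  moreover have "g ** \<gamma> 0 ** matrix_inv g = mat 1" using \<gamma>(1) g by (simp add: matrix_inv)
  ultimately show "X \<in> tang (conj_set g H)"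
    using \<gamma>(2) unfolding tang_def conj_set_def by (intro CollectI exI[of _ "\<lambda>t. g ** \<gamma> t ** matrix_inv g"]) auto
qed

lemma tang_conj:
  fixes g :: "real^'n^'n"
  assumes g: "invertible g"
  shows "tang (conj_set g H) = conj_set g (tang H)"
proof
  have "conj_set (matrix_inv g) (tang (conj_set g H)) \<subseteq> tang H"
    using tang_conj_subset[OF invertible_matrix_inv[OF g], of "conj_set g H"] by (simp add: conj_set_inverse[OF g])
  then have "conj_set g (conj_set (matrix_inv g) (tang (conj_set g H))) \<subseteq> conj_set g (tang H)"
    unfolding conj_set_def by blast
  then show "tang (conj_set g H) \<subseteq> conj_set g (tang H)" by (simp add: conj_set_inverse[OF g])
qed (rule tang_conj_subset[OF g])

lemma connected_conj_set: "connected Q \<Longrightarrow> connected (conj_set g Q)"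
  unfolding conj_set_def
  by (rule connected_continuous_image) (auto intro: linear_continuous_on bounded_linear_conj)

lemma conj_set_mono: "A \<subseteq> B \<Longrightarrow> conj_set g A \<subseteq> conj_set g B"
  unfolding conj_set_def by (rule image_mono)

lemma subgroup_conj_set:
  fixes g :: "real^'n^'n"
  assumes g: "invertible g" and H: "subgroup H GL"
  shows "subgroup (conj_set g H) GL"
  unfolding subgroup_GL_iff
proof (intro conjI ballI)
  note H = H[unfolded subgroup_GL_iff]
  show "invertible h" if "h \<in> conj_set g H" for h
    using that g H by (auto simp: conj_set_def intro!: invertible_mult invertible_matrix_inv)
  show "mat 1 \<in> conj_set g H"
    using H g by (auto simp: conj_set_def matrix_inv image_iff intro!: bexI[of _ "mat 1"])
  show "a ** b \<in> conj_set g H" if "a \<in> conj_set g H" "b \<in> conj_set g H" for a b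
    using that H by (auto simp: conj_set_def conj_inverse(3)[OF g, symmetric])
  show "matrix_inv a \<in> conj_set g H" if "a \<in> conj_set g H" for a
    using that H by (auto simp: conj_set_def conj_matrix_inv[OF g])
qed

text \<open>Each clause is pulled back along conjugation: a test function F becomes F composed with
  conjugation, and a competing group Q becomes its conjugate by the inverse.\<close>

lemma lie_data_conj:
  fixes H \<hh> :: "(real^'n^'n) set"
  assumes d: "lie_data H \<hh>" and g: "invertible g"
  shows "lie_data (conj_set g H) (conj_set g \<hh>)"
proof -
  from d have H: "subgroup H GL" "subspace \<hh>" "\<hh> \<subseteq> tang H"
    and Ad: "\<And>h X. h \<in> H \<Longrightarrow> X \<in> \<hh> \<Longrightarrow> h ** X ** matrix_inv h \<in> \<hh>"
    and br: "\<And>X Y. X \<in> \<hh> \<Longrightarrow> Y \<in> \<hh> \<Longrightarrow> X ** Y - Y ** X \<in> \<hh>"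
    and F: "\<And>F :: real^'n^'n \<Rightarrow> real. \<forall>h\<in>H. \<exists>F'. (F has_derivative F') (at h) \<and> (\<forall>X\<in>\<hh>. F' (X ** h) = 0) \<Longrightarrow> \<forall>h\<in>H. F h = F (mat 1)"
    and Q: "\<And>Q n. emb_lie n Q \<Longrightarrow> connected Q \<Longrightarrow> H \<subseteq> Q \<Longrightarrow> tang Q \<subseteq> \<hh> \<Longrightarrow> H = Q"
    unfolding lie_data_def by auto
  note Hg = H(1)[unfolded subgroup_GL_iff]
  define c where "c = (\<lambda>x. g ** x ** matrix_inv g)"
  have cs: "conj_set g A = c ` A" for A by (simp add: conj_set_def c_def)
  have blc: "bounded_linear c" unfolding c_def by (rule bounded_linear_conj)
  interpret c: bounded_linear c by fact
  have cm: "c (x ** y) = c x ** c y" for x y unfolding c_def by (rule conj_inverse(3)[OF g])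
  have ci: "matrix_inv (c x) = c (matrix_inv x)" if "invertible x" for x
    unfolding c_def by (rule conj_matrix_inv[OF g that])
  have c1: "c (mat 1) = mat 1" by (simp add: c_def matrix_inv[OF g])
  show ?thesis
    unfolding lie_data_def
  proof (intro conjI allI impI ballI)
    show "subgroup (conj_set g H) GL" by (rule subgroup_conj_set[OF g H(1)])
    show "subspace (conj_set g \<hh>)" unfolding cs by (rule linear_subspace_image[OF c.linear H(2)])
    show "conj_set g \<hh> \<subseteq> tang (conj_set g H)" unfolding tang_conj[OF g] by (rule conj_set_mono[OF H(3)])
    show "h ** X ** matrix_inv h \<in> conj_set g \<hh>" if "h \<in> conj_set g H" "X \<in> conj_set g \<hh>" for h X
      using that Ad Hg by (auto simp: cs ci cm[symmetric])
    show "X ** Y - Y ** X \<in> conj_set g \<hh>" if "X \<in> conj_set g \<hh>" "Y \<in> conj_set g \<hh>" for X Y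
      using that br by (auto simp: cs cm[symmetric] c.diff[symmetric])
  next
    fix F :: "real^'n^'n \<Rightarrow> real" and h
    assume *: "\<forall>h\<in>conj_set g H. \<exists>F'. (F has_derivative F') (at h) \<and> (\<forall>X\<in>conj_set g \<hh>. F' (X ** h) = 0)"
      and h: "h \<in> conj_set g H"
    have "\<forall>h\<in>H. F (c h) = F (c (mat 1))"
    proof (rule F, intro ballI)
      fix h assume "h \<in> H"
      then obtain F' where F': "(F has_derivative F') (at (c h))" "\<And>X. X \<in> \<hh> \<Longrightarrow> F' (c X ** c h) = 0"
        using * unfolding cs by blast
      have "((\<lambda>h. F (c h)) has_derivative (\<lambda>x. F' (c x))) (at h)"
        using diff_chain_at[OF bounded_linear_imp_has_derivative[OF blc] F'(1)] by (simp add: o_def)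
      then show "\<exists>F'. ((\<lambda>h. F (c h)) has_derivative F') (at h) \<and> (\<forall>X\<in>\<hh>. F' (X ** h) = 0)"
        using F'(2) by (intro exI[of _ "\<lambda>x. F' (c x)"]) (auto simp: cm)
    qed
    then show "F h = F (mat 1)" using h c1 by (auto simp: cs)
  next
    fix Q assume "\<exists>n. emb_lie n Q \<and> connected Q \<and> conj_set g H \<subseteq> Q \<and> tang Q \<subseteq> conj_set g \<hh>"
    then obtain n where n: "emb_lie n Q" "connected Q" "conj_set g H \<subseteq> Q" "tang Q \<subseteq> conj_set g \<hh>" by blast
    note gi = invertible_matrix_inv[OF g]
    have "H = conj_set (matrix_inv g) Q"
    proof (rule Q)
      show "emb_lie n (conj_set (matrix_inv g) Q)" by (rule emb_lie_conj[OF n(1) gi])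
      show "connected (conj_set (matrix_inv g) Q)" by (rule connected_conj_set[OF n(2)])
      show "H \<subseteq> conj_set (matrix_inv g) Q"
        using conj_set_mono[OF n(3), of "matrix_inv g"] by (simp add: conj_set_inverse[OF g])
      show "tang (conj_set (matrix_inv g) Q) \<subseteq> \<hh>"
        using conj_set_mono[OF n(4), of "matrix_inv g"] by (simp add: conj_set_inverse[OF g] tang_conj[OF gi])
    qed
    then show "conj_set g H = Q" by (simp add: conj_set_inverse[OF g])
  qed
qed

text \<open>In an embedded group a curve differentiable at 0 stays in U for small t, so \<kappa>
  pulls it back to the chart and X = E (K X). Unlike for immersed groups, no further topology is
  involved.\<close>

lemma chart_tang:
  fixes H :: "(real^'n^'n) set" and W V :: "(real^'n^'n) set"
  assumes W: "subspace W" and V: "openin (top_of_set W) V" and f: "smooth_on W V f"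
    and U: "open U" "mat 1 \<in> U" "f ` V = H \<inter> U" and H: "mat 1 \<in> H"
    and \<kappa>: "\<And>x. x \<in> V \<Longrightarrow> \<kappa> (f x) = x" "\<And>p. p \<in> U \<Longrightarrow> \<kappa> differentiable (at p)"
    and y0: "y0 \<in> V" "f y0 = mat 1" and E: "(f has_derivative E) (at y0 within V)"
  shows "tang H = E ` W"
proof safe
  fix w assume w: "w \<in> W"
  from has_derivative_line[OF W V y0(1) w E] obtain S where
    d: "((\<lambda>t. f (y0 + t *\<^sub>R w)) has_vector_derivative E w) (at 0)"
    and S: "open S" "0 \<in> S" "\<And>t. t \<in> S \<Longrightarrow> y0 + t *\<^sub>R w \<in> V" by blast
  define \<gamma> where "\<gamma> = (\<lambda>t. if t \<in> S then f (y0 + t *\<^sub>R w) else mat 1)"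
  have "(\<gamma> has_vector_derivative E w) (at 0)"
    by (rule has_vector_derivative_transform_within_open[OF d S(1,2)]) (auto simp: \<gamma>_def)
  moreover have "\<gamma> t \<in> H" for t using S(3) U(3) H by (auto simp: \<gamma>_def)
  moreover have "\<gamma> 0 = mat 1" using y0 by (auto simp: \<gamma>_def)
  ultimately show "E w \<in> tang H" unfolding tang_def by blast
next
  fix X assume "X \<in> tang H"
  then obtain \<gamma> where \<gamma>: "\<gamma> 0 = mat 1" "\<And>t. \<gamma> t \<in> H" "(\<gamma> has_vector_derivative X) (at (0::real))"
    unfolding tang_def by blast
  obtain K where K: "(\<kappa> has_derivative K) (at (mat 1))"
    using \<kappa>(2)[OF U(2)] unfolding differentiable_def by blast
  have "isCont \<gamma> 0" using \<gamma>(3) has_vector_derivative_continuous by blast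
  then have "open U \<and> \<gamma> 0 \<in> U \<longrightarrow> (\<exists>S. open S \<and> 0 \<in> S \<and> (\<forall>t\<in>S. \<gamma> t \<in> U))"
    unfolding continuous_at_open by (rule spec)
  then obtain S where S: "open S" "0 \<in> S" "\<And>t. t \<in> S \<Longrightarrow> \<gamma> t \<in> U"
    using U(1,2) \<gamma>(1) by auto
  have \<gamma>f: "\<kappa> (\<gamma> t) \<in> V" "f (\<kappa> (\<gamma> t)) = \<gamma> t" if "t \<in> S" for t
  proof -
    have "\<gamma> t \<in> f ` V" using S(3)[OF that] \<gamma>(2) U(3) by blast
    then obtain x where "x \<in> V" "\<gamma> t = f x" by blast
    then show "\<kappa> (\<gamma> t) \<in> V" "f (\<kappa> (\<gamma> t)) = \<gamma> t" using \<kappa>(1) by simp_all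
  qed
  have \<gamma>d: "(\<gamma> has_derivative (\<lambda>t. t *\<^sub>R X)) (at 0)" using \<gamma>(3) by (simp add: has_vector_derivative_def)
  have "((\<kappa> \<circ> \<gamma>) has_derivative (K \<circ> (\<lambda>t. t *\<^sub>R X))) (at 0)"
    by (rule diff_chain_at[OF \<gamma>d]) (simp add: \<gamma>(1) K)
  then have kd: "((\<lambda>t. \<kappa> (\<gamma> t)) has_vector_derivative K X) (at 0)"
    using K by (simp add: has_vector_derivative_def o_def has_derivative_def linear_simps)
  have \<kappa>0: "\<kappa> (\<gamma> 0) = y0" using \<gamma>(1) \<kappa>(1)[OF y0(1)] y0(2) by simp
  have VW: "V \<subseteq> W" using V openin_imp_subset by blast
  \<comment> \<open>The pulled back curve runs in V, a subset of W, so its difference quotients and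
    their limit lie in W.\<close>
  have KX: "K X \<in> W"
  proof (rule Lim_in_closed_set[OF closed_subspace[OF W] _ _ tendsto_difference_quotient[OF kd]])
    have "\<forall>\<^sub>F t in at 0. t \<in> S" using S eventually_at_topological by blast
    then show "\<forall>\<^sub>F t in at 0. (\<kappa> (\<gamma> t) - \<kappa> (\<gamma> 0)) /\<^sub>R t \<in> W"
      by (rule eventually_mono) (use \<gamma>f(1) VW W S(2) in \<open>auto intro!: subspace_scale subspace_diff\<close>)
  qed simp
  have "((\<lambda>t. \<kappa> (\<gamma> t)) has_derivative (\<lambda>t. t *\<^sub>R K X)) (at 0 within S)"
    using kd by (simp add: has_vector_derivative_def has_derivative_at_withinI)
  moreover have "(f has_derivative E) (at (\<kappa> (\<gamma> 0)) within (\<lambda>t. \<kappa> (\<gamma> t)) ` S)"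
    unfolding \<kappa>0 using E by (rule has_derivative_subset) (use \<gamma>f in auto)
  ultimately have "((\<lambda>t. f (\<kappa> (\<gamma> t))) has_derivative (\<lambda>t. E (t *\<^sub>R K X))) (at 0 within S)"
    using diff_chain_within by (fastforce simp: o_def)
  then have "((\<lambda>t. f (\<kappa> (\<gamma> t))) has_vector_derivative E (K X)) (at 0)"
    using at_within_open[OF S(2,1)] E by (simp add: has_vector_derivative_def has_derivative_def linear_simps)
  then have "(\<gamma> has_vector_derivative E (K X)) (at 0)"
    by (rule has_vector_derivative_transform_within_open[OF _ S(1,2)]) (use \<gamma>f in auto)
  then have "X = E (K X)" using \<gamma>(3) vector_derivative_unique_at by blast
  then show "X \<in> E ` W" using KX by blast
qed

text \<open>Near the identity the group is the affine space \<open>mat 1 + W\<close>, so translation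
  by \<open>mat 1\<close> is a chart with identity differential.\<close>

lemma emb_lie_affine:
  fixes H :: "(real^'n^'n) set"
  assumes H: "subgroup H GL" and W: "subspace W" and U: "open U" "mat 1 \<in> U"
    and HU: "H \<inter> U = {z \<in> U. z - mat 1 \<in> W}"
  shows "emb_lie (dim W) H" "tang H = W"
proof -
  define V where "V = W \<inter> (\<lambda>w. mat 1 + w) -` U"
  have opn: "open ((\<lambda>w. mat 1 + w) -` U)" by (rule open_vimage[OF U(1)]) (intro continuous_intros)
  have V: "openin (top_of_set W) V" unfolding V_def using opn by blast
  have f: "smooth_on W V (\<lambda>w. mat 1 + w)"
    by (intro smooth_on_add smooth_on_const smooth_on_bounded_linear bounded_linear_ident)
  have im: "(\<lambda>w. mat 1 + w) ` V = H \<inter> U"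
    unfolding HU V_def by (auto simp: image_iff intro!: bexI[of _ "_ - mat 1"])
  have d: "(\<lambda>p. p - mat 1) differentiable (at p)" for p :: "real^'n^'n" by (auto intro!: derivative_intros)
  show "emb_lie (dim W) H"
    unfolding emb_lie_def using H W V f U im d
    by (intro conjI exI[of _ W] exI[of _ V] exI[of _ "\<lambda>w. mat 1 + w"] exI[of _ U] exI[of _ "\<lambda>p. p - mat 1"]) auto
  have 1: "mat 1 \<in> H" using H unfolding subgroup_GL_iff by blast
  have 2: "mat 1 + x - mat 1 = x" for x :: "real^'n^'n" by simp
  have 3: "0 \<in> V" "mat 1 + 0 = (mat 1 :: real^'n^'n)" using U W by (auto simp: V_def subspace_0)
  have 4: "((\<lambda>w. mat 1 + w) has_derivative (\<lambda>w. w)) (at 0 within V)" by (auto intro!: derivative_eq_intros)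
  have "tang H = (\<lambda>w. w) ` W"
    by (rule chart_tang[OF W V f U im 1 2 d 3 4])
  then show "tang H = W" by simp
qed

text \<open>The chart lives on the line spanned by X, with coordinate l. The interval I is kept
  separate from the domain of E so that periodic groups are covered, where \<tau> recovers the
  parameter only locally.\<close>

lemma emb_lie_one_param:
  fixes E :: "real \<Rightarrow> real^'n^'n"
  assumes E': "\<And>t. (E has_vector_derivative X ** E t) (at t)" and E0: "E 0 = mat 1"
    and hom: "\<And>s t. E (s + t) = E s ** E t" and X: "X \<noteq> 0"
    and U: "open U" "mat 1 \<in> U" and I: "open I" "0 \<in> I" "E ` I = range E \<inter> U"
    and \<tau>: "\<And>t. t \<in> I \<Longrightarrow> \<tau> (E t) = t" "\<And>p. p \<in> U \<Longrightarrow> \<tau> differentiable (at p)"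
  shows "emb_lie 1 (range E)" "tang (range E) = span {X}" "connected (range E)"
proof -
  define l where "l = (\<lambda>w. (w \<bullet> X) / (X \<bullet> X))"
  have l: "bounded_linear l"
    unfolding l_def using bounded_linear_mult_left[of "inverse (X \<bullet> X)"]
    by (auto intro!: bounded_linear_divide bounded_linear_compose[OF bounded_linear_divide] bounded_linear_inner_left)
  have lX: "l (t *\<^sub>R X) = t" for t using X by (simp add: l_def)
  define W where "W = span {X}"
  have W: "subspace W" and dW: "dim W = 1" using X by (auto simp: W_def)
  have WX: "w = l w *\<^sub>R X" if "w \<in> W" for w using that lX by (auto simp: W_def span_singleton)
  define V where "V = W \<inter> l -` I"
  have V: "openin (top_of_set W) V"
    unfolding V_def using open_vimage[OF I(1) linear_continuous_on[OF l]] by blast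
  define f where "f = (\<lambda>w. E (l w))"
  \<comment> \<open>The differential equation makes the n-th derivative of E equal to X^n E, which
    provides the full sequence of derivatives.\<close>
  have "smooth_on W V (\<lambda>w. (\<lambda>n t. (((**) X) ^^ n) (E t)) 0 (l w))"
  proof (rule smooth_on_compose_real[OF l])
    fix n t
    have "(((\<lambda>t. (((**) X) ^^ n) (E t)) has_vector_derivative (((**) X) ^^ n) (X ** E t)) (at t))"
    proof (induction n)
      case (Suc n)
      then show ?case using bounded_linear.has_vector_derivative[OF matrix_mult.bounded_linear_right Suc] by simp
    qed (simp add: E')
    then show "(((\<lambda>t. (((**) X) ^^ n) (E t)) has_vector_derivative (((**) X) ^^ Suc n) (E t)) (at t))"
      by (simp add: funpow_swap1)
  qed
  then have f: "smooth_on W V f" by (simp add: f_def)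
  have lV: "l ` V = I"
  proof
    show "I \<subseteq> l ` V"
    proof
      fix t assume "t \<in> I"
      then have "t *\<^sub>R X \<in> V" using lX by (auto simp: V_def W_def span_base span_scale)
      then show "t \<in> l ` V" using lX by (metis imageI)
    qed
  qed (auto simp: V_def)
  have im: "f ` V = range E \<inter> U"
    using I(3) lV unfolding f_def by (metis image_image)
  have \<kappa>: "\<tau> (f x) *\<^sub>R X = x" if "x \<in> V" for x
    using that \<tau>(1) WX[of x] by (auto simp: f_def V_def)
  have d\<kappa>: "(\<lambda>p. \<tau> p *\<^sub>R X) differentiable (at p)" if "p \<in> U" for p
    using \<tau>(2)[OF that] by (auto intro!: derivative_intros)
  have inv: "E t ** E (- t) = mat 1" for t using hom[of t "- t"] E0 by simp
  have sub: "subgroup (range E) GL"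
    unfolding subgroup_GL_iff using matrix_inv_unique[OF inv] E0 hom
    by (auto simp: image_iff) metis+
  show "emb_lie 1 (range E)"
    unfolding emb_lie_def using sub W dW V f U im \<kappa> d\<kappa>
    by (intro conjI exI[of _ W] exI[of _ V] exI[of _ f] exI[of _ U] exI[of _ "\<lambda>p. \<tau> p *\<^sub>R X"]) auto
  have "tang (range E) = (\<lambda>w. l w *\<^sub>R X) ` W"
  proof (rule chart_tang[OF W V f U im _ \<kappa> d\<kappa>])
    have "(E has_derivative (\<lambda>t. t *\<^sub>R X)) (at (l 0))"
      using E'[of 0] by (simp add: l_def has_vector_derivative_def E0)
    from diff_chain_at[OF bounded_linear_imp_has_derivative[OF l] this]
    show "(f has_derivative (\<lambda>w. l w *\<^sub>R X)) (at 0 within V)"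
      by (simp add: f_def o_def has_derivative_at_withinI)
    show "0 \<in> V" using I(2) W by (auto simp: V_def l_def subspace_0)
    show "f 0 = mat 1" by (simp add: f_def l_def E0)
  qed (use E0 in \<open>auto simp: image_iff intro!: exI[of _ 0]\<close>)
  then show "tang (range E) = span {X}" using WX by (simp add: W_def)
  have "continuous_on UNIV E"
    by (meson E' continuous_at_imp_continuous_on has_vector_derivative_continuous)
  then show "connected (range E)" using connected_continuous_image connected_UNIV by blast
qed

section \<open>Matrix groups of size two\<close>

lemma mat2_nth [simp]:
  "mat2 a b c d $ 1 $ 1 = a" "mat2 a b c d $ 1 $ 2 = b" "mat2 a b c d $ 2 $ 1 = c" "mat2 a b c d $ 2 $ 2 = d"
  by (simp_all add: mat2_def)

lemma vec2_eq_iff: "(A :: real^2^2) = B \<longleftrightarrow>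
    A$1$1 = B$1$1 \<and> A$1$2 = B$1$2 \<and> A$2$1 = B$2$1 \<and> A$2$2 = B$2$2"
  by (auto simp: vec_eq_iff forall_2)

lemma mat2_eq_iff [simp]: "mat2 a b c d = mat2 a' b' c' d' \<longleftrightarrow> a = a' \<and> b = b' \<and> c = c' \<and> d = d'"
  by (simp add: vec2_eq_iff)

lemma mat2_cases: obtains a b c d where "A = mat2 a b c d"
  using that[of "A$1$1" "A$1$2" "A$2$1" "A$2$2"] by (simp add: vec2_eq_iff)

lemma mat2_mult [simp]: "mat2 a b c d ** mat2 a' b' c' d' =
    mat2 (a * a' + b * c') (a * b' + b * d') (c * a' + d * c') (c * b' + d * d')"
  by (simp add: vec2_eq_iff matrix_matrix_mult_def sum_2)

lemma mat2_arith [simp]: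
  "mat2 a b c d + mat2 a' b' c' d' = mat2 (a + a') (b + b') (c + c') (d + d')"
  "mat2 a b c d - mat2 a' b' c' d' = mat2 (a - a') (b - b') (c - c') (d - d')"
  "- mat2 a b c d = mat2 (- a) (- b) (- c) (- d)"
  "r *\<^sub>R mat2 a b c d = mat2 (r * a) (r * b) (r * c) (r * d)"
  "transpose (mat2 a b c d) = mat2 a c b d"
  by (simp_all add: vec2_eq_iff transpose_def)

lemma mat2_zero: "(0 :: real^2^2) = mat2 0 0 0 0"
  by (simp add: vec2_eq_iff)

lemma mat2_one: "(mat 1 :: real^2^2) = mat2 1 0 0 1"
  by (simp add: vec2_eq_iff mat_def)

lemma det_mat2 [simp]: "det (mat2 a b c d) = a * d - b * c"
  by (simp add: det_2)

lemma trace_mat2 [simp]: "trace (mat2 a b c d) = a + d"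
  by (simp add: trace_def sum_2)

lemma invertible_mat2 [simp]: "invertible (mat2 a b c d) \<longleftrightarrow> a * d - b * c \<noteq> 0"
  by (simp add: invertible_det_nz)

lemma matrix_inv_mat2:
  assumes "a * d - b * c \<noteq> 0"
  shows "matrix_inv (mat2 a b c d) =
    mat2 (d / (a * d - b * c)) (- b / (a * d - b * c)) (- c / (a * d - b * c)) (a / (a * d - b * c))"
proof (rule matrix_inv_unique(1))
  define D where "D = a * d - b * c"
  then have "a * d = D + b * c" "D \<noteq> 0" using assms by auto
  then show "mat2 a b c d ** mat2 (d / (a * d - b * c)) (- b / (a * d - b * c)) (- c / (a * d - b * c)) (a / (a * d - b * c)) = mat 1"
    unfolding D_def[symmetric] by (simp add: mat2_one field_simps)
qed

lemma mat2_expand: "mat2 a b c d = a *\<^sub>R mat2 1 0 0 0 + b *\<^sub>R mat2 0 1 0 0 + c *\<^sub>R mat2 0 0 1 0 + d *\<^sub>R mat2 0 0 0 1"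
  by simp

lemma bounded_linear_entry: "bounded_linear (\<lambda>A :: real^'n^'m. A $ i $ j)"
  using bounded_linear_compose[OF bounded_linear_vec_nth bounded_linear_vec_nth] .

lemma has_derivative_mat2:
  assumes "(f has_derivative f') F" "(g has_derivative g') F" "(h has_derivative h') F" "(k has_derivative k') F"
  shows "((\<lambda>x. mat2 (f x) (g x) (h x) (k x)) has_derivative (\<lambda>x. mat2 (f' x) (g' x) (h' x) (k' x))) F"
  unfolding mat2_expand[of "f _"] mat2_expand[of "f' _"]
  by (intro has_derivative_add has_derivative_scaleR_left assms)

lemma has_vector_derivative_mat2:
  assumes "(f has_vector_derivative f') F" "(g has_vector_derivative g') F"
    "(h has_vector_derivative h') F" "(k has_vector_derivative k') F"
  shows "((\<lambda>x. mat2 (f x) (g x) (h x) (k x)) has_vector_derivative mat2 f' g' h' k') F"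
  using has_derivative_mat2[OF assms[unfolded has_vector_derivative_def]]
  by (simp add: has_vector_derivative_def)

lemma continuous_on_mat2:
  assumes "continuous_on S f" "continuous_on S g" "continuous_on S h" "continuous_on S k"
  shows "continuous_on S (\<lambda>x. mat2 (f x) (g x) (h x) (k x))"
  unfolding mat2_expand[of "f _"] by (intro continuous_intros assms)

lemma smooth_on_mat2:
  assumes "smooth_on W V f" "smooth_on W V g" "smooth_on W V h" "smooth_on W V k"
  shows "smooth_on W V (\<lambda>x. mat2 (f x) (g x) (h x) (k x))"
  unfolding mat2_expand[of "f _"]
  by (intro smooth_on_add smooth_on_bilinear[OF bounded_bilinear_scaleR] smooth_on_const assms)

section \<open>Charts and tangent spaces of the explicit groups\<close>

lemma range_linear_inj:
  fixes f :: "'a::euclidean_space \<Rightarrow> 'b::euclidean_space"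
  assumes "linear f" "inj f"
  shows "subspace (range f)" "dim (range f) = DIM('a)"
  using assms linear_subspace_image[of f UNIV] dim_image_eq[of f UNIV] by auto

text \<open>The one-dimensional and the two-dimensional groups of lower triangular matrices whose diagonal
  part is a one-parameter group. They contain the groups \<open>H_diag\<sigma>3\<close>, \<open>L\<sigma>3\<close> and \<open>K_inf\<sigma>3\<close>, but keep
  the diagonal directions homogeneous.\<close>

definition Dgrp :: "real \<Rightarrow> real \<Rightarrow> (real^2^2) set" where
  "Dgrp c a = range (\<lambda>t. mat2 (exp (c * t)) 0 0 (exp (a * t)))"

definition Tgrp :: "real \<Rightarrow> real \<Rightarrow> (real^2^2) set" where
  "Tgrp c a = {mat2 (exp (c * t)) 0 s (exp (a * t)) | s t. True}"

definition T0 :: "(real^2^2) set" where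
  "T0 = {mat2 c 0 b a | a b c. 0 < c \<and> 0 < a}"

lemma open_entries: 
  "open {p :: real^2^2. 0 < p$1$1}" "open {p :: real^2^2. 0 < p$1$1 \<and> 0 < p$2$2}"
  "open {p :: real^2^2. 0 < p$1$1 * p$2$2 - p$1$2 * p$2$1}"
  by (intro open_Collect_less open_Collect_conj continuous_intros)+

lemma Dgrp:
  assumes "c \<noteq> 0 \<or> a \<noteq> 0"
  shows "emb_lie 1 (Dgrp c a)" "tang (Dgrp c a) = span {mat2 c 0 0 a}" "connected (Dgrp c a)"
proof -
  define E where "E = (\<lambda>t. mat2 (exp (c * t)) 0 0 (exp (a * t)))"
  define U where "U = {p :: real^2^2. 0 < p$1$1 \<and> 0 < p$2$2}"
  \<comment> \<open>The parameter is read from the logarithm of whichever diagonal entry has a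
    nonzero exponent.\<close>
  define \<tau> where "\<tau> = (\<lambda>p :: real^2^2. if c \<noteq> 0 then ln (p$1$1) / c else ln (p$2$2) / a)"
  have E': "(E has_vector_derivative mat2 c 0 0 a ** E t) (at t)" for t
    unfolding E_def mat2_mult
    by (rule has_vector_derivative_mat2)
      (auto intro!: derivative_eq_intros simp flip: has_real_derivative_iff_has_vector_derivative)
  have d: "\<tau> differentiable (at p)" if "p \<in> U" for p
  proof -
    have "(\<lambda>p :: real^2^2. ln (p$1$1) * k) differentiable (at p)" "(\<lambda>p :: real^2^2. ln (p$2$2) * k) differentiable (at p)" for k
      using that unfolding U_def differentiable_def
      by (auto intro!: exI derivative_eq_intros bounded_linear_imp_has_derivative bounded_linear_entry)
    from this(1)[of "1 / c"] this(2)[of "1 / a"] show ?thesis unfolding \<tau>_def by (cases "c = 0") simp_all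
  qed
  have I: "E ` UNIV = range E \<inter> U" by (auto simp: E_def U_def)
  have U: "open U" "mat 1 \<in> U" unfolding U_def by (rule open_entries) (simp add: mat2_one)
  have \<tau>: "\<tau> (E t) = t" for t using assms by (auto simp: \<tau>_def E_def)
  have "mat2 c 0 0 a \<noteq> 0" using assms by (simp add: mat2_zero)
  note * = emb_lie_one_param[of E "mat2 c 0 0 a" U UNIV \<tau>, OF E' _ _ this U open_UNIV UNIV_I I \<tau> d]
  have "E 0 = mat 1" "\<And>s t. E (s + t) = E s ** E t" by (simp_all add: E_def mat2_one exp_add algebra_simps)
  from *[OF this] show "emb_lie 1 (Dgrp c a)" "tang (Dgrp c a) = span {mat2 c 0 0 a}" "connected (Dgrp c a)"
    unfolding Dgrp_def E_def by simp_all
qed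

lemma H_one\<sigma>3:
  shows "emb_lie 1 H_one\<sigma>3" "tang H_one\<sigma>3 = span {mat2 1 0 1 1}" "connected H_one\<sigma>3"
proof -
  define E where "E = (\<lambda>t. mat2 (exp t) 0 (exp t * t) (exp t))"
  define U where "U = {p :: real^2^2. 0 < p$1$1}"
  define \<tau> where "\<tau> = (\<lambda>p :: real^2^2. ln (p$1$1))"
  have E': "(E has_vector_derivative mat2 1 0 1 1 ** E t) (at t)" for t
    unfolding E_def mat2_mult
    by (rule has_vector_derivative_mat2)
      (auto intro!: derivative_eq_intros simp flip: has_real_derivative_iff_has_vector_derivative)
  have d: "\<tau> differentiable (at p)" if "p \<in> U" for p
    using that unfolding U_def \<tau>_def differentiable_def
    by (auto intro!: exI derivative_eq_intros bounded_linear_imp_has_derivative bounded_linear_entry)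
  have I: "E ` UNIV = range E \<inter> U" by (auto simp: E_def U_def)
  have U: "open U" "mat 1 \<in> U" unfolding U_def by (rule open_entries) (simp add: mat2_one)
  have \<tau>: "\<tau> (E t) = t" for t by (auto simp: \<tau>_def E_def)
  have "mat2 1 0 1 1 \<noteq> 0" by (simp add: mat2_zero)
  note * = emb_lie_one_param[of E "mat2 1 0 1 1" U UNIV \<tau>, OF E' _ _ this U open_UNIV UNIV_I I \<tau> d]
  have **: "E 0 = mat 1" "\<And>s t. E (s + t) = E s ** E t" by (simp_all add: E_def mat2_one exp_add algebra_simps)
  have "H_one\<sigma>3 = range E" unfolding H_one\<sigma>3_def E_def by auto
  with *[OF **] show "emb_lie 1 H_one\<sigma>3" "tang H_one\<sigma>3 = span {mat2 1 0 1 1}" "connected H_one\<sigma>3" by simp_all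
qed

text \<open>The determinant of a point of the spiral is exp (2 t), so half its logarithm is a global
  coordinate even though the angle winds around.\<close>

lemma H\<sigma>1_real:
  shows "emb_lie 1 (H\<sigma>1 (ereal \<alpha>))" "tang (H\<sigma>1 (ereal \<alpha>)) = span {mat2 1 \<alpha> (- \<alpha>) 1}" "connected (H\<sigma>1 (ereal \<alpha>))"
proof -
  define E where "E = (\<lambda>t. mat2 (exp t * cos (\<alpha> * t)) (exp t * sin (\<alpha> * t)) (exp t * - sin (\<alpha> * t)) (exp t * cos (\<alpha> * t)))"
  define U where "U = {p :: real^2^2. 0 < p$1$1 * p$2$2 - p$1$2 * p$2$1}"
  define \<tau> where "\<tau> = (\<lambda>p :: real^2^2. ln (p$1$1 * p$2$2 - p$1$2 * p$2$1) / 2)"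
  have E': "(E has_vector_derivative mat2 1 \<alpha> (- \<alpha>) 1 ** E t) (at t)" for t
    unfolding E_def mat2_mult
    by (rule has_vector_derivative_mat2)
      (auto intro!: derivative_eq_intros simp: algebra_simps simp flip: has_real_derivative_iff_has_vector_derivative)
  have d: "\<tau> differentiable (at p)" if "p \<in> U" for p
    using that unfolding U_def \<tau>_def differentiable_def
    by (auto intro!: exI derivative_eq_intros bounded_linear_imp_has_derivative bounded_linear_entry)
  have "det (E t) = exp t * exp t" for t
  proof -
    have "(e * x) * (e * x) - (e * y) * (e * - y) = e * e * (x\<^sup>2 + y\<^sup>2)" for e x y :: real
      by (simp add: algebra_simps power2_eq_square)
    then show ?thesis unfolding E_def det_mat2 by simp
  qed
  then have dt: "E t $ 1 $ 1 * E t $ 2 $ 2 - E t $ 1 $ 2 * E t $ 2 $ 1 = exp t * exp t" for t by (simp add: det_2)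
  have "0 < E t $ 1 $ 1 * E t $ 2 $ 2 - E t $ 1 $ 2 * E t $ 2 $ 1" for t by (simp only: dt) simp
  then have I: "E ` UNIV = range E \<inter> U" by (auto simp: U_def)
  have U: "open U" "mat 1 \<in> U" unfolding U_def by (rule open_entries) (simp add: mat2_one)
  have \<tau>: "\<tau> (E t) = t" for t by (simp add: \<tau>_def dt ln_mult)
  have "mat2 1 \<alpha> (- \<alpha>) 1 \<noteq> 0" by (simp add: mat2_zero)
  note * = emb_lie_one_param[of E "mat2 1 \<alpha> (- \<alpha>) 1" U UNIV \<tau>, OF E' _ _ this U open_UNIV UNIV_I I \<tau> d]
  have **: "E 0 = mat 1" "\<And>s t. E (s + t) = E s ** E t"
    by (simp_all add: E_def mat2_one exp_add algebra_simps cos_add sin_add)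
  have "H\<sigma>1 (ereal \<alpha>) = range E" unfolding H\<sigma>1_def E_def Rmat_def by auto
  with *[OF **] show "emb_lie 1 (H\<sigma>1 (ereal \<alpha>))" "tang (H\<sigma>1 (ereal \<alpha>)) = span {mat2 1 \<alpha> (- \<alpha>) 1}" "connected (H\<sigma>1 (ereal \<alpha>))" by simp_all
qed

text \<open>On the circle the angle is only a local coordinate: it is recovered by
  \<open>arctan\<close> where the first entry is positive, and I is the corresponding interval of
  length pi.\<close>

lemma H\<sigma>1_infinity:
  shows "emb_lie 1 (H\<sigma>1 \<infinity>)" "tang (H\<sigma>1 \<infinity>) = span {mat2 0 1 (-1) 0}" "connected (H\<sigma>1 \<infinity>)"
proof -
  define I :: "real set" where "I = {- (pi / 2) <..< pi / 2}"
  define U where "U = {p :: real^2^2. 0 < p$1$1}"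
  define \<tau> where "\<tau> = (\<lambda>p :: real^2^2. arctan (p$1$2 / p$1$1))"
  have E': "(Rmat has_vector_derivative mat2 0 1 (-1) 0 ** Rmat t) (at t)" for t
    unfolding Rmat_def mat2_mult
    by (rule has_vector_derivative_mat2)
      (auto intro!: derivative_eq_intros simp flip: has_real_derivative_iff_has_vector_derivative)
  have d: "\<tau> differentiable (at p)" if "p \<in> U" for p
    using that unfolding U_def \<tau>_def differentiable_def
    by (auto intro!: exI derivative_eq_intros bounded_linear_imp_has_derivative bounded_linear_entry)
  have I: "open I" "0 \<in> I" "Rmat ` I = range Rmat \<inter> U"
  proof -
    show "Rmat ` I = range Rmat \<inter> U"
    proof
      show "range Rmat \<inter> U \<subseteq> Rmat ` I"
      proof
        fix p assume "p \<in> range Rmat \<inter> U"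
        then obtain t where t: "p = Rmat t" "cos t > 0" by (auto simp: U_def Rmat_def)
        \<comment> \<open>This is the principal angle; a positive cosine makes its sine and cosine
          agree with those of t.\<close>
        define s where "s = arctan (tan t)"
        have c: "sqrt (1 + (tan t)\<^sup>2) = 1 / cos t"
          using t(2) by (intro real_sqrt_unique) (auto simp: tan_def field_simps simp flip: sin_squared_eq)
        have "cos s = cos t" "sin s = tan t * cos t"
          unfolding s_def cos_arctan sin_arctan c by simp_all
        then have "cos s = cos t" "sin s = sin t" using t(2) by (simp_all add: tan_def)
        moreover have "s \<in> I" using arctan[of "tan t"] by (auto simp: s_def I_def)
        ultimately show "p \<in> Rmat ` I" using t(1) by (auto simp: Rmat_def image_iff intro!: bexI[of _ s])
      qed
    qed (auto simp: U_def I_def Rmat_def cos_gt_zero_pi)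
  qed (auto simp: I_def)
  have U: "open U" "mat 1 \<in> U" unfolding U_def by (rule open_entries) (simp add: mat2_one)
  have \<tau>: "\<tau> (Rmat t) = t" if "t \<in> I" for t
    using that arctan_tan[of t] by (simp add: \<tau>_def Rmat_def I_def tan_def)
  have "mat2 0 1 (-1) 0 \<noteq> 0" by (simp add: mat2_zero)
  note * = emb_lie_one_param[of Rmat "mat2 0 1 (-1) 0" U I \<tau>, OF E' _ _ this U I \<tau> d]
  have **: "Rmat 0 = mat 1" "\<And>s t. Rmat (s + t) = Rmat s ** Rmat t"
    by (simp_all add: Rmat_def mat2_one algebra_simps cos_add sin_add)
  from *[OF **] show "emb_lie 1 (H\<sigma>1 \<infinity>)" "tang (H\<sigma>1 \<infinity>) = span {mat2 0 1 (-1) 0}" "connected (H\<sigma>1 \<infinity>)"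
    by (simp_all add: H\<sigma>1_def)
qed

lemma H_zero\<sigma>3:
  shows "emb_lie 1 H_zero\<sigma>3" "tang H_zero\<sigma>3 = span {mat2 0 0 1 0}" "connected H_zero\<sigma>3"
proof -
  have sub: "subgroup H_zero\<sigma>3 GL"
    unfolding subgroup_GL_iff H_zero\<sigma>3_def
    by (auto simp: mat2_one matrix_inv_mat2)
  have HU: "H_zero\<sigma>3 \<inter> UNIV = {z \<in> UNIV. z - mat 1 \<in> span {mat2 0 0 1 0}}"
    by (auto simp: H_zero\<sigma>3_def span_singleton mat2_one image_iff vec2_eq_iff)
  have "emb_lie (dim (span {mat2 0 0 1 0})) H_zero\<sigma>3"
    by (rule emb_lie_affine[OF sub subspace_span _ _ HU]) auto
  moreover have "mat2 0 0 1 0 \<noteq> 0" by (simp add: mat2_zero)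
  ultimately show "emb_lie 1 H_zero\<sigma>3" by simp
  show "tang H_zero\<sigma>3 = span {mat2 0 0 1 0}"
    by (rule emb_lie_affine[OF sub subspace_span _ _ HU]) auto
  have "H_zero\<sigma>3 = range (\<lambda>t. mat2 1 0 t 1)" by (auto simp: H_zero\<sigma>3_def)
  moreover have "connected (range (\<lambda>t. mat2 1 0 t 1))"
    by (rule connected_continuous_image[OF continuous_on_mat2 connected_UNIV]) (intro continuous_intros)+
  ultimately show "connected H_zero\<sigma>3" by simp
qed

lemma subspaces_mat2:
  "subspace {A. \<exists>x y. A = mat2 x 0 0 y}" "dim {A. \<exists>x y. A = mat2 x 0 0 y} = 2"
  "subspace {A. \<exists>x y. A = mat2 x y (- y) x}" "dim {A. \<exists>x y. A = mat2 x y (- y) x} = 2"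
  "subspace {A. \<exists>x y. A = mat2 x 0 y 0}" "dim {A. \<exists>x y. A = mat2 x 0 y 0} = 2"
  "subspace {A. \<exists>x y z. A = mat2 x 0 y z}" "dim {A. \<exists>x y z. A = mat2 x 0 y z} = 3"
  "subspace {A. \<exists>x y. A = mat2 x y y (- x)}" "dim {A. \<exists>x y. A = mat2 x y y (- x)} = 2"
  "subspace {A. \<exists>x y. A = mat2 x y y 0}" "dim {A. \<exists>x y. A = mat2 x y y 0} = 2"
proof -
  have 1: "{A. \<exists>x y. A = mat2 x 0 0 y} = range (\<lambda>(x, y). mat2 x 0 0 y)"
    "{A. \<exists>x y. A = mat2 x y (- y) x} = range (\<lambda>(x, y). mat2 x y (- y) x)"
    "{A. \<exists>x y. A = mat2 x 0 y 0} = range (\<lambda>(x, y). mat2 x 0 y 0)"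
    "{A. \<exists>x y z. A = mat2 x 0 y z} = range (\<lambda>(x, y, z). mat2 x 0 y z)"
    "{A. \<exists>x y. A = mat2 x y y (- x)} = range (\<lambda>(x, y). mat2 x y y (- x))"
    "{A. \<exists>x y. A = mat2 x y y 0} = range (\<lambda>(x, y). mat2 x y y 0)"
    by (auto simp: image_def)
  have 2: "linear (\<lambda>(x, y). mat2 x 0 0 y)" "linear (\<lambda>(x, y). mat2 x y (- y) x)"
    "linear (\<lambda>(x, y). mat2 x 0 y 0)" "linear (\<lambda>(x, y, z). mat2 x 0 y z)"
    "linear (\<lambda>(x, y). mat2 x y y (- x))" "linear (\<lambda>(x, y). mat2 x y y 0)"
    by (rule linearI; auto simp: algebra_simps)+
  have 3: "inj (\<lambda>(x, y). mat2 x 0 0 y)" "inj (\<lambda>(x, y). mat2 x y (- y) x)"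
    "inj (\<lambda>(x, y). mat2 x 0 y 0)" "inj (\<lambda>(x, y, z). mat2 x 0 y z)"
    "inj (\<lambda>(x, y). mat2 x y y (- x))" "inj (\<lambda>(x, y). mat2 x y y 0)"
    by (auto simp: inj_def)
  show "subspace {A. \<exists>x y. A = mat2 x 0 0 y}" "dim {A. \<exists>x y. A = mat2 x 0 0 y} = 2"
    "subspace {A. \<exists>x y. A = mat2 x y (- y) x}" "dim {A. \<exists>x y. A = mat2 x y (- y) x} = 2"
    "subspace {A. \<exists>x y. A = mat2 x 0 y 0}" "dim {A. \<exists>x y. A = mat2 x 0 y 0} = 2"
    "subspace {A. \<exists>x y z. A = mat2 x 0 y z}" "dim {A. \<exists>x y z. A = mat2 x 0 y z} = 3"
    "subspace {A. \<exists>x y. A = mat2 x y y (- x)}" "dim {A. \<exists>x y. A = mat2 x y y (- x)} = 2"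
    "subspace {A. \<exists>x y. A = mat2 x y y 0}" "dim {A. \<exists>x y. A = mat2 x y y 0} = 2"
    unfolding 1 using range_linear_inj[OF 2(1) 3(1)] range_linear_inj[OF 2(2) 3(2)]
      range_linear_inj[OF 2(3) 3(3)] range_linear_inj[OF 2(4) 3(4)]
      range_linear_inj[OF 2(5) 3(5)] range_linear_inj[OF 2(6) 3(6)] by simp_all
qed

lemma K_zero\<sigma>3_eq: "K_zero\<sigma>3 = {mat2 x 0 0 y | x y. 0 < x \<and> 0 < y}"
  unfolding K_zero\<sigma>3_def by (auto intro: exp_gt_zero) (metis exp_ln)+

lemma K_zero\<sigma>3:
  shows "emb_lie 2 K_zero\<sigma>3" "tang K_zero\<sigma>3 = {A. \<exists>x y. A = mat2 x 0 0 y}" "connected K_zero\<sigma>3"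
proof -
  define U where "U = {p :: real^2^2. 0 < p$1$1 \<and> 0 < p$2$2}"
  have sub: "subgroup K_zero\<sigma>3 GL"
    unfolding subgroup_GL_iff K_zero\<sigma>3_eq by (auto simp: mat2_one matrix_inv_mat2)
  have U: "open U" "mat 1 \<in> U" unfolding U_def by (rule open_entries) (simp add: mat2_one)
  have HU: "K_zero\<sigma>3 \<inter> U = {z \<in> U. z - mat 1 \<in> {A. \<exists>x y. A = mat2 x 0 0 y}}"
    by (auto simp: U_def K_zero\<sigma>3_eq mat2_one vec2_eq_iff)
  show "emb_lie 2 K_zero\<sigma>3" "tang K_zero\<sigma>3 = {A. \<exists>x y. A = mat2 x 0 0 y}"
    using emb_lie_affine[OF sub subspaces_mat2(1) U HU] by (simp_all add: subspaces_mat2)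
  have "K_zero\<sigma>3 = range (\<lambda>(t, s). mat2 (exp t) 0 0 (exp s))" by (auto simp: K_zero\<sigma>3_def)
  moreover have "connected (range (\<lambda>x :: real \<times> real. mat2 (exp (fst x)) 0 0 (exp (snd x))))"
    by (rule connected_continuous_image[OF continuous_on_mat2 connected_UNIV]) (intro continuous_intros)+
  ultimately show "connected K_zero\<sigma>3" by (simp add: case_prod_beta)
qed

lemma T0:
  shows "emb_lie 3 T0" "tang T0 = {A. \<exists>x y z. A = mat2 x 0 y z}" "connected T0"
proof -
  define U where "U = {p :: real^2^2. 0 < p$1$1 \<and> 0 < p$2$2}"
  have sub: "subgroup T0 GL"
    unfolding subgroup_GL_iff T0_def by (auto simp: mat2_one matrix_inv_mat2)
  have U: "open U" "mat 1 \<in> U" unfolding U_def by (rule open_entries) (simp add: mat2_one)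
  have HU: "T0 \<inter> U = {z \<in> U. z - mat 1 \<in> {A. \<exists>x y z. A = mat2 x 0 y z}}"
    by (auto simp: U_def T0_def mat2_one vec2_eq_iff)
  show "emb_lie 3 T0" "tang T0 = {A. \<exists>x y z. A = mat2 x 0 y z}"
    using emb_lie_affine[OF sub subspaces_mat2(7) U HU] by (simp_all add: subspaces_mat2)
  have "mat2 c 0 b a \<in> range (\<lambda>x :: real \<times> real \<times> real. mat2 (exp (fst x)) 0 (fst (snd x)) (exp (snd (snd x))))"
    if "0 < c" "0 < a" for a b c
    by (rule image_eqI[of _ _ "(ln c, b, ln a)"]) (use that in auto)
  then have "T0 = range (\<lambda>x :: real \<times> real \<times> real. mat2 (exp (fst x)) 0 (fst (snd x)) (exp (snd (snd x))))"
    unfolding T0_def by auto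
  moreover have "connected (range (\<lambda>x :: real \<times> real \<times> real. mat2 (exp (fst x)) 0 (fst (snd x)) (exp (snd (snd x)))))"
    by (rule connected_continuous_image[OF continuous_on_mat2 connected_UNIV]) (intro continuous_intros)+
  ultimately show "connected T0" by simp
qed

text \<open>\<open>T0\<close> is connected, which gives one inclusion. Conversely, on the component
  the diagonal entries never vanish, so requiring them to be positive or nonnegative is the same
  condition, once open and once closed.\<close>

lemma H0\<sigma>3_eq: "H0\<sigma>3 = T0"
proof -
  define T where "T = {mat2 c 0 b a | a b c. a * c \<noteq> 0}"
  have "T0 \<subseteq> connected_component_set T (mat 1)"
    by (rule connected_component_maximal[OF _ T0(3)]) (auto simp: T0_def mat2_one T_def)
  moreover have "connected_component_set T (mat 1) \<subseteq> T0"
  proof -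
    define C where "C = connected_component_set T (mat 1)"
    have CT: "C \<subseteq> T" unfolding C_def by (rule connected_component_subset)
    have "openin (top_of_set C) (C \<inter> {p. 0 < p$1$1 \<and> 0 < p$2$2})"
      using open_entries(2) by blast
    moreover have "closedin (top_of_set C) (C \<inter> {p. 0 \<le> p$1$1 \<and> 0 \<le> p$2$2})"
      by (intro closedin_closed_Int closed_Collect_conj closed_Collect_le continuous_intros)
    moreover have "C \<inter> {p. 0 \<le> p$1$1 \<and> 0 \<le> p$2$2} = C \<inter> T0" "C \<inter> {p. 0 < p$1$1 \<and> 0 < p$2$2} = C \<inter> T0"
      using CT by (auto simp: T_def T0_def)
    ultimately have "openin (top_of_set C) (C \<inter> T0)" "closedin (top_of_set C) (C \<inter> T0)" by simp_all
    moreover have "connected C" by (simp add: C_def)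
    ultimately have "C \<inter> T0 = {} \<or> C \<inter> T0 = C" unfolding connected_clopen by blast
    moreover have "mat 1 \<in> C \<inter> T0" by (auto simp: C_def T_def T0_def mat2_one)
    ultimately show ?thesis unfolding C_def by blast
  qed
  ultimately show ?thesis unfolding H0\<sigma>3_def T_def by blast
qed

lemma H0\<sigma>1_eq: "H0\<sigma>1 = {mat2 x y (- y) x | x y. 0 < x * x + y * y}"
proof -
  have "\<exists>r t. r > 0 \<and> x = r * cos t \<and> y = r * sin t" if "0 < x * x + y * y" for x y :: real
  proof -
    define r where "r = sqrt (x * x + y * y)"
    have r: "r > 0" "r\<^sup>2 = x * x + y * y" using that by (auto simp: r_def)
    have "(x / r)\<^sup>2 + (y / r)\<^sup>2 = (x * x + y * y) / r\<^sup>2"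
      by (simp add: power_divide power2_eq_square add_divide_distrib)
    then have "(x / r)\<^sup>2 + (y / r)\<^sup>2 = r\<^sup>2 / r\<^sup>2" unfolding r(2) .
    then have "(x / r)\<^sup>2 + (y / r)\<^sup>2 = 1" using r(1) by simp
    then obtain t where "x / r = cos t" "y / r = sin t" using sincos_total_2pi by metis
    then show ?thesis using r(1) by (intro exI[of _ r] exI[of _ t]) (auto simp: field_simps)
  qed
  moreover have "0 < r * cos t * (r * cos t) + r * sin t * (r * sin t)" if "r > 0" for r t :: real
  proof -
    have "r * cos t * (r * cos t) + r * sin t * (r * sin t) = r * r * ((cos t)\<^sup>2 + (sin t)\<^sup>2)"
      unfolding power2_eq_square by (simp only: algebra_simps)
    then show ?thesis using that by simp
  qed
  ultimately show ?thesis unfolding H0\<sigma>1_def Rmat_def by fastforce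
qed

lemma H0\<sigma>1:
  shows "emb_lie 2 H0\<sigma>1" "tang H0\<sigma>1 = {A. \<exists>x y. A = mat2 x y (- y) x}" "connected H0\<sigma>1"
proof -
  define U where "U = {p :: real^2^2. 0 < p$1$1 * p$2$2 - p$1$2 * p$2$1}"
  have 1: "mat2 x y (- y) x \<in> H0\<sigma>1 \<longleftrightarrow> 0 < x * x + y * y" for x y by (auto simp: H0\<sigma>1_eq)
  have sub: "subgroup H0\<sigma>1 GL"
    unfolding subgroup_GL_iff
  proof (intro conjI ballI)
    show "mat 1 \<in> H0\<sigma>1" using 1[of 1 0] by (simp add: mat2_one)
    show "a ** b \<in> H0\<sigma>1" if ab: "a \<in> H0\<sigma>1" "b \<in> H0\<sigma>1" for a b
    proof -
      obtain x y x' y' where *: "a = mat2 x y (- y) x" "0 < x * x + y * y" "b = mat2 x' y' (- y') x'" "0 < x' * x' + y' * y'"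
        using ab unfolding H0\<sigma>1_eq by blast
      \<comment> \<open>Multiplicativity of the norm of complex numbers, with
        \<open>mat2 x y (- y) x\<close> in the role of x + i y.\<close>
      have "(x * x' - y * y') * (x * x' - y * y') + (x * y' + y * x') * (x * y' + y * x') = (x * x + y * y) * (x' * x' + y' * y')"
        by algebra
      then have "0 < (x * x' - y * y') * (x * x' - y * y') + (x * y' + y * x') * (x * y' + y * x')" using * by simp
      then have "mat2 (x * x' - y * y') (x * y' + y * x') (- (x * y' + y * x')) (x * x' - y * y') \<in> H0\<sigma>1"
        using 1 by blast
      moreover have "a ** b = mat2 (x * x' - y * y') (x * y' + y * x') (- (x * y' + y * x')) (x * x' - y * y')"
        by (simp add: * algebra_simps)
      ultimately show ?thesis by simp
    qed
    show "matrix_inv a \<in> H0\<sigma>1" if a: "a \<in> H0\<sigma>1" for a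
    proof -
      obtain x y where *: "a = mat2 x y (- y) x" "0 < x * x + y * y"
        using a unfolding H0\<sigma>1_eq by auto
      define D where "D = x * x + y * y"
      have "x / D * (x / D) + - y / D * (- y / D) = 1 / D" using * unfolding D_def by (simp add: divide_simps)
      then have "0 < x / D * (x / D) + - y / D * (- y / D)" using * by (simp add: D_def)
      moreover have "x * x - y * - y \<noteq> 0" using *(2) by linarith
      from matrix_inv_mat2[OF this] have "matrix_inv a = mat2 (x / D) (- y / D) (- (- y / D)) (x / D)"
        using * by (simp add: D_def)
      ultimately show ?thesis using 1 by metis
    qed
  qed (auto simp: H0\<sigma>1_eq)
  have U: "open U" "mat 1 \<in> U" unfolding U_def by (rule open_entries) (simp add: mat2_one)
  have HU: "H0\<sigma>1 \<inter> U = {z \<in> U. z - mat 1 \<in> {A. \<exists>x y. A = mat2 x y (- y) x}}"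
    by (auto simp: U_def H0\<sigma>1_eq mat2_one vec2_eq_iff) 
  show "emb_lie 2 H0\<sigma>1" "tang H0\<sigma>1 = {A. \<exists>x y. A = mat2 x y (- y) x}"
    using emb_lie_affine[OF sub subspaces_mat2(3) U HU] by (simp_all add: subspaces_mat2)
  have "H0\<sigma>1 = range (\<lambda>x :: real \<times> real. mat2 (exp (fst x) * cos (snd x)) (exp (fst x) * sin (snd x)) (- (exp (fst x) * sin (snd x))) (exp (fst x) * cos (snd x)))"
  proof -
    have "\<exists>x. r *\<^sub>R Rmat t = mat2 (exp (fst x) * cos (snd x)) (exp (fst x) * sin (snd x)) (- (exp (fst x) * sin (snd x))) (exp (fst x) * cos (snd x))"
      if "r > 0" for r t
      by (rule exI[of _ "(ln r, t)"]) (use that in \<open>simp add: Rmat_def\<close>)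
    moreover have "mat2 (exp s * cos t) (exp s * sin t) (- (exp s * sin t)) (exp s * cos t) = exp s *\<^sub>R Rmat t" for s t
      by (simp add: Rmat_def)
    ultimately show ?thesis unfolding H0\<sigma>1_def by (auto simp: image_iff)
  qed
  moreover have "connected (range (\<lambda>x :: real \<times> real. mat2 (exp (fst x) * cos (snd x)) (exp (fst x) * sin (snd x)) (- (exp (fst x) * sin (snd x))) (exp (fst x) * cos (snd x))))"
    by (rule connected_continuous_image[OF continuous_on_mat2 connected_UNIV]) (intro continuous_intros)+
  ultimately show "connected H0\<sigma>1" by simp
qed

lemma Tgrp:
  assumes ca: "c \<noteq> 0 \<or> a \<noteq> 0"
  shows "emb_lie 2 (Tgrp c a)" "tang (Tgrp c a) = {A. \<exists>x y. A = mat2 (c * x) 0 y (a * x)}" "connected (Tgrp c a)"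
proof -
  \<comment> \<open>W is a mere parameter plane inside the matrix space: its upper left entry is the
    exponent parameter t and its lower left entry is the free entry s.\<close>
  define W where "W = {A. \<exists>x y. A = mat2 x 0 y 0}"
  have W: "subspace W" "dim W = 2" unfolding W_def by (rule subspaces_mat2)+
  define U where "U = {p :: real^2^2. 0 < p$1$1 \<and> 0 < p$2$2}"
  define \<tau> where "\<tau> = (\<lambda>p :: real^2^2. if c \<noteq> 0 then ln (p$1$1) / c else ln (p$2$2) / a)"
  define f where "f = (\<lambda>w :: real^2^2. mat2 (exp (c * w$1$1)) 0 (w$2$1) (exp (a * w$1$1)))"
  define \<kappa> where "\<kappa> = (\<lambda>p :: real^2^2. mat2 (\<tau> p) 0 (p$2$1) 0)"
  have mem: "mat2 x 0 y z \<in> Tgrp c a \<longleftrightarrow> (\<exists>t. x = exp (c * t) \<and> z = exp (a * t))" for x y z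
    by (auto simp: Tgrp_def)
  have sub: "subgroup (Tgrp c a) GL"
    unfolding subgroup_GL_iff
  proof (intro conjI ballI)
    show "mat 1 \<in> Tgrp c a" using mem[of 1 0 1] by (auto simp: mat2_one intro: exI[of _ 0])
    show "g ** h \<in> Tgrp c a" if gh: "g \<in> Tgrp c a" "h \<in> Tgrp c a" for g h
    proof -
      obtain s t s' t' where "g = mat2 (exp (c * t)) 0 s (exp (a * t))" "h = mat2 (exp (c * t')) 0 s' (exp (a * t'))"
        using gh unfolding Tgrp_def by auto
      then show ?thesis by (auto simp: mem intro!: exI[of _ "t + t'"] simp: exp_add algebra_simps)
    qed
    show "matrix_inv g \<in> Tgrp c a" if g: "g \<in> Tgrp c a" for g
    proof -
      obtain s t where "g = mat2 (exp (c * t)) 0 s (exp (a * t))" using g unfolding Tgrp_def by auto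
      then show ?thesis by (auto simp: matrix_inv_mat2 mem exp_minus field_simps intro!: exI[of _ "- t"])
    qed
  qed (auto simp: Tgrp_def)
  have smooth_exp: "smooth_on W W (\<lambda>w :: real^2^2. exp (k * w$1$1))" for k
  proof -
    have "smooth_on W W (\<lambda>w. (\<lambda>n t. k ^ n * exp (k * t)) 0 (w$1$1))"
      by (rule smooth_on_compose_real[OF bounded_linear_entry])
        (auto intro!: derivative_eq_intros simp flip: has_real_derivative_iff_has_vector_derivative)
    then show ?thesis by simp
  qed
  have f: "smooth_on W W f"
    unfolding f_def by (intro smooth_on_mat2 smooth_exp smooth_on_const smooth_on_bounded_linear bounded_linear_entry)
  have U: "open U" "mat 1 \<in> U" unfolding U_def by (rule open_entries) (simp add: mat2_one)
  have "mat2 (exp (c * t)) 0 s (exp (a * t)) \<in> f ` W" for s t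
    by (rule image_eqI[of _ _ "mat2 t 0 s 0"]) (auto simp: f_def W_def)
  then have im: "f ` W = Tgrp c a \<inter> U"
    by (auto simp: f_def W_def U_def Tgrp_def)
  have \<kappa>: "\<kappa> (f x) = x" if "x \<in> W" for x
    using that ca by (auto simp: \<kappa>_def f_def \<tau>_def W_def)
  have d: "\<kappa> differentiable (at p)" if "p \<in> U" for p
  proof -
    have "(\<lambda>p :: real^2^2. ln (p$1$1) * k) differentiable (at p)" "(\<lambda>p :: real^2^2. ln (p$2$2) * k) differentiable (at p)" for k
      using that unfolding U_def differentiable_def
      by (auto intro!: exI derivative_eq_intros bounded_linear_imp_has_derivative bounded_linear_entry)
    from this(1)[of "1 / c"] this(2)[of "1 / a"] have "\<tau> differentiable (at p)" unfolding \<tau>_def by (cases "c = 0") simp_all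
    then show ?thesis
      unfolding \<kappa>_def differentiable_def
      using has_derivative_mat2[OF _ has_derivative_const bounded_linear_imp_has_derivative[OF bounded_linear_entry] has_derivative_const]
      by blast
  qed
  show "emb_lie 2 (Tgrp c a)"
    unfolding emb_lie_def using sub W f U im \<kappa> d
    by (intro conjI exI[of _ W] exI[of _ W] exI[of _ f] exI[of _ U] exI[of _ \<kappa>]) auto
  have "tang (Tgrp c a) = (\<lambda>w :: real^2^2. mat2 (c * w$1$1) 0 (w$2$1) (a * w$1$1)) ` W"
  proof (rule chart_tang[OF W(1) _ f U im _ \<kappa> d])
    show "(f has_derivative (\<lambda>w. mat2 (c * w$1$1) 0 (w$2$1) (a * w$1$1))) (at 0 within W)"
      unfolding f_def
      by (rule has_derivative_mat2)
        (auto intro!: derivative_eq_intros bounded_linear_imp_has_derivative bounded_linear_entry)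
  qed (use sub W(1) in \<open>auto simp: subgroup_GL_iff subspace_0 f_def mat2_one\<close>)
  also have "\<dots> = {A. \<exists>x y. A = mat2 (c * x) 0 y (a * x)}"
    unfolding W_def by (auto simp: image_def) (metis mat2_nth)
  finally show "tang (Tgrp c a) = {A. \<exists>x y. A = mat2 (c * x) 0 y (a * x)}" .
  have "Tgrp c a = range (\<lambda>x :: real \<times> real. mat2 (exp (c * fst x)) 0 (snd x) (exp (a * fst x)))"
  proof -
    have "mat2 (exp (c * t)) 0 s (exp (a * t)) \<in> range (\<lambda>x :: real \<times> real. mat2 (exp (c * fst x)) 0 (snd x) (exp (a * fst x)))" for s t
      by (rule image_eqI[of _ _ "(t, s)"]) auto
    then show ?thesis unfolding Tgrp_def by auto
  qed
  moreover have "connected (range (\<lambda>x :: real \<times> real. mat2 (exp (c * fst x)) 0 (snd x) (exp (a * fst x))))"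
    by (rule connected_continuous_image[OF continuous_on_mat2 connected_UNIV]) (intro continuous_intros)+
  ultimately show "connected (Tgrp c a)" by simp
qed

section \<open>Block matrices and semidirect products\<close>

lemma block_matrix_nth [simp]:
  "block_matrix A B C D $ Inl a $ Inl b = A $ a $ b" "block_matrix A B C D $ Inl a $ Inr b = B $ a $ b"
  "block_matrix A B C D $ Inr a $ Inl b = C $ a $ b" "block_matrix A B C D $ Inr a $ Inr b = D $ a $ b"
  by (simp_all add: block_matrix_def)

lemma block_eq_iff [simp]: "block_matrix A B C D = block_matrix A' B' C' D' \<longleftrightarrow> A = A' \<and> B = B' \<and> C = C' \<and> D = D'"
  by (auto simp: vec_eq_iff split_sum_all)

definition TL :: "real^('d::finite + 'd)^('d + 'd) \<Rightarrow> real^'d^'d" where "TL M = (\<chi> i j. M $ Inl i $ Inl j)"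
definition TR :: "real^('d::finite + 'd)^('d + 'd) \<Rightarrow> real^'d^'d" where "TR M = (\<chi> i j. M $ Inl i $ Inr j)"
definition BL :: "real^('d::finite + 'd)^('d + 'd) \<Rightarrow> real^'d^'d" where "BL M = (\<chi> i j. M $ Inr i $ Inl j)"
definition BR :: "real^('d::finite + 'd)^('d + 'd) \<Rightarrow> real^'d^'d" where "BR M = (\<chi> i j. M $ Inr i $ Inr j)"

lemma block_parts [simp]: "TL (block_matrix A B C D) = A" "TR (block_matrix A B C D) = B"
  "BL (block_matrix A B C D) = C" "BR (block_matrix A B C D) = D"
  by (simp_all add: TL_def TR_def BL_def BR_def vec_eq_iff)

lemma block_matrix_parts: "block_matrix (TL M) (TR M) (BL M) (BR M) = M"
  by (simp add: TL_def TR_def BL_def BR_def vec_eq_iff split_sum_all)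

lemma block_cases: obtains A B C D where "M = block_matrix A B C D"
  using block_matrix_parts by metis

lemma sum_UNIV_Plus: "sum f (UNIV :: ('a::finite + 'b::finite) set) = (\<Sum>x\<in>UNIV. f (Inl x)) + (\<Sum>x\<in>UNIV. f (Inr x))"
  using sum.Plus[of "UNIV :: 'a set" "UNIV :: 'b set" f] by (simp add: o_def)

lemma block_mult [simp]: "block_matrix A B C D ** block_matrix A' B' C' D' =
    block_matrix (A ** A' + B ** C') (A ** B' + B ** D') (C ** A' + D ** C') (C ** B' + D ** D')"
  by (simp add: vec_eq_iff split_sum_all matrix_matrix_mult_def sum_UNIV_Plus)

lemma block_arith [simp]:
  "block_matrix A B C D + block_matrix A' B' C' D' = block_matrix (A + A') (B + B') (C + C') (D + D')"
  "block_matrix A B C D - block_matrix A' B' C' D' = block_matrix (A - A') (B - B') (C - C') (D - D')"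
  "- block_matrix A B C D = block_matrix (- A) (- B) (- C) (- D)"
  "r *\<^sub>R block_matrix A B C D = block_matrix (r *\<^sub>R A) (r *\<^sub>R B) (r *\<^sub>R C) (r *\<^sub>R D)"
  "transpose (block_matrix A B C D) = block_matrix (transpose A) (transpose C) (transpose B) (transpose D)"
  by (simp_all add: vec_eq_iff split_sum_all transpose_def)

lemma block_zero: "(0 :: real^('d::finite + 'd)^('d + 'd)) = block_matrix 0 0 0 0"
  by (simp add: vec_eq_iff split_sum_all)

lemma block_one: "(mat 1 :: real^('d::finite + 'd)^('d + 'd)) = block_matrix (mat 1) 0 0 (mat 1)"
  by (simp add: vec_eq_iff split_sum_all mat_def)

lemma trace_block [simp]: "trace (block_matrix A B C D) = trace A + trace D"
  by (simp add: trace_def sum_UNIV_Plus)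

lemma bounded_linear_parts: "bounded_linear TL" "bounded_linear TR" "bounded_linear BL" "bounded_linear BR"
proof -
  have "linear TL" "linear TR" "linear BL" "linear BR"
    by (rule linearI; simp add: TL_def TR_def BL_def BR_def vec_eq_iff)+
  then show "bounded_linear TL" "bounded_linear TR" "bounded_linear BL" "bounded_linear BR"
    by (simp_all add: linear_conv_bounded_linear)
qed

lemma bounded_linear_block:
  "bounded_linear (\<lambda>A. block_matrix A 0 0 0)" "bounded_linear (\<lambda>A. block_matrix 0 0 A 0)"
  "bounded_linear (\<lambda>A. block_matrix 0 0 0 A)"
proof -
  have "linear (\<lambda>A. block_matrix A 0 0 0)" "linear (\<lambda>A. block_matrix 0 0 A 0)" "linear (\<lambda>A. block_matrix 0 0 0 A)"
    by (rule linearI; simp)+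
  then show "bounded_linear (\<lambda>A. block_matrix A 0 0 0)" "bounded_linear (\<lambda>A. block_matrix 0 0 A 0)"
    "bounded_linear (\<lambda>A. block_matrix 0 0 0 A)"
    by (simp_all add: linear_conv_bounded_linear)
qed

section \<open>The semidirect product and its block diagonal conjugations\<close>

lemma sharp_eq:
  assumes "invertible h"
  shows "sharp h = transpose (matrix_inv h)" "transpose h ** sharp h = mat 1" "sharp h ** transpose h = mat 1"
    "transpose (sharp h) = matrix_inv h" "invertible (sharp h)"
proof -
  show 1: "sharp h = transpose (matrix_inv h)" using assms by (simp add: sharp_def transpose_matrix_inv)
  show "transpose h ** sharp h = mat 1" "sharp h ** transpose h = mat 1"
    unfolding 1 matrix_transpose_mul[symmetric] by (simp_all add: matrix_inv[OF assms] transpose_mat)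
  then show "invertible (sharp h)" using invertible_def by blast
  show "transpose (sharp h) = matrix_inv h" unfolding 1 by (rule transpose_transpose)
qed

lemma sharp_mult: "invertible h \<Longrightarrow> invertible k \<Longrightarrow> sharp (h ** k) = sharp h ** sharp k"
  by (simp add: sharp_eq invertible_mult matrix_inv_mult matrix_transpose_mul)

lemma sharp_one [simp]: "sharp (mat 1) = (mat 1 :: real^'n^'n)"
  by (simp add: sharp_def transpose_mat)

lemma sharp_matrix_inv: "invertible h \<Longrightarrow> sharp (matrix_inv h) = transpose h"
  by (simp add: sharp_eq invertible_matrix_inv matrix_inv_matrix_inv)

lemma gmat_mult:
  assumes "invertible h" "invertible k"
  shows "gmat \<sigma> h ** gmat \<tau> k = gmat (\<sigma> + sharp h ** \<tau> ** matrix_inv h) (h ** k)"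
proof -
  have "sharp h ** \<tau> ** matrix_inv h ** (h ** k) = sharp h ** (\<tau> ** k)"
    using assms by (simp add: matrix_mul_assoc[symmetric] matrix_inv_cancel)
  then show ?thesis
    using assms by (simp add: gmat_def sharp_mult matrix_mul_assoc matrix_mult.add_left)
qed

lemma gmat_one: "gmat 0 (mat 1) = mat 1"
  by (simp add: gmat_def block_one)

lemma gmat_eq_iff:
  assumes "invertible h" "invertible k"
  shows "gmat \<sigma> h = gmat \<tau> k \<longleftrightarrow> \<sigma> = \<tau> \<and> h = k"
proof
  assume "gmat \<sigma> h = gmat \<tau> k"
  then have "h = k" "\<sigma> ** h = \<tau> ** h" by (auto simp: gmat_def)
  then show "\<sigma> = \<tau> \<and> h = k" using matrix_inv_cancel(3)[OF assms(1)] by metis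
qed auto

lemma gmat_inverse:
  assumes h: "invertible h"
  shows "gmat \<sigma> h ** gmat (- (transpose h ** \<sigma> ** h)) (matrix_inv h) = mat 1"
    "matrix_inv (gmat \<sigma> h) = gmat (- (transpose h ** \<sigma> ** h)) (matrix_inv h)"
    "invertible (gmat \<sigma> h)"
proof -
  have "sharp h ** - (transpose h ** \<sigma> ** h) ** matrix_inv h = - \<sigma>"
  proof -
    have "sharp h ** (transpose h ** \<sigma> ** h) ** matrix_inv h = (sharp h ** transpose h) ** \<sigma> ** (h ** matrix_inv h)"
      by (simp add: matrix_mul_assoc)
    then show ?thesis using h by (simp add: sharp_eq(3) matrix_inv matrix_mult.minus_left matrix_mult.minus_right)
  qed
  then show *: "gmat \<sigma> h ** gmat (- (transpose h ** \<sigma> ** h)) (matrix_inv h) = mat 1"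
    using h by (simp add: gmat_mult invertible_matrix_inv matrix_inv gmat_one)
  show "matrix_inv (gmat \<sigma> h) = gmat (- (transpose h ** \<sigma> ** h)) (matrix_inv h)" "invertible (gmat \<sigma> h)"
    using matrix_inv_unique[OF *] by simp_all
qed

text \<open>The congruence is written without inverses, as a polynomial in h; for a group this is
  the same as invariance under the action in the semidirect product.\<close>

definition stab :: "(real^'d^'d) set \<Rightarrow> (real^'d^'d) set \<Rightarrow> bool" where
  "stab \<Sigma> H \<longleftrightarrow> (\<forall>h\<in>H. \<forall>\<sigma>\<in>\<Sigma>. transpose h ** \<sigma> ** h \<in> \<Sigma>)"

lemma stab_sharp:
  assumes "stab \<Sigma> H" "subgroup H GL" "h \<in> H" "\<sigma> \<in> \<Sigma>"
  shows "sharp h ** \<sigma> ** matrix_inv h \<in> \<Sigma>"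
proof -
  have "invertible h" "matrix_inv h \<in> H" using assms(2,3) by (auto simp: subgroup_GL_iff)
  then show ?thesis using assms(1,4) unfolding stab_def by (simp add: sharp_eq(1))
qed

lemma subgroup_semidirect:
  fixes \<Sigma> H :: "(real^'d::finite^'d) set"
  assumes H: "subgroup H GL" and S: "subspace \<Sigma>" and st: "stab \<Sigma> H"
  shows "subgroup (\<Sigma> \<rtimes> H) GL"
  unfolding subgroup_GL_iff
proof (intro conjI ballI)
  note Hg = H[unfolded subgroup_GL_iff]
  show "invertible g" if "g \<in> \<Sigma> \<rtimes> H" for g
    using that Hg gmat_inverse(3) by (auto simp: semidirect_def)
  show "mat 1 \<in> \<Sigma> \<rtimes> H"
    unfolding semidirect_def using Hg subspace_0[OF S] gmat_one[symmetric] by blast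
  show "a ** b \<in> \<Sigma> \<rtimes> H" if ab: "a \<in> \<Sigma> \<rtimes> H" "b \<in> \<Sigma> \<rtimes> H" for a b
  proof -
    obtain \<sigma> h \<tau> k where "a = gmat \<sigma> h" "b = gmat \<tau> k" "\<sigma> \<in> \<Sigma>" "\<tau> \<in> \<Sigma>" "h \<in> H" "k \<in> H"
      using ab unfolding semidirect_def by blast
    then show ?thesis
      using Hg S stab_sharp[OF st H, of h \<tau>] unfolding semidirect_def by (auto simp: gmat_mult subspace_add intro!: exI)
  qed
  show "matrix_inv a \<in> \<Sigma> \<rtimes> H" if a: "a \<in> \<Sigma> \<rtimes> H" for a
  proof -
    obtain \<sigma> h where "a = gmat \<sigma> h" "\<sigma> \<in> \<Sigma>" "h \<in> H"
      using a unfolding semidirect_def by blast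
    then show ?thesis
      using Hg S st unfolding semidirect_def stab_def by (auto simp: gmat_inverse(2) subspace_neg intro!: exI)
  qed
qed

text \<open>With k the inverse of h, the product \<open>gmat 0 k ** gmat \<sigma> (mat 1)\<close>
  has symmetric part equal to the congruence transform of \<sigma> by h; uniqueness of the
  decomposition shows that this lies in \<Sigma>.\<close>

lemma stab_of_subgroup:
  fixes \<Sigma> H :: "(real^'d::finite^'d) set"
  assumes H: "subgroup H GL" and S: "subspace \<Sigma>" and G: "subgroup (\<Sigma> \<rtimes> H) GL"
  shows "stab \<Sigma> H"
  unfolding stab_def
proof (intro ballI)
  note Hg = H[unfolded subgroup_GL_iff]
  fix h \<sigma> assume h: "h \<in> H" and \<sigma>: "\<sigma> \<in> \<Sigma>"
  define k where "k = matrix_inv h"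
  have k: "k \<in> H" "invertible k" "invertible h" "matrix_inv k = h" "sharp k = transpose h"
    using h Hg by (auto simp: k_def invertible_matrix_inv matrix_inv_matrix_inv sharp_matrix_inv)
  have "gmat 0 k \<in> \<Sigma> \<rtimes> H" "gmat \<sigma> (mat 1) \<in> \<Sigma> \<rtimes> H"
    using k \<sigma> Hg subspace_0[OF S] by (auto simp: semidirect_def)
  then have "gmat 0 k ** gmat \<sigma> (mat 1) \<in> \<Sigma> \<rtimes> H" using G unfolding subgroup_GL_iff by blast
  then have "gmat (transpose h ** \<sigma> ** h) k \<in> \<Sigma> \<rtimes> H" using k by (simp add: gmat_mult)
  then obtain \<tau> k' where "\<tau> \<in> \<Sigma>" "k' \<in> H" "gmat (transpose h ** \<sigma> ** h) k = gmat \<tau> k'"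
    unfolding semidirect_def by auto
  then show "transpose h ** \<sigma> ** h \<in> \<Sigma>" using gmat_eq_iff[of k k'] k(2) Hg by metis
qed

text \<open>This is the change of \<Sigma> produced by conjugating a semidirect product with
  \<open>gmat 0 k\<close>, so that a congruence of symmetric forms is realised inside the symplectic
  group.\<close>

definition act :: "real^'d^'d \<Rightarrow> (real^'d^'d) set \<Rightarrow> (real^'d^'d) set" where
  "act k \<Sigma> = (\<lambda>\<sigma>. sharp k ** \<sigma> ** matrix_inv k) ` \<Sigma>"

lemma conj_semidirect:
  fixes \<Sigma> H :: "(real^'d::finite^'d) set"
  assumes k: "invertible k" and H: "subgroup H GL"
  shows "conj_set (gmat 0 k) (\<Sigma> \<rtimes> H) = act k \<Sigma> \<rtimes> conj_set k H"
proof -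
  note Hg = H[unfolded subgroup_GL_iff]
  have ki: "matrix_inv (gmat 0 k) = gmat 0 (matrix_inv k)" using gmat_inverse(2)[OF k, of 0] by simp
  have "gmat 0 k ** gmat \<sigma> h ** matrix_inv (gmat 0 k) = gmat (sharp k ** \<sigma> ** matrix_inv k) (k ** h ** matrix_inv k)"
    if "h \<in> H" for \<sigma> h
    using k that Hg by (simp add: ki gmat_mult invertible_mult invertible_matrix_inv)
  then show ?thesis
    unfolding conj_set_def semidirect_def act_def by (auto simp: image_iff) metis+
qed

lemma act_subspace: "subspace \<Sigma> \<Longrightarrow> subspace (act k \<Sigma>)"
  unfolding act_def by (rule linear_subspace_image[OF bounded_linear.linear[OF bounded_linear_conj]])

lemma act_inverse:
  assumes k: "invertible k"
  shows "act (matrix_inv k) (act k \<Sigma>) = \<Sigma>" "act k (act (matrix_inv k) \<Sigma>) = \<Sigma>"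
proof -
  have "transpose k ** (sharp k ** \<sigma> ** matrix_inv k) ** k = \<sigma>"
    "sharp k ** (transpose k ** \<sigma> ** k) ** matrix_inv k = \<sigma>" for \<sigma>
    using sharp_eq(2,3)[OF k] matrix_inv[OF k] by (simp_all add: matrix_mul_assoc)
      (simp_all add: matrix_mul_assoc[symmetric] matrix_inv[OF k])
  then show "act (matrix_inv k) (act k \<Sigma>) = \<Sigma>" "act k (act (matrix_inv k) \<Sigma>) = \<Sigma>"
    using k unfolding act_def image_image by (simp_all add: sharp_matrix_inv matrix_inv_matrix_inv)
qed

lemma act_Sym:
  assumes k: "invertible k" and S: "\<Sigma> \<subseteq> Sym"
  shows "act k \<Sigma> \<subseteq> Sym"
  using S sharp_eq(4)[OF k] sharp_eq(1)[OF k]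
  by (auto simp: act_def Sym_def matrix_transpose_mul matrix_mul_assoc)

lemma stab_conj:
  assumes k: "invertible k" and st: "stab \<Sigma> H"
  shows "stab (act k \<Sigma>) (conj_set k H)"
  unfolding stab_def
proof (intro ballI)
  fix h' \<sigma>' assume "h' \<in> conj_set k H" "\<sigma>' \<in> act k \<Sigma>"
  then obtain h \<sigma> where h: "h \<in> H" "h' = k ** h ** matrix_inv k" and \<sigma>: "\<sigma> \<in> \<Sigma>" "\<sigma>' = sharp k ** \<sigma> ** matrix_inv k"
    unfolding conj_set_def act_def by blast
  have "transpose h' ** \<sigma>' ** h' =
      sharp k ** transpose h ** (transpose k ** sharp k) ** \<sigma> ** (matrix_inv k ** k) ** h ** matrix_inv k"
    by (simp add: h \<sigma> matrix_transpose_mul matrix_mul_assoc sharp_eq(1)[OF k])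
  also have "\<dots> = sharp k ** (transpose h ** \<sigma> ** h) ** matrix_inv k"
    by (simp add: sharp_eq(2)[OF k] matrix_inv[OF k] matrix_mul_assoc)
  also have "\<dots> \<in> act k \<Sigma>" using st h \<sigma> by (auto simp: act_def stab_def)
  finally show "transpose h' ** \<sigma>' ** h' \<in> act k \<Sigma>" .
qed

section \<open>The symplectic group\<close>

lemma Sp_iff: "g \<in> Sp \<longleftrightarrow> transpose g ** Jmat ** g = Jmat"
proof -
  have "invertible g" if "transpose g ** Jmat ** g = Jmat"
  proof -
    \<comment> \<open>Since J squared is -1, preservation of J displays -J g^t J as a left inverse
      of g.\<close>
    have "(- Jmat) ** Jmat = (mat 1 :: real^('a + 'a)^('a + 'a))"
      by (simp add: Jmat_def block_one matrix_mult.minus_left)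
    then have "((- Jmat) ** transpose g ** Jmat) ** g = mat 1" using that by (simp add: matrix_mul_assoc[symmetric])
    then show ?thesis using invertible_left_inverse by blast
  qed
  then show ?thesis by (auto simp: Sp_def)
qed

lemma Sp_mult: "g \<in> Sp \<Longrightarrow> h \<in> Sp \<Longrightarrow> g ** h \<in> Sp"
proof -
  assume *: "g \<in> Sp" "h \<in> Sp"
  have "transpose (g ** h) ** Jmat ** (g ** h) = transpose h ** (transpose g ** Jmat ** g) ** h"
    by (simp add: matrix_transpose_mul matrix_mul_assoc)
  then show ?thesis using * by (simp add: Sp_iff)
qed

lemma Sp_invertible: "g \<in> Sp \<Longrightarrow> invertible g"
  by (simp add: Sp_def)

lemma Sp_inverse: "g \<in> Sp \<Longrightarrow> matrix_inv g \<in> Sp"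
proof -
  assume g: "g \<in> Sp"
  then have "transpose (matrix_inv g) ** Jmat ** matrix_inv g =
      transpose (matrix_inv g) ** (transpose g ** Jmat ** g) ** matrix_inv g" by (simp add: Sp_iff)
  also have "\<dots> = transpose (g ** matrix_inv g) ** Jmat ** (g ** matrix_inv g)"
    by (simp add: matrix_transpose_mul matrix_mul_assoc)
  finally show ?thesis using Sp_invertible[OF g] by (simp add: Sp_iff matrix_inv transpose_mat)
qed

lemma transpose_zero [simp]: "transpose (0 :: real^'n^'m) = 0"
  by (simp add: transpose_def vec_eq_iff)

lemma gmat_Sp: "invertible k \<Longrightarrow> gmat 0 k \<in> Sp"
  by (simp add: Sp_iff gmat_def Jmat_def sharp_eq(2,4) matrix_inv matrix_mult.minus_left matrix_mult.minus_right)

text \<open>The quotient (\<gamma>^-1 - 1)/t equals -\<gamma>^-1 (\<gamma> - 1)/t, and continuity of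
  inversion gives the limit.\<close>

lemma has_vector_derivative_matrix_inv:
  fixes \<gamma> :: "real \<Rightarrow> real^'n^'n"
  assumes \<gamma>: "\<gamma> 0 = mat 1" "\<And>t. invertible (\<gamma> t)" "(\<gamma> has_vector_derivative X) (at 0)"
  shows "((\<lambda>t. matrix_inv (\<gamma> t)) has_vector_derivative - X) (at 0)"
proof -
  have "isCont \<gamma> 0" using \<gamma>(3) has_vector_derivative_continuous by blast
  then have "(\<gamma> \<longlongrightarrow> mat 1) (at 0)" using \<gamma>(1) by (simp add: isCont_def)
  then have "((\<lambda>t. matrix_inv (\<gamma> t)) \<longlongrightarrow> matrix_inv (mat 1)) (at 0)"
    by (rule continuous_on_tendsto_compose[OF continuous_on_matrix_inv]) (use \<gamma>(2) in auto)
  from matrix_mult.tendsto[OF tendsto_minus[OF this] tendsto_difference_quotient[OF \<gamma>(3)]]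
  have "((\<lambda>t. - matrix_inv (\<gamma> t) ** ((\<gamma> t - mat 1) /\<^sub>R t)) \<longlongrightarrow> - mat 1 ** X) (at 0)"
    by (simp add: \<gamma>(1))
  moreover have "- matrix_inv (\<gamma> t) ** ((\<gamma> t - mat 1) /\<^sub>R t) = (matrix_inv (\<gamma> t) - mat 1) /\<^sub>R t" for t
    by (simp add: matrix_mult.scaleR_right matrix_mult.diff_right matrix_mult.minus_left matrix_inv(2)[OF \<gamma>(2)])
  ultimately have lim: "((\<lambda>t. (matrix_inv (\<gamma> t) - mat 1) /\<^sub>R t) \<longlongrightarrow> - X) (at 0)"
    by (simp add: matrix_mult.minus_left)
  have "((\<lambda>t. norm ((matrix_inv (\<gamma> t) - mat 1) /\<^sub>R t - - X)) \<longlongrightarrow> 0) (at 0)"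
    by (rule tendsto_norm_zero) (rule LIM_zero[OF lim])
  then have "((\<lambda>t. norm (matrix_inv (\<gamma> (0 + t)) - matrix_inv (\<gamma> 0) - t *\<^sub>R - X) / norm t) \<longlongrightarrow> 0) (at 0)"
  proof (rule Lim_transform_eventually)
    have "norm ((matrix_inv (\<gamma> t) - mat 1) /\<^sub>R t - - X) = norm (matrix_inv (\<gamma> (0 + t)) - matrix_inv (\<gamma> 0) - t *\<^sub>R - X) / norm t"
      if "t \<noteq> 0" for t
    proof -
      have "matrix_inv (\<gamma> (0 + t)) - matrix_inv (\<gamma> 0) - t *\<^sub>R - X = t *\<^sub>R ((matrix_inv (\<gamma> t) - mat 1) /\<^sub>R t - - X)"
        using that by (simp add: scaleR_diff_right scaleR_add_right \<gamma>(1))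
      then show ?thesis using that by simp
    qed
    then show "\<forall>\<^sub>F t in at 0. norm ((matrix_inv (\<gamma> t) - mat 1) /\<^sub>R t - - X) =
        norm (matrix_inv (\<gamma> (0 + t)) - matrix_inv (\<gamma> 0) - t *\<^sub>R - X) / norm t"
      by (auto simp: eventually_at_filter)
  qed
  then show ?thesis
    unfolding has_vector_derivative_def has_derivative_at
    using bounded_linear_scaleR_left[of "- X"] by simp
qed

text \<open>The derivative of \<sigma> h at \<sigma> = 0, h = 1 is the derivative of \<sigma>, and
  that of the inverse transpose is minus the transpose.\<close>

definition lie_sd :: "(real^'d^'d) set \<Rightarrow> (real^'d^'d) set \<Rightarrow> (real^('d::finite + 'd)^('d + 'd)) set" where
  "lie_sd \<Sigma> \<hh> = {block_matrix X 0 \<sigma> (- transpose X) | X \<sigma>. X \<in> \<hh> \<and> \<sigma> \<in> \<Sigma>}"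

lemma bounded_linear_transpose: "bounded_linear (transpose :: real^'n^'m \<Rightarrow> real^'m^'n)"
proof -
  have "linear (transpose :: real^'n^'m \<Rightarrow> real^'m^'n)"
    by (rule linearI) (simp_all add: transpose_def vec_eq_iff)
  then show ?thesis by (simp add: linear_conv_bounded_linear)
qed

lemma tang_semidirect:
  fixes \<Sigma> H :: "(real^'d::finite^'d) set"
  assumes H: "subgroup H GL" and S: "subspace \<Sigma>"
  shows "tang (\<Sigma> \<rtimes> H) = lie_sd \<Sigma> (tang H)"
proof
  note Hg = H[unfolded subgroup_GL_iff]
  show "lie_sd \<Sigma> (tang H) \<subseteq> tang (\<Sigma> \<rtimes> H)"
  proof
    fix Y assume "Y \<in> lie_sd \<Sigma> (tang H)"
    then obtain \<gamma> X \<sigma> where \<gamma>: "\<gamma> 0 = mat 1" "\<And>t. \<gamma> t \<in> H" "(\<gamma> has_vector_derivative X) (at (0::real))"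
      and \<sigma>: "\<sigma> \<in> \<Sigma>" and Y: "Y = block_matrix X 0 \<sigma> (- transpose X)"
      unfolding lie_sd_def tang_def by blast
    have inv: "invertible (\<gamma> t)" for t using \<gamma>(2) Hg by blast
    define \<delta> where "\<delta> = (\<lambda>t. gmat (t *\<^sub>R \<sigma>) (\<gamma> t))"
    have eq: "\<delta> t = block_matrix (\<gamma> t) 0 0 0 + block_matrix 0 0 ((t *\<^sub>R \<sigma>) ** \<gamma> t) 0
        + block_matrix 0 0 0 (transpose (matrix_inv (\<gamma> t)))" for t
      by (simp add: \<delta>_def gmat_def sharp_eq(1)[OF inv])
    have d1: "((\<lambda>t. (t *\<^sub>R \<sigma>) ** \<gamma> t) has_vector_derivative (0 *\<^sub>R \<sigma>) ** X + (1 *\<^sub>R \<sigma>) ** \<gamma> 0) (at 0)"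
      by (rule matrix_mult.has_vector_derivative[OF _ \<gamma>(3)]) (auto intro!: derivative_eq_intros)
    have "(\<delta> has_vector_derivative block_matrix X 0 0 0 + block_matrix 0 0 ((0 *\<^sub>R \<sigma>) ** X + (1 *\<^sub>R \<sigma>) ** \<gamma> 0) 0
        + block_matrix 0 0 0 (transpose (- X))) (at 0)"
      unfolding eq[abs_def]
      by (intro has_vector_derivative_add bounded_linear.has_vector_derivative[OF bounded_linear_block(1) \<gamma>(3)]
          bounded_linear.has_vector_derivative[OF bounded_linear_block(2) d1]
          bounded_linear.has_vector_derivative[OF bounded_linear_block(3)]
          bounded_linear.has_vector_derivative[OF bounded_linear_transpose]
          has_vector_derivative_matrix_inv \<gamma> inv)
    moreover have "transpose (- X) = - transpose X" by (simp add: transpose_def vec_eq_iff)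
    ultimately have "(\<delta> has_vector_derivative Y) (at 0)" by (simp add: Y \<gamma>(1))
    moreover have "\<delta> t \<in> \<Sigma> \<rtimes> H" for t
      unfolding \<delta>_def semidirect_def using \<gamma>(2) subspace_scale[OF S \<sigma>] by blast
    moreover have "\<delta> 0 = mat 1" by (simp add: \<delta>_def \<gamma>(1) gmat_one)
    ultimately show "Y \<in> tang (\<Sigma> \<rtimes> H)" unfolding tang_def by blast
  qed
  show "tang (\<Sigma> \<rtimes> H) \<subseteq> lie_sd \<Sigma> (tang H)"
  proof
    fix Y assume "Y \<in> tang (\<Sigma> \<rtimes> H)"
    then obtain \<delta> where \<delta>: "\<delta> 0 = mat 1" "\<And>t. \<delta> t \<in> \<Sigma> \<rtimes> H" "(\<delta> has_vector_derivative Y) (at (0::real))"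
      unfolding tang_def by blast
    have "\<exists>\<sigma> h. \<delta> t = gmat \<sigma> h \<and> \<sigma> \<in> \<Sigma> \<and> h \<in> H" for t using \<delta>(2)[of t] unfolding semidirect_def by blast
    then obtain \<sigma> h where sh: "\<And>t. \<delta> t = gmat (\<sigma> t) (h t)" "\<And>t. \<sigma> t \<in> \<Sigma>" "\<And>t. h t \<in> H" by metis
    have inv: "invertible (h t)" for t using sh Hg by blast
    have parts: "TL (\<delta> t) = h t" "TR (\<delta> t) = 0" "BL (\<delta> t) = \<sigma> t ** h t" "BR (\<delta> t) = transpose (matrix_inv (h t))" for t
      by (simp_all add: sh gmat_def sharp_eq(1)[OF inv])
    note vd = bounded_linear.has_vector_derivative[OF bounded_linear_parts(1) \<delta>(3)]
      bounded_linear.has_vector_derivative[OF bounded_linear_parts(2) \<delta>(3)]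
      bounded_linear.has_vector_derivative[OF bounded_linear_parts(3) \<delta>(3)]
      bounded_linear.has_vector_derivative[OF bounded_linear_parts(4) \<delta>(3)]
    note vd = vd[unfolded parts]
    have h0: "h 0 = mat 1" using parts(1)[of 0] \<delta>(1) by (simp add: block_one)
    have \<sigma>0: "\<sigma> 0 = 0" using parts(3)[of 0] \<delta>(1) h0 by (simp add: block_one)
    have TL: "TL Y \<in> tang H" using h0 sh(3) vd(1) unfolding tang_def by blast
    have TR: "TR Y = 0"
      using vd(2) vector_derivative_unique_at[of "\<lambda>t. 0 :: real^'d^'d" _ 0 0] by (metis has_vector_derivative_const)
    have "((\<lambda>t. transpose (matrix_inv (h t))) has_vector_derivative transpose (- TL Y)) (at 0)"
      by (intro bounded_linear.has_vector_derivative[OF bounded_linear_transpose]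
          has_vector_derivative_matrix_inv h0 inv vd(1))
    then have "BR Y = transpose (- TL Y)" using vd(4) vector_derivative_unique_at by blast
    moreover have "transpose (- TL Y) = - transpose (TL Y)" by (simp add: transpose_def vec_eq_iff)
    ultimately have BR: "BR Y = - transpose (TL Y)" by simp
    \<comment> \<open>The lower left block of the curve is \<sigma> h, not \<sigma>. Multiplying its
      difference quotient by the inverse of h, which tends to 1, leaves \<sigma>/t, which lies in
      the closed subspace \<Sigma>.\<close>
    have BL: "BL Y \<in> \<Sigma>"
    proof -
      have "isCont h 0" using vd(1) has_vector_derivative_continuous by blast
      then have "(h \<longlongrightarrow> mat 1) (at 0)" using h0 by (simp add: isCont_def)
      then have "((\<lambda>t. matrix_inv (h t)) \<longlongrightarrow> matrix_inv (mat 1)) (at 0)"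
        by (rule continuous_on_tendsto_compose[OF continuous_on_matrix_inv]) (use inv in auto)
      from matrix_mult.tendsto[OF tendsto_difference_quotient[OF vd(3)] this]
      have "((\<lambda>t. (\<sigma> t ** h t) /\<^sub>R t ** matrix_inv (h t)) \<longlongrightarrow> BL Y ** matrix_inv (mat 1)) (at 0)"
        by (simp add: \<sigma>0)
      moreover have "(\<sigma> t ** h t) /\<^sub>R t ** matrix_inv (h t) = \<sigma> t /\<^sub>R t" for t
        by (simp add: matrix_mult.scaleR_left matrix_inv_cancel[OF inv])
      ultimately have lim: "((\<lambda>t. \<sigma> t /\<^sub>R t) \<longlongrightarrow> BL Y) (at 0)" by simp
      show ?thesis
        by (rule Lim_in_closed_set[OF closed_subspace[OF S] _ _ lim]) (use sh(2) S in \<open>auto simp: subspace_scale\<close>)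
    qed
    have "Y = block_matrix (TL Y) 0 (BL Y) (- transpose (TL Y))"
      using block_matrix_parts[of Y] TR BR by simp
    then show "Y \<in> lie_sd \<Sigma> (tang H)" using TL BL unfolding lie_sd_def by blast
  qed
qed

lemma dim_lie_sd:
  fixes \<Sigma> \<hh> :: "(real^'d::finite^'d) set"
  assumes S: "subspace \<Sigma>" and h: "subspace \<hh>"
  shows "subspace (lie_sd \<Sigma> \<hh>)" "dim (lie_sd \<Sigma> \<hh>) = dim \<hh> + dim \<Sigma>"
proof -
  define f :: "(real^'d^'d) \<times> (real^'d^'d) \<Rightarrow> real^('d + 'd)^('d + 'd)" where
    "f = (\<lambda>(X, \<sigma>). block_matrix X 0 \<sigma> (- transpose X))"
  have lin: "linear f"
    unfolding f_def by (rule linearI) (auto simp: transpose_def vec_eq_iff split_sum_all)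
  have inj: "inj f" by (auto simp: inj_def f_def)
  have eq: "lie_sd \<Sigma> \<hh> = f ` (\<hh> \<times> \<Sigma>)" unfolding lie_sd_def f_def by auto
  have sub: "subspace (\<hh> \<times> \<Sigma>)" using S h by (rule subspace_Times[rotated])
  show "subspace (lie_sd \<Sigma> \<hh>)" unfolding eq by (rule linear_subspace_image[OF lin sub])
  have "dim (f ` (\<hh> \<times> \<Sigma>)) = dim (\<hh> \<times> \<Sigma>)"
    by (rule dim_image_eq[OF lin]) (use inj in \<open>auto simp: inj_on_def inj_def\<close>)
  then show "dim (lie_sd \<Sigma> \<hh>) = dim \<hh> + dim \<Sigma>" unfolding eq using dim_Times[OF h S] by simp
qed

text \<open>Polynomial substitutes for \<open>det h *\<^sub>R matrix_inv h\<close> and \<open>det h *\<^sub>R sharp h\<close>, needed to see that the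
  chart of a semidirect product is smooth.\<close>

definition adj2 :: "real^2^2 \<Rightarrow> real^2^2" where
  "adj2 h = mat2 (h$2$2) (- h$1$2) (- h$2$1) (h$1$1)"

lemma adj2_inverse:
  assumes "invertible h"
  shows "inverse (h$1$1 * h$2$2 - h$1$2 * h$2$1) *\<^sub>R adj2 h = matrix_inv h"
    "inverse (h$1$1 * h$2$2 - h$1$2 * h$2$1) *\<^sub>R transpose (adj2 h) = sharp h"
proof -
  have h: "h = mat2 (h$1$1) (h$1$2) (h$2$1) (h$2$2)" by (simp add: vec2_eq_iff)
  have d: "h$1$1 * h$2$2 - h$1$2 * h$2$1 \<noteq> 0" using assms invertible_det_nz[of h] by (simp add: det_2)
  show 1: "inverse (h$1$1 * h$2$2 - h$1$2 * h$2$1) *\<^sub>R adj2 h = matrix_inv h"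
    using matrix_inv_mat2[OF d] by (subst (6) h) (simp add: adj2_def divide_inverse mult.commute)
  have "transpose (r *\<^sub>R A) = r *\<^sub>R transpose A" for r and A :: "real^2^2" by (simp add: transpose_scalar)
  then show "inverse (h$1$1 * h$2$2 - h$1$2 * h$2$1) *\<^sub>R transpose (adj2 h) = sharp h"
    using 1 sharp_eq(1)[OF assms] by metis
qed

lemma bounded_linear_adj2: "bounded_linear adj2"
proof -
  have "linear adj2" by (rule linearI) (simp_all add: adj2_def)
  then show ?thesis by (simp add: linear_conv_bounded_linear)
qed

text \<open>The chart sends (w, \<sigma>) to \<open>gmat \<sigma> (f w)\<close>. The pair is stored
  as two blocks because a model space must consist of matrices of the ambient size.\<close>

lemma emb_lie_semidirect:
  fixes \<Sigma> H :: "(real^2^2) set"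
  assumes emb: "emb_lie m H" and S: "subspace \<Sigma>" and st: "stab \<Sigma> H"
  shows "emb_lie (m + dim \<Sigma>) (\<Sigma> \<rtimes> H)"
proof -
  from emb obtain W :: "(real^2^2) set" and V f U \<kappa> where
    sub: "subgroup H GL" and W: "subspace W" "dim W = m" and V: "openin (top_of_set W) V"
    and f: "smooth_on W V f" and U: "open U" "mat 1 \<in> U" "f ` V = H \<inter> U"
    and \<kappa>: "\<And>x. x \<in> V \<Longrightarrow> \<kappa> (f x) = x" "\<And>p. p \<in> U \<Longrightarrow> \<kappa> differentiable (at p)"
    unfolding emb_lie_def by blast
  note H = sub[unfolded subgroup_GL_iff]
  define W' :: "(real^(2 + 2)^(2 + 2)) set" where "W' = {block_matrix X 0 \<sigma> 0 | X \<sigma>. X \<in> W \<and> \<sigma> \<in> \<Sigma>}"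
  define dt where "dt = (\<lambda>h :: real^2^2. h$1$1 * h$2$2 - h$1$2 * h$2$1)"
  have dt: "dt h \<noteq> 0 \<longleftrightarrow> invertible h" for h unfolding dt_def invertible_det_nz det_2 ..
  have W': "subspace W'" "dim W' = m + dim \<Sigma>"
  proof -
    define g :: "(real^2^2) \<times> (real^2^2) \<Rightarrow> real^(2 + 2)^(2 + 2)" where "g = (\<lambda>(X, \<sigma>). block_matrix X 0 \<sigma> 0)"
    have lin: "linear g" unfolding g_def by (rule linearI) (auto simp: vec_eq_iff split_sum_all)
    have inj: "inj g" by (auto simp: inj_def g_def)
    have eq: "W' = g ` (W \<times> \<Sigma>)" unfolding W'_def g_def by auto
    have sub: "subspace (W \<times> \<Sigma>)" using W(1) S by (rule subspace_Times)
    show "subspace W'" unfolding eq by (rule linear_subspace_image[OF lin sub])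
    have "dim (g ` (W \<times> \<Sigma>)) = dim (W \<times> \<Sigma>)"
      by (rule dim_image_eq[OF lin]) (use inj in \<open>auto simp: inj_on_def inj_def\<close>)
    then show "dim W' = m + dim \<Sigma>" unfolding eq using dim_Times[OF W(1) S] W(2) by simp
  qed
  define V' where "V' = W' \<inter> TL -` V"
  obtain O' where O': "open O'" "V = W \<inter> O'" using V unfolding openin_open by blast
  have "V' = W' \<inter> TL -` O'" unfolding V'_def W'_def O' by auto
  then have V': "openin (top_of_set W') V'"
    using open_vimage[OF O'(1) linear_continuous_on[OF bounded_linear_parts(1)]] by blast
  define f' :: "real^(2 + 2)^(2 + 2) \<Rightarrow> real^(2 + 2)^(2 + 2)" where
    "f' = (\<lambda>z. block_matrix (f (TL z)) 0 0 0 + block_matrix 0 0 (BL z ** f (TL z)) 0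
       + block_matrix 0 0 0 (inverse (dt (f (TL z))) *\<^sub>R transpose (adj2 (f (TL z)))))"
  have fTL: "f (TL z) \<in> H" "f (TL z) \<in> U" "invertible (f (TL z))" if "z \<in> V'" for z
    using that U(3) H by (auto simp: V'_def)
  have f'g: "f' z = gmat (BL z) (f (TL z))" if "z \<in> V'" for z
    using adj2_inverse(2)[OF fTL(3)[OF that]] by (simp add: f'_def gmat_def dt_def)
  have sfT: "smooth_on W' V' (\<lambda>z. f (TL z))"
    by (rule smooth_on_compose_linear[OF bounded_linear_parts(1) _ _ f]) (auto simp: W'_def V'_def)
  have entry: "smooth_on W' V' (\<lambda>z. f (TL z) $ i $ j)" for i j
    by (rule smooth_on_linear_compose[OF bounded_linear_entry sfT])
  have "smooth_on W' V' (\<lambda>z. dt (f (TL z)))"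
  proof -
    have "smooth_on W' V' (\<lambda>z. f (TL z) $ 1 $ 1 * f (TL z) $ 2 $ 2 + - (f (TL z) $ 1 $ 2 * f (TL z) $ 2 $ 1))"
      by (intro smooth_on_add smooth_on_linear_compose[OF bounded_linear_minus[OF bounded_linear_ident]]
          smooth_on_bilinear[OF bounded_bilinear_mult] entry)
    then show ?thesis by (simp add: dt_def)
  qed
  then have sinv: "smooth_on W' V' (\<lambda>z. inverse (dt (f (TL z))))"
    by (rule smooth_on_inverse) (use fTL(3) dt in blast)
  have sf': "smooth_on W' V' f'"
    unfolding f'_def
    by (intro smooth_on_add smooth_on_linear_compose[OF bounded_linear_block(1)]
        smooth_on_linear_compose[OF bounded_linear_block(2)] smooth_on_linear_compose[OF bounded_linear_block(3)]
        smooth_on_bilinear[OF bounded_bilinear_matrix_mult] smooth_on_bilinear[OF bounded_bilinear_scaleR]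
        smooth_on_linear_compose[OF bounded_linear_transpose] smooth_on_linear_compose[OF bounded_linear_adj2]
        smooth_on_bounded_linear[OF bounded_linear_parts(3)] sfT sinv)
  define U' :: "(real^(2 + 2)^(2 + 2)) set" where "U' = TL -` (U \<inter> {h. dt h \<noteq> 0})"
  have U': "open U'" "mat 1 \<in> U'"
  proof -
    have "open {h :: real^2^2. dt h \<noteq> 0}" unfolding dt_def by (intro open_Collect_neq continuous_intros)
    then show "open U'" unfolding U'_def
      by (intro open_vimage[OF _ linear_continuous_on[OF bounded_linear_parts(1)]] open_Int U(1))
    show "mat 1 \<in> U'" using U(2) by (simp add: U'_def block_one dt_def mat2_one)
  qed
  have im: "f' ` V' = (\<Sigma> \<rtimes> H) \<inter> U'"
  proof (intro equalityI subsetI)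
    fix p assume "p \<in> f' ` V'"
    then obtain z where z: "z \<in> V'" "p = gmat (BL z) (f (TL z))" using f'g by auto
    have "BL z \<in> \<Sigma>" using z(1) by (auto simp: V'_def W'_def)
    then show "p \<in> (\<Sigma> \<rtimes> H) \<inter> U'"
      using z fTL[OF z(1)] dt unfolding semidirect_def U'_def by (auto simp: gmat_def)
  next
    fix p assume p: "p \<in> (\<Sigma> \<rtimes> H) \<inter> U'"
    then obtain \<sigma> h where sh: "p = gmat \<sigma> h" "\<sigma> \<in> \<Sigma>" "h \<in> H" unfolding semidirect_def by blast
    then have "h \<in> U" using p by (simp add: U'_def gmat_def)
    then have "h \<in> f ` V" using sh U(3) by blast
    then obtain w where w: "w \<in> V" "h = f w" by auto
    have "w \<in> W" using w V openin_imp_subset by blast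
    then have "block_matrix w 0 \<sigma> 0 \<in> V'" using w sh by (auto simp: V'_def W'_def)
    moreover from f'g[OF this] have "f' (block_matrix w 0 \<sigma> 0) = p" using w sh by simp
    ultimately show "p \<in> f' ` V'" by (metis imageI)
  qed
  \<comment> \<open>The pair is recovered by applying \<kappa> to the upper left block h and
    multiplying the lower left block \<sigma> h by the inverse of h, written as adjugate over
    determinant.\<close>
  define \<kappa>' :: "real^(2 + 2)^(2 + 2) \<Rightarrow> real^(2 + 2)^(2 + 2)" where
    "\<kappa>' = (\<lambda>p. block_matrix (\<kappa> (TL p)) 0 0 0 + block_matrix 0 0 (BL p ** (inverse (dt (TL p)) *\<^sub>R adj2 (TL p))) 0)"
  have \<kappa>'f: "\<kappa>' (f' z) = z" if z: "z \<in> V'" for z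
  proof -
    have inv: "invertible (f (TL z))" using fTL(3)[OF z] .
    have "TL (f' z) = f (TL z)" "BL (f' z) = BL z ** f (TL z)" using f'g[OF z] by (simp_all add: gmat_def)
    moreover have "\<kappa> (f (TL z)) = TL z" using \<kappa>(1) z by (auto simp: V'_def)
    moreover have "BL z ** f (TL z) ** (inverse (dt (f (TL z))) *\<^sub>R adj2 (f (TL z))) = BL z"
      using adj2_inverse(1)[OF inv] matrix_inv_cancel(3)[OF inv] by (simp add: dt_def)
    ultimately have "\<kappa>' (f' z) = block_matrix (TL z) 0 (BL z) 0" by (simp add: \<kappa>'_def)
    also have "\<dots> = z" using z by (auto simp: V'_def W'_def)
    finally show ?thesis .
  qed
  have d\<kappa>': "\<kappa>' differentiable (at p)" if p: "p \<in> U'" for p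
  proof -
    have pU: "TL p \<in> U" "dt (TL p) \<noteq> 0" using p by (auto simp: U'_def)
    have lin: "\<And>g :: _ \<Rightarrow> real^2^2. bounded_linear g \<Longrightarrow> g differentiable (at p)"
      by (rule bounded_linear_imp_differentiable)
    have comp: "(\<lambda>x. L (g x)) differentiable (at p)" if "bounded_linear L" "g differentiable (at p)"
      for L :: "'x::real_normed_vector \<Rightarrow> 'y::real_normed_vector" and g
      using differentiable_chain_at[OF that(2) bounded_linear_imp_differentiable[OF that(1)]] by (simp add: o_def)
    have bil: "(\<lambda>x. B (g x) (h x)) differentiable (at p)"
      if "bounded_bilinear B" "g differentiable (at p)" "h differentiable (at p)"
      for B :: "'x::real_normed_vector \<Rightarrow> 'y::real_normed_vector \<Rightarrow> 'z::real_normed_vector" and g h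
      using that bounded_bilinear.FDERIV[OF that(1)] unfolding differentiable_def by blast
    have k: "(\<lambda>p. \<kappa> (TL p)) differentiable (at p)"
      using differentiable_chain_at[OF lin[OF bounded_linear_parts(1)] \<kappa>(2)[OF pU(1)]] by (simp add: o_def)
    have e: "(\<lambda>p. TL p $ i $ j) differentiable (at p)" for i j
      by (rule bounded_linear_imp_differentiable) (rule bounded_linear_compose[OF bounded_linear_entry bounded_linear_parts(1)])
    have dd: "(\<lambda>p. dt (TL p)) differentiable (at p)"
      unfolding dt_def by (intro differentiable_diff differentiable_mult e)
    have "(\<lambda>p. inverse (dt (TL p))) differentiable (at p)"
      by (rule differentiable_inverse[OF dd pU(2)])
    then show ?thesis
      unfolding \<kappa>'_def
      by (intro differentiable_add comp[OF bounded_linear_block(1)] comp[OF bounded_linear_block(2)] k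
          bil[OF bounded_bilinear_matrix_mult] bil[OF bounded_bilinear_scaleR] lin[OF bounded_linear_parts(3)]
          lin[OF bounded_linear_compose[OF bounded_linear_adj2 bounded_linear_parts(1)]])
  qed
  show ?thesis
    unfolding emb_lie_def using subgroup_semidirect[OF sub S st] W' V' sf' U' im \<kappa>'f d\<kappa>'
    by (intro conjI exI[of _ W'] exI[of _ V'] exI[of _ f'] exI[of _ U'] exI[of _ \<kappa>']) auto
qed

section \<open>Representatives in triangular form\<close>

text \<open>In light-cone coordinates \<open>Soff\<close> and \<open>Sdiag\<close> represent
  \<open>\<Sigma>\<^sub>2\<close> and its orthogonal complement; after a swap of axes
  \<open>S3p\<close> represents the complement of \<open>\<Sigma>\<^sub>3\<close>. Every group
  acting is then conformal or lower triangular.\<close>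

definition S1 :: "(real^2^2) set" where "S1 = {A. \<exists>u. A = mat2 u 0 0 u}"
definition Soff :: "(real^2^2) set" where "Soff = {A. \<exists>u. A = mat2 0 u u 0}"
definition S3 :: "(real^2^2) set" where "S3 = {A. \<exists>u. A = mat2 u 0 0 0}"
definition S1p :: "(real^2^2) set" where "S1p = {A. \<exists>u v. A = mat2 u v v (- u)}"
definition Sdiag :: "(real^2^2) set" where "Sdiag = {A. \<exists>u v. A = mat2 u 0 0 v}"
definition S3p :: "(real^2^2) set" where "S3p = {A. \<exists>u v. A = mat2 u v v 0}"

lemmas S_defs = S1_def Soff_def S3_def S1p_def Sdiag_def S3p_def

text \<open>The direction \<open>(p, q)\<close> stands for the slope \<open>\<alpha> = q / p\<close>; in light-cone coordinates the
  matrix \<open>p I + q K\<close> with \<open>K\<close> the hyperbolic generator becomes \<open>diag (p + q, p - q)\<close>.\<close>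

definition par :: "ereal \<Rightarrow> real \<times> real" where
  "par \<alpha> = (if \<alpha> = \<infinity> then (0, 1) else (1, real_of_ereal \<alpha>))"

fun sig :: "label \<Rightarrow> (real^2^2) set" where
  "sig (L21 \<alpha>) = S1" | "sig (L22 \<alpha>) = Soff" | "sig L23 = S3" | "sig L24 = S3" | "sig (L25 \<alpha>) = S3"
| "sig L31 = S1" | "sig L32 = Soff" | "sig L33 = S3" | "sig L34 = S3" | "sig (L35 \<gamma>) = S3"
| "sig (L36 \<alpha>) = S1p" | "sig (L37 \<alpha>) = Sdiag" | "sig L38 = S3p" | "sig L39 = S3p"
| "sig L41 = S3" | "sig L42 = S1p" | "sig L43 = Sdiag" | "sig (L44 \<gamma>) = S3p" | "sig L51 = S3p"

definition Hlc :: "ereal \<Rightarrow> (real^2^2) set" where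
  "Hlc \<alpha> = Dgrp (fst (par \<alpha>) + snd (par \<alpha>)) (fst (par \<alpha>) - snd (par \<alpha>))"

fun hgp :: "label \<Rightarrow> (real^2^2) set" where
  "hgp (L21 \<alpha>) = H\<sigma>1 \<alpha>" | "hgp (L22 \<alpha>) = Hlc \<alpha>" | "hgp L23 = H_zero\<sigma>3" | "hgp L24 = H_one\<sigma>3"
| "hgp (L25 \<alpha>) = Dgrp \<alpha> (\<alpha> + 1)"
| "hgp L31 = H0\<sigma>1" | "hgp L32 = K_zero\<sigma>3" | "hgp L33 = K_zero\<sigma>3" | "hgp L34 = Tgrp 1 1"
| "hgp (L35 \<gamma>) = Tgrp \<gamma> (\<gamma> + 1)"
| "hgp (L36 \<alpha>) = H\<sigma>1 \<alpha>" | "hgp (L37 \<alpha>) = Hlc \<alpha>" | "hgp L38 = H_zero\<sigma>3" | "hgp L39 = H_one\<sigma>3"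
| "hgp L41 = T0" | "hgp L42 = H0\<sigma>1" | "hgp L43 = K_zero\<sigma>3" | "hgp (L44 \<gamma>) = Tgrp (\<gamma> + 1) \<gamma>" | "hgp L51 = T0"

definition h_ell :: "ereal \<Rightarrow> (real^2^2) set" where
  "h_ell \<alpha> = span {mat2 (fst (par \<alpha>)) (snd (par \<alpha>)) (- snd (par \<alpha>)) (fst (par \<alpha>))}"
definition h_lc :: "ereal \<Rightarrow> (real^2^2) set" where
  "h_lc \<alpha> = span {mat2 (fst (par \<alpha>) + snd (par \<alpha>)) 0 0 (fst (par \<alpha>) - snd (par \<alpha>))}"
definition h_tri :: "real \<Rightarrow> real \<Rightarrow> (real^2^2) set" where
  "h_tri c a = {A. \<exists>x y. A = mat2 (c * x) 0 y (a * x)}"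
definition h_co :: "(real^2^2) set" where "h_co = {A. \<exists>x y. A = mat2 x y (- y) x}"
definition h_T :: "(real^2^2) set" where "h_T = {A. \<exists>x y z. A = mat2 x 0 y z}"

fun halg :: "label \<Rightarrow> (real^2^2) set" where
  "halg (L21 \<alpha>) = h_ell \<alpha>" | "halg (L22 \<alpha>) = h_lc \<alpha>" | "halg L23 = span {mat2 0 0 1 0}"
| "halg L24 = span {mat2 1 0 1 1}" | "halg (L25 \<alpha>) = span {mat2 \<alpha> 0 0 (\<alpha> + 1)}"
| "halg L31 = h_co" | "halg L32 = Sdiag" | "halg L33 = Sdiag" | "halg L34 = h_tri 1 1"
| "halg (L35 \<gamma>) = h_tri \<gamma> (\<gamma> + 1)"
| "halg (L36 \<alpha>) = h_ell \<alpha>" | "halg (L37 \<alpha>) = h_lc \<alpha>" | "halg L38 = span {mat2 0 0 1 0}"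
| "halg L39 = span {mat2 1 0 1 1}"
| "halg L41 = h_T" | "halg L42 = h_co" | "halg L43 = Sdiag" | "halg (L44 \<gamma>) = h_tri (\<gamma> + 1) \<gamma>" | "halg L51 = h_T"

fun hdim :: "label \<Rightarrow> nat" where
  "hdim L31 = 2" | "hdim L32 = 2" | "hdim L33 = 2" | "hdim L34 = 2" | "hdim (L35 _) = 2"
| "hdim L41 = 3" | "hdim L42 = 2" | "hdim L43 = 2" | "hdim (L44 _) = 2" | "hdim L51 = 3" | "hdim _ = 1"

text \<open>Its columns (1, 1) and (1, -1) are the common eigenvectors of the hyperbolic
  rotations.\<close>

definition kLC :: "real^2^2" where "kLC = mat2 1 1 1 (-1)"
definition kSW :: "real^2^2" where "kSW = mat2 0 1 1 0"

fun kmat :: "label \<Rightarrow> real^2^2" where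
  "kmat (L22 _) = kLC" | "kmat L32 = kLC" | "kmat (L37 _) = kLC" | "kmat L43 = kLC"
| "kmat L38 = kSW" | "kmat L39 = kSW" | "kmat (L44 _) = kSW" | "kmat L51 = kSW"
| "kmat _ = mat 1"

section \<open>The representatives belong to the class and conjugate to the listed groups\<close>

lemma dim_S:
  "subspace S1" "dim S1 = 1" "subspace Soff" "dim Soff = 1" "subspace S3" "dim S3 = 1"
  "subspace S1p" "dim S1p = 2" "subspace Sdiag" "dim Sdiag = 2" "subspace S3p" "dim S3p = 2"
proof -
  have *: "S1 = span {mat2 1 0 0 1}" "Soff = span {mat2 0 1 1 0}" "S3 = span {mat2 1 0 0 0}"
    by (auto simp: S_defs span_singleton)
  show "subspace S1" "dim S1 = 1" "subspace Soff" "dim Soff = 1" "subspace S3" "dim S3 = 1"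
    unfolding * by (simp_all add: mat2_zero)
  show "subspace S1p" "dim S1p = 2" "subspace Sdiag" "dim Sdiag = 2" "subspace S3p" "dim S3p = 2"
    unfolding S_defs by (rule subspaces_mat2)+
qed

lemma dim_sig: "subspace (sig l)" "dim (sig l) = grp_dim l - hdim l" "hdim l + dim (sig l) = grp_dim l"
  by (cases l; simp add: dim_S)+

lemma sig_Sym: "sig l \<subseteq> Sym"
  by (cases l) (auto simp: S_defs Sym_def)

lemma par_cases: "\<alpha> \<in> {0..\<infinity>} \<Longrightarrow> \<alpha> = \<infinity> \<or> (\<exists>r\<ge>0. \<alpha> = ereal r)"
  by (cases \<alpha>) auto

lemma par_simps [simp]: "par \<infinity> = (0, 1)" "par (ereal r) = (1, r)"
  by (simp_all add: par_def)

lemma hgp_emb: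
  assumes "admissible l"
  shows "emb_lie (hdim l) (hgp l)" "tang (hgp l) = halg l" "connected (hgp l)"
proof -
  have ell: "emb_lie 1 (H\<sigma>1 \<alpha>) \<and> tang (H\<sigma>1 \<alpha>) = h_ell \<alpha> \<and> connected (H\<sigma>1 \<alpha>)" if "\<alpha> \<in> {0..\<infinity>}" for \<alpha>
    using par_cases[OF that] H\<sigma>1_infinity H\<sigma>1_real by (auto simp: h_ell_def)
  have lc: "emb_lie 1 (Hlc \<alpha>) \<and> tang (Hlc \<alpha>) = h_lc \<alpha> \<and> connected (Hlc \<alpha>)" for \<alpha>
  proof -
    have "fst (par \<alpha>) + snd (par \<alpha>) \<noteq> 0 \<or> fst (par \<alpha>) - snd (par \<alpha>) \<noteq> 0" by (auto simp: par_def)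
    from Dgrp[OF this] show ?thesis unfolding Hlc_def h_lc_def by blast
  qed
  have tri: "emb_lie 2 (Tgrp c a) \<and> tang (Tgrp c a) = h_tri c a \<and> connected (Tgrp c a)" if "c \<noteq> 0 \<or> a \<noteq> 0" for c a
    using Tgrp[OF that] by (simp add: h_tri_def)
  have "emb_lie (hdim l) (hgp l) \<and> tang (hgp l) = halg l \<and> connected (hgp l)"
    using assms ell lc tri Dgrp[of \<alpha> "\<alpha> + 1" for \<alpha>] H_zero\<sigma>3 H_one\<sigma>3 K_zero\<sigma>3 T0 H0\<sigma>1
    by (cases l) (auto simp: Sdiag_def h_T_def h_co_def)
  then show "emb_lie (hdim l) (hgp l)" "tang (hgp l) = halg l" "connected (hgp l)" by auto
qed

lemma emb_lie_subgroup: "emb_lie n H \<Longrightarrow> subgroup H GL"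
  unfolding emb_lie_def by blast

lemma stab_mono: "stab \<Sigma> H \<Longrightarrow> H' \<subseteq> H \<Longrightarrow> stab \<Sigma> H'"
  unfolding stab_def by blast

lemma S1p_iff: "A \<in> S1p \<longleftrightarrow> (\<exists>u v. A = mat2 u v v (- u))"
  by (simp add: S1p_def)

lemma stab_models:
  "stab S1 H0\<sigma>1" "stab S1p H0\<sigma>1" "stab Soff K_zero\<sigma>3" "stab Sdiag K_zero\<sigma>3" "stab S3 T0" "stab S3p T0"
proof -
  \<comment> \<open>A conformal matrix acts on traceless symmetric matrices as multiplication of u +
    i v by (x + i y)^2.\<close>
  have "transpose (mat2 x y (- y) x) ** mat2 u v v (- u) ** mat2 x y (- y) x =
      mat2 ((x * x - y * y) * u - 2 * x * y * v) (2 * x * y * u + (x * x - y * y) * v)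
        (2 * x * y * u + (x * x - y * y) * v) (- ((x * x - y * y) * u - 2 * x * y * v))" for x y u v
    by (simp add: algebra_simps)
  then have "transpose (mat2 x y (- y) x) ** mat2 u v v (- u) ** mat2 x y (- y) x \<in> S1p" for x y u v
    unfolding S1p_def by blast
  then have "transpose h ** \<sigma> ** h \<in> S1p" if "h \<in> H0\<sigma>1" "\<sigma> \<in> S1p" for h \<sigma>
    using that unfolding H0\<sigma>1_eq by (auto simp only: mem_Collect_eq S1p_iff)
  then show "stab S1p H0\<sigma>1" unfolding stab_def by blast
qed (auto simp: stab_def S_defs H0\<sigma>1_eq K_zero\<sigma>3_eq T0_def algebra_simps)

lemma group_inclusions:
  "H\<sigma>1 \<alpha> \<subseteq> H0\<sigma>1" "Dgrp c a \<subseteq> K_zero\<sigma>3" "K_zero\<sigma>3 \<subseteq> T0" "H_zero\<sigma>3 \<subseteq> T0" "H_one\<sigma>3 \<subseteq> T0" "Tgrp c a \<subseteq> T0"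
proof -
  have *: "r *\<^sub>R Rmat t \<in> H0\<sigma>1" if "r > 0" for r t using that unfolding H0\<sigma>1_def by blast
  have "Rmat t \<in> H0\<sigma>1" "exp s *\<^sub>R Rmat t \<in> H0\<sigma>1" for s t
    using *[of 1 t] *[of "exp s" t] by simp_all
  then show "H\<sigma>1 \<alpha> \<subseteq> H0\<sigma>1" by (auto simp: H\<sigma>1_def)
qed (auto simp: Dgrp_def K_zero\<sigma>3_eq T0_def H_zero\<sigma>3_def H_one\<sigma>3_def Tgrp_def)

lemma stab_hgp: "stab (sig l) (hgp l)"
proof -
  have "Dgrp c a \<subseteq> T0" for c a using group_inclusions by blast
  then have "stab S1 (H\<sigma>1 \<alpha>)" "stab S1p (H\<sigma>1 \<alpha>)" "stab Soff (Dgrp c a)" "stab Sdiag (Dgrp c a)"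
    "stab S3 (Dgrp c a)" "stab S3 H_zero\<sigma>3" "stab S3 H_one\<sigma>3" "stab S3 K_zero\<sigma>3" "stab S3 (Tgrp c a)"
    "stab S3p H_zero\<sigma>3" "stab S3p H_one\<sigma>3" "stab S3p (Tgrp c a)" for \<alpha> c a
    by (intro stab_mono[OF stab_models(1)] stab_mono[OF stab_models(2)] stab_mono[OF stab_models(3)]
        stab_mono[OF stab_models(4)] stab_mono[OF stab_models(5)] stab_mono[OF stab_models(6)] group_inclusions; assumption?)+
  then show ?thesis using stab_models by (cases l) (simp_all add: Hlc_def)
qed

text \<open>In the eigenbasis of the hyperbolic rotations the eigenvalues cosh t + sinh t and cosh t
  - sinh t become exp t and exp (- t).\<close>

lemma H\<sigma>2_conj: "\<alpha> \<in> {0..\<infinity>} \<Longrightarrow> H\<sigma>2 \<alpha> = conj_set kLC (Hlc \<alpha>)" "H0\<sigma>2 = conj_set kLC K_zero\<sigma>3"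
proof -
  have inv: "matrix_inv kLC = mat2 (1/2) (1/2) (1/2) (-1/2)"
    unfolding kLC_def by (subst matrix_inv_mat2) auto
  have c: "kLC ** mat2 x 0 0 y ** matrix_inv kLC = mat2 ((x + y) / 2) ((x - y) / 2) ((x - y) / 2) ((x + y) / 2)" for x y
    unfolding inv unfolding kLC_def by (simp add: field_simps)
  have A: "exp s *\<^sub>R Amat t = mat2 ((exp (s + t) + exp (s - t)) / 2) ((exp (s + t) - exp (s - t)) / 2)
     ((exp (s + t) - exp (s - t)) / 2) ((exp (s + t) + exp (s - t)) / 2)" for s t
    by (simp add: Amat_def cosh_field_def sinh_field_def exp_add exp_diff exp_minus field_simps)
  show "H\<sigma>2 \<alpha> = conj_set kLC (Hlc \<alpha>)" if "\<alpha> \<in> {0..\<infinity>}"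
  proof -
    have e: "conj_set kLC (Dgrp c a) = range (\<lambda>t. mat2 ((exp (c * t) + exp (a * t)) / 2) ((exp (c * t) - exp (a * t)) / 2)
       ((exp (c * t) - exp (a * t)) / 2) ((exp (c * t) + exp (a * t)) / 2))" for c a
      unfolding conj_set_def Dgrp_def image_image c ..
    from par_cases[OF that] show ?thesis
    proof
      assume "\<alpha> = \<infinity>"
      then show ?thesis using A[of 0] by (simp add: Hlc_def e H\<sigma>2_def)
    next
      assume "\<exists>r\<ge>0. \<alpha> = ereal r"
      then obtain r where "\<alpha> = ereal r" by blast
      then show ?thesis by (auto simp: Hlc_def e H\<sigma>2_def A algebra_simps image_iff)
    qed
  qed
  have "H0\<sigma>2 = {exp s *\<^sub>R Amat t | s t. True}"
    unfolding H0\<sigma>2_def by (auto intro: exp_gt_zero) (metis exp_ln)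
  also have "\<dots> = conj_set kLC K_zero\<sigma>3"
  proof -
    have "\<exists>x y. exp s *\<^sub>R Amat t = kLC ** mat2 (exp x) 0 0 (exp y) ** matrix_inv kLC" for s t
      unfolding c A by blast
    moreover have "\<exists>s t. kLC ** mat2 (exp x) 0 0 (exp y) ** matrix_inv kLC = exp s *\<^sub>R Amat t" for x y
      unfolding c A by (intro exI[of _ "(x + y) / 2"] exI[of _ "(x - y) / 2"]) (simp add: field_simps)
    moreover have "conj_set kLC K_zero\<sigma>3 = {kLC ** mat2 (exp x) 0 0 (exp y) ** matrix_inv kLC | x y. True}"
      unfolding conj_set_def K_zero\<sigma>3_def by blast
    ultimately show ?thesis by (simp only:) blast
  qed
  finally show "H0\<sigma>2 = conj_set kLC K_zero\<sigma>3" .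
qed

lemma sym_perp_eq:
  "sym_perp \<Sigma>\<^sub>1 = S1p" "sym_perp \<Sigma>\<^sub>2 = {A. \<exists>u v. A = mat2 u v v u}" "sym_perp \<Sigma>\<^sub>3 = {A. \<exists>u v. A = mat2 0 v v u}"
proof -
  have sp: "sym_perp (span {B}) = {A. \<exists>a b d. A = mat2 a b b d \<and> trace (B ** A) = 0}" for B
  proof -
    have "A \<in> Sym \<longleftrightarrow> (\<exists>a b d. A = mat2 a b b d)" for A :: "real^2^2"
      by (cases A rule: mat2_cases) (auto simp: Sym_def)
    moreover have "(\<forall>\<sigma>\<in>span {B}. trace (\<sigma> ** A) = 0) \<longleftrightarrow> trace (B ** A) = 0" for A
    proof -
      have "trace ((k *\<^sub>R B) ** A) = k * trace (B ** A)" for k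
        by (simp add: matrix_mult.scaleR_left trace_def sum_2 distrib_left)
      then show ?thesis unfolding span_singleton by (auto dest: spec[of _ 1])
    qed
    ultimately show ?thesis unfolding sym_perp_def by auto
  qed
  show "sym_perp \<Sigma>\<^sub>1 = S1p" "sym_perp \<Sigma>\<^sub>2 = {A. \<exists>u v. A = mat2 u v v u}" "sym_perp \<Sigma>\<^sub>3 = {A. \<exists>u v. A = mat2 0 v v u}"
    unfolding \<Sigma>\<^sub>1_def \<Sigma>\<^sub>2_def \<Sigma>\<^sub>3_def sp by (auto simp: S1p_def)
qed

lemma kmat_invertible: "invertible (kmat l)"
  by (cases l) (auto simp: kLC_def kSW_def)

lemma act_one: "act (mat 1) \<Sigma> = \<Sigma>" and conj_set_one: "conj_set (mat 1 :: real^'n^'n) G = G"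
  by (simp_all add: act_def conj_set_def)

lemma act_models:
  "act kLC Soff = \<Sigma>\<^sub>2" "act kLC Sdiag = sym_perp \<Sigma>\<^sub>2" "act kSW S3p = sym_perp \<Sigma>\<^sub>3"
proof -
  have inv: "matrix_inv kLC = mat2 (1/2) (1/2) (1/2) (-1/2)" "sharp kLC = mat2 (1/2) (1/2) (1/2) (-1/2)"
    "matrix_inv kSW = mat2 0 1 1 0" "sharp kSW = mat2 0 1 1 0"
    unfolding kLC_def kSW_def sharp_def by (simp_all add: matrix_inv_mat2)
  have "mat2 k 0 0 (- k) \<in> act kLC Soff" for k
    unfolding act_def inv Soff_def by (rule image_eqI[of _ _ "mat2 0 (2 * k) (2 * k) 0"]) auto
  moreover have "mat2 (u / 2) 0 0 (- (u / 2)) \<in> range (\<lambda>x. mat2 x 0 0 (- x))" for u :: real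
    by (rule range_eqI[of _ _ "u / 2"]) simp
  ultimately show "act kLC Soff = \<Sigma>\<^sub>2"
    unfolding \<Sigma>\<^sub>2_def span_singleton by (auto simp: act_def inv Soff_def)
  have c: "mat2 (1/2) (1/2) (1/2) (-1/2) ** mat2 u 0 0 v ** mat2 (1/2) (1/2) (1/2) (-1/2) =
      mat2 ((u + v) / 4) ((u - v) / 4) ((u - v) / 4) ((u + v) / 4)" for u v
    by (simp add: field_simps)
  show "act kLC Sdiag = sym_perp \<Sigma>\<^sub>2"
  proof (intro equalityI subsetI)
    fix A assume "A \<in> act kLC Sdiag"
    then obtain u v where "A = mat2 ((u + v) / 4) ((u - v) / 4) ((u - v) / 4) ((u + v) / 4)"
      unfolding act_def inv Sdiag_def using c by blast
    then show "A \<in> sym_perp \<Sigma>\<^sub>2" unfolding sym_perp_eq by blast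
  next
    fix A assume "A \<in> sym_perp \<Sigma>\<^sub>2"
    then obtain u v where "A = mat2 u v v u" unfolding sym_perp_eq by blast
    then have "A = mat2 (1/2) (1/2) (1/2) (-1/2) ** mat2 (2 * (u + v)) 0 0 (2 * (u - v)) ** mat2 (1/2) (1/2) (1/2) (-1/2)"
      unfolding c by simp
    then show "A \<in> act kLC Sdiag" unfolding act_def inv Sdiag_def by blast
  qed
  show "act kSW S3p = sym_perp \<Sigma>\<^sub>3"
  proof (intro equalityI subsetI)
    fix A assume "A \<in> sym_perp \<Sigma>\<^sub>3"
    then obtain u v where "A = mat2 0 1 1 0 ** mat2 u v v 0 ** mat2 0 1 1 0" unfolding sym_perp_eq by auto
    then show "A \<in> act kSW S3p" unfolding act_def inv S3p_def by blast
  qed (auto simp: act_def inv sym_perp_eq S3p_def)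
qed

text \<open>Exchanging the axes makes a lower triangular matrix upper triangular and swaps its
  diagonal entries. This is why the representative of \<open>L44\<close> carries the exponents in
  the order \<gamma> + 1, \<gamma>.\<close>

lemma conj_kSW:
  "conj_set kSW H_zero\<sigma>3 = transpose ` H_zero\<sigma>3" "conj_set kSW H_one\<sigma>3 = transpose ` H_one\<sigma>3"
  "conj_set kSW (Tgrp (\<gamma> + 1) \<gamma>) = transpose ` L\<sigma>3 \<gamma>" "conj_set kSW T0 = transpose ` H0\<sigma>3"
proof -
  have inv: "matrix_inv kSW = mat2 0 1 1 0" unfolding kSW_def by (simp add: matrix_inv_mat2)
  have c: "kSW ** mat2 x 0 s y ** matrix_inv kSW = mat2 y s 0 x" for x y s
    unfolding inv unfolding kSW_def by simp
  have *: "conj_set kSW H = transpose ` H'"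
    if H: "H \<subseteq> T0" "H' \<subseteq> T0" and eq: "\<And>x y s. mat2 x 0 s y \<in> H \<longleftrightarrow> mat2 y 0 s x \<in> H'" for H H'
  proof (intro equalityI subsetI)
    fix A assume "A \<in> conj_set kSW H"
    then obtain x s y where "mat2 x 0 s y \<in> H" "A = kSW ** mat2 x 0 s y ** matrix_inv kSW"
      using H(1) unfolding conj_set_def T0_def by blast
    then show "A \<in> transpose ` H'" using c eq by (auto simp: image_iff intro!: bexI[of _ "mat2 y 0 s x"])
  next
    fix A assume "A \<in> transpose ` H'"
    then obtain x s y where "mat2 y 0 s x \<in> H'" "A = mat2 y s 0 x"
      using H(2) unfolding T0_def by auto
    then show "A \<in> conj_set kSW H" using c eq unfolding conj_set_def by (metis imageI)
  qed
  show "conj_set kSW H_zero\<sigma>3 = transpose ` H_zero\<sigma>3" "conj_set kSW H_one\<sigma>3 = transpose ` H_one\<sigma>3"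
    by (rule *[OF group_inclusions(4) group_inclusions(4)]; force simp: H_zero\<sigma>3_def)
      (rule *[OF group_inclusions(5) group_inclusions(5)]; force simp: H_one\<sigma>3_def)
  show "conj_set kSW T0 = transpose ` H0\<sigma>3"
    unfolding H0\<sigma>3_eq by (rule *) (auto simp: T0_def)
  have "L\<sigma>3 \<gamma> = Tgrp \<gamma> (\<gamma> + 1)" by (simp add: L\<sigma>3_def Tgrp_def)
  then show "conj_set kSW (Tgrp (\<gamma> + 1) \<gamma>) = transpose ` L\<sigma>3 \<gamma>"
    using *[OF group_inclusions(6) group_inclusions(6), of "\<gamma> + 1" \<gamma> \<gamma> "\<gamma> + 1"] by (auto simp: Tgrp_def)
qed

lemma grp_rep:
  assumes l: "admissible l"
  shows "grp l = act (kmat l) (sig l) \<rtimes> conj_set (kmat l) (hgp l)"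
proof -
  have "\<Sigma>\<^sub>1 = S1" "\<Sigma>\<^sub>3 = S3" by (auto simp: \<Sigma>\<^sub>1_def \<Sigma>\<^sub>3_def span_singleton S_defs)
  moreover from this(1) have "sym_perp S1 = S1p" using sym_perp_eq(1) by simp
  moreover have "H_diag\<sigma>3 \<alpha> = Dgrp \<alpha> (\<alpha> + 1)" "L\<sigma>3 \<alpha> = Tgrp \<alpha> (\<alpha> + 1)" "K_inf\<sigma>3 = Tgrp 1 1" for \<alpha>
    by (auto simp: H_diag\<sigma>3_def Dgrp_def L\<sigma>3_def Tgrp_def K_inf\<sigma>3_def)
  ultimately show ?thesis
    using l by (cases l) (simp_all add: act_one conj_set_one act_models conj_kSW H\<sigma>2_conj[symmetric] H0\<sigma>3_eq)
qed

lemma tang_trivial: "tang {mat 1} \<subseteq> {0}"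
  by (rule tang_subset_subspace) (auto simp: subspace_single_0)

text \<open>The trivial group has only the zero tangent vector, whereas each listed Lie algebra
  contains a nonzero matrix.\<close>

lemma hgp_nontrivial:
  assumes "admissible l"
  shows "hgp l \<noteq> {mat 1}"
proof
  assume "hgp l = {mat 1}"
  then have "halg l \<subseteq> {0}" using hgp_emb(2)[OF assms] tang_trivial by metis
  moreover have "\<exists>X\<in>halg l. X \<noteq> 0"
  proof -
    have "mat2 0 0 1 0 \<in> h_tri c a" "mat2 0 0 1 0 \<in> h_T" for c a by (auto simp: h_tri_def h_T_def)
    moreover have "mat2 1 0 0 1 \<in> h_co" "mat2 1 0 0 1 \<in> Sdiag" by (auto simp: h_co_def Sdiag_def)
    ultimately show ?thesis
      by (cases l) (auto simp: h_ell_def h_lc_def par_def mat2_zero intro!: bexI span_base split: if_splits)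
  qed
  ultimately show False by blast
qed

text \<open>Membership is checked on the conjugated pair of \<open>grp_rep\<close>. The Lie
  structure of the whole group comes from the chart of the model semidirect product, carried over by
  conjugation.\<close>

theorem grp_class_E:
  assumes l: "admissible l"
  shows "grp l \<in> class_E" "lie_subgroup (grp_dim l) (grp l) (top_of_set (grp l))"
proof -
  let ?k = "kmat l"
  note k = kmat_invertible[of l]
  have S: "subspace (act ?k (sig l))" by (rule act_subspace[OF dim_sig(1)])
  have emb: "emb_lie (hdim l) (conj_set ?k (hgp l))" by (rule emb_lie_conj[OF hgp_emb(1)[OF l] k])
  have st: "stab (act ?k (sig l)) (conj_set ?k (hgp l))" by (rule stab_conj[OF k stab_hgp])
  have "dim (sig l) > 0" by (cases l) (simp_all add: dim_S)
  then have "sig l \<noteq> {0}" using dim_eq_0[of "sig l"] by fastforce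
  moreover have "act (matrix_inv ?k) {0} = {0}" by (simp add: act_def)
  ultimately have "act ?k (sig l) \<noteq> {0}"
    using act_inverse(1)[OF k, of "sig l"] by fastforce
  moreover have "conj_set (matrix_inv ?k) {mat 1} = {mat 1}"
    using matrix_inv(2)[OF k] matrix_inv_matrix_inv[OF k] by (simp add: conj_set_def)
  then have "conj_set ?k (hgp l) \<noteq> {mat 1}"
    using conj_set_inverse(1)[OF k, of "hgp l"] hgp_nontrivial[OF l] by fastforce
  moreover have "connected_lie_subgroup (conj_set ?k (hgp l))"
    unfolding connected_lie_subgroup_def
  proof (intro exI conjI)
    show "lie_subgroup (hdim l) (conj_set ?k (hgp l)) (top_of_set (conj_set ?k (hgp l)))"
      by (rule emb_lie_imp_lie_subgroup[OF emb])
    have "connectedin euclidean (conj_set ?k (hgp l))"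
      using connected_conj_set[OF hgp_emb(3)[OF l], of ?k] by simp
    then show "connected_space (top_of_set (conj_set ?k (hgp l)))" unfolding connectedin_def by blast
  qed
  moreover have "act ?k (sig l) \<subseteq> Sym" by (rule act_Sym[OF k sig_Sym])
  ultimately have "class_E_pair (act ?k (sig l)) (conj_set ?k (hgp l))"
    unfolding class_E_pair_def using S subgroup_semidirect[OF emb_lie_subgroup[OF emb] S st] by blast
  then show "grp l \<in> class_E" unfolding class_E_def grp_rep[OF l] by blast
  have "emb_lie (grp_dim l) (sig l \<rtimes> hgp l)"
    using emb_lie_semidirect[OF hgp_emb(1)[OF l] dim_sig(1) stab_hgp] dim_sig(3)[of l] by simp
  from emb_lie_conj[OF this Sp_invertible[OF gmat_Sp[OF k]]]
  have "emb_lie (grp_dim l) (grp l)"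
    unfolding grp_rep[OF l] conj_semidirect[OF k emb_lie_subgroup[OF hgp_emb(1)[OF l]]] .
  then show "lie_subgroup (grp_dim l) (grp l) (top_of_set (grp l))" by (rule emb_lie_imp_lie_subgroup)
qed

section \<open>Invariants of the Lie algebras\<close>

text \<open>For the matrices of size four considered here, vanishing of the fourth power is
  nilpotency.\<close>

definition nilp :: "real^'n^'n \<Rightarrow> bool" where "nilp Y \<longleftrightarrow> Y ** Y ** (Y ** Y) = 0"

text \<open>For \<open>Y \<noteq> 0\<close> the identity \<open>Y Z Y = tr (Y Z) Y\<close> for all \<open>Z\<close> says that \<open>Y\<close> has rank one.\<close>

definition rk1 :: "real^'n^'n \<Rightarrow> bool" where
  "rk1 Y \<longleftrightarrow> Y \<noteq> 0 \<and> (\<forall>Z. Y ** Z ** Y = trace (Y ** Z) *\<^sub>R Y)"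

text \<open>For Y in the symplectic Lie algebra J Y is symmetric, the quadratic Hamiltonian of Y;
  either sign of semidefiniteness is accepted.\<close>

definition semidef :: "real^('d::finite + 'd)^('d + 'd) \<Rightarrow> bool" where
  "semidef Y \<longleftrightarrow> (\<forall>x. 0 \<le> x \<bullet> (Jmat ** Y *v x)) \<or> (\<forall>x. x \<bullet> (Jmat ** Y *v x) \<le> 0)"

definition bracket :: "real^'n^'n \<Rightarrow> real^'n^'n \<Rightarrow> real^'n^'n" where
  "bracket X Y = X ** Y - Y ** X"

abbreviation blk :: "real^'d^'d \<Rightarrow> real^'d^'d \<Rightarrow> real^('d::finite + 'd)^('d + 'd)" where
  "blk X \<sigma> \<equiv> block_matrix X 0 \<sigma> (- transpose X)"

locale sp_conj =
  fixes g :: "real^('d::finite + 'd)^('d + 'd)" and c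
  assumes g: "g \<in> Sp" and c_def: "c = (\<lambda>x. g ** x ** matrix_inv g)"
begin

lemma inv: "invertible g" by (rule Sp_invertible[OF g])

sublocale c: bounded_linear c unfolding c_def by (rule bounded_linear_conj)

lemma mult: "c (x ** y) = c x ** c y" unfolding c_def by (rule conj_inverse(3)[OF inv])

lemma eq_iff: "c x = c y \<longleftrightarrow> x = y" unfolding c_def using conj_inverse(2)[OF inv] by metis

lemma eq_0_iff: "c x = 0 \<longleftrightarrow> x = 0" using eq_iff[of x 0] c.zero by simp

lemma one: "c (mat 1) = mat 1" by (simp add: c_def matrix_inv[OF inv])

lemma trace: "trace (c x) = trace x"
  unfolding c_def using trace_mul_sym[of "g ** x" "matrix_inv g"] by (simp add: matrix_mul_assoc matrix_inv[OF inv])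

lemma surj: "\<exists>z. c z = y"
  unfolding c_def using conj_inverse(1)[OF inv] by metis

lemma nilp: "nilp (c Y) \<longleftrightarrow> nilp Y"
  unfolding nilp_def by (simp flip: mult add: eq_0_iff)

lemma rk1: "rk1 (c Y) \<longleftrightarrow> rk1 Y"
proof -
  have "(\<forall>Z. c Y ** Z ** c Y = trace (c Y ** Z) *\<^sub>R c Y) \<longleftrightarrow> (\<forall>Z. c Y ** c Z ** c Y = trace (c Y ** c Z) *\<^sub>R c Y)"
    using surj by metis
  then show ?thesis
    unfolding rk1_def by (simp flip: mult c.scaleR add: eq_0_iff trace eq_iff)
qed

lemma bracket: "bracket (c X) (c Y) = c (bracket X Y)"
  by (simp add: bracket_def mult c.diff)

text \<open>Symplecticity of g turns J g Y g^-1 into g^-t (J Y) g^-1, so conjugation of Y is a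
  congruence of the form.\<close>

lemma semidef: "semidef (c Y) \<longleftrightarrow> semidef Y"
proof -
  have J: "Jmat ** (g ** Y ** matrix_inv g) = transpose (matrix_inv g) ** (Jmat ** Y) ** matrix_inv g"
  proof -
    have "transpose (matrix_inv g) ** (transpose g ** Jmat ** g) = Jmat ** g"
    proof -
      have "transpose (matrix_inv g) ** transpose g = mat 1"
        by (simp add: matrix_transpose_mul[symmetric] matrix_inv(1)[OF inv] transpose_mat)
      then show ?thesis by (simp add: matrix_mul_assoc)
    qed
    moreover have "transpose g ** Jmat ** g = Jmat" using g by (simp add: Sp_iff)
    ultimately have "transpose (matrix_inv g) ** Jmat = Jmat ** g" by simp
    then show ?thesis by (simp add: matrix_mul_assoc)
  qed
  have t: "x \<bullet> (transpose (matrix_inv g) *v y) = (matrix_inv g *v x) \<bullet> y" for x y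
    by (metis dot_lmul_matrix inner_commute transpose_matrix_vector)
  have *: "x \<bullet> (Jmat ** c Y *v x) = (matrix_inv g *v x) \<bullet> (Jmat ** Y *v (matrix_inv g *v x))" for x
    unfolding c_def J unfolding matrix_vector_mul_assoc[symmetric] t ..
  have s: "\<exists>x. matrix_inv g *v x = y" for y
    using matrix_inv(2)[OF inv] by (metis matrix_vector_mul_assoc matrix_vector_mul_lid)
  have "(\<forall>x. 0 \<le> x \<bullet> (Jmat ** c Y *v x)) \<longleftrightarrow> (\<forall>x. 0 \<le> x \<bullet> (Jmat ** Y *v x))"
    "(\<forall>x. x \<bullet> (Jmat ** c Y *v x) \<le> 0) \<longleftrightarrow> (\<forall>x. x \<bullet> (Jmat ** Y *v x) \<le> 0)"
    unfolding * using s by metis+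
  then show ?thesis unfolding semidef_def by simp
qed

end

section \<open>Evaluation of the invariants on block triangular elements\<close>

lemma trace_zero [simp]: "trace (0 :: real^'n^'n) = 0"
  by (simp add: trace_def)

text \<open>The determinant vanishes, so X^2 = tr(X) X by Cayley-Hamilton, and X^4 = tr(X)^3 X
  forces X = 0 or tr(X) = 0.\<close>

lemma mat2_square_zero:
  fixes X :: "real^2^2"
  assumes "X ** X ** (X ** X) = 0"
  shows "X ** X = 0"
proof -
  obtain a b c d where X: "X = mat2 a b c d" by (rule mat2_cases)
  have "det X ^ 4 = det (X ** X ** (X ** X))" by (simp add: det_mul power4_eq_xxxx)
  also have "\<dots> = det (0 :: real^2^2)" using assms by simp
  also have "\<dots> = 0" by (simp add: mat2_zero)
  finally have "a * d = b * c" by (simp add: X)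
  then have sq: "X ** X = (a + d) *\<^sub>R X" by (simp add: X algebra_simps)
  then have "X ** X ** (X ** X) = (a + d) ^ 3 *\<^sub>R X"
    by (simp add: matrix_mult.scaleR_left matrix_mult.scaleR_right power3_eq_cube)
  then show ?thesis using assms sq by auto
qed

text \<open>The lower left block of the fourth power is a signed sum of terms (X^t)^i \<sigma> X^j
  with i + j = 3, so one exponent is at least two and X^2 = 0 kills every term.\<close>

lemma nilp_blk:
  fixes X \<sigma> :: "real^2^2"
  shows "nilp (blk X \<sigma>) \<longleftrightarrow> X ** X = 0"
proof
  assume "nilp (blk X \<sigma>)"
  then have "X ** X ** (X ** X) = 0" by (simp add: nilp_def block_zero)
  then show "X ** X = 0" by (rule mat2_square_zero)
next
  assume X: "X ** X = 0"
  then have "transpose X ** transpose X = 0" by (simp flip: matrix_transpose_mul)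
  then show "nilp (blk X \<sigma>)" using X
    by (simp add: nilp_def block_zero matrix_mult.minus_left matrix_mult.minus_right)
qed

text \<open>The diagonal blocks X and -X^t have equal rank, so rank one leaves X = 0 and a rank one
  \<sigma>; this is extracted by inserting special matrices Z.\<close>

lemma rk1_blk:
  fixes X \<sigma> :: "real^2^2"
  shows "rk1 (blk X \<sigma>) \<longleftrightarrow> X = 0 \<and> \<sigma> \<noteq> 0 \<and> det \<sigma> = 0"
proof
  assume r: "rk1 (blk X \<sigma>)"
  obtain a b c d where X: "X = mat2 a b c d" by (rule mat2_cases)
  obtain p q r' s where \<sigma>: "\<sigma> = mat2 p q r' s" by (rule mat2_cases)
  \<comment> \<open>With this Z the lower right block of the left side is zero, so tr(X X^t) X^t =
    0, and tr(X X^t) is a sum of squares.\<close>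
  have "blk X \<sigma> ** block_matrix (transpose X) 0 0 0 ** blk X \<sigma> =
      trace (blk X \<sigma> ** block_matrix (transpose X) 0 0 0) *\<^sub>R blk X \<sigma>"
    using r unfolding rk1_def by blast
  then have "trace (X ** transpose X) *\<^sub>R - transpose X = 0" by simp
  then have "X = 0 \<or> a * a + b * b + (c * c + d * d) = 0" by (auto simp: X mat2_zero)
  moreover have "a = 0 \<and> b = 0 \<and> c = 0 \<and> d = 0" if "a * a + b * b + (c * c + d * d) = 0"
    using that sum_squares_ge_zero[of a b] sum_squares_ge_zero[of c d]
    by (metis add_nonneg_eq_0_iff sum_squares_eq_zero_iff)
  ultimately have X0: "X = 0" by (auto simp: X mat2_zero)
  \<comment> \<open>The upper right block is the adjugate of \<sigma>: one side becomes det \<sigma>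
    times \<sigma>, the other 2 det \<sigma> times \<sigma>.\<close>
  have "blk X \<sigma> ** block_matrix 0 (mat2 s (- q) (- r') p) 0 0 ** blk X \<sigma> =
      trace (blk X \<sigma> ** block_matrix 0 (mat2 s (- q) (- r') p) 0 0) *\<^sub>R blk X \<sigma>"
    using r unfolding rk1_def by blast
  then have "\<sigma> ** mat2 s (- q) (- r') p ** \<sigma> = trace (\<sigma> ** mat2 s (- q) (- r') p) *\<^sub>R \<sigma>"
    by (simp add: X0 trace_zero)
  then have "det \<sigma> *\<^sub>R \<sigma> = 0"
    by (simp add: \<sigma> mat2_zero algebra_simps) metis
  moreover have "\<sigma> \<noteq> 0" using r X0 by (auto simp: rk1_def block_zero)
  ultimately show "X = 0 \<and> \<sigma> \<noteq> 0 \<and> det \<sigma> = 0" using X0 by simp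
next
  assume *: "X = 0 \<and> \<sigma> \<noteq> 0 \<and> det \<sigma> = 0"
  obtain p q r s where \<sigma>: "\<sigma> = mat2 p q r s" by (rule mat2_cases)
  have "\<sigma> ** B ** \<sigma> = trace (\<sigma> ** B) *\<^sub>R \<sigma>" for B
  proof -
    obtain a b c d where B: "B = mat2 a b c d" by (rule mat2_cases)
    have "p * s = q * r" using * by (simp add: \<sigma>)
    then show ?thesis unfolding \<sigma> B mat2_mult mat2_arith trace_mat2 mat2_eq_iff by algebra
  qed
  then show "rk1 (blk X \<sigma>)"
    unfolding rk1_def
  proof (intro conjI allI)
    fix Z :: "real^(2 + 2)^(2 + 2)"
    obtain A B C D where Z: "Z = block_matrix A B C D" by (rule block_cases)
    show "blk X \<sigma> ** Z ** blk X \<sigma> = trace (blk X \<sigma> ** Z) *\<^sub>R blk X \<sigma>"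
      using * \<open>\<And>B. \<sigma> ** B ** \<sigma> = trace (\<sigma> ** B) *\<^sub>R \<sigma>\<close> by (simp add: Z)
  qed (use * in \<open>auto simp: block_zero\<close>)
qed

text \<open>The form is a \<sigma> a - 2 b X a, affine in b for fixed a, so it cannot keep one sign
  unless X = 0. What remains is semidefiniteness of a binary form, decided by its
  determinant.\<close>

lemma semidef_blk:
  fixes X :: "real^2^2"
  shows "semidef (blk X (mat2 u v v w)) \<longleftrightarrow> X = 0 \<and> 0 \<le> u * w - v * v"
proof -
  obtain x11 x12 x21 x22 where X: "X = mat2 x11 x12 x21 x22" by (rule mat2_cases)
  define Y where "Y = Jmat ** blk X (mat2 u v v w)"
  define V :: "real \<Rightarrow> real \<Rightarrow> real \<Rightarrow> real \<Rightarrow> real^(2 + 2)" where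
    "V a1 a2 b1 b2 = (\<chi> i. case i of Inl j \<Rightarrow> (if j = 1 then a1 else a2) | Inr j \<Rightarrow> (if j = 1 then b1 else b2))" for a1 a2 b1 b2
  define q where "q = (\<lambda>a1 a2 b1 b2. u * a1 * a1 + 2 * v * a1 * a2 + w * a2 * a2
      - 2 * (b1 * (x11 * a1 + x12 * a2) + b2 * (x21 * a1 + x22 * a2)))"
  have Y: "Y = block_matrix (mat2 u v v w) (- transpose X) (- X) 0"
    unfolding Y_def Jmat_def by (simp add: matrix_mult.minus_left)
  have qV: "V a1 a2 b1 b2 \<bullet> (Y *v V a1 a2 b1 b2) = q a1 a2 b1 b2" for a1 a2 b1 b2
    unfolding Y X by (simp add: inner_vec_def matrix_vector_mult_def sum_UNIV_Plus sum_2 V_def q_def mat2_zero algebra_simps)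
  have "\<exists>a1 a2 b1 b2. x = V a1 a2 b1 b2" for x
    by (rule exI[of _ "x $ Inl 1"], rule exI[of _ "x $ Inl 2"], rule exI[of _ "x $ Inr 1"], rule exI[of _ "x $ Inr 2"])
      (auto simp: V_def vec_eq_iff split_sum_all forall_2)
  then have sd: "semidef (blk X (mat2 u v v w)) \<longleftrightarrow>
      (\<forall>a1 a2 b1 b2. 0 \<le> q a1 a2 b1 b2) \<or> (\<forall>a1 a2 b1 b2. q a1 a2 b1 b2 \<le> 0)"
    unfolding semidef_def Y_def[symmetric] by (metis qV)
  \<comment> \<open>An affine function of nonzero slope attains both -1 and 1.\<close>
  have line: False if "k \<noteq> 0" "(\<forall>s. 0 \<le> k * s + m) \<or> (\<forall>s. k * s + m \<le> 0)" for k m :: real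
  proof -
    have "k * ((- m - 1) / k) + m = - 1" "k * ((- m + 1) / k) + m = 1" using that(1) by auto
    then show False using that(2) by (metis less_numeral_extra(1) neg_0_le_iff_le not_le)
  qed
  show ?thesis
  proof
    assume "semidef (blk X (mat2 u v v w))"
    then have q: "(\<forall>a1 a2 b1 b2. 0 \<le> q a1 a2 b1 b2) \<or> (\<forall>a1 a2 b1 b2. q a1 a2 b1 b2 \<le> 0)" using sd by simp
    have "q 1 0 s 0 = (- 2 * x11) * s + u" "q 0 1 s 0 = (- 2 * x12) * s + w"
      "q 1 0 0 s = (- 2 * x21) * s + u" "q 0 1 0 s = (- 2 * x22) * s + w" "q s 1 0 0 = u * s * s + (2 * v) * s + w" for s
      by (simp_all add: q_def)
    note e = this
    have "x11 = 0" using line[of "- 2 * x11" u] q e(1) by (metis mult_eq_0_iff neg_numeral_neq_numeral zero_neq_neg_numeral)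
    moreover have "x12 = 0" using line[of "- 2 * x12" w] q e(2) by (metis mult_eq_0_iff zero_neq_neg_numeral)
    moreover have "x21 = 0" using line[of "- 2 * x21" u] q e(3) by (metis mult_eq_0_iff zero_neq_neg_numeral)
    moreover have "x22 = 0" using line[of "- 2 * x22" w] q e(4) by (metis mult_eq_0_iff zero_neq_neg_numeral)
    moreover have "0 \<le> u * w - v * v"
    proof (cases "u = 0")
      case True
      then have "v = 0" using line[of "2 * v" w] q e(5) by (metis add_0 mult_eq_0_iff mult_zero_left zero_neq_numeral)
      then show ?thesis using True by simp
    next
      case False
      \<comment> \<open>The second test vector (-v, u) is orthogonal to (1, 0) with respect to the
        form, and its value is u times the determinant.\<close>
      have "q 1 0 0 0 = u" "q (- v) u 0 0 = u * (u * w - v * v)" by (simp_all add: q_def algebra_simps)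
      then show ?thesis using q False by (metis linorder_not_le mult_le_0_iff mult_neg_neg mult_pos_neg not_le order_antisym zero_le_mult_iff)
    qed
    ultimately show "X = 0 \<and> 0 \<le> u * w - v * v" by (simp add: X mat2_zero)
  next
    assume *: "X = 0 \<and> 0 \<le> u * w - v * v"
    then have x0: "x11 = 0" "x12 = 0" "x21 = 0" "x22 = 0" by (simp_all add: X mat2_zero)
    show "semidef (blk X (mat2 u v v w))"
      unfolding sd
    proof (cases "u = 0")
      case True
      then have "v * v \<le> 0" using * by simp
      then have "v = 0" by (auto simp: mult_le_0_iff)
      then have "q a1 a2 b1 b2 = w * (a2 * a2)" for a1 a2 b1 b2 using True by (simp add: q_def x0)
      then show "(\<forall>a1 a2 b1 b2. 0 \<le> q a1 a2 b1 b2) \<or> (\<forall>a1 a2 b1 b2. q a1 a2 b1 b2 \<le> 0)"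
        by (cases "w \<ge> 0") (auto simp: mult_nonpos_nonneg)
    next
      case False
      have "u * q a1 a2 b1 b2 = (u * a1 + v * a2)\<^sup>2 + (u * w - v * v) * a2\<^sup>2" for a1 a2 b1 b2
        by (simp add: q_def x0 power2_eq_square algebra_simps)
      then have "0 \<le> u * q a1 a2 b1 b2" for a1 a2 b1 b2 using * by simp
      then show "(\<forall>a1 a2 b1 b2. 0 \<le> q a1 a2 b1 b2) \<or> (\<forall>a1 a2 b1 b2. q a1 a2 b1 b2 \<le> 0)"
        using False by (metis linorder_neqE_linordered_idom zero_le_mult_iff not_less)
    qed
  qed
qed

text \<open>The dimension of the nilpotent part of \<open>halg l\<close>, which is zero or the line
  of strictly lower triangular matrices.\<close>

fun nilh :: "label \<Rightarrow> nat" where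
  "nilh L23 = 1" | "nilh L34 = 1" | "nilh (L35 _) = 1" | "nilh L38 = 1" | "nilh L41 = 1" | "nilh (L44 _) = 1"
| "nilh L51 = 1" | "nilh _ = 0"

lemma halg_nil:
  assumes "admissible l"
  shows "{X \<in> halg l. X ** X = 0} = (if nilh l = 1 then span {mat2 0 0 1 0} else {0})"
proof -
  have N: "span {mat2 0 0 1 0} = {A. \<exists>y. A = mat2 0 0 y 0}" by (auto simp: span_singleton)
  have tri: "{X \<in> h_tri c a. X ** X = 0} = span {mat2 0 0 1 0}" if "c \<noteq> 0 \<or> a \<noteq> 0" for c a
    using that unfolding N h_tri_def by (auto simp: mat2_zero intro: exI[of _ 0])
  have sq: "p * p + q * q = 0 \<longleftrightarrow> p = 0 \<and> q = 0" for p q :: real by simp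
  have ell: "mat2 x y (- y) x ** mat2 x y (- y) x = 0 \<longleftrightarrow> x = 0 \<and> y = 0" for x y
    by (auto simp: mat2_zero)
  have diag: "mat2 x 0 0 y ** mat2 x 0 0 y = 0 \<longleftrightarrow> x = 0 \<and> y = 0" for x y
    by (auto simp: mat2_zero)
  have 1: "{X \<in> h_ell \<alpha>. X ** X = 0} = {0}" for \<alpha>
    unfolding h_ell_def span_singleton by (auto simp: mat2_zero)
  have 2: "{X \<in> span {mat2 x 0 0 y}. X ** X = 0} = {0}" for x y
    unfolding span_singleton by (auto simp: mat2_zero)
  have 3: "{X \<in> Sdiag. X ** X = 0} = {0}" "{X \<in> h_co. X ** X = 0} = {0}" "{X \<in> span {mat2 1 0 1 1}. X ** X = 0} = {0}"
    "{X \<in> h_T. X ** X = 0} = span {mat2 0 0 1 0}" "{X \<in> span {mat2 0 0 1 0}. X ** X = 0} = span {mat2 0 0 1 0}"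
    unfolding N unfolding Sdiag_def h_co_def h_T_def span_singleton by (auto simp: mat2_zero)
  show ?thesis
    by (cases l) (simp_all add: 1 2 3 tri h_lc_def)
qed

text \<open>A rank one element of these algebras is always semidefinite. Excluding those makes the
  condition detect a definite form in \<Sigma>.\<close>

definition SD :: "(real^('d::finite + 'd)^('d + 'd)) set \<Rightarrow> bool" where
  "SD L \<longleftrightarrow> (\<exists>Y\<in>L. Y \<noteq> 0 \<and> \<not> rk1 Y \<and> semidef Y)"

definition code :: "(real^('d::finite + 'd)^('d + 'd)) set \<Rightarrow> nat \<times> nat \<times> bool \<times> bool" where
  "code L = (dim L, dim {Y \<in> L. nilp Y}, SD L, \<exists>Y\<in>L. rk1 Y)"

abbreviation lie_of :: "label \<Rightarrow> (real^(2 + 2)^(2 + 2)) set" where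
  "lie_of l \<equiv> lie_sd (sig l) (halg l)"

lemma halg_subspace:
  assumes "admissible l"
  shows "subspace (halg l)" "dim (halg l) = hdim l"
proof -
  have tri: "subspace (h_tri c a) \<and> dim (h_tri c a) = 2" if "c \<noteq> 0 \<or> a \<noteq> 0" for c a
  proof -
    have "linear (\<lambda>(x, y). mat2 (c * x) 0 y (a * x))" by (rule linearI) (auto simp: algebra_simps)
    moreover have "inj (\<lambda>(x, y). mat2 (c * x) 0 y (a * x))" using that by (auto simp: inj_def)
    moreover have "h_tri c a = range (\<lambda>(x, y). mat2 (c * x) 0 y (a * x))" by (auto simp: h_tri_def image_def)
    ultimately show ?thesis using range_linear_inj by fastforce
  qed
  have "par \<alpha> \<noteq> (0, 0)" for \<alpha> by (simp add: par_def)
  then have pp: "fst (par \<alpha>) \<noteq> 0 \<or> snd (par \<alpha>) \<noteq> 0" for \<alpha> by (metis prod.collapse)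
  then have p: "mat2 (fst (par \<alpha>)) (snd (par \<alpha>)) (- snd (par \<alpha>)) (fst (par \<alpha>)) \<noteq> 0"
    "mat2 (fst (par \<alpha>) + snd (par \<alpha>)) 0 0 (fst (par \<alpha>) - snd (par \<alpha>)) \<noteq> 0" for \<alpha>
    using pp[of \<alpha>] by (auto simp: mat2_zero)
  have "subspace (halg l) \<and> dim (halg l) = hdim l"
    using p subspaces_mat2 dim_S by (cases l) (simp_all add: tri h_ell_def h_lc_def h_co_def h_T_def, simp_all add: mat2_zero)
  then show "subspace (halg l)" "dim (halg l) = hdim l" by auto
qed

text \<open>Nilpotency constrains only X, so the nilpotent elements form a semidirect algebra again.
  Semidefinite and rank one elements have X = 0, so the two flags depend on the signs of det
  \<sigma> over \<open>sig l\<close>.\<close>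

lemma code_lie_of:
  assumes l: "admissible l"
  shows "code (lie_of l) = (grp_dim l, nilh l + dim (sig l), sig l \<in> {S1, Sdiag}, sig l \<in> {S3, Sdiag, S3p})"
proof -
  have sym: "\<exists>u v w. \<sigma> = mat2 u v v w" if "\<sigma> \<in> sig l" for \<sigma>
    using that by (cases l) (auto simp: S_defs)
  have "dim (lie_of l) = grp_dim l"
    using dim_lie_sd(2)[OF dim_sig(1) halg_subspace(1)[OF l]] halg_subspace(2)[OF l] dim_sig(3) by metis
  moreover have "dim {Y \<in> lie_of l. nilp Y} = nilh l + dim (sig l)"
  proof -
    have "{Y \<in> lie_of l. nilp Y} = lie_sd (sig l) {X \<in> halg l. X ** X = 0}"
      unfolding lie_sd_def by (auto simp: nilp_blk)
    moreover have "dim {0 :: real^2^2} = 0" "dim (span {mat2 0 0 1 0}) = 1" by (simp_all add: mat2_zero)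
    moreover have "nilh l = 1 \<or> nilh l = 0" by (cases l) auto
    ultimately show ?thesis
      using dim_lie_sd(2)[OF dim_sig(1) subspace_span, of l "{mat2 0 0 1 0}"]
        dim_lie_sd(2)[OF dim_sig(1) subspace_single_0, of l] halg_nil[OF l] by auto
  qed
  moreover have "SD (lie_of l) \<longleftrightarrow> (\<exists>\<sigma>\<in>sig l. det \<sigma> > 0)"
  proof
    assume "SD (lie_of l)"
    then obtain X \<sigma> where *: "blk X \<sigma> \<noteq> 0" "\<not> rk1 (blk X \<sigma>)" "semidef (blk X \<sigma>)" "\<sigma> \<in> sig l"
      unfolding SD_def lie_sd_def by blast
    obtain u v w where \<sigma>: "\<sigma> = mat2 u v v w" using sym * by blast
    have "X = 0" "0 \<le> det \<sigma>" using *(3) by (simp_all add: \<sigma> semidef_blk)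
    moreover have "det \<sigma> \<noteq> 0" using * calculation rk1_blk[of 0 \<sigma>] by (auto simp: block_zero)
    ultimately have "det \<sigma> > 0" by simp
    then show "\<exists>\<sigma>\<in>sig l. det \<sigma> > 0" using *(4) by blast
  next
    assume "\<exists>\<sigma>\<in>sig l. det \<sigma> > 0"
    then obtain \<sigma> where *: "\<sigma> \<in> sig l" "det \<sigma> > 0" by blast
    obtain u v w where \<sigma>: "\<sigma> = mat2 u v v w" using sym * by blast
    have "blk 0 \<sigma> \<in> lie_of l" using * subspace_0[OF halg_subspace(1)[OF l]] unfolding lie_sd_def by blast
    moreover have "\<sigma> \<noteq> 0" using *(2) by (auto simp: mat2_zero)
    then have "blk 0 \<sigma> \<noteq> 0" "\<not> rk1 (blk 0 \<sigma>)" "semidef (blk 0 \<sigma>)"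
      using * rk1_blk[of 0 \<sigma>] semidef_blk[of 0 u v w] by (auto simp: block_zero \<sigma>)
    ultimately show "SD (lie_of l)" unfolding SD_def by blast
  qed
  moreover have "(\<exists>\<sigma>\<in>sig l. det \<sigma> > 0) \<longleftrightarrow> sig l \<in> {S1, Sdiag}"
  proof -
    have "mat2 1 0 0 1 \<in> S1" "mat2 1 0 0 1 \<in> Sdiag" "det (mat2 1 0 0 1) > 0" by (auto simp: S_defs)
    moreover have "\<not> det \<sigma> > 0" if "\<sigma> \<in> Soff \<union> S3 \<union> S1p \<union> S3p" for \<sigma>
      using that by (auto simp: S_defs not_less sum_squares_ge_zero)
    moreover have "sig l \<in> {S1, Sdiag} \<or> sig l \<in> {Soff, S3, S1p, S3p}" by (cases l) auto
    ultimately show ?thesis by blast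
  qed
  moreover have "(\<exists>Y\<in>lie_of l. rk1 Y) \<longleftrightarrow> (\<exists>\<sigma>\<in>sig l. \<sigma> \<noteq> 0 \<and> det \<sigma> = 0)"
    using subspace_0[OF halg_subspace(1)[OF l]] unfolding lie_sd_def by (auto simp: rk1_blk) (metis rk1_blk)
  moreover have "(\<exists>\<sigma>\<in>sig l. \<sigma> \<noteq> 0 \<and> det \<sigma> = 0) \<longleftrightarrow> sig l \<in> {S3, Sdiag, S3p}"
  proof -
    have "mat2 1 0 0 0 \<in> S3" "mat2 1 0 0 0 \<in> Sdiag" "mat2 1 0 0 0 \<in> S3p" "mat2 1 0 0 0 \<noteq> 0 \<and> det (mat2 1 0 0 0) = 0"
      by (auto simp: S_defs mat2_zero)
    moreover have "\<not> (\<sigma> \<noteq> 0 \<and> det \<sigma> = 0)" if "\<sigma> \<in> Soff \<union> S1 \<union> S1p" for \<sigma>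
    proof -
      have "- u * u - v * v = 0 \<longleftrightarrow> u = 0 \<and> v = 0" for u v :: real
        using sum_squares_eq_zero_iff[of u v] by linarith
      then show ?thesis using that by (auto simp: S_defs mat2_zero)
    qed
    moreover have "sig l \<in> {S3, Sdiag, S3p} \<or> sig l \<in> {Soff, S1, S1p}" by (cases l) auto
    ultimately show ?thesis by blast
  qed
  ultimately show ?thesis unfolding code_def by simp
qed

lemma (in sp_conj) code_image: "code (c ` L) = code L"
proof -
  have inj: "inj_on c A" for A using eq_iff by (simp add: inj_on_def)
  have "dim (c ` A) = dim A" for A by (rule dim_image_eq[OF c.linear inj])
  moreover have "{Y \<in> c ` L. nilp Y} = c ` {Y \<in> L. nilp Y}" by (auto simp: nilp)
  ultimately show ?thesis
    by (auto simp: code_def SD_def rk1 semidef eq_0_iff)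
qed

section \<open>Separating groups with equal numerical invariants\<close>

lemma (in sp_conj) mem_image:
  assumes "c ` L = L'" "Y \<in> L"
  shows "c Y \<in> L'"
  using assms by blast

text \<open>The diagonal blocks X and -X^t contribute equally to traces of even powers.\<close>

lemma trace_blk_powers:
  fixes X \<sigma> :: "real^2^2"
  shows "trace (blk X \<sigma> ** blk X \<sigma>) = 2 * trace (X ** X)"
    "trace (blk X \<sigma> ** blk X \<sigma> ** (blk X \<sigma> ** blk X \<sigma>)) = 2 * trace (X ** X ** (X ** X))"
proof -
  obtain a b c d where X: "X = mat2 a b c d" by (rule mat2_cases)
  show "trace (blk X \<sigma> ** blk X \<sigma>) = 2 * trace (X ** X)"
    "trace (blk X \<sigma> ** blk X \<sigma> ** (blk X \<sigma> ** blk X \<sigma>)) = 2 * trace (X ** X ** (X ** X))"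
    by (simp_all add: X algebra_simps)
qed

lemma bracket_blk:
  fixes X \<sigma> X' \<sigma>' :: "real^2^2"
  shows "bracket (blk X \<sigma>) (blk X' \<sigma>') =
    block_matrix (bracket X X') 0 (\<sigma> ** X' - transpose X ** \<sigma>' - (\<sigma>' ** X - transpose X' ** \<sigma>)) (- transpose (bracket X X'))"
proof -
  obtain a b c d where X: "X = mat2 a b c d" by (rule mat2_cases)
  obtain a' b' c' d' where X': "X' = mat2 a' b' c' d'" by (rule mat2_cases)
  show ?thesis
    by (simp add: bracket_def matrix_mult.minus_left matrix_mult.minus_right) (simp add: X X' algebra_simps)
qed

text \<open>\<open>par\<close> gives homogeneous coordinates with nonnegative entries, so equality
  of squares up to a common factor is proportionality.\<close>

lemma par_proportional:
  assumes ab: "\<alpha> \<in> {0..\<infinity>}" "\<beta> \<in> {0..\<infinity>}"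
    and sq: "(fst (par \<alpha>))\<^sup>2 = (t * fst (par \<beta>))\<^sup>2" "(snd (par \<alpha>))\<^sup>2 = (t * snd (par \<beta>))\<^sup>2"
  shows "\<alpha> = \<beta>"
proof -
  have nn: "0 \<le> fst (par \<alpha>)" "0 \<le> snd (par \<alpha>)" "0 \<le> fst (par \<beta>)" "0 \<le> snd (par \<beta>)"
    using par_cases[OF ab(1)] par_cases[OF ab(2)] by auto
  have "fst (par \<alpha>) = \<bar>t\<bar> * fst (par \<beta>)" "snd (par \<alpha>) = \<bar>t\<bar> * snd (par \<beta>)"
    using nn sq unfolding power2_eq_iff by (auto simp: abs_if mult_nonneg_nonpos2 mult_le_0_iff zero_le_mult_iff)
  then show ?thesis
    using par_cases[OF ab(1)] par_cases[OF ab(2)] by auto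
qed

text \<open>The identity (P + Q)^2 = (P - Q)^2 + 4 P Q supplies the sum, and nonnegativity fixes its
  sign.\<close>

lemma sum_prod_determines:
  fixes P Q P' Q' :: real
  assumes "P - Q = P' - Q'" "P * Q = P' * Q'" "0 \<le> P" "0 \<le> Q" "0 \<le> P'" "0 \<le> Q'"
  shows "P = P'" "Q = Q'"
proof -
  have "(P + Q)\<^sup>2 = (P - Q)\<^sup>2 + 4 * (P * Q)" by (simp add: power2_eq_square algebra_simps)
  also have "\<dots> = (P' - Q')\<^sup>2 + 4 * (P' * Q')" using assms by simp
  also have "\<dots> = (P' + Q')\<^sup>2" by (simp add: power2_eq_square algebra_simps)
  finally have "P + Q = P' + Q'" using assms by (simp add: power2_eq_iff_nonneg)
  then show "P = P'" "Q = Q'" using assms by linarith+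
qed

lemma h_ell_iff: "X \<in> h_ell \<alpha> \<longleftrightarrow>
    (\<exists>t. X = mat2 (t * fst (par \<alpha>)) (t * snd (par \<alpha>)) (- (t * snd (par \<alpha>))) (t * fst (par \<alpha>)))"
  by (auto simp: h_ell_def span_singleton)

lemma h_lc_iff: "X \<in> h_lc \<alpha> \<longleftrightarrow>
    (\<exists>t. X = mat2 (t * (fst (par \<alpha>) + snd (par \<alpha>))) 0 0 (t * (fst (par \<alpha>) - snd (par \<alpha>))))"
  by (auto simp: h_lc_def span_singleton)

lemma span_one_iff: "X \<in> span {mat2 1 0 1 1} \<longleftrightarrow> (\<exists>t. X = mat2 t 0 t t)"
  by (auto simp: span_singleton)

lemma tri_subset: "h_tri a b \<subseteq> h_T" "span {mat2 1 0 1 1} \<subseteq> h_T" "span {mat2 a 0 0 b} \<subseteq> h_T"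
  by (auto simp: h_tri_def h_T_def span_singleton)

text \<open>On [-1, 0] the numbers -\<alpha> and \<alpha> + 1 are nonnegative with sum 1, and
  likewise for \<beta>; both scale by |t|, hence |t| = 1.\<close>

lemma root_ratio_unique:
  assumes "\<alpha> \<in> {-1..0}" "\<beta> \<in> {-1..0}" "\<alpha> = t * \<beta>" "(\<alpha> + 1)\<^sup>2 = (t * (\<beta> + 1))\<^sup>2"
  shows "\<alpha> = (\<beta> :: real)"
proof -
  have "- \<alpha> = \<bar>t\<bar> * (- \<beta>)"
  proof -
    have "\<bar>\<alpha>\<bar> = \<bar>t\<bar> * \<bar>\<beta>\<bar>" using assms(3) by (simp add: abs_mult)
    then show ?thesis using assms(1,2) by simp
  qed
  moreover have "\<alpha> + 1 = \<bar>t\<bar> * (\<beta> + 1)"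
  proof -
    have "\<bar>\<alpha> + 1\<bar> = \<bar>t\<bar> * \<bar>\<beta> + 1\<bar>" using assms(4) by (metis abs_mult power2_eq_iff abs_minus_cancel)
    then show ?thesis using assms(1,2) by simp
  qed
  ultimately have "1 = \<bar>t\<bar>" by (simp add: algebra_simps)
  then show ?thesis using \<open>- \<alpha> = \<bar>t\<bar> * (- \<beta>)\<close> by simp
qed

context
  fixes g :: "real^(2 + 2)^(2 + 2)" and c
  assumes sp: "sp_conj g c"
begin

interpretation sp_conj g c by (rule sp)

text \<open>A generator with eigenvalues p \<plusminus> i q has traces of its square and fourth
  power that determine p^2 - q^2 and p^2 q^2, hence p^2 and q^2 up to the factor t^2.\<close>

lemma ell_unique:
  assumes im: "c ` lie_sd S (h_ell \<alpha>) = lie_sd S (h_ell \<beta>)" and S: "0 \<in> S"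
    and ab: "\<alpha> \<in> {0..\<infinity>}" "\<beta> \<in> {0..\<infinity>}"
  shows "\<alpha> = \<beta>"
proof -
  obtain p q p' q' where pq: "par \<alpha> = (p, q)" "par \<beta> = (p', q')" by fastforce
  define Y :: "real^(2 + 2)^(2 + 2)" where "Y = blk (mat2 p q (- q) p) 0"
  have "Y \<in> lie_sd S (h_ell \<alpha>)"
    unfolding Y_def lie_sd_def h_ell_def using S pq by (auto intro: span_base)
  then have "c Y \<in> lie_sd S (h_ell \<beta>)" using im by blast
  then obtain t \<sigma> where cY: "c Y = blk (mat2 (t * p') (t * q') (- (t * q')) (t * p')) \<sigma>"
    unfolding lie_sd_def h_ell_iff pq fst_conv snd_conv by blast
  have tr: "trace (mat2 x y (- y) x ** mat2 x y (- y) x) = 2 * (x\<^sup>2 - y\<^sup>2)"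
    "trace (mat2 x y (- y) x ** mat2 x y (- y) x ** (mat2 x y (- y) x ** mat2 x y (- y) x)) =
      2 * ((x\<^sup>2 - y\<^sup>2)\<^sup>2 - 4 * (x\<^sup>2 * y\<^sup>2))" for x y
    by (simp_all add: power2_eq_square algebra_simps)
  have "trace (c Y ** c Y) = trace (Y ** Y)" "trace (c Y ** c Y ** (c Y ** c Y)) = trace (Y ** Y ** (Y ** Y))"
    by (simp_all flip: mult add: trace)
  note tt = this[unfolded cY, unfolded Y_def trace_blk_powers tr]
  have cancel: "2 * (2 * x) = 2 * (2 * y) \<Longrightarrow> x = y" for x y :: real by simp
  have e: "(t * p')\<^sup>2 - (t * q')\<^sup>2 = p\<^sup>2 - q\<^sup>2"
    "((t * p')\<^sup>2 - (t * q')\<^sup>2)\<^sup>2 - 4 * ((t * p')\<^sup>2 * (t * q')\<^sup>2) = (p\<^sup>2 - q\<^sup>2)\<^sup>2 - 4 * (p\<^sup>2 * q\<^sup>2)"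
    by (rule cancel[OF tt(1)], rule cancel[OF tt(2)])
  then have "p\<^sup>2 * q\<^sup>2 = (t * p')\<^sup>2 * (t * q')\<^sup>2" by simp
  from sum_prod_determines[OF e(1)[symmetric] this] have "p\<^sup>2 = (t * p')\<^sup>2" "q\<^sup>2 = (t * q')\<^sup>2" by simp_all
  then show ?thesis using par_proportional[OF ab, of t] by (simp add: pq)
qed

text \<open>The nilpotent elements form the line of S, so its image spans the corresponding line.
  The generator acts there with weight -2 p, and the trace of its square supplies p^2 + q^2.\<close>

lemma lc_unique_off:
  assumes im: "c ` lie_sd Soff (h_lc \<alpha>) = lie_sd Soff (h_lc \<beta>)"
    and ab: "\<alpha> \<in> {0..\<infinity>}" "\<beta> \<in> {0..\<infinity>}"
  shows "\<alpha> = \<beta>"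
proof -
  obtain p q p' q' where pq: "par \<alpha> = (p, q)" "par \<beta> = (p', q')" by fastforce
  define Y :: "real^(2 + 2)^(2 + 2)" where "Y = blk (mat2 (p + q) 0 0 (p - q)) 0"
  define S :: "real^(2 + 2)^(2 + 2)" where "S = blk 0 (mat2 0 1 1 0)"
  have mem: "Y \<in> lie_sd Soff (h_lc \<alpha>)" "S \<in> lie_sd Soff (h_lc \<alpha>)"
    unfolding Y_def S_def lie_sd_def h_lc_def using pq
    using subspace_0[OF dim_S(3)] by (auto intro: span_base span_0 simp: Soff_def)
  then obtain t u where cY: "c Y = blk (mat2 (t * (p' + q')) 0 0 (t * (p' - q'))) (mat2 0 u u 0)"
    using mem_image[OF im mem(1)] unfolding lie_sd_def h_lc_iff pq fst_conv snd_conv Soff_def by blast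
  obtain X s where cS: "c S = blk X (mat2 0 s s 0)" "X \<in> h_lc \<beta>"
    using mem_image[OF im mem(2)] unfolding lie_sd_def Soff_def by blast
  have "nilp S" unfolding S_def nilp_blk by simp
  then have "nilp (c S)" by (simp add: nilp)
  then have X0: "X = 0" using cS(2) unfolding cS(1) nilp_blk h_lc_def span_singleton by (auto simp: mat2_zero)
  have "S \<noteq> 0" by (simp add: S_def block_zero mat2_zero)
  then have "c S \<noteq> 0" by (simp add: eq_0_iff)
  then have s0: "s \<noteq> 0" by (auto simp: cS X0 block_zero mat2_zero)
  have br: "bracket (blk (mat2 x 0 0 y) \<tau>) (blk 0 (mat2 0 z z 0)) = (- (x + y)) *\<^sub>R blk 0 (mat2 0 z z 0)" for x y z \<tau>
    unfolding bracket_blk by (simp add: bracket_def, (simp add: mat2_zero algebra_simps)?)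
  have "bracket Y S = (- (p + q + (p - q))) *\<^sub>R S" unfolding Y_def S_def by (rule br)
  then have "bracket (c Y) (c S) = (- (2 * p)) *\<^sub>R c S"
    by (simp add: bracket c.scaleR c.neg)
  then have "(- (2 * t * p')) *\<^sub>R c S = (- (2 * p)) *\<^sub>R c S"
    unfolding cY cS X0 br by (simp add: algebra_simps)
  then have "p = t * p'" using \<open>c S \<noteq> 0\<close> by simp
  moreover have "trace (c Y ** c Y) = trace (Y ** Y)" by (simp flip: mult add: trace)
  note tt = this[unfolded cY, unfolded Y_def trace_blk_powers]
  have "(t * (p' + q'))\<^sup>2 + (t * (p' - q'))\<^sup>2 = (p + q)\<^sup>2 + (p - q)\<^sup>2"
    using tt by (simp add: power2_eq_square)
  then have "(t * p')\<^sup>2 + (t * q')\<^sup>2 = p\<^sup>2 + q\<^sup>2" by (simp add: power2_eq_square algebra_simps)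
  ultimately have "p\<^sup>2 = (t * p')\<^sup>2" "q\<^sup>2 = (t * q')\<^sup>2" by simp_all
  then show ?thesis using par_proportional[OF ab, of t] by (simp add: pq)
qed

text \<open>The rank one elements form two lines, which a conjugation preserves or exchanges. The
  weights on them are -2 (p + q) and -2 (p - q), and an exchange only reverses the sign of
  q.\<close>

lemma lc_unique_diag:
  assumes im: "c ` lie_sd Sdiag (h_lc \<alpha>) = lie_sd Sdiag (h_lc \<beta>)"
    and ab: "\<alpha> \<in> {0..\<infinity>}" "\<beta> \<in> {0..\<infinity>}"
  shows "\<alpha> = \<beta>"
proof -
  obtain p q p' q' where pq: "par \<alpha> = (p, q)" "par \<beta> = (p', q')" by fastforce
  define Y :: "real^(2 + 2)^(2 + 2)" where "Y = blk (mat2 (p + q) 0 0 (p - q)) 0"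
  define E :: "real^(2 + 2)^(2 + 2)" where "E = blk 0 (mat2 1 0 0 0)"
  define F :: "real^(2 + 2)^(2 + 2)" where "F = blk 0 (mat2 0 0 0 1)"
  have mem: "Y \<in> lie_sd Sdiag (h_lc \<alpha>)" "E \<in> lie_sd Sdiag (h_lc \<alpha>)" "F \<in> lie_sd Sdiag (h_lc \<alpha>)"
    unfolding Y_def E_def F_def lie_sd_def h_lc_def using pq
    using subspace_0[OF dim_S(9)] by (auto intro: span_base span_0 simp: Sdiag_def)
  obtain t \<tau> where cY: "c Y = blk (mat2 (t * (p' + q')) 0 0 (t * (p' - q'))) \<tau>" "\<tau> \<in> Sdiag"
    using mem_image[OF im mem(1)] unfolding lie_sd_def h_lc_iff pq fst_conv snd_conv by blast
  have rk: "\<exists>x y. c Z = blk 0 (mat2 x 0 0 y) \<and> x * y = 0 \<and> (x \<noteq> 0 \<or> y \<noteq> 0)"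
    if Z: "Z \<in> lie_sd Sdiag (h_lc \<alpha>)" "rk1 Z" for Z
  proof -
    obtain X x y where *: "c Z = blk X (mat2 x 0 0 y)"
      using mem_image[OF im Z(1)] unfolding lie_sd_def Sdiag_def by blast
    then have "rk1 (blk X (mat2 x 0 0 y))" using Z(2) rk1[of Z] by simp
    then show ?thesis unfolding rk1_blk using * by (auto simp: mat2_zero)
  qed
  have "rk1 E" "rk1 F" "\<not> rk1 (E + F)"
    unfolding E_def F_def using rk1_blk[of 0 "mat2 1 0 0 0"] rk1_blk[of 0 "mat2 0 0 0 1"] rk1_blk[of 0 "mat2 1 0 0 1"]
    by (simp_all add: mat2_zero)
  then obtain x y x' y' where cE: "c E = blk 0 (mat2 x 0 0 y)" "x * y = 0" "x \<noteq> 0 \<or> y \<noteq> 0"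
    and cF: "c F = blk 0 (mat2 x' 0 0 y')" "x' * y' = 0" "x' \<noteq> 0 \<or> y' \<noteq> 0"
    using rk mem by metis
  \<comment> \<open>If the images of E and F lay on the same axis, their nonzero sum would have rank
    one.\<close>
  have "\<not> rk1 (c E + c F)" using \<open>\<not> rk1 (E + F)\<close> by (simp flip: c.add add: rk1)
  moreover have "E + F \<noteq> 0" by (simp add: E_def F_def block_zero mat2_zero)
  then have "c E + c F \<noteq> 0" by (simp flip: c.add add: eq_0_iff)
  ultimately have cross: "(y = 0 \<and> x' = 0) \<or> (x = 0 \<and> y' = 0)"
    using cE cF rk1_blk[of 0 "mat2 (x + x') 0 0 (y + y')"] by (auto simp: mat2_zero block_zero)
  have br: "bracket (blk (mat2 a 0 0 b) (mat2 k 0 0 l)) (blk 0 (mat2 u 0 0 v)) = blk 0 (mat2 (- 2 * a * u) 0 0 (- 2 * b * v))"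
    for a b u v k l unfolding bracket_blk by (simp add: bracket_def, (simp add: mat2_zero algebra_simps)?)
  have br0: "bracket (blk (mat2 a 0 0 b) 0) (blk 0 (mat2 u 0 0 v)) = blk 0 (mat2 (- 2 * a * u) 0 0 (- 2 * b * v))"
    for a b u v using br[of a b 0 0 u v] by (simp add: mat2_zero)
  obtain k l where \<tau>: "\<tau> = mat2 k 0 0 l" using cY(2) by (auto simp: Sdiag_def)
  have "bracket Y E = (- 2 * (p + q)) *\<^sub>R E" "bracket Y F = (- 2 * (p - q)) *\<^sub>R F"
    unfolding Y_def E_def F_def br0 by simp_all
  then have "bracket (c Y) (c E) = (- 2 * (p + q)) *\<^sub>R c E" "bracket (c Y) (c F) = (- 2 * (p - q)) *\<^sub>R c F"
    by (simp_all only: bracket c.scaleR)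
  then have "- 2 * (t * (p' + q')) * x = - 2 * (p + q) * x" "- 2 * (t * (p' - q')) * y = - 2 * (p + q) * y"
    "- 2 * (t * (p' + q')) * x' = - 2 * (p - q) * x'" "- 2 * (t * (p' - q')) * y' = - 2 * (p - q) * y'"
    unfolding cY \<tau> cE cF br by simp_all
  note e = this
  have can: "- 2 * a * k = - 2 * b * k \<Longrightarrow> k \<noteq> 0 \<Longrightarrow> a = b" for a b k :: real by simp
  have "(t * (p' + q') = p + q \<and> t * (p' - q') = p - q) \<or> (t * (p' - q') = p + q \<and> t * (p' + q') = p - q)"
    using cross cE(3) cF(3) can[OF e(1)] can[OF e(2)] can[OF e(3)] can[OF e(4)] by blast
  then have "(t * p' = p \<and> t * q' = q) \<or> (t * p' = p \<and> t * q' = - q)" by (auto simp: algebra_simps)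
  then have "p\<^sup>2 = (t * p')\<^sup>2" "q\<^sup>2 = (t * q')\<^sup>2" by auto
  then show ?thesis using par_proportional[OF ab, of t] by (simp add: pq)
qed

text \<open>A nonzero element of rank one spans a root space; on it an element of the Lie algebra acts by a
  scalar, which is compared with its trace form.\<close>

lemma root_weight:
  assumes im: "c ` lie_sd S \<hh> = lie_sd S' \<hh>'"
    and S: "S = S3 \<or> S = S3p" "S' = S3 \<or> S' = S3p" and T: "\<hh>' \<subseteq> h_T" and 0: "0 \<in> \<hh>"
    and Y: "mat2 x 0 y z \<in> \<hh>"
  shows "\<exists>y' z' \<tau>'. c (blk (mat2 x 0 y z) 0) = blk (mat2 x 0 y' z') \<tau>' \<and> mat2 x 0 y' z' \<in> \<hh>' \<and>
    \<tau>' \<in> S' \<and> z'\<^sup>2 = z\<^sup>2"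
proof -
  have zS: "0 \<in> S" "0 \<in> S'" using S subspace_0[OF dim_S(5)] subspace_0[OF dim_S(11)] by auto
  define Y where "Y = blk (mat2 x 0 y z) 0"
  define E :: "real^(2 + 2)^(2 + 2)" where "E = blk 0 (mat2 1 0 0 0)"
  have "mat2 1 0 0 0 \<in> S" using S by (auto simp: S_defs)
  then have mem: "Y \<in> lie_sd S \<hh>" "E \<in> lie_sd S \<hh>"
    unfolding Y_def E_def lie_sd_def using zS 0 assms(6) by blast+
  obtain X' \<tau>' where cY: "c Y = blk X' \<tau>'" "X' \<in> \<hh>'" "\<tau>' \<in> S'"
    using mem_image[OF im mem(1)] unfolding lie_sd_def by blast
  obtain x' y' z' where X': "X' = mat2 x' 0 y' z'" using cY(2) T by (auto simp: h_T_def)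
  obtain X \<sigma> where cE: "c E = blk X \<sigma>" "\<sigma> \<in> S'"
    using mem_image[OF im mem(2)] unfolding lie_sd_def by blast
  have "rk1 E" unfolding E_def using rk1_blk[of 0 "mat2 1 0 0 0"] by (simp add: mat2_zero)
  then have "rk1 (blk X \<sigma>)" using rk1[of E] cE(1) by simp
  then have "X = 0" "\<sigma> \<noteq> 0" "det \<sigma> = 0" unfolding rk1_blk by simp_all
  then obtain u where cE': "c E = blk 0 (mat2 u 0 0 0)" "u \<noteq> 0"
    using cE S(2) by (auto simp: S_defs mat2_zero)
  have br: "bracket (blk (mat2 a 0 b d) \<tau>) (blk 0 (mat2 v 0 0 0)) = (- (2 * a)) *\<^sub>R blk 0 (mat2 v 0 0 0)" for a b d \<tau> v
    unfolding bracket_blk by (simp add: bracket_def, (simp add: mat2_zero algebra_simps)?)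
  have "bracket Y E = (- (2 * x)) *\<^sub>R E" unfolding Y_def E_def by (rule br)
  then have "bracket (c Y) (c E) = (- (2 * x)) *\<^sub>R c E" by (simp add: bracket c.scaleR c.neg)
  then have "(- (2 * x')) *\<^sub>R c E = (- (2 * x)) *\<^sub>R c E" unfolding cY X' cE' br .
  moreover have "c E \<noteq> 0" using cE' by (simp add: block_zero mat2_zero)
  ultimately have x: "x' = x" by simp
  have "trace (c Y ** c Y) = trace (Y ** Y)" by (simp flip: mult add: trace)
  note tt = this[unfolded cY X', unfolded Y_def trace_blk_powers]
  have "x'\<^sup>2 + z'\<^sup>2 = x\<^sup>2 + z\<^sup>2" using tt by (simp add: power2_eq_square)
  then have "z'\<^sup>2 = z\<^sup>2" using x by simp
  then show ?thesis using cY unfolding X' x Y_def by blast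
qed

lemma diag_unique:
  assumes im: "c ` lie_sd S3 (span {mat2 \<alpha> 0 0 (\<alpha> + 1)}) = lie_sd S3 (span {mat2 \<beta> 0 0 (\<beta> + 1)})"
    and ab: "\<alpha> \<in> {-1..0}" "\<beta> \<in> {-1..0}"
  shows "\<alpha> = \<beta>"
proof -
  obtain y' z' where "mat2 \<alpha> 0 y' z' \<in> span {mat2 \<beta> 0 0 (\<beta> + 1)}" "z'\<^sup>2 = (\<alpha> + 1)\<^sup>2"
    using root_weight[OF im disjI1[OF refl] disjI1[OF refl] tri_subset(3) span_0 span_base[OF insertI1]] by blast
  then obtain t where "mat2 \<alpha> 0 y' z' = t *\<^sub>R mat2 \<beta> 0 0 (\<beta> + 1)" unfolding span_singleton by blast
  then have "\<alpha> = t * \<beta>" "z' = t * (\<beta> + 1)" by simp_all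
  with \<open>z'\<^sup>2 = (\<alpha> + 1)\<^sup>2\<close> have "\<alpha> = t * \<beta>" "(\<alpha> + 1)\<^sup>2 = (t * (\<beta> + 1))\<^sup>2" by simp_all
  then show ?thesis using root_ratio_unique[OF ab] by blast
qed

lemma tri_unique_perp:
  assumes im: "c ` lie_sd S3p (h_tri (\<alpha> + 1) \<alpha>) = lie_sd S3p (h_tri (\<beta> + 1) \<beta>)"
    and ab: "\<alpha> \<in> {-1..0}" "\<beta> \<in> {-1..0}"
  shows "\<alpha> = \<beta>"
proof -
  have "0 \<in> h_tri (\<alpha> + 1) \<alpha>" "mat2 (\<alpha> + 1) 0 0 \<alpha> \<in> h_tri (\<alpha> + 1) \<alpha>"
    by (auto simp: h_tri_def mat2_zero intro: exI[of _ 0] exI[of _ 1])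
  then obtain y' z' where "mat2 (\<alpha> + 1) 0 y' z' \<in> h_tri (\<beta> + 1) \<beta>" "z'\<^sup>2 = \<alpha>\<^sup>2"
    using root_weight[OF im disjI2[OF refl] disjI2[OF refl] tri_subset(1)] by blast
  then obtain t y where "mat2 (\<alpha> + 1) 0 y' z' = mat2 ((\<beta> + 1) * t) 0 y (\<beta> * t)" unfolding h_tri_def by blast
  then have "\<alpha> + 1 = t * (\<beta> + 1)" "z' = t * \<beta>" by (simp_all add: mult.commute)
  with \<open>z'\<^sup>2 = \<alpha>\<^sup>2\<close> have "\<alpha> + 1 = t * (\<beta> + 1)" "\<alpha>\<^sup>2 = (t * \<beta>)\<^sup>2" by simp_all
  \<comment> \<open>The substitution of -\<alpha> - 1 for \<alpha> preserves [-1, 0] and exchanges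
    the roles of the two exponents up to sign, as \<open>root_ratio_unique\<close> expects.\<close>
  then have "- \<alpha> - 1 = t * (- \<beta> - 1)" "(- \<alpha> - 1 + 1)\<^sup>2 = (t * (- \<beta> - 1 + 1))\<^sup>2"
    by (simp add: right_diff_distrib distrib_left, simp add: power_mult_distrib)
  from root_ratio_unique[OF _ _ this] show ?thesis using ab by simp
qed

text \<open>Equal weight and trace form leave only \<beta> = -1/2. Then twice the generator squares
  to the identity, while no multiple of the Jordan block with off-diagonal entry does.\<close>

lemma diag_not_unipotent: "c ` lie_sd S3 (span {mat2 \<beta> 0 0 (\<beta> + 1)}) \<noteq> lie_sd S3 (span {mat2 1 0 1 1})"
proof
  assume im: "c ` lie_sd S3 (span {mat2 \<beta> 0 0 (\<beta> + 1)}) = lie_sd S3 (span {mat2 1 0 1 1})"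
  obtain y' z' where "mat2 \<beta> 0 y' z' \<in> span {mat2 1 0 1 1}" "z'\<^sup>2 = (\<beta> + 1)\<^sup>2"
    using root_weight[OF im disjI1[OF refl] disjI1[OF refl] tri_subset(2) span_0 span_base[OF insertI1]] by blast
  then have "\<beta>\<^sup>2 = (\<beta> + 1)\<^sup>2" unfolding span_one_iff by auto
  then have \<beta>: "\<beta> = - 1 / 2" by (simp add: power2_sum)
  define Y :: "real^(2 + 2)^(2 + 2)" where "Y = blk (mat2 (- 1) 0 0 1) 0"
  have "2 *\<^sub>R mat2 \<beta> 0 0 (\<beta> + 1) \<in> span {mat2 \<beta> 0 0 (\<beta> + 1)}" by (intro span_mul span_base insertI1)
  moreover have "2 *\<^sub>R mat2 \<beta> 0 0 (\<beta> + 1) = mat2 (- 1) 0 0 1" by (simp add: \<beta>)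
  ultimately have "mat2 (- 1) 0 0 1 \<in> span {mat2 \<beta> 0 0 (\<beta> + 1)}" by (simp only:)
  then have "Y \<in> lie_sd S3 (span {mat2 \<beta> 0 0 (\<beta> + 1)})"
    unfolding Y_def lie_sd_def using subspace_0[OF dim_S(5)] by blast
  then obtain t \<sigma> where cY: "c Y = blk (mat2 t 0 t t) \<sigma>"
    using mem_image[OF im] unfolding lie_sd_def span_one_iff by blast
  have "Y ** Y = mat 1" by (simp add: Y_def block_one mat2_one)
  then have "c Y ** c Y = mat 1" by (simp flip: mult add: one)
  then show False unfolding cY by (auto simp: block_one mat2_one)
qed

text \<open>There are two weights to compare: that of the rank one root vector, and that of the
  nilpotent matrix N taken modulo \<Sigma>, read from the upper left block of the bracket. Both
  belong to the image of the same Y, hence the common factor t.\<close>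

lemma S3_tri_weights:
  assumes im: "c ` lie_sd S3 (h_tri a b) = lie_sd S3 (h_tri a' b')"
  obtains t where "a = t * a'" "b - a = t * (b' - a')"
proof -
  define Y :: "real^(2 + 2)^(2 + 2)" where "Y = blk (mat2 a 0 0 b) 0"
  define N :: "real^(2 + 2)^(2 + 2)" where "N = blk (mat2 0 0 1 0) 0"
  have hm: "mat2 (a * x) 0 y (b * x) \<in> h_tri a b" for x y unfolding h_tri_def by blast
  have h: "0 \<in> h_tri a b" "mat2 a 0 0 b \<in> h_tri a b" "mat2 0 0 1 0 \<in> h_tri a b"
    using hm[of 0 0] hm[of 1 0] hm[of 0 1] by (simp_all add: mat2_zero)
  then have mem: "N \<in> lie_sd S3 (h_tri a b)"
    unfolding Y_def N_def lie_sd_def using subspace_0[OF dim_S(5)] by blast+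
  define x' where "x' = a"
  obtain y' z' \<tau> where cY: "c Y = blk (mat2 x' 0 y' z') \<tau>" "mat2 x' 0 y' z' \<in> h_tri a' b'" "\<tau> \<in> S3"
    using root_weight[OF im disjI1[OF refl] disjI1[OF refl] tri_subset(1) h(1,2)] unfolding Y_def x'_def by blast
  obtain X' \<sigma>' where cN: "c N = blk X' \<sigma>'" "X' \<in> h_tri a' b'" "\<sigma>' \<in> S3"
    using mem_image[OF im mem] unfolding lie_sd_def by blast
  obtain t where t: "x' = a' * t" "z' = b' * t" using cY(2) by (auto simp: h_tri_def)
  obtain s n where sn: "X' = mat2 (a' * s) 0 n (b' * s)" using cN(2) by (auto simp: h_tri_def)
  have "nilp N" unfolding N_def nilp_blk by (simp add: mat2_zero)
  then have "nilp (c N)" by (simp add: nilp)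
  then have "X' ** X' = 0" unfolding cN nilp_blk .
  then have X': "X' = mat2 0 0 n 0" unfolding sn by (simp add: mat2_zero)
  \<comment> \<open>A nonzero element with vanishing upper left block has rank one here, whereas N
    has not.\<close>
  have n: "n \<noteq> 0"
  proof
    assume "n = 0"
    then have "c N = blk 0 \<sigma>'" using cN X' by (simp add: mat2_zero)
    moreover have "N \<noteq> 0" by (simp add: N_def block_zero mat2_zero)
    then have "c N \<noteq> 0" by (simp add: eq_0_iff)
    ultimately have "rk1 (c N)"
      using cN(3) rk1_blk[of 0 \<sigma>'] by (auto simp: S3_def block_zero mat2_zero)
    then have "rk1 N" by (simp add: rk1)
    then show False unfolding N_def rk1_blk by (simp add: mat2_zero)
  qed
  have "bracket Y N = (b - a) *\<^sub>R N"
    unfolding Y_def N_def bracket_blk by (simp add: bracket_def, (simp add: mat2_zero)?)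
  then have "bracket (c Y) (c N) = (b - a) *\<^sub>R c N" by (simp only: bracket c.scaleR)
  then have "TL (bracket (c Y) (c N)) = (b - a) *\<^sub>R mat2 0 0 n 0" by (simp add: cN X')
  moreover have "TL (bracket (c Y) (c N)) = mat2 0 0 ((z' - x') * n) 0"
    unfolding cY cN X' bracket_blk block_parts by (simp add: bracket_def algebra_simps)
  ultimately have "(z' - x') * n = (b - a) * n" by simp
  then have e: "z' - x' = b - a" using mult_right_cancel[OF n] by blast
  have "a = t * a'" using t(1) by (simp only: x'_def mult.commute)
  moreover have "b - a = t * (b' - a')" using e unfolding t by (simp only: right_diff_distrib mult.commute)
  ultimately show thesis by (rule that)
qed

text \<open>Y acts on the two-dimensional \<Sigma> by a Jordan block: [Y, S] + 2 S is a nonzero rank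
  one element. On the other side the same combination has no \<sigma> part, so it cannot have rank
  one.\<close>

lemma S3p_not_S3: "c ` lie_sd S3p (span {mat2 1 0 1 1}) \<noteq> lie_sd S3 (h_tri a b)"
proof
  assume im: "c ` lie_sd S3p (span {mat2 1 0 1 1}) = lie_sd S3 (h_tri a b)"
  define Y :: "real^(2 + 2)^(2 + 2)" where "Y = blk (mat2 1 0 1 1) 0"
  define S :: "real^(2 + 2)^(2 + 2)" where "S = blk 0 (mat2 0 1 1 0)"
  have mem: "S \<in> lie_sd S3p (span {mat2 1 0 1 1})"
    unfolding S_def lie_sd_def using span_0 by (auto simp: S3p_def)
  obtain y' z' \<tau> where cY: "c Y = blk (mat2 1 0 y' z') \<tau>" "mat2 1 0 y' z' \<in> h_tri a b" "\<tau> \<in> S3"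
    using root_weight[OF im disjI2[OF refl] disjI1[OF refl] tri_subset(1) span_0 span_base[OF insertI1]]
    unfolding Y_def by blast
  obtain X' \<sigma>' where cS: "c S = blk X' \<sigma>'" "X' \<in> h_tri a b" "\<sigma>' \<in> S3"
    using mem_image[OF im mem] unfolding lie_sd_def by blast
  obtain s n where sn: "X' = mat2 (a * s) 0 n (b * s)" using cS(2) by (auto simp: h_tri_def)
  have "nilp S" unfolding S_def nilp_blk by simp
  then have "nilp (c S)" by (simp add: nilp)
  then have "X' ** X' = 0" unfolding cS nilp_blk .
  then have X': "X' = mat2 0 0 n 0" unfolding sn by (simp add: mat2_zero)
  obtain w where \<sigma>': "\<sigma>' = mat2 w 0 0 0" using cS(3) by (auto simp: S3_def)
  obtain k where \<tau>: "\<tau> = mat2 k 0 0 0" using cY(3) by (auto simp: S3_def)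
  have b1: "bracket Y S = (- 2) *\<^sub>R S + blk 0 (mat2 (- 2) 0 0 0)"
    unfolding Y_def S_def bracket_blk by (simp add: bracket_def, (simp add: mat2_zero)?)
  have b2: "bracket (c Y) (c S) = blk (mat2 0 0 ((z' - 1) * n) 0) (mat2 (- 2 * w) 0 0 0)"
    unfolding cY cS X' \<sigma>' \<tau> bracket_blk by (simp add: bracket_def, (simp add: mat2_zero algebra_simps)?)
  have "c (blk 0 (mat2 (- 2) 0 0 0)) = bracket (c Y) (c S) + 2 *\<^sub>R c S"
    by (simp only: bracket b1 c.add c.scaleR) simp
  also have "\<dots> = blk (mat2 0 0 ((z' + 1) * n) 0) 0"
    unfolding b2 unfolding cS X' \<sigma>' by (simp add: mat2_zero algebra_simps)
  finally have e: "c (blk 0 (mat2 (- 2) 0 0 0)) = blk (mat2 0 0 ((z' + 1) * n) 0) 0" .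
  have "rk1 (blk 0 (mat2 (- 2) 0 0 0))" using rk1_blk[of 0 "mat2 (- 2) 0 0 0"] by (simp add: mat2_zero)
  then have "rk1 (blk (mat2 0 0 ((z' + 1) * n) 0) 0)" using e rk1 by metis
  then show False unfolding rk1_blk by simp
qed

end

section \<open>Pairwise non-conjugacy\<close>

definition lie_conj :: "label \<Rightarrow> label \<Rightarrow> bool" where
  "lie_conj l l' \<longleftrightarrow> (\<exists>g\<in>Sp. conj_set g (lie_of l) = lie_of l')"

lemma lie_conj_sym: "lie_conj l l' \<Longrightarrow> lie_conj l' l"
  unfolding lie_conj_def using Sp_inverse conj_set_inverse(1)[OF Sp_invertible] by metis

lemma lie_conj_image:
  assumes "lie_conj l l'"
  obtains g c where "sp_conj g c" "c ` lie_of l = lie_of l'"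
  using assms unfolding lie_conj_def conj_set_def sp_conj_def by blast

text \<open>Both ends are moved to their triangular representatives by block diagonal elements, and
  the resulting conjugation is passed to tangent spaces.\<close>

lemma grp_conj_lie_conj:
  assumes l: "admissible l" "admissible l'" and g: "g \<in> Sp" and eq: "conj_set g (grp l) = grp l'"
  shows "lie_conj l l'"
proof -
  define k where "k = (\<lambda>l. gmat 0 (kmat l) :: real^(2 + 2)^(2 + 2))"
  have k: "k l \<in> Sp" for l unfolding k_def by (rule gmat_Sp[OF kmat_invertible])
  note inv = Sp_invertible[OF k]
  have grp: "grp l = conj_set (k l) (sig l \<rtimes> hgp l)" if "admissible l" for l
    unfolding k_def grp_rep[OF that] conj_semidirect[OF kmat_invertible emb_lie_subgroup[OF hgp_emb(1)[OF that]]] ..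
  have tang: "tang (sig l \<rtimes> hgp l) = lie_of l" if "admissible l" for l
    using tang_semidirect[OF emb_lie_subgroup[OF hgp_emb(1)[OF that]] dim_sig(1)] hgp_emb(2)[OF that] by simp
  define h where "h = matrix_inv (k l') ** (g ** k l)"
  have h: "h \<in> Sp" unfolding h_def by (intro Sp_mult Sp_inverse k g)
  have "conj_set h (sig l \<rtimes> hgp l) = conj_set (matrix_inv (k l')) (conj_set g (conj_set (k l) (sig l \<rtimes> hgp l)))"
    unfolding h_def using inv Sp_invertible[OF g]
    by (simp add: conj_set_conj_set invertible_matrix_inv invertible_mult matrix_mul_assoc)
  also have "\<dots> = sig l' \<rtimes> hgp l'"
    using eq unfolding grp[OF l(1)] grp[OF l(2)] by (simp add: conj_set_inverse[OF inv])
  finally have "conj_set h (lie_of l) = lie_of l'"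
    using tang_conj[OF Sp_invertible[OF h], of "sig l \<rtimes> hgp l"] tang l by metis
  then show ?thesis using h unfolding lie_conj_def by blast
qed

text \<open>The six spaces are told apart by two test matrices: the identity lies only in
  \<open>S1\<close> and \<open>Sdiag\<close>, and \<open>mat2 1 0 0 0\<close> only in
  \<open>S3\<close>, \<open>Sdiag\<close> and \<open>S3p\<close>. Membership is easier to evaluate
  over all labels than equality of sets.\<close>

lemma lie_conj_code:
  assumes "lie_conj l l'" "admissible l" "admissible l'"
  shows "grp_dim l = grp_dim l'" "nilh l + dim (sig l) = nilh l' + dim (sig l')"
    "mat2 1 0 0 1 \<in> sig l \<longleftrightarrow> mat2 1 0 0 1 \<in> sig l'" "mat2 1 0 0 0 \<in> sig l \<longleftrightarrow> mat2 1 0 0 0 \<in> sig l'"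
proof -
  obtain g c where "sp_conj g c" "c ` lie_of l = lie_of l'" using lie_conj_image[OF assms(1)] .
  then have code: "code (lie_of l) = code (lie_of l')" using sp_conj.code_image by metis
  have I: "mat2 1 0 0 1 \<in> S1" "mat2 1 0 0 1 \<notin> Soff" "mat2 1 0 0 1 \<notin> S3" "mat2 1 0 0 1 \<notin> S1p" "mat2 1 0 0 1 \<in> Sdiag"
    "mat2 1 0 0 1 \<notin> S3p" by (auto simp: S_defs)
  have E: "mat2 1 0 0 0 \<notin> S1" "mat2 1 0 0 0 \<notin> Soff" "mat2 1 0 0 0 \<in> S3" "mat2 1 0 0 0 \<notin> S1p" "mat2 1 0 0 0 \<in> Sdiag"
    "mat2 1 0 0 0 \<in> S3p" by (auto simp: S_defs)
  have six: "sig l \<in> {S1, Soff, S3, S1p, Sdiag, S3p}" for l by (cases l) auto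
  have "sig l \<in> {S1, Sdiag} \<longleftrightarrow> mat2 1 0 0 1 \<in> sig l" "sig l \<in> {S3, Sdiag, S3p} \<longleftrightarrow> mat2 1 0 0 0 \<in> sig l" for l
    using six[of l] I E by blast+
  then show "grp_dim l = grp_dim l'" "nilh l + dim (sig l) = nilh l' + dim (sig l')"
    "mat2 1 0 0 1 \<in> sig l \<longleftrightarrow> mat2 1 0 0 1 \<in> sig l'" "mat2 1 0 0 0 \<in> sig l \<longleftrightarrow> mat2 1 0 0 0 \<in> sig l'"
    using code unfolding code_lie_of[OF assms(2)] code_lie_of[OF assms(3)] by auto
qed

lemma lie_conj_not:
  "\<not> lie_conj (L25 \<alpha>) L24" "\<not> lie_conj L34 (L35 \<gamma>)" "\<not> lie_conj (L35 \<gamma>) L34"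
  "\<not> lie_conj L39 L34" "\<not> lie_conj L39 (L35 \<gamma>)"
proof -
  show "\<not> lie_conj (L25 \<alpha>) L24"
  proof
    assume "lie_conj (L25 \<alpha>) L24"
    then obtain g c where "sp_conj g c" "c ` lie_of (L25 \<alpha>) = lie_of L24" by (rule lie_conj_image)
    then show False using diag_not_unipotent by simp
  qed
  show "\<not> lie_conj L34 (L35 \<gamma>)"
  proof
    assume "lie_conj L34 (L35 \<gamma>)"
    then obtain g c where "sp_conj g c" "c ` lie_of L34 = lie_of (L35 \<gamma>)" by (rule lie_conj_image)
    then obtain t where "1 = t * \<gamma>" "1 - 1 = t * (\<gamma> + 1 - \<gamma>)"
      using S3_tri_weights[of g c 1 1 \<gamma> "\<gamma> + 1"] by auto
    then show False by simp
  qed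
  show "\<not> lie_conj (L35 \<gamma>) L34"
  proof
    assume "lie_conj (L35 \<gamma>) L34"
    then obtain g c where "sp_conj g c" "c ` lie_of (L35 \<gamma>) = lie_of L34" by (rule lie_conj_image)
    then obtain t where "\<gamma> = t * 1" "\<gamma> + 1 - \<gamma> = t * (1 - 1)"
      using S3_tri_weights[of g c \<gamma> "\<gamma> + 1" 1 1] by auto
    then show False by simp
  qed
  show "\<not> lie_conj L39 L34"
  proof
    assume "lie_conj L39 L34"
    then obtain g c where "sp_conj g c" "c ` lie_of L39 = lie_of L34" by (rule lie_conj_image)
    then show False using S3p_not_S3 by simp
  qed
  show "\<not> lie_conj L39 (L35 \<gamma>)"
  proof
    assume "lie_conj L39 (L35 \<gamma>)"
    then obtain g c where "sp_conj g c" "c ` lie_of L39 = lie_of (L35 \<gamma>)" by (rule lie_conj_image)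
    then show False using S3p_not_S3 by simp
  qed
qed

lemma lie_conj_param:
  "lie_conj (L21 \<alpha>) (L21 \<beta>) \<Longrightarrow> \<alpha> \<in> {0..\<infinity>} \<Longrightarrow> \<beta> \<in> {0..\<infinity>} \<Longrightarrow> \<alpha> = \<beta>"
  "lie_conj (L36 \<alpha>) (L36 \<beta>) \<Longrightarrow> \<alpha> \<in> {0..\<infinity>} \<Longrightarrow> \<beta> \<in> {0..\<infinity>} \<Longrightarrow> \<alpha> = \<beta>"
  "lie_conj (L22 \<alpha>) (L22 \<beta>) \<Longrightarrow> \<alpha> \<in> {0..\<infinity>} \<Longrightarrow> \<beta> \<in> {0..\<infinity>} \<Longrightarrow> \<alpha> = \<beta>"
  "lie_conj (L37 \<alpha>) (L37 \<beta>) \<Longrightarrow> \<alpha> \<in> {0..\<infinity>} \<Longrightarrow> \<beta> \<in> {0..\<infinity>} \<Longrightarrow> \<alpha> = \<beta>"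
  "lie_conj (L25 x) (L25 y) \<Longrightarrow> x \<in> {-1..0} \<Longrightarrow> y \<in> {-1..0} \<Longrightarrow> x = y"
  "lie_conj (L44 x) (L44 y) \<Longrightarrow> x \<in> {-1..0} \<Longrightarrow> y \<in> {-1..0} \<Longrightarrow> x = y"
  "lie_conj (L35 x) (L35 y) \<Longrightarrow> x = y"
proof -
  show "lie_conj (L21 \<alpha>) (L21 \<beta>) \<Longrightarrow> \<alpha> \<in> {0..\<infinity>} \<Longrightarrow> \<beta> \<in> {0..\<infinity>} \<Longrightarrow> \<alpha> = \<beta>"
    by (erule lie_conj_image) (rule ell_unique[of _ _ S1], use subspace_0[OF dim_S(1)] in auto)
  show "lie_conj (L36 \<alpha>) (L36 \<beta>) \<Longrightarrow> \<alpha> \<in> {0..\<infinity>} \<Longrightarrow> \<beta> \<in> {0..\<infinity>} \<Longrightarrow> \<alpha> = \<beta>"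
    by (erule lie_conj_image) (rule ell_unique[of _ _ S1p], use subspace_0[OF dim_S(7)] in auto)
  show "lie_conj (L22 \<alpha>) (L22 \<beta>) \<Longrightarrow> \<alpha> \<in> {0..\<infinity>} \<Longrightarrow> \<beta> \<in> {0..\<infinity>} \<Longrightarrow> \<alpha> = \<beta>"
    by (erule lie_conj_image) (rule lc_unique_off, auto)
  show "lie_conj (L37 \<alpha>) (L37 \<beta>) \<Longrightarrow> \<alpha> \<in> {0..\<infinity>} \<Longrightarrow> \<beta> \<in> {0..\<infinity>} \<Longrightarrow> \<alpha> = \<beta>"
    by (erule lie_conj_image) (rule lc_unique_diag, auto)
  show "lie_conj (L25 x) (L25 y) \<Longrightarrow> x \<in> {-1..0} \<Longrightarrow> y \<in> {-1..0} \<Longrightarrow> x = y"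
    by (erule lie_conj_image) (rule diag_unique, auto)
  show "lie_conj (L44 x) (L44 y) \<Longrightarrow> x \<in> {-1..0} \<Longrightarrow> y \<in> {-1..0} \<Longrightarrow> x = y"
    by (erule lie_conj_image) (rule tri_unique_perp, auto)
  show "x = y" if xy: "lie_conj (L35 x) (L35 y)"
  proof -
    obtain g c where "sp_conj g c" "c ` lie_of (L35 x) = lie_of (L35 y)" using xy by (rule lie_conj_image)
    then obtain t where "x = t * y" "x + 1 - x = t * (y + 1 - y)"
      using S3_tri_weights[of g c x "x + 1" y "y + 1"] by auto
    then show ?thesis by simp
  qed
qed

theorem grp_not_conj:
  assumes l: "admissible l" "admissible l'" "l \<noteq> l'" and g: "g \<in> Sp"
  shows "conj_set g (grp l) \<noteq> grp l'"
proof
  assume "conj_set g (grp l) = grp l'"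
  then have lc: "lie_conj l l'" by (rule grp_conj_lie_conj[OF l(1,2) g])
  note code = lie_conj_code[OF lc l(1,2)]
  \<comment> \<open>These are the pairs that the four numerical invariants leave undecided.\<close>
  have "(\<exists>\<alpha> \<beta>. l = L21 \<alpha> \<and> l' = L21 \<beta>) \<or> (\<exists>\<alpha> \<beta>. l = L36 \<alpha> \<and> l' = L36 \<beta>) \<or> (\<exists>\<alpha> \<beta>. l = L22 \<alpha> \<and> l' = L22 \<beta>)
      \<or> (\<exists>\<alpha> \<beta>. l = L37 \<alpha> \<and> l' = L37 \<beta>) \<or> (\<exists>x y. l = L25 x \<and> l' = L25 y) \<or> (\<exists>x y. l = L44 x \<and> l' = L44 y)
      \<or> (\<exists>x y. l = L35 x \<and> l' = L35 y) \<or> (\<exists>x. l = L25 x \<and> l' = L24) \<or> (\<exists>x. l = L24 \<and> l' = L25 x)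
      \<or> (\<exists>x. l = L34 \<and> l' = L35 x) \<or> (\<exists>x. l = L35 x \<and> l' = L34) \<or> (l = L39 \<and> l' = L34) \<or> (l = L34 \<and> l' = L39)
      \<or> (\<exists>x. l = L39 \<and> l' = L35 x) \<or> (\<exists>x. l = L35 x \<and> l' = L39)"
    using code l(3) by (cases l; cases l') (simp_all add: dim_S, simp_all add: S_defs)
  then show False
    using lc lie_conj_sym[OF lc] lie_conj_not lie_conj_param l by (elim disjE exE conjE) (auto simp del: atLeastAtMost_iff)
qed

section \<open>Connected subgroups of the model groups\<close>

lemma lie_dataD:
  assumes "lie_data H \<hh>"
  shows "subgroup H GL" "subspace \<hh>" "\<hh> \<subseteq> tang H"
    "\<And>h X. h \<in> H \<Longrightarrow> X \<in> \<hh> \<Longrightarrow> h ** X ** matrix_inv h \<in> \<hh>"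
    "\<And>X Y. X \<in> \<hh> \<Longrightarrow> Y \<in> \<hh> \<Longrightarrow> X ** Y - Y ** X \<in> \<hh>"
    "\<And>Q n. emb_lie n Q \<Longrightarrow> connected Q \<Longrightarrow> H \<subseteq> Q \<Longrightarrow> tang Q \<subseteq> \<hh> \<Longrightarrow> H = Q"
  using assms unfolding lie_data_def by auto

lemma lie_data_const:
  fixes F :: "real^'n^'n \<Rightarrow> real"
  assumes d: "lie_data H \<hh>"
    and F: "\<And>h. h \<in> H \<Longrightarrow> (F has_derivative F' h) (at h)" "\<And>h X. h \<in> H \<Longrightarrow> X \<in> \<hh> \<Longrightarrow> F' h (X ** h) = 0"
    and h: "h \<in> H"
  shows "F h = F (mat 1)"
proof -
  have "\<forall>h\<in>H. \<exists>F'. (F has_derivative F') (at h) \<and> (\<forall>X\<in>\<hh>. F' (X ** h) = 0)" using F by blast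
  then have "\<forall>h\<in>H. F h = F (mat 1)" using d unfolding lie_data_def by blast
  then show ?thesis using h by blast
qed

text \<open>Where P does not vanish its sign is locally constant in the matrix space, hence
  differentiable with zero derivative; this replaces connectedness of H.\<close>

lemma lie_data_sign:
  fixes P :: "real^'n^'n \<Rightarrow> real"
  assumes d: "lie_data H \<hh>" and P: "continuous_on UNIV P" "\<And>h. h \<in> H \<Longrightarrow> P h \<noteq> 0" "P (mat 1) > 0"
    and h: "h \<in> H"
  shows "P h > 0"
proof -
  have op: "open {x. P x > 0}" "open {x. P x < 0}"
    using P(1) by (auto intro!: open_Collect_less continuous_intros)
  have "((\<lambda>x. sgn (P x)) has_derivative (\<lambda>_. 0)) (at k)" if "k \<in> H" for k
  proof (cases "P k > 0")
    case True
    have "((\<lambda>x. 1) has_derivative (\<lambda>_. 0)) (at k)" by simp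
    then show ?thesis
      by (rule has_derivative_transform_within_open[OF _ op(1)]) (use True in auto)
  next
    case False
    then have "P k < 0" using P(2)[OF that] by simp
    have "((\<lambda>x. - 1) has_derivative (\<lambda>_. 0)) (at k)" by simp
    then show ?thesis
      by (rule has_derivative_transform_within_open[OF _ op(2)]) (use \<open>P k < 0\<close> in auto)
  qed
  from lie_data_const[OF d this _ h] have "sgn (P h) = sgn (P (mat 1))" by simp
  then show ?thesis using P(3) by (simp add: sgn_if split: if_splits)
qed

lemma tang_mono: "H \<subseteq> Q \<Longrightarrow> tang H \<subseteq> tang Q"
  unfolding tang_def by blast

lemma lie_data_trivial:
  fixes H :: "(real^2^2) set"
  assumes d: "lie_data H {0}"
  shows "H = {mat 1}"
proof -
  have "h = mat 1" if h: "h \<in> H" for h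
  proof -
    have "h $ i $ j = mat 1 $ i $ j" for i j
      by (rule lie_data_const[OF d _ _ h, of "\<lambda>h. h $ i $ j" "\<lambda>_ v. v $ i $ j"])
        (auto intro: bounded_linear_imp_has_derivative bounded_linear_entry)
    then show ?thesis by (simp add: vec_eq_iff)
  qed
  moreover have "mat 1 \<in> H" using lie_dataD(1)[OF d] by (simp add: subgroup_GL_iff)
  ultimately show ?thesis by blast
qed

lemma has_derivative_entry: "((\<lambda>h :: real^2^2. h $ i $ j) has_derivative (\<lambda>v. v $ i $ j)) (at h)"
  by (rule bounded_linear_imp_has_derivative[OF bounded_linear_entry])

lemma has_derivative_ln_entry:
  "0 < h $ i $ j \<Longrightarrow> ((\<lambda>h :: real^2^2. ln (h $ i $ j)) has_derivative (\<lambda>v. v $ i $ j / h $ i $ j)) (at h)"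
  using has_derivative_ln[OF _ has_derivative_entry] by (simp add: divide_inverse)

text \<open>Along X h the logarithms of the diagonal entries have derivatives proportional to c and
  a, so a ln h11 - c ln h22 is a first integral. The parameter t comes from a nonzero
  exponent.\<close>

lemma diag_log_const:
  assumes d: "lie_data H \<hh>" and H: "H \<subseteq> T0" and T: "\<hh> \<subseteq> h_tri c a" and ca: "c \<noteq> 0 \<or> a \<noteq> 0" and h: "h \<in> H"
  obtains t where "h$1$1 = exp (c * t)" "h$2$2 = exp (a * t)"
proof -
  have pos: "0 < h$1$1 \<and> 0 < h$2$2 \<and> h$1$2 = 0" if "h \<in> H" for h using that H by (auto simp: T0_def)
  have "a * ln (h$1$1) - c * ln (h$2$2) = a * ln ((mat 1 :: real^2^2)$1$1) - c * ln ((mat 1 :: real^2^2)$2$2)"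
  proof (rule lie_data_const[OF d _ _ h])
    fix h assume "h \<in> H"
    then show "((\<lambda>h. a * ln (h$1$1) - c * ln (h$2$2)) has_derivative
        (\<lambda>v. a * (v$1$1 / h$1$1) - c * (v$2$2 / h$2$2))) (at h)"
      using pos by (intro has_derivative_diff has_derivative_mult_right has_derivative_ln_entry) auto
  next
    fix h X assume hX: "h \<in> H" "X \<in> \<hh>"
    then obtain p q r x y where "h = mat2 p 0 q r" "p > 0" "r > 0" "X = mat2 (c * x) 0 y (a * x)"
      using H T unfolding T0_def h_tri_def by blast
    then show "a * ((X ** h)$1$1 / h$1$1) - c * ((X ** h)$2$2 / h$2$2) = 0" by simp
  qed
  then have e: "a * ln (h$1$1) = c * ln (h$2$2)" by (simp add: mat2_one)
  show thesis
  proof (cases "c = 0")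
    case False
    have "h$1$1 = exp (c * (ln (h$1$1) / c))" using False pos[OF h] by simp
    moreover have "h$2$2 = exp (a * (ln (h$1$1) / c))" using False pos[OF h] e by simp
    ultimately show thesis by (rule that)
  next
    case True
    then have "a \<noteq> 0" using ca by simp
    have "h$1$1 = exp (c * (ln (h$2$2) / a))" using \<open>a \<noteq> 0\<close> pos[OF h] e True by simp
    moreover have "h$2$2 = exp (a * (ln (h$2$2) / a))" using \<open>a \<noteq> 0\<close> pos[OF h] by simp
    ultimately show thesis by (rule that)
  qed
qed

text \<open>Multiplying by a diagonal matrix from the left rescales each row, so the quotient of the
  two entries of the second row is a first integral.\<close>

lemma T0_diag:
  assumes d: "lie_data H \<hh>" and H: "H \<subseteq> T0" and T: "\<hh> \<subseteq> Sdiag" and h: "h \<in> H"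
  shows "h$2$1 = 0"
proof -
  have pos: "0 < h$1$1 \<and> 0 < h$2$2 \<and> h$1$2 = 0" if "h \<in> H" for h using that H by (auto simp: T0_def)
  have "h$2$1 / h$2$2 = (mat 1 :: real^2^2)$2$1 / (mat 1 :: real^2^2)$2$2"
  proof (rule lie_data_const[OF d _ _ h])
    fix h assume "h \<in> H"
    then have "h$2$2 \<noteq> 0" using pos by force
    then show "((\<lambda>h. h$2$1 / h$2$2) has_derivative
        (\<lambda>v. (v$2$1 * h$2$2 - h$2$1 * v$2$2) / (h$2$2 * h$2$2))) (at h)"
      by (rule has_derivative_divide'[OF has_derivative_entry has_derivative_entry])
  next
    fix h X assume hX: "h \<in> H" "X \<in> \<hh>"
    then obtain p q r x y where "h = mat2 p 0 q r" "p > 0" "r > 0" "X = mat2 x 0 0 y"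
      using H T unfolding T0_def Sdiag_def by blast
    then show "((X ** h)$2$1 * h$2$2 - h$2$1 * (X ** h)$2$2) / (h$2$2 * h$2$2) = 0" by simp
  qed
  then show ?thesis using pos[OF h] by (simp add: mat2_one)
qed

lemma mem_T0_expand: "h \<in> T0 \<Longrightarrow> h = mat2 (h$1$1) 0 (h$2$1) (h$2$2)"
  by (auto simp: T0_def)

text \<open>First integrals place H inside the model; the exhaustion clause makes the inclusion an
  equality. The other model groups follow the same pattern.\<close>

lemma lie_data_Dgrp:
  assumes d: "lie_data H (span {mat2 c 0 0 a})" and H: "H \<subseteq> T0" and ca: "c \<noteq> 0 \<or> a \<noteq> 0"
  shows "H = Dgrp c a"
proof (rule lie_dataD(6)[OF d Dgrp(1)[OF ca] Dgrp(3)[OF ca]])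
  have T: "span {mat2 c 0 0 a} \<subseteq> Sdiag" "span {mat2 c 0 0 a} \<subseteq> h_tri c a"
    by (auto simp: span_singleton Sdiag_def h_tri_def)
  show "H \<subseteq> Dgrp c a"
  proof
    fix h assume h: "h \<in> H"
    obtain t where "h$1$1 = exp (c * t)" "h$2$2 = exp (a * t)" using diag_log_const[OF d H T(2) ca h] .
    then have "h = mat2 (exp (c * t)) 0 0 (exp (a * t))"
      using mem_T0_expand[of h] H h T0_diag[OF d H T(1) h] by auto
    then show "h \<in> Dgrp c a" unfolding Dgrp_def by blast
  qed
qed (simp add: Dgrp(2)[OF ca])

lemma lie_data_Tgrp:
  assumes d: "lie_data H (h_tri c a)" and H: "H \<subseteq> T0" and ca: "c \<noteq> 0 \<or> a \<noteq> 0"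
  shows "H = Tgrp c a"
proof (rule lie_dataD(6)[OF d Tgrp(1)[OF ca] Tgrp(3)[OF ca]])
  show "H \<subseteq> Tgrp c a"
  proof
    fix h assume h: "h \<in> H"
    obtain t where "h$1$1 = exp (c * t)" "h$2$2 = exp (a * t)" using diag_log_const[OF d H order_refl ca h] .
    then have "h = mat2 (exp (c * t)) 0 (h$2$1) (exp (a * t))"
      using mem_T0_expand[of h] H h by auto
    then show "h \<in> Tgrp c a" unfolding Tgrp_def by blast
  qed
qed (simp add: Tgrp(2)[OF ca] h_tri_def)

lemma lie_data_K_zero:
  assumes d: "lie_data H Sdiag" and H: "H \<subseteq> T0"
  shows "H = K_zero\<sigma>3"
proof (rule lie_dataD(6)[OF d K_zero\<sigma>3(1) K_zero\<sigma>3(3)])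
  show "H \<subseteq> K_zero\<sigma>3"
  proof
    fix h assume h: "h \<in> H"
    then show "h \<in> K_zero\<sigma>3"
      using H T0_diag[OF d H order_refl h] by (auto simp: T0_def K_zero\<sigma>3_eq)
  qed
qed (simp add: K_zero\<sigma>3(2) Sdiag_def)

lemma lie_data_T0:
  assumes d: "lie_data H h_T" and H: "H \<subseteq> T0"
  shows "H = T0"
  by (rule lie_dataD(6)[OF d T0(1) T0(3) H]) (simp add: T0(2) h_T_def)

lemma lie_data_H_zero:
  assumes d: "lie_data H (span {mat2 0 0 1 0})" and H: "H \<subseteq> T0"
  shows "H = H_zero\<sigma>3"
proof (rule lie_dataD(6)[OF d H_zero\<sigma>3(1) H_zero\<sigma>3(3)])
  show "H \<subseteq> H_zero\<sigma>3"
  proof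
    fix h assume h: "h \<in> H"
    have z: "(X ** h)$1$1 = 0 \<and> (X ** h)$2$2 = 0" if "h \<in> H" "X \<in> span {mat2 0 0 1 0}" for h X
      using that H by (auto simp: T0_def span_singleton)
    have "h$1$1 = (mat 1 :: real^2^2)$1$1"
      by (rule lie_data_const[OF d has_derivative_entry _ h]) (use z in blast)
    moreover have "h$2$2 = (mat 1 :: real^2^2)$2$2"
      by (rule lie_data_const[OF d has_derivative_entry _ h]) (use z in blast)
    ultimately have "h = mat2 1 0 (h$2$1) 1" using mem_T0_expand[of h] H h by (auto simp: mat2_one)
    then show "h \<in> H_zero\<sigma>3" unfolding H_zero\<sigma>3_def by blast
  qed
qed (simp add: H_zero\<sigma>3(2))

text \<open>On the model the ratio h21/h11 equals the logarithm of h11; the difference of the two is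
  the extra first integral.\<close>

lemma lie_data_H_one:
  assumes d: "lie_data H (span {mat2 1 0 1 1})" and H: "H \<subseteq> T0"
  shows "H = H_one\<sigma>3"
proof (rule lie_dataD(6)[OF d H_one\<sigma>3(1) H_one\<sigma>3(3)])
  have pos: "0 < h$1$1 \<and> 0 < h$2$2 \<and> h$1$2 = 0" if "h \<in> H" for h using that H by (auto simp: T0_def)
  have T: "span {mat2 1 0 1 1} \<subseteq> h_tri 1 1" by (auto simp: span_singleton h_tri_def)
  show "H \<subseteq> H_one\<sigma>3"
  proof
    fix h assume h: "h \<in> H"
    obtain t where t: "h$1$1 = exp (1 * t)" "h$2$2 = exp (1 * t)" using diag_log_const[OF d H T _ h] by auto
    have "h$2$1 / h$1$1 - ln (h$1$1) = (mat 1 :: real^2^2)$2$1 / (mat 1 :: real^2^2)$1$1 - ln ((mat 1 :: real^2^2)$1$1)"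
    proof (rule lie_data_const[OF d _ _ h])
      fix h assume "h \<in> H"
      then have p: "0 < h$1$1" using pos by blast
      show "((\<lambda>h. h$2$1 / h$1$1 - ln (h$1$1)) has_derivative
          (\<lambda>v. (v$2$1 * h$1$1 - h$2$1 * v$1$1) / (h$1$1 * h$1$1) - v$1$1 / h$1$1)) (at h)"
        by (intro has_derivative_diff has_derivative_divide'[OF has_derivative_entry has_derivative_entry]
            has_derivative_ln_entry) (use p in auto)
    next
      fix h X assume hX: "h \<in> H" "X \<in> span {mat2 1 0 1 1}"
      then obtain p q r where "h = mat2 p 0 q r" "p > 0" "r > 0" using H unfolding T0_def by blast
      moreover obtain x where "X = mat2 x 0 x x" using hX(2) unfolding span_one_iff by blast
      ultimately show "((X ** h)$2$1 * h$1$1 - h$2$1 * (X ** h)$1$1) / (h$1$1 * h$1$1) - (X ** h)$1$1 / h$1$1 = 0"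
        by (simp add: field_simps)
    qed
    then have "h$2$1 = exp t * t" using t by (simp add: mat2_one field_simps)
    then have "h = exp t *\<^sub>R mat2 1 0 t 1" using t mem_T0_expand[of h] H h by auto
    then show "h \<in> H_one\<sigma>3" unfolding H_one\<sigma>3_def by blast
  qed
qed (simp add: H_one\<sigma>3(2))

text \<open>Two unit vectors with inner product 1 coincide.\<close>

lemma rotation_eq:
  fixes x y :: real
  assumes "x\<^sup>2 + y\<^sup>2 = 1" "x * cos t + y * sin t = 1"
  shows "x = cos t" "y = sin t"
proof -
  have "(x - cos t)\<^sup>2 + (y - sin t)\<^sup>2 = x\<^sup>2 + y\<^sup>2 + ((cos t)\<^sup>2 + (sin t)\<^sup>2) - 2 * (x * cos t + y * sin t)"
    unfolding power2_eq_square by (simp only: algebra_simps)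
  also have "\<dots> = 0" using assms by simp
  finally show "x = cos t" "y = sin t" by simp_all
qed

text \<open>L is the logarithm of the norm of the first row, and F is the inner product of the
  normalised first row with the direction of angle \<alpha> L that the spiral prescribes. F is
  constant, so its value 1 forces agreement, and no branch of the argument function has to be
  chosen.\<close>

lemma lie_data_H\<sigma>1_real:
  assumes d: "lie_data H (span {mat2 1 \<alpha> (- \<alpha>) 1})" and H: "H \<subseteq> H0\<sigma>1"
  shows "H = H\<sigma>1 (ereal \<alpha>)"
proof (rule lie_dataD(6)[OF d H\<sigma>1_real(1) H\<sigma>1_real(3)])
  show "H \<subseteq> H\<sigma>1 (ereal \<alpha>)"
  proof
    fix h assume h: "h \<in> H"
    define L where "L = (\<lambda>h :: real^2^2. ln (h$1$1 * h$1$1 + h$1$2 * h$1$2) / 2)"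
    define F where "F = (\<lambda>h :: real^2^2. (h$1$1 * cos (\<alpha> * L h) + h$1$2 * sin (\<alpha> * L h)) * exp (- L h))"
    define L' where "L' = (\<lambda>(h :: real^2^2) (v :: real^2^2). (h$1$1 * v$1$1 + h$1$2 * v$1$2) / (h$1$1 * h$1$1 + h$1$2 * h$1$2))"
    define F' where "F' = (\<lambda>(h :: real^2^2) (v :: real^2^2).
      (v$1$1 * cos (\<alpha> * L h) - h$1$1 * (\<alpha> * L' h v * sin (\<alpha> * L h)) + (v$1$2 * sin (\<alpha> * L h) + h$1$2 * (\<alpha> * L' h v * cos (\<alpha> * L h)))) * exp (- L h)
      + (h$1$1 * cos (\<alpha> * L h) + h$1$2 * sin (\<alpha> * L h)) * (- L' h v * exp (- L h)))"
    have pos: "0 < h$1$1 * h$1$1 + h$1$2 * h$1$2" if "h \<in> H" for h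
      using that H by (auto simp: H0\<sigma>1_eq)
    have halve: "2 * X * inverse D * (1 / 2) = X / D" for X D :: real by (simp add: inverse_eq_divide)
    have dL: "(L has_derivative L' h) (at h)" if "h \<in> H" for h
    proof -
      have "((\<lambda>h :: real^2^2. h$1$1 * h$1$1 + h$1$2 * h$1$2) has_derivative
          (\<lambda>v. 2 * (h$1$1 * v$1$1 + h$1$2 * v$1$2))) (at h)"
        by (rule derivative_eq_intros has_derivative_entry refl)+ (simp add: fun_eq_iff algebra_simps)
      note D = has_derivative_mult_left[OF has_derivative_ln[OF pos[OF that] this], of "1 / 2"]
      have "(\<lambda>v :: real^2^2. 2 * (h$1$1 * v$1$1 + h$1$2 * v$1$2) * inverse (h$1$1 * h$1$1 + h$1$2 * h$1$2) * (1 / 2)) = L' h"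
        unfolding L'_def by (intro ext) (rule halve)
      moreover have "(\<lambda>h :: real^2^2. ln (h$1$1 * h$1$1 + h$1$2 * h$1$2) * (1 / 2)) = L"
        unfolding L_def by (rule ext) simp
      ultimately show ?thesis using D by simp
    qed
    have dF: "(F has_derivative F' h) (at h)" if "h \<in> H" for h
      unfolding F_def F'_def
      by (rule derivative_eq_intros has_derivative_entry dL[OF that] refl)+ (simp add: fun_eq_iff algebra_simps)
    have "F h = F (mat 1)"
    proof (rule lie_data_const[OF d dF _ h])
      fix h X assume hX: "h \<in> H" "X \<in> span {mat2 1 \<alpha> (- \<alpha>) 1}"
      obtain x y where xy: "h = mat2 x y (- y) x" "0 < x * x + y * y" using hX(1) H unfolding H0\<sigma>1_eq by blast
      obtain c where c: "X = c *\<^sub>R mat2 1 \<alpha> (- \<alpha>) 1" using hX(2) unfolding span_singleton by blast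
      have v: "(X ** h)$1$1 = c * (x - \<alpha> * y)" "(X ** h)$1$2 = c * (y + \<alpha> * x)" by (simp_all add: c xy algebra_simps)
      have "h$1$1 * (X ** h)$1$1 + h$1$2 * (X ** h)$1$2 = c * (x * x + y * y)" unfolding v by (simp add: xy(1) algebra_simps)
      moreover have "h$1$1 * h$1$1 + h$1$2 * h$1$2 = x * x + y * y" using xy(1) by simp
      moreover have "x * x + y * y \<noteq> 0" using xy(2) by linarith
      ultimately have L': "L' h (X ** h) = c" unfolding L'_def by (metis nonzero_mult_div_cancel_right)
      show "F' h (X ** h) = 0" unfolding F'_def L' v by (simp add: xy(1) algebra_simps)
    qed
    then have F1: "F h = 1" by (simp add: F_def L_def mat2_one)
    obtain x y where xy: "h = mat2 x y (- y) x" "0 < x * x + y * y" using h H unfolding H0\<sigma>1_eq by blast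
    define s where "s = L h"
    have "exp s * exp s = x * x + y * y"
      unfolding s_def L_def using xy by (simp flip: exp_add)
    then have "(x * exp (- s))\<^sup>2 + (y * exp (- s))\<^sup>2 = (exp s * exp (- s))\<^sup>2"
      unfolding power2_eq_square by algebra
    also have "\<dots> = 1" by (simp flip: exp_add)
    finally have "(x * exp (- s))\<^sup>2 + (y * exp (- s))\<^sup>2 = 1" .
    moreover have "x * exp (- s) * cos (\<alpha> * s) + y * exp (- s) * sin (\<alpha> * s) = 1"
      using F1 unfolding F_def s_def[symmetric] by (simp add: xy(1) algebra_simps)
    ultimately have "x * exp (- s) = cos (\<alpha> * s)" "y * exp (- s) = sin (\<alpha> * s)" by (rule rotation_eq)+
    then have "x = exp s * cos (\<alpha> * s)" "y = exp s * sin (\<alpha> * s)" by (simp_all add: exp_minus field_simps)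
    then have "h = exp s *\<^sub>R Rmat (\<alpha> * s)" by (simp add: xy(1) Rmat_def)
    then show "h \<in> H\<sigma>1 (ereal \<alpha>)" unfolding H\<sigma>1_def by auto
  qed
qed (simp add: H\<sigma>1_real(2))

lemma lie_data_H\<sigma>1_infinity:
  assumes d: "lie_data H (span {mat2 0 1 (-1) 0})" and H: "H \<subseteq> H0\<sigma>1"
  shows "H = H\<sigma>1 \<infinity>"
proof (rule lie_dataD(6)[OF d H\<sigma>1_infinity(1) H\<sigma>1_infinity(3)])
  show "H \<subseteq> H\<sigma>1 \<infinity>"
  proof
    fix h assume h: "h \<in> H"
    define F where "F = (\<lambda>h :: real^2^2. h$1$1 * h$1$1 + h$1$2 * h$1$2)"
    have "F h = F (mat 1)"
    proof (rule lie_data_const[OF d _ _ h])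
      fix h show "(F has_derivative (\<lambda>v. 2 * (h$1$1 * v$1$1 + h$1$2 * v$1$2))) (at h)"
        unfolding F_def by (rule derivative_eq_intros has_derivative_entry refl)+ (simp add: fun_eq_iff algebra_simps)
    next
      fix h X assume hX: "h \<in> H" "X \<in> span {mat2 0 1 (-1) 0}"
      obtain x y where xy: "h = mat2 x y (- y) x" "0 < x * x + y * y" using hX(1) H unfolding H0\<sigma>1_eq by blast
      obtain c where c: "X = c *\<^sub>R mat2 0 1 (-1) 0" using hX(2) unfolding span_singleton by blast
      show "2 * (h$1$1 * (X ** h)$1$1 + h$1$2 * (X ** h)$1$2) = 0" by (simp add: c xy(1))
    qed
    moreover obtain x y where xy: "h = mat2 x y (- y) x" "0 < x * x + y * y" using h H unfolding H0\<sigma>1_eq by blast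
    ultimately have "x\<^sup>2 + y\<^sup>2 = 1" by (simp add: F_def mat2_one power2_eq_square)
    then obtain t where "x = cos t" "y = sin t" using sincos_total_2pi by metis
    then show "h \<in> H\<sigma>1 \<infinity>" by (simp add: xy(1) H\<sigma>1_def Rmat_def)
  qed
qed (simp add: H\<sigma>1_infinity(2))

section \<open>Subalgebras of the conformal, diagonal and triangular algebras\<close>

lemma span_scale_singleton:
  fixes x :: "'a::real_vector"
  assumes "k \<noteq> 0"
  shows "span {k *\<^sub>R x} = span {x}"
proof -
  have "x \<in> span {k *\<^sub>R x}"
    using assms span_mul[OF span_base[of "k *\<^sub>R x" "{k *\<^sub>R x}"], of "inverse k"] by simp
  then show ?thesis by (simp add: span_eq span_base span_mul)
qed

text \<open>The hypothesis on f is linearity in the pair of parameters, stated as one equation; the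
  three cases are the dimensions 0, 1 and 2 of S.\<close>

lemma plane_subspace_cases:
  fixes f :: "real \<Rightarrow> real \<Rightarrow> 'a::real_vector"
  assumes f: "\<And>x y x' y' k. f (x + k * x') (y + k * y') = f x y + k *\<^sub>R f x' y'"
    and S: "subspace S" "S \<subseteq> {A. \<exists>x y. A = f x y}"
  obtains "S = {0}" | p q where "p \<noteq> 0 \<or> q \<noteq> 0" "S = span {f p q}" | "S = {A. \<exists>x y. A = f x y}"
proof (cases "S = {0}")
  case False
  have f0: "f 0 0 = 0" using f[of 0 1 0 0 0] by simp
  have fk: "f (k * x) (k * y) = k *\<^sub>R f x y" for k x y using f[of 0 k x 0 y] f0 by simp
  obtain p q where pq: "f p q \<in> S" "f p q \<noteq> 0" using False S subspace_0[OF S(1)] by blast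
  then have "p \<noteq> 0 \<or> q \<noteq> 0" using f0 by auto
  show thesis
  proof (cases "\<forall>x y. f x y \<in> S \<longrightarrow> p * y = q * x")
    case True
    have "A \<in> span {f p q}" if A: "A \<in> S" for A
    proof -
      obtain x y where xy: "A = f x y" using A S(2) by blast
      then have e: "p * y = q * x" using True A by blast
      have "\<exists>k. x = k * p \<and> y = k * q"
      proof (cases "p = 0")
        case True
        then have "q \<noteq> 0" "x = 0" using \<open>p \<noteq> 0 \<or> q \<noteq> 0\<close> e by auto
        then show ?thesis using True by (intro exI[of _ "y / q"]) simp
      next
        case False
        then show ?thesis using e by (intro exI[of _ "x / p"]) (simp add: field_simps)
      qed
      then obtain k where "x = k * p" "y = k * q" by blast
      then have "A = k *\<^sub>R f p q" using fk xy by simp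
      then show ?thesis by (simp add: span_base span_mul)
    qed
    moreover have "span {f p q} \<subseteq> S" using pq S(1) by (simp add: span_minimal)
    ultimately have "S = span {f p q}" by blast
    then show thesis using that(2) \<open>p \<noteq> 0 \<or> q \<noteq> 0\<close> by blast
  next
    case False
    then obtain r s where rs: "f r s \<in> S" "p * s \<noteq> q * r" by blast
    define D where "D = p * s - q * r"
    have D: "D \<noteq> 0" using rs by (simp add: D_def)
    have "f x y \<in> S" for x y
    proof -
      \<comment> \<open>Cramer's rule for writing (x, y) in terms of (p, q) and (r, s).\<close>
      define k l where "k = (x * s - y * r) / D" and "l = (p * y - q * x) / D"
      have "k * p + l * r = (x * (p * s - q * r)) / D" "k * q + l * s = (y * (p * s - q * r)) / D"
        unfolding k_def l_def by (simp_all add: algebra_simps flip: add_divide_distrib diff_divide_distrib)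
      then have "x = k * p + l * r" "y = k * q + l * s" using D by (simp_all add: D_def)
      then have "f x y = k *\<^sub>R f p q + l *\<^sub>R f r s" using f[of "k * p" l r "k * q" s] fk by simp
      then show ?thesis using pq rs S(1) by (simp add: subspace_add subspace_scale)
    qed
    then have "S = {A. \<exists>x y. A = f x y}" using S(2) by blast
    then show thesis by (rule that(3))
  qed
qed (rule that(1))

lemma lie_data_CO:
  assumes d: "lie_data H \<hh>" and H: "H \<subseteq> H0\<sigma>1" and nt: "H \<noteq> {mat 1}"
  shows "(\<exists>\<alpha>. H = H\<sigma>1 (ereal \<alpha>)) \<or> H = H\<sigma>1 \<infinity> \<or> H = H0\<sigma>1"
proof -
  have "\<hh> \<subseteq> {A. \<exists>x y. A = mat2 x y (- y) x}"
    using lie_dataD(3)[OF d] tang_mono[OF H] H0\<sigma>1(2) by blast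
  then consider "\<hh> = {0}" | p q where "p \<noteq> 0 \<or> q \<noteq> 0" "\<hh> = span {mat2 p q (- q) p}" | "\<hh> = {A. \<exists>x y. A = mat2 x y (- y) x}"
    by (rule plane_subspace_cases[OF _ lie_dataD(2)[OF d], of "\<lambda>x y. mat2 x y (- y) x", rotated]) (simp_all add: algebra_simps)
  then show ?thesis
  proof cases
    case 1
    then show ?thesis using lie_data_trivial d nt by blast
  next
    case 2
    show ?thesis
    proof (cases "p = 0")
      case True
      then have "span {mat2 p q (- q) p} = span {q *\<^sub>R mat2 0 1 (-1) 0}" by simp
      also have "\<dots> = span {mat2 0 1 (-1) 0}" using span_scale_singleton 2 True by blast
      finally show ?thesis using lie_data_H\<sigma>1_infinity[OF _ H] d 2 by simp
    next
      case False
      then have "span {mat2 p q (- q) p} = span {p *\<^sub>R mat2 1 (q / p) (- (q / p)) 1}" by simp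
      also have "\<dots> = span {mat2 1 (q / p) (- (q / p)) 1}" using span_scale_singleton False by blast
      finally show ?thesis using lie_data_H\<sigma>1_real[OF _ H] d 2 by auto
    qed
  next
    case 3
    have "H = H0\<sigma>1" by (rule lie_dataD(6)[OF d H0\<sigma>1(1,3) H]) (simp add: H0\<sigma>1(2) 3)
    then show ?thesis by simp
  qed
qed

lemma lie_data_diag:
  assumes d: "lie_data H \<hh>" and H: "H \<subseteq> K_zero\<sigma>3" and nt: "H \<noteq> {mat 1}"
  shows "(\<exists>c a. (c \<noteq> 0 \<or> a \<noteq> 0) \<and> H = Dgrp c a) \<or> H = K_zero\<sigma>3"
proof -
  have HT: "H \<subseteq> T0" using H group_inclusions(3) by blast
  have "\<hh> \<subseteq> {A. \<exists>x y. A = mat2 x 0 0 y}"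
    using lie_dataD(3)[OF d] tang_mono[OF H] K_zero\<sigma>3(2) by blast
  then consider "\<hh> = {0}" | p q where "p \<noteq> 0 \<or> q \<noteq> 0" "\<hh> = span {mat2 p 0 0 q}" | "\<hh> = {A. \<exists>x y. A = mat2 x 0 0 y}"
    by (rule plane_subspace_cases[OF _ lie_dataD(2)[OF d], of "\<lambda>x y. mat2 x 0 0 y", rotated]) (simp_all add: algebra_simps)
  then show ?thesis
  proof cases
    case 1
    then show ?thesis using lie_data_trivial d nt by blast
  next
    case 2
    then show ?thesis using lie_data_Dgrp[OF _ HT] d by blast
  next
    case 3
    then show ?thesis using lie_data_K_zero[OF _ HT] d by (simp add: Sdiag_def)
  qed
qed

lemma conj_T0:
  assumes k: "invertible (mat2 x 0 y z)" and H: "H \<subseteq> T0"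
  shows "conj_set (mat2 x 0 y z) H \<subseteq> T0"
proof
  fix A assume "A \<in> conj_set (mat2 x 0 y z) H"
  then obtain c b a where "c > 0" "a > 0" "A = mat2 x 0 y z ** mat2 c 0 b a ** matrix_inv (mat2 x 0 y z)"
    using H unfolding conj_set_def T0_def by blast
  then show "A \<in> T0" using k by (auto simp: T0_def matrix_inv_mat2)
qed

lemma conj_span: "conj_set g (span {X}) = span {g ** X ** matrix_inv g}"
  unfolding conj_set_def span_singleton
  by (auto simp: image_def matrix_mult.scaleR_left matrix_mult.scaleR_right)

text \<open>If the strictly triangular line lies in the Lie algebra, the algebra is determined by
  its diagonal parts. Otherwise taking diagonal parts is injective, and a triangular conjugation
  brings the algebra to the diagonal or to a Jordan block.\<close>

lemma lie_data_T0_cases: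
  assumes d: "lie_data H \<hh>" and H: "H \<subseteq> T0" and nt: "H \<noteq> {mat 1}"
  shows "\<exists>x y z. invertible (mat2 x 0 y z) \<and> (conj_set (mat2 x 0 y z) H \<in> {H_zero\<sigma>3, H_one\<sigma>3, K_zero\<sigma>3, T0} \<or>
     (\<exists>c a. (c \<noteq> 0 \<or> a \<noteq> 0) \<and> conj_set (mat2 x 0 y z) H \<in> {Dgrp c a, Tgrp c a}))"
proof -
  have sub: "subspace \<hh>" by (rule lie_dataD(2)[OF d])
  have hT: "\<hh> \<subseteq> h_T" using lie_dataD(3)[OF d] tang_mono[OF H] T0(2) by (auto simp: h_T_def)
  have one: "mat2 1 0 0 1 = mat 1" by (simp add: mat2_one)
  have triv: ?thesis if "H \<in> {H_zero\<sigma>3, H_one\<sigma>3, K_zero\<sigma>3, T0} \<or> (\<exists>c a. (c \<noteq> 0 \<or> a \<noteq> 0) \<and> H \<in> {Dgrp c a, Tgrp c a})"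
    using that by (intro exI[of _ 1] exI[of _ 0] exI[of _ 1]) (simp add: one conj_set_one)
  have lin: "k *\<^sub>R A + l *\<^sub>R B \<in> \<hh>" if "A \<in> \<hh>" "B \<in> \<hh>" for k l A B
    using that sub by (simp add: subspace_add subspace_scale)
  show ?thesis
  proof (cases "mat2 0 0 1 0 \<in> \<hh>")
    case N: True
    have shift: "mat2 x 0 y' z \<in> \<hh>" if "mat2 x 0 y z \<in> \<hh>" for x y z y'
      using lin[OF that N, of 1 "y' - y"] by simp
    show ?thesis
    proof (cases "\<forall>x y z. mat2 x 0 y z \<in> \<hh> \<longrightarrow> x = 0 \<and> z = 0")
      case True
      have "\<hh> = span {mat2 0 0 1 0}"
      proof
        show "\<hh> \<subseteq> span {mat2 0 0 1 0}"
        proof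
          fix A assume A: "A \<in> \<hh>"
          then obtain x y z where xyz: "A = mat2 x 0 y z" using hT unfolding h_T_def by blast
          then have "A = y *\<^sub>R mat2 0 0 1 0" using True A by simp
          then show "A \<in> span {mat2 0 0 1 0}" unfolding span_singleton by blast
        qed
        show "span {mat2 0 0 1 0} \<subseteq> \<hh>" using N sub by (simp add: span_minimal)
      qed
      then show ?thesis using triv lie_data_H_zero[OF _ H] d by simp
    next
      case False
      then obtain c y a where ca: "mat2 c 0 y a \<in> \<hh>" "c \<noteq> 0 \<or> a \<noteq> 0" by blast
      show ?thesis
      proof (cases "\<forall>x y z. mat2 x 0 y z \<in> \<hh> \<longrightarrow> c * z = a * x")
        case True
        have "\<hh> = h_tri c a"
        proof
          show "\<hh> \<subseteq> h_tri c a"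
          proof
            fix X assume X: "X \<in> \<hh>"
            then obtain x y z where xyz: "X = mat2 x 0 y z" using hT unfolding h_T_def by blast
            then have e: "c * z = a * x" using True X by blast
            show "X \<in> h_tri c a"
            proof (cases "c = 0")
              case True
              then have "X = mat2 (c * (z / a)) 0 y (a * (z / a))" using ca e xyz by simp
              then show ?thesis unfolding h_tri_def by blast
            next
              case False
              then have "z = a * (x / c)" using e by (simp add: field_simps)
              then have "X = mat2 (c * (x / c)) 0 y (a * (x / c))" using False xyz by simp
              then show ?thesis unfolding h_tri_def by blast
            qed
          qed
          show "h_tri c a \<subseteq> \<hh>"
          proof
            fix X assume "X \<in> h_tri c a"
            then obtain x y where "X = x *\<^sub>R mat2 c 0 0 a + y *\<^sub>R mat2 0 0 1 0"
              by (auto simp: h_tri_def mult.commute)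
            then show "X \<in> \<hh>" using lin[OF shift[OF ca(1), of 0] N, of x y] by (simp only:)
          qed
        qed
        then show ?thesis using triv lie_data_Tgrp[OF _ H ca(2)] d ca(2) by blast
      next
        case False
        then obtain x y' z where xz: "mat2 x 0 y' z \<in> \<hh>" "c * z \<noteq> a * x" by blast
        define D where "D = c * z - a * x"
        have D: "D \<noteq> 0" using xz by (simp add: D_def)
        have "\<hh> = h_T"
        proof
          show "h_T \<subseteq> \<hh>"
          proof
            fix X assume "X \<in> h_T"
            then obtain p q r where X: "X = mat2 p 0 q r" unfolding h_T_def by blast
            define k l where "k = (p * z - r * x) / D" and "l = (c * r - a * p) / D"
            have "k * c + l * x = (p * (c * z - a * x)) / D" "k * a + l * z = (r * (c * z - a * x)) / D"
              unfolding k_def l_def by (simp_all add: algebra_simps flip: add_divide_distrib diff_divide_distrib)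
            then have "p = k * c + l * x" "r = k * a + l * z" using D by (simp_all add: D_def)
            moreover have "mat2 (k * c + l * x) 0 (k * 0 + l * 0) (k * a + l * z) \<in> \<hh>"
              using lin[OF shift[OF ca(1), of 0] shift[OF xz(1), of 0], of k l] by simp
            ultimately show "X \<in> \<hh>" using shift unfolding X by blast
          qed
        qed (rule hT)
        then show ?thesis using triv lie_data_T0[OF _ H] d by simp
      qed
    qed
  next
    case N: False
    have inj: "y = 0" if "mat2 0 0 y 0 \<in> \<hh>" for y
      using N subspace_scale[OF sub that, of "inverse y"] by (cases "y = 0") auto
    have "\<hh> \<noteq> {0}" using lie_data_trivial d nt by blast
    then obtain X where X: "X \<in> \<hh>" "X \<noteq> 0" using subspace_0[OF sub] by blast
    then obtain c b a where cba: "X = mat2 c 0 b a" using hT unfolding h_T_def by blast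
    have ca: "c \<noteq> 0 \<or> a \<noteq> 0" using inj[of b] X cba by (auto simp: mat2_zero)
    show ?thesis
    proof (cases "\<hh> = span {X}")
      case True
      show ?thesis
      proof (cases "c = a")
        case False
        \<comment> \<open>The shear that diagonalises a triangular matrix with distinct
          eigenvalues.\<close>
        define k where "k = mat2 1 0 (b / (a - c)) 1"
        have k: "invertible k" by (simp add: k_def)
        have "conj_set k \<hh> = span {mat2 c 0 0 a}"
          using False unfolding True conj_span cba k_def by (simp add: matrix_inv_mat2 field_simps)
        then have "conj_set k H = Dgrp c a"
          using lie_data_Dgrp[OF _ _ ca] lie_data_conj[OF d k] conj_T0[OF k[unfolded k_def] H] by (simp add: k_def)
        then show ?thesis using k ca unfolding k_def by blast
      next
        case eq: True
        then have a: "a \<noteq> 0" using ca by simp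
        show ?thesis
        proof (cases "b = 0")
          case True
          then have "H = Dgrp c a" using lie_data_Dgrp[OF _ H ca] d \<open>\<hh> = span {X}\<close> cba by simp
          then show ?thesis using triv ca by blast
        next
          case False
          \<comment> \<open>Rescaling the second axis makes the lower left entry equal to the
            eigenvalue a, so the matrix is a multiple of the standard generator.\<close>
          define k where "k = mat2 1 0 0 (a / b)"
          have k: "invertible k" using a False by (simp add: k_def)
          have "conj_set k \<hh> = span {a *\<^sub>R mat2 1 0 1 1}"
            using False a eq unfolding \<open>\<hh> = span {X}\<close> conj_span cba k_def by (simp add: matrix_inv_mat2)
          also have "\<dots> = span {mat2 1 0 1 1}" using span_scale_singleton a by blast
          finally have "conj_set k H = H_one\<sigma>3"
            using lie_data_H_one lie_data_conj[OF d k] conj_T0[OF k[unfolded k_def] H] by (simp add: k_def)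
          then show ?thesis using k unfolding k_def by blast
        qed
      qed
    next
      case False
      moreover have "span {X} \<subseteq> \<hh>" using X sub by (simp add: span_minimal)
      ultimately obtain Y where Y: "Y \<in> \<hh>" "Y \<notin> span {X}" by blast
      then obtain x y z where xyz: "Y = mat2 x 0 y z" using hT unfolding h_T_def by blast
      define D where "D = c * z - a * x"
      have D: "D \<noteq> 0"
      proof
        assume "D = 0"
        then have e: "c * z = a * x" by (simp add: D_def)
        have "mat2 0 0 (c * y - x * b) 0 \<in> \<hh>" "mat2 0 0 (a * y - z * b) 0 \<in> \<hh>"
          using lin[OF Y(1) X(1), of c "- x"] lin[OF Y(1) X(1), of a "- z"] e unfolding xyz cba by (simp_all add: mult.commute)
        then have "c * y = x * b" "a * y = z * b" using inj by fastforce+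
        then have "c *\<^sub>R Y = x *\<^sub>R X" "a *\<^sub>R Y = z *\<^sub>R X" using e unfolding xyz cba by (simp_all add: mult.commute)
        then have "Y = (x / c) *\<^sub>R X \<or> Y = (z / a) *\<^sub>R X"
          using ca by (metis (no_types) divide_inverse_commute scaleR_one scaleR_scaleR left_inverse)
        then show False using Y(2) by (auto simp: span_base span_mul)
      qed
      \<comment> \<open>Cramer's rule again: these are the lower left entries of the elements whose
        diagonal parts are (0, 1) and (1, 0).\<close>
      define b1 d1 where "b1 = (c * y - x * b) / D" and "d1 = (z * b - a * y) / D"
      have "mat2 0 0 b1 1 = (c / D) *\<^sub>R Y + (- x / D) *\<^sub>R X" "mat2 1 0 d1 0 = (- a / D) *\<^sub>R Y + (z / D) *\<^sub>R X"
        unfolding xyz cba b1_def d1_def mat2_arith mat2_eq_iff using D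
        by (simp_all add: divide_simps, simp_all add: D_def algebra_simps)
      then have E: "mat2 0 0 b1 1 \<in> \<hh>" "mat2 1 0 d1 0 \<in> \<hh>" using lin[OF Y(1) X(1)] by metis+
      \<comment> \<open>Closure under brackets enters here: the bracket is strictly triangular,
        hence zero, and a single shear then diagonalises both elements.\<close>
      have "mat2 0 0 (b1 + d1) 0 \<in> \<hh>" using lie_dataD(5)[OF d E] by simp
      then have d1: "d1 = - b1" using inj by fastforce
      define k where "k = mat2 1 0 b1 1"
      have k: "invertible k" by (simp add: k_def)
      have gen: "A = mat2 (A$1$1) 0 (b1 * (A$2$2 - A$1$1)) (A$2$2)" if A: "A \<in> \<hh>" for A
      proof -
        obtain p q r where pqr: "A = mat2 p 0 q r" using hT A unfolding h_T_def by blast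
        have "A - (r *\<^sub>R mat2 0 0 b1 1 + p *\<^sub>R mat2 1 0 d1 0) \<in> \<hh>" using lin[OF E] A sub by (simp add: subspace_diff)
        then have "mat2 0 0 (q - (r * b1 + p * d1)) 0 \<in> \<hh>" by (simp add: pqr)
        then have "q = r * b1 + p * d1" using inj by fastforce
        then show ?thesis by (simp add: pqr d1 algebra_simps)
      qed
      have cj: "k ** mat2 p 0 (b1 * (r - p)) r ** matrix_inv k = mat2 p 0 0 r" for p r
        unfolding k_def by (simp add: matrix_inv_mat2 algebra_simps)
      have "conj_set k \<hh> = Sdiag"
      proof
        show "conj_set k \<hh> \<subseteq> Sdiag"
          unfolding conj_set_def Sdiag_def using gen cj by (metis (mono_tags, lifting) image_subsetI mem_Collect_eq)
        show "Sdiag \<subseteq> conj_set k \<hh>"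
        proof
          fix A assume "A \<in> Sdiag"
          then obtain p r where A: "A = mat2 p 0 0 r" unfolding Sdiag_def by blast
          have "mat2 p 0 (b1 * (r - p)) r \<in> \<hh>" using lin[OF E, of r p] by (simp add: d1 algebra_simps)
          then show "A \<in> conj_set k \<hh>" unfolding conj_set_def A using cj by (metis imageI)
        qed
      qed
      then have "conj_set k H = K_zero\<sigma>3"
        using lie_data_K_zero lie_data_conj[OF d k] conj_T0[OF k[unfolded k_def] H] by (simp add: k_def)
      then show ?thesis using k unfolding k_def by blast
    qed
  qed
qed

section \<open>Reduction to the list\<close>

definition listed :: "(real^(2 + 2)^(2 + 2)) set \<Rightarrow> bool" where
  "listed G \<longleftrightarrow> (\<exists>g\<in>Sp. \<exists>l. admissible l \<and> conj_set g G = grp l)"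

lemma listed_conj:
  assumes g: "g \<in> Sp" and G: "listed (conj_set g G)"
  shows "listed G"
proof -
  obtain k l where k: "k \<in> Sp" "admissible l" "conj_set k (conj_set g G) = grp l"
    using G unfolding listed_def by blast
  then have "conj_set (k ** g) G = grp l" using g by (simp add: conj_set_conj_set Sp_invertible)
  then show ?thesis unfolding listed_def using Sp_mult[OF k(1) g] k(2) by blast
qed

lemma listed_act:
  assumes k: "invertible k" and H: "subgroup H GL" and G: "listed (act k \<Sigma> \<rtimes> conj_set k H)"
  shows "listed (\<Sigma> \<rtimes> H)"
  by (rule listed_conj[OF gmat_Sp[OF k]]) (simp add: conj_semidirect[OF k H] G)

lemma listed_rep:
  assumes l: "admissible l"
  shows "listed (sig l \<rtimes> hgp l)"
proof -
  have "conj_set (gmat 0 (kmat l)) (sig l \<rtimes> hgp l) = grp l"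
    using conj_semidirect[OF kmat_invertible emb_lie_subgroup[OF hgp_emb(1)[OF l]]] grp_rep[OF l] by simp
  then show ?thesis unfolding listed_def using gmat_Sp[OF kmat_invertible] l by blast
qed

lemma act_eq_dim:
  assumes k: "invertible k" and S: "subspace \<Sigma>" and S': "subspace \<Sigma>'" "dim \<Sigma>' = dim \<Sigma>" "act k \<Sigma> \<subseteq> \<Sigma>'"
  shows "act k \<Sigma> = \<Sigma>'"
proof (rule subspace_dim_equal[OF act_subspace[OF S] S'(1) S'(3)])
  have le: "dim (act j A) \<le> dim A" for j and A :: "(real^'a^'a) set"
    unfolding act_def by (rule dim_image_le[OF bounded_linear.linear[OF bounded_linear_conj]])
  show "dim \<Sigma>' \<le> dim (act k \<Sigma>)"
    using le[of "matrix_inv k" "act k \<Sigma>"] act_inverse(1)[OF k] S'(2) by simp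
qed

text \<open>The congruence transform of \<open>mat2 1 0 0 0\<close> by h has lower right entry the
  square of h12, which must vanish. The sign argument makes the diagonal entries positive.\<close>

lemma stab_T0:
  assumes d: "lie_data H \<hh>" and st: "stab S3 H \<or> stab S3p H"
  shows "H \<subseteq> T0"
proof -
  have z: "h$1$2 = 0 \<and> h$1$1 \<noteq> 0 \<and> h$2$2 \<noteq> 0" if h: "h \<in> H" for h
  proof -
    obtain p q r s where hm: "h = mat2 p q r s" by (rule mat2_cases)
    have "mat2 1 0 0 0 \<in> S3" "mat2 1 0 0 0 \<in> S3p" by (auto simp: S_defs)
    then have "transpose h ** mat2 1 0 0 0 ** h \<in> S3 \<or> transpose h ** mat2 1 0 0 0 ** h \<in> S3p"
      using st h unfolding stab_def by blast
    then have "q = 0" unfolding hm by (auto simp: S_defs)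
    moreover have "invertible h" using lie_dataD(1)[OF d] h by (simp add: subgroup_GL_iff)
    ultimately show ?thesis by (simp add: hm)
  qed
  show ?thesis
  proof
    fix h assume h: "h \<in> H"
    have "0 < h$1$1" by (rule lie_data_sign[OF d _ _ _ h]) (use z in \<open>auto simp: mat2_one intro!: continuous_intros\<close>)
    moreover have "0 < h$2$2" by (rule lie_data_sign[OF d _ _ _ h]) (use z in \<open>auto simp: mat2_one intro!: continuous_intros\<close>)
    moreover have "h = mat2 (h$1$1) 0 (h$2$1) (h$2$2)" using z[OF h] by (simp add: vec2_eq_iff)
    ultimately show "h \<in> T0" unfolding T0_def by blast
  qed
qed

text \<open>Preserving either space means preserving or exchanging the two coordinate axes; the
  exchange is ruled out by signs that stay constant on H.\<close>

lemma stab_K_zero: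
  assumes d: "lie_data H \<hh>" and st: "stab Soff H \<or> stab Sdiag H"
  shows "H \<subseteq> K_zero\<sigma>3"
proof -
  have inv: "h$1$1 * h$2$2 - h$1$2 * h$2$1 \<noteq> 0" if "h \<in> H" for h
    using lie_dataD(1)[OF d] that by (auto simp: subgroup_GL_iff invertible_det_nz det_2)
  have z: "h$1$1 = 0 \<and> h$2$2 = 0 \<or> h$1$2 = 0 \<and> h$2$1 = 0" if h: "h \<in> H" for h
  proof -
    obtain p q r s where hm: "h = mat2 p q r s" by (rule mat2_cases)
    have m: "mat2 0 1 1 0 \<in> Soff" "mat2 1 0 0 0 \<in> Sdiag" "mat2 0 0 0 1 \<in> Sdiag" by (auto simp: S_defs)
    from st have "p * r = 0 \<and> q * s = 0 \<or> p * q = 0 \<and> r * s = 0"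
    proof
      assume "stab Soff H"
      then have "transpose h ** mat2 0 1 1 0 ** h \<in> Soff" using h m unfolding stab_def by blast
      then show ?thesis unfolding hm by (auto simp: S_defs)
    next
      assume "stab Sdiag H"
      then have "transpose h ** mat2 1 0 0 0 ** h \<in> Sdiag" "transpose h ** mat2 0 0 0 1 ** h \<in> Sdiag"
        using h m unfolding stab_def by blast+
      then show ?thesis unfolding hm by (auto simp: S_defs)
    qed
    then show ?thesis using inv[OF h] by (auto simp: hm)
  qed
  have z': "h$1$2 = 0 \<and> h$2$1 = 0 \<and> h$1$1 * h$2$2 > 0" if h: "h \<in> H" for h
  proof -
    have "0 < h$1$1 * h$2$2 - h$1$2 * h$2$1"
      by (rule lie_data_sign[OF d _ _ _ h]) (use inv in \<open>auto simp: mat2_one intro!: continuous_intros\<close>)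
    \<comment> \<open>The permanent equals the determinant on diagonal matrices and its negative on
      antidiagonal ones, so both being positive leaves the diagonal case.\<close>
    moreover have "0 < h$1$1 * h$2$2 + h$1$2 * h$2$1"
    proof (rule lie_data_sign[OF d _ _ _ h])
      fix h assume "h \<in> H"
      then show "h$1$1 * h$2$2 + h$1$2 * h$2$1 \<noteq> 0" using z[of h] inv[of h] by auto
    qed (auto simp: mat2_one intro!: continuous_intros)
    ultimately show ?thesis using z[OF h] by auto
  qed
  show ?thesis
  proof
    fix h assume h: "h \<in> H"
    have "0 < h$1$1"
    proof (rule lie_data_sign[OF d _ _ _ h])
      fix h assume "h \<in> H"
      then show "h$1$1 \<noteq> 0" using z'[of h] by auto
    qed (auto simp: mat2_one intro!: continuous_intros)
    moreover from this have "0 < h$2$2" using z'[OF h] by (simp add: zero_less_mult_iff)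
    moreover have "h = mat2 (h$1$1) 0 0 (h$2$2)" using z'[OF h] by (simp add: vec2_eq_iff)
    ultimately show "h \<in> K_zero\<sigma>3" unfolding K_zero\<sigma>3_eq by blast
  qed
qed

text \<open>A matrix of positive determinant whose columns (or rows) are orthogonal of equal length
  satisfies \<open>(p - s)\<^sup>2 + (q + r)\<^sup>2 = p\<^sup>2 + q\<^sup>2 + r\<^sup>2 + s\<^sup>2 - 2 det = 0\<close>.\<close>

lemma stab_CO:
  assumes d: "lie_data H \<hh>" and st: "stab S1 H \<or> stab S1p H"
  shows "H \<subseteq> H0\<sigma>1"
proof
  fix h assume h: "h \<in> H"
  obtain p q r s where hm: "h = mat2 p q r s" by (rule mat2_cases)
  have "0 < h$1$1 * h$2$2 - h$1$2 * h$2$1"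
    by (rule lie_data_sign[OF d _ _ _ h])
      (use lie_dataD(1)[OF d] in \<open>auto simp: subgroup_GL_iff invertible_det_nz det_2 mat2_one intro!: continuous_intros\<close>)
  then have D: "0 < p * s - q * r" by (simp add: hm)
  have m: "mat2 1 0 0 1 \<in> S1" "mat2 1 0 0 (-1) \<in> S1p" "mat2 0 1 1 0 \<in> S1p" by (auto simp: S_defs)
  from st have *: "p * p + r * r = q * q + s * s \<and> p * q + r * s = 0 \<or> p * p + q * q = r * r + s * s \<and> p * r + q * s = 0"
  proof
    assume "stab S1 H"
    then have "transpose h ** mat2 1 0 0 1 ** h \<in> S1" using h m unfolding stab_def by blast
    then show ?thesis unfolding hm by (auto simp: S_defs)
  next
    assume "stab S1p H"
    then have "transpose h ** mat2 1 0 0 (-1) ** h \<in> S1p" "transpose h ** mat2 0 1 1 0 ** h \<in> S1p"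
      using h m unfolding stab_def by blast+
    then show ?thesis unfolding hm by (auto simp: S_defs algebra_simps)
  qed
  have sq: "2 * (p * s - q * r) = p * p + q * q + r * r + s * s"
    using *
  proof
    assume a: "p * p + r * r = q * q + s * s \<and> p * q + r * s = 0"
    have "(p * s - q * r)\<^sup>2 = (p * p + r * r) * (q * q + s * s) - (p * q + r * s)\<^sup>2"
      by (simp add: power2_eq_square algebra_simps)
    also have "\<dots> = (p * p + r * r)\<^sup>2" using a by (simp add: power2_eq_square)
    finally have "p * s - q * r = p * p + r * r" using D by (simp add: power2_eq_iff_nonneg)
    then show ?thesis using a by simp
  next
    assume a: "p * p + q * q = r * r + s * s \<and> p * r + q * s = 0"
    have "(p * s - q * r)\<^sup>2 = (p * p + q * q) * (r * r + s * s) - (p * r + q * s)\<^sup>2"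
      by (simp add: power2_eq_square algebra_simps)
    also have "\<dots> = (p * p + q * q)\<^sup>2" using a by (simp add: power2_eq_square)
    finally have "p * s - q * r = p * p + q * q" using D by (simp add: power2_eq_iff_nonneg)
    then show ?thesis using a by simp
  qed
  have "(p - s)\<^sup>2 + (q + r)\<^sup>2 = 0" using sq by (simp add: power2_eq_square algebra_simps)
  then have "s = p" "r = - q" by auto
  then show "h \<in> H0\<sigma>1" using D unfolding hm H0\<sigma>1_eq by auto
qed

lemma conj_H\<sigma>1_minus: "conj_set (mat2 1 0 0 (-1)) (H\<sigma>1 (ereal \<alpha>)) = H\<sigma>1 (ereal (- \<alpha>))"
proof -
  have "mat2 1 0 0 (-1) ** (exp t *\<^sub>R Rmat (\<alpha> * t)) ** matrix_inv (mat2 1 0 0 (-1)) = exp t *\<^sub>R Rmat (- \<alpha> * t)" for t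
    by (simp add: Rmat_def matrix_inv_mat2)
  then show ?thesis unfolding conj_set_def H\<sigma>1_def by (auto simp: image_iff) metis+
qed

text \<open>The reflection \<open>mat2 1 0 0 (-1)\<close> preserves both spaces and reverses the
  sense of rotation, so a negative slope becomes positive.\<close>

lemma listed_CO:
  assumes d: "lie_data H \<hh>" and nt: "H \<noteq> {mat 1}" and S: "S = S1 \<or> S = S1p" and st: "stab S H"
  shows "listed (S \<rtimes> H)"
proof -
  have H: "H \<subseteq> H0\<sigma>1" using stab_CO[OF d] S st by blast
  have pos: "listed (S \<rtimes> H\<sigma>1 \<alpha>)" if "\<alpha> \<in> {0..\<infinity>}" for \<alpha>
    using S listed_rep[of "L21 \<alpha>"] listed_rep[of "L36 \<alpha>"] that by auto
  show ?thesis using lie_data_CO[OF d H nt]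
  proof (elim disjE exE)
    fix \<alpha> assume \<alpha>: "H = H\<sigma>1 (ereal \<alpha>)"
    show ?thesis
    proof (cases "\<alpha> \<ge> 0")
      case True
      then show ?thesis using pos[of "ereal \<alpha>"] \<alpha> by simp
    next
      case False
      let ?k = "mat2 1 0 0 (-1)"
      have k: "invertible ?k" by simp
      have "act ?k S = S"
      proof (rule act_eq_dim[OF k])
        show "act ?k S \<subseteq> S" using S by (auto simp: act_def S_defs sharp_def matrix_inv_mat2)
      qed (use S dim_S in auto)
      then have "act ?k S \<rtimes> conj_set ?k H = S \<rtimes> H\<sigma>1 (ereal (- \<alpha>))" unfolding \<alpha> conj_H\<sigma>1_minus by simp
      moreover have "listed (S \<rtimes> H\<sigma>1 (ereal (- \<alpha>)))" using pos[of "ereal (- \<alpha>)"] False by simp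
      ultimately show ?thesis using listed_act[OF k lie_dataD(1)[OF d]] by simp
    qed
  next
    assume "H = H\<sigma>1 \<infinity>"
    then show ?thesis using pos[of \<infinity>] by simp
  next
    assume "H = H0\<sigma>1"
    then show ?thesis using S listed_rep[of L31] listed_rep[of L42] by auto
  qed
qed

section \<open>Normalising the exponents\<close>

lemma mem_Tgrp: "A \<in> Tgrp c a \<longleftrightarrow> (\<exists>s t. A = mat2 (exp (c * t)) 0 s (exp (a * t)))"
  by (auto simp: Tgrp_def)

lemma mem_Dgrp: "A \<in> Dgrp c a \<longleftrightarrow> (\<exists>t. A = mat2 (exp (c * t)) 0 0 (exp (a * t)))"
  by (auto simp: Dgrp_def)

lemma Dgrp_scale:
  assumes "k \<noteq> 0"
  shows "Dgrp (k * c) (k * a) = Dgrp c a" "Tgrp (k * c) (k * a) = Tgrp c a"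
proof -
  have "exp (k * c * t) = exp (c * (k * t))" "exp (c * t) = exp (k * c * (t / k))" for c t
    using assms by (simp_all add: mult.commute mult.left_commute)
  then show "Dgrp (k * c) (k * a) = Dgrp c a" "Tgrp (k * c) (k * a) = Tgrp c a"
    unfolding set_eq_iff mem_Dgrp mem_Tgrp by metis+
qed

text \<open>Scaling (c, a) to sum 2 gives (1 + \<alpha>, 1 - \<alpha>) with \<alpha> = (c - a)/(c +
  a). Swapping the exponents changes the sign of \<alpha>, and c + a = 0 is the slope
  \<infinity>.\<close>

lemma Dgrp_Hlc:
  assumes ca: "c \<noteq> 0 \<or> a \<noteq> 0"
  shows "\<exists>\<alpha>\<in>{0..\<infinity>}. Dgrp c a = Hlc \<alpha> \<or> Dgrp a c = Hlc \<alpha>"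
proof (cases "c + a = 0")
  case True
  then have "a = - c" "c \<noteq> 0" using ca by auto
  then have "Dgrp c a = Hlc \<infinity>" using Dgrp_scale(1)[of c 1 "-1"] by (simp add: Hlc_def)
  then show ?thesis by (intro bexI[of _ \<infinity>]) auto
next
  case False
  define \<alpha> where "\<alpha> = (c - a) / (c + a)"
  have "1 + \<alpha> = 2 / (c + a) * c" "1 - \<alpha> = 2 / (c + a) * a"
    using False unfolding \<alpha>_def by (simp_all add: field_simps)
  then have *: "Dgrp (1 + \<alpha>) (1 - \<alpha>) = Dgrp c a" "Dgrp (1 - \<alpha>) (1 + \<alpha>) = Dgrp a c"
    using Dgrp_scale(1)[of "2 / (c + a)"] False by simp_all
  show ?thesis
  proof (cases "\<alpha> \<ge> 0")
    case True
    then show ?thesis using * by (intro bexI[of _ "ereal \<alpha>"]) (auto simp: Hlc_def)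
  next
    case False
    then show ?thesis using * by (intro bexI[of _ "ereal (- \<alpha>)"]) (auto simp: Hlc_def)
  qed
qed

text \<open>\<open>kSW\<close> exchanges the two light-cone axes, preserves both spaces and
  interchanges the exponents.\<close>

lemma listed_diag:
  assumes d: "lie_data H \<hh>" and nt: "H \<noteq> {mat 1}" and S: "S = Soff \<or> S = Sdiag" and st: "stab S H"
  shows "listed (S \<rtimes> H)"
proof -
  have H: "H \<subseteq> K_zero\<sigma>3" using stab_K_zero[OF d] S st by blast
  have pos: "listed (S \<rtimes> Hlc \<alpha>)" if "\<alpha> \<in> {0..\<infinity>}" for \<alpha>
    using S listed_rep[of "L22 \<alpha>"] listed_rep[of "L37 \<alpha>"] that by auto
  show ?thesis using lie_data_diag[OF d H nt]
  proof
    assume "\<exists>c a. (c \<noteq> 0 \<or> a \<noteq> 0) \<and> H = Dgrp c a"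
    then obtain c a where H: "H = Dgrp c a" and ca: "c \<noteq> 0 \<or> a \<noteq> 0" by blast
    have k: "invertible kSW" by (simp add: kSW_def)
    have "act kSW S = S"
    proof (rule act_eq_dim[OF k])
      show "act kSW S \<subseteq> S" using S by (auto simp: act_def S_defs sharp_def matrix_inv_mat2 kSW_def)
    qed (use S dim_S in auto)
    moreover have "conj_set kSW (Dgrp c a) = Dgrp a c"
      unfolding conj_set_def Dgrp_def image_image by (simp add: kSW_def matrix_inv_mat2)
    ultimately have "listed (S \<rtimes> Dgrp a c) \<Longrightarrow> listed (S \<rtimes> H)"
      using listed_act[OF k lie_dataD(1)[OF d], of S] H by simp
    then show ?thesis using Dgrp_Hlc[OF ca] pos H by metis
  next
    assume "H = K_zero\<sigma>3"
    then show ?thesis using S listed_rep[of L32] listed_rep[of L43] by auto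
  qed
qed

text \<open>The symplectic rotation \<open>e\<^sub>2 \<mapsto> f\<^sub>2\<close>, \<open>f\<^sub>2 \<mapsto> - e\<^sub>2\<close>; it interchanges the lower
  left entry of \<open>h\<close> with the off-diagonal entry of \<open>\<sigma>\<close>.\<close>

definition flip :: "real^(2 + 2)^(2 + 2)" where
  "flip = block_matrix (mat2 1 0 0 0) (- mat2 0 0 0 1) (mat2 0 0 0 1) (mat2 1 0 0 0)"

lemma flip_Sp: "flip \<in> Sp"
  by (simp add: Sp_iff flip_def Jmat_def mat2_one mat2_zero)

lemma flip_gmat:
  assumes "x > 0" "y > 0"
  shows "flip ** gmat (mat2 u v v 0) (mat2 x 0 s y) ** matrix_inv flip =
    gmat (mat2 (u + 2 * v * s / x) (s / x) (s / x) 0) (mat2 x 0 (- v * x) (1 / y))"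
proof -
  have "flip ** transpose flip = mat 1" by (simp add: flip_def block_one mat2_one mat2_zero)
  then have "matrix_inv flip = transpose flip" by (rule matrix_inv_unique)
  then show ?thesis
    using assms by (simp add: flip_def gmat_def sharp_def matrix_inv_mat2 mat2_zero field_simps)
qed

text \<open>Conjugation acts on the parameters by (u, v, x, s, y) to (u + 2 v s / x, s / x, x, - v
  x, 1 / y), an invertible substitution, so an equality of groups reduces to matching membership
  conditions.\<close>

lemma conj_flip:
  assumes S: "\<Sigma> \<subseteq> S3p" "\<Sigma>' \<subseteq> S3p" and H: "H \<subseteq> T0" "H' \<subseteq> T0"
    and eq: "\<And>u v x s y. x > 0 \<Longrightarrow> y > 0 \<Longrightarrow> mat2 u v v 0 \<in> \<Sigma> \<and> mat2 x 0 s y \<in> H \<longleftrightarrow>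
      mat2 (u + 2 * v * s / x) (s / x) (s / x) 0 \<in> \<Sigma>' \<and> mat2 x 0 (- v * x) (1 / y) \<in> H'"
  shows "conj_set flip (\<Sigma> \<rtimes> H) = \<Sigma>' \<rtimes> H'"
proof (intro equalityI subsetI)
  fix A assume "A \<in> conj_set flip (\<Sigma> \<rtimes> H)"
  then obtain \<sigma> h where A: "\<sigma> \<in> \<Sigma>" "h \<in> H" "A = flip ** gmat \<sigma> h ** matrix_inv flip"
    unfolding conj_set_def semidirect_def by blast
  obtain u v where \<sigma>: "\<sigma> = mat2 u v v 0" using A S unfolding S3p_def by blast
  obtain x s y where h: "h = mat2 x 0 s y" "x > 0" "y > 0" using A H unfolding T0_def by blast
  show "A \<in> \<Sigma>' \<rtimes> H'"
    unfolding A \<sigma> h(1) flip_gmat[OF h(2,3)] semidirect_def using eq[OF h(2,3), of u v s] A \<sigma> h(1) by blast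
next
  fix A assume "A \<in> \<Sigma>' \<rtimes> H'"
  then obtain \<sigma> h where A: "\<sigma> \<in> \<Sigma>'" "h \<in> H'" "A = gmat \<sigma> h" unfolding semidirect_def by blast
  obtain u' v' where \<sigma>: "\<sigma> = mat2 u' v' v' 0" using A S unfolding S3p_def by blast
  obtain x s' y' where h: "h = mat2 x 0 s' y'" "x > 0" "y' > 0" using A H unfolding T0_def by blast
  define u v s y where "u = u' + 2 * s' * v' / x" and "v = - s' / x" and "s = v' * x" and "y = 1 / y'"
  have y: "y > 0" using h by (simp add: y_def)
  have e: "u + 2 * v * s / x = u'" "s / x = v'" "- v * x = s'" "1 / y = y'"
    using h by (simp_all add: u_def v_def s_def y_def field_simps)
  then have "mat2 u v v 0 \<in> \<Sigma>" "mat2 x 0 s y \<in> H" using eq[OF h(2) y, of u v s] A \<sigma> h(1) by simp_all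
  moreover have "A = flip ** gmat (mat2 u v v 0) (mat2 x 0 s y) ** matrix_inv flip"
    unfolding flip_gmat[OF h(2) y] e A \<sigma> h(1) ..
  ultimately show "A \<in> conj_set flip (\<Sigma> \<rtimes> H)" unfolding conj_set_def semidirect_def by blast
qed

text \<open>The entry y becomes 1/y, which negates the second exponent. A free v becomes a free s
  and conversely, so a two-dimensional \<Sigma> with diagonal H turns into a one-dimensional
  \<Sigma> with triangular H.\<close>

lemma conj_flip_models:
  "conj_set flip (S3 \<rtimes> Dgrp c a) = S3 \<rtimes> Dgrp c (- a)"
  "conj_set flip (S3p \<rtimes> K_zero\<sigma>3) = S3 \<rtimes> T0"
  "conj_set flip (S3p \<rtimes> Dgrp c a) = S3 \<rtimes> Tgrp c (- a)"
  "conj_set flip (S3p \<rtimes> Tgrp c a) = S3p \<rtimes> Tgrp c (- a)"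
proof -
  have S: "S3 \<subseteq> S3p" "S3p \<subseteq> S3p" by (auto simp: S_defs)
  have D: "Dgrp c a \<subseteq> T0" for c a using group_inclusions(2,3) by blast
  have S3: "mat2 p q q r \<in> S3 \<longleftrightarrow> q = 0 \<and> r = 0" for p q r by (auto simp: S_defs)
  have S3p: "mat2 p q q r \<in> S3p \<longleftrightarrow> r = 0" for p q r by (auto simp: S_defs)
  have K: "mat2 x 0 s y \<in> K_zero\<sigma>3 \<longleftrightarrow> s = 0 \<and> 0 < x \<and> 0 < y" for x s y by (auto simp: K_zero\<sigma>3_eq)
  have T: "mat2 x 0 s y \<in> T0 \<longleftrightarrow> 0 < x \<and> 0 < y" for x s y by (auto simp: T0_def)
  have y: "1 / y = exp (- z) \<longleftrightarrow> y = exp z" for y z :: real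
    by (auto simp: exp_minus inverse_eq_divide)
  show "conj_set flip (S3 \<rtimes> Dgrp c a) = S3 \<rtimes> Dgrp c (- a)"
    by (rule conj_flip[OF S(1) S(1) D D]) (auto simp: S3 mem_Dgrp y)
  show "conj_set flip (S3p \<rtimes> K_zero\<sigma>3) = S3 \<rtimes> T0"
    by (rule conj_flip[OF S(2) S(1) group_inclusions(3) order_refl]) (auto simp: S3 S3p K T)
  show "conj_set flip (S3p \<rtimes> Dgrp c a) = S3 \<rtimes> Tgrp c (- a)"
    by (rule conj_flip[OF S(2) S(1) D group_inclusions(6)]) (auto simp: S3 S3p mem_Dgrp mem_Tgrp y)
  show "conj_set flip (S3p \<rtimes> Tgrp c a) = S3p \<rtimes> Tgrp c (- a)"
    by (rule conj_flip[OF S(2) S(2) group_inclusions(6) group_inclusions(6)]) (auto simp: S3p mem_Tgrp y)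
qed

text \<open>Scaling by 1/(a - c) makes the difference of the exponents 1; the condition c a \<le> 0
  then reads \<gamma> (\<gamma> + 1) \<le> 0.\<close>

lemma unit_slope:
  fixes c a :: real
  assumes "c \<noteq> a"
  shows "\<exists>k \<gamma>. k \<noteq> 0 \<and> \<gamma> = k * c \<and> \<gamma> + 1 = k * a \<and> (c * a \<le> 0 \<longrightarrow> \<gamma> \<in> {-1..0})"
proof (intro exI conjI impI)
  define k where "k = 1 / (a - c)"
  show "k \<noteq> 0" "k * c + 1 = k * a" using assms by (simp_all add: k_def field_simps)
  then have e: "k * a = 1 + k * c" by simp
  assume "c * a \<le> 0"
  then have "(k * k) * (c * a) \<le> 0" by (simp add: mult_nonneg_nonpos)
  then have "(k * c) * (1 + k * c) \<le> 0" unfolding e[symmetric] by (simp add: mult.commute mult.left_commute)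
  then show "k * c \<in> {-1..0}" by (auto simp: mult_le_0_iff)
qed simp

text \<open>Equal exponents cannot be scaled to difference 1; they give the separate group
  \<open>L34\<close>.\<close>

lemma listed_S3_Tgrp: "listed (S3 \<rtimes> Tgrp c a)" if ca: "c \<noteq> 0 \<or> a \<noteq> 0"
proof (cases "c = a")
  case True
  then have "Tgrp c a = Tgrp 1 1" using Dgrp_scale(2)[of c 1 1] ca by simp
  then show ?thesis using listed_rep[of L34] by simp
next
  case False
  then obtain k \<gamma> where "k \<noteq> 0" "\<gamma> = k * c" "\<gamma> + 1 = k * a" using unit_slope by blast
  then show ?thesis using listed_rep[of "L35 \<gamma>"] Dgrp_scale(2)[of k c a] by simp
qed

text \<open>The flip keeps this family and negates the second exponent, so the exponents may be
  assumed not to have the same strict sign; this is where [-1, 0] comes from.\<close>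

lemma listed_S3_Dgrp: "listed (S3 \<rtimes> Dgrp c a)" if ca: "c \<noteq> 0 \<or> a \<noteq> 0"
proof -
  have *: "listed (S3 \<rtimes> Dgrp c a)" if ca: "c \<noteq> 0 \<or> a \<noteq> 0" "c * a \<le> 0" for c a
  proof -
    have "c \<noteq> a" using ca by (auto simp: mult_le_0_iff)
    then obtain k \<gamma> where "k \<noteq> 0" "\<gamma> = k * c" "\<gamma> + 1 = k * a" "\<gamma> \<in> {-1..0}" using unit_slope ca by blast
    then show ?thesis using listed_rep[of "L25 \<gamma>"] Dgrp_scale(1)[of k c a] by simp
  qed
  show ?thesis
  proof (cases "c * a \<le> 0")
    case False
    then have "listed (conj_set flip (S3 \<rtimes> Dgrp c a))"
      using *[of c "- a"] ca by (simp add: conj_flip_models)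
    then show ?thesis by (rule listed_conj[OF flip_Sp])
  qed (use * ca in blast)
qed

lemma listed_S3p_Tgrp: "listed (S3p \<rtimes> Tgrp c a)" if ca: "c \<noteq> 0 \<or> a \<noteq> 0"
proof -
  have *: "listed (S3p \<rtimes> Tgrp c a)" if ca: "c \<noteq> 0 \<or> a \<noteq> 0" "c * a \<le> 0" for c a
  proof -
    have "a \<noteq> c" "a * c \<le> 0" using ca by (auto simp: mult_le_0_iff mult.commute)
    then obtain k \<gamma> where "k \<noteq> 0" "\<gamma> = k * a" "\<gamma> + 1 = k * c" "\<gamma> \<in> {-1..0}" using unit_slope by blast
    then show ?thesis using listed_rep[of "L44 \<gamma>"] Dgrp_scale(2)[of k c a] by simp
  qed
  show ?thesis
  proof (cases "c * a \<le> 0")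
    case False
    then have "listed (conj_set flip (S3p \<rtimes> Tgrp c a))"
      using *[of c "- a"] ca by (simp add: conj_flip_models)
    then show ?thesis by (rule listed_conj[OF flip_Sp])
  qed (use * ca in blast)
qed

text \<open>With \<open>S3p\<close>, the groups with diagonal H have no label of their own: the flip
  identifies them with groups over \<open>S3\<close> having triangular H.\<close>

lemma listed_T0:
  assumes d: "lie_data H \<hh>" and nt: "H \<noteq> {mat 1}" and S: "S = S3 \<or> S = S3p" and st: "stab S H"
  shows "listed (S \<rtimes> H)"
proof -
  have H: "H \<subseteq> T0" using stab_T0[OF d] S st by blast
  obtain x y z where k: "invertible (mat2 x 0 y z)" and cases: "conj_set (mat2 x 0 y z) H \<in> {H_zero\<sigma>3, H_one\<sigma>3, K_zero\<sigma>3, T0} \<or>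
     (\<exists>c a. (c \<noteq> 0 \<or> a \<noteq> 0) \<and> conj_set (mat2 x 0 y z) H \<in> {Dgrp c a, Tgrp c a})"
    using lie_data_T0_cases[OF d H nt] by blast
  have "act (mat2 x 0 y z) S = S"
  proof (rule act_eq_dim[OF k])
    show "act (mat2 x 0 y z) S \<subseteq> S" using S k by (auto simp: act_def S_defs sharp_def matrix_inv_mat2)
  qed (use S dim_S in auto)
  moreover have "listed (S \<rtimes> conj_set (mat2 x 0 y z) H)"
    using cases
  proof
    assume "conj_set (mat2 x 0 y z) H \<in> {H_zero\<sigma>3, H_one\<sigma>3, K_zero\<sigma>3, T0}"
    moreover have "listed (S3p \<rtimes> K_zero\<sigma>3)"
      by (rule listed_conj[OF flip_Sp]) (use listed_rep[of L41] in \<open>simp add: conj_flip_models\<close>)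
    ultimately show ?thesis
      using S listed_rep[of L23] listed_rep[of L24] listed_rep[of L33] listed_rep[of L41]
        listed_rep[of L38] listed_rep[of L39] listed_rep[of L51] by auto
  next
    assume "\<exists>c a. (c \<noteq> 0 \<or> a \<noteq> 0) \<and> conj_set (mat2 x 0 y z) H \<in> {Dgrp c a, Tgrp c a}"
    then obtain c a where ca: "c \<noteq> 0 \<or> a \<noteq> 0" and H: "conj_set (mat2 x 0 y z) H \<in> {Dgrp c a, Tgrp c a}" by blast
    have "listed (S3p \<rtimes> Dgrp c a)"
      by (rule listed_conj[OF flip_Sp]) (use listed_S3_Tgrp[of c "- a"] ca in \<open>simp add: conj_flip_models\<close>)
    then show ?thesis using S H listed_S3_Tgrp[OF ca] listed_S3_Dgrp[OF ca] listed_S3p_Tgrp[OF ca] by auto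
  qed
  ultimately show ?thesis using listed_act[OF k lie_dataD(1)[OF d]] by simp
qed

section \<open>Normal forms of subspaces of symmetric matrices\<close>

lemma Sym_mat2: "mat2 p q q' r \<in> Sym \<longleftrightarrow> q' = q"
  by (auto simp: Sym_def)

text \<open>Cases by the determinant D: a definite form becomes a multiple of the identity, an
  indefinite one is written in a basis of isotropic vectors, a degenerate one is a multiple of a
  square. The scalar u is kept because only the spanned line matters.\<close>

lemma quadratic_form_normal:
  assumes \<sigma>: "\<sigma> \<in> Sym" "\<sigma> \<noteq> 0"
  obtains m u where "invertible (m :: real^2^2)" "u \<noteq> 0"
    "transpose m ** \<sigma> ** m \<in> {mat2 u 0 0 u, mat2 0 u u 0, mat2 u 0 0 0}"
proof -
  obtain p q q' r where "\<sigma> = mat2 p q q' r" by (rule mat2_cases)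
  then have s: "\<sigma> = mat2 p q q r" using \<sigma> Sym_mat2 by simp
  have nz: "p \<noteq> 0 \<or> q \<noteq> 0 \<or> r \<noteq> 0" using \<sigma> s by (auto simp: mat2_zero)
  define D where "D = p * r - q * q"
  consider "D > 0" | "D < 0" "p = 0" | "D < 0" "p \<noteq> 0" | "D = 0" "p = 0" | "D = 0" "p \<noteq> 0" by linarith
  then show thesis
  proof cases
    case 1
    then have p: "p \<noteq> 0" unfolding D_def by (metis diff_0 mult_zero_left neg_0_less_iff_less not_square_less_zero)
    \<comment> \<open>Removing the cross term leaves the second diagonal entry D/p; scaling the
      second basis vector by t turns it into p.\<close>
    define t where "t = \<bar>p\<bar> / sqrt D"
    have t: "t * t * D = p * p" "t \<noteq> 0" using 1 p by (simp_all add: t_def field_simps)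
    have "transpose (mat2 1 (- q * t / p) 0 t) ** \<sigma> ** mat2 1 (- q * t / p) 0 t = mat2 p 0 0 (t * t * D / p)"
      using p by (simp add: s D_def field_simps)
    also have "\<dots> = mat2 p 0 0 p" using p t by simp
    finally show thesis using that[of "mat2 1 (- q * t / p) 0 t" p] p t by simp
  next
    case 2
    then have q: "q \<noteq> 0" by (auto simp: D_def)
    then show thesis using 2 that[of "mat2 1 (- r / (2 * q)) 0 1" q] by (simp add: s)
  next
    case 3
    \<comment> \<open>The vectors (x, 1) and (y, 1) are isotropic when x and y are the two roots of
      p z^2 + 2 q z + r, whose discriminant is -4 D.\<close>
    define d where "d = sqrt (- D)"
    have d: "d > 0" "d * d = q * q - p * r" using 3 by (simp_all add: d_def) (simp add: D_def)
    define x y where "x = (- q + d) / p" and "y = (- q - d) / p"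
    have px: "p * x = - q + d" "p * y = - q - d" using 3 by (simp_all add: x_def y_def)
    have "p * (p * x * x + 2 * q * x + r) = 0" "p * (p * y * y + 2 * q * y + r) = 0"
      using px d(2) by algebra+
    then have xy: "p * x * x + 2 * q * x + r = 0" "p * y * y + 2 * q * y + r = 0" using 3 by simp_all
    define u where "u = p * x * y + q * (x + y) + r"
    have "p * u = 2 * D" unfolding u_def D_def using px d(2) by algebra
    then have u: "u \<noteq> 0" using 3 by auto
    have "p * (x - y) = 2 * d" using px by (simp add: algebra_simps)
    then have "x \<noteq> y" using d by auto
    moreover have "transpose (mat2 x y 1 1) ** \<sigma> ** mat2 x y 1 1 = mat2 0 u u 0"
      using xy by (simp add: s u_def algebra_simps)
    ultimately show thesis using that[of "mat2 x y 1 1" u] u by simp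
  next
    case 4
    then have "q = 0" by (simp add: D_def)
    then show thesis using 4 nz that[of "mat2 0 1 1 0" r] by (simp add: s)
  next
    case 5
    then have "r = q * q / p" by (simp add: D_def field_simps)
    then show thesis using 5 that[of "mat2 1 (- q / p) 0 1" p] by (simp add: s)
  qed
qed

lemma act_matrix_inv: "invertible m \<Longrightarrow> act (matrix_inv m) \<Sigma> = (\<lambda>\<sigma>. transpose m ** \<sigma> ** m) ` \<Sigma>"
  unfolding act_def by (simp add: sharp_matrix_inv matrix_inv_matrix_inv)

lemma dim_one_normal:
  fixes \<Sigma> :: "(real^2^2) set"
  assumes S: "subspace \<Sigma>" "\<Sigma> \<subseteq> Sym" "dim \<Sigma> = 1"
  obtains k where "invertible k" "act k \<Sigma> \<in> {S1, Soff, S3}"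
proof -
  obtain \<sigma> where \<sigma>: "\<sigma> \<in> \<Sigma>" "\<sigma> \<noteq> 0" using S(3) dim_eq_0[of \<Sigma>] by auto
  have "span {\<sigma>} = \<Sigma>"
    by (rule subspace_dim_equal) (use S \<sigma> in \<open>auto simp: span_minimal dim_insert\<close>)
  then have el: "\<exists>c. A = c *\<^sub>R \<sigma>" if "A \<in> \<Sigma>" for A using that unfolding span_singleton by blast
  obtain m u where m: "invertible (m :: real^2^2)" "u \<noteq> 0"
    "transpose m ** \<sigma> ** m \<in> {mat2 u 0 0 u, mat2 0 u u 0, mat2 u 0 0 0}"
    using quadratic_form_normal \<sigma> S(2) by blast
  have "c *\<^sub>R mat2 u 0 0 u \<in> S1" "c *\<^sub>R mat2 0 u u 0 \<in> Soff" "c *\<^sub>R mat2 u 0 0 0 \<in> S3" for c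
    by (simp_all add: S_defs)
  then have "\<exists>M\<in>{S1, Soff, S3}. \<forall>c. c *\<^sub>R (transpose m ** \<sigma> ** m) \<in> M"
    using m(3) by (elim insertE emptyE) (simp_all only:, blast+)
  then obtain M where M: "M \<in> {S1, Soff, S3}" "\<And>c. c *\<^sub>R (transpose m ** \<sigma> ** m) \<in> M" by blast
  have "act (matrix_inv m) \<Sigma> = M"
  proof (rule act_eq_dim)
    show "act (matrix_inv m) \<Sigma> \<subseteq> M"
    proof
      fix A assume "A \<in> act (matrix_inv m) \<Sigma>"
      then obtain c where "A = transpose m ** (c *\<^sub>R \<sigma>) ** m" using el act_matrix_inv[OF m(1)] by force
      also have "\<dots> = c *\<^sub>R (transpose m ** \<sigma> ** m)"
        by (simp add: matrix_mult.scaleR_left matrix_mult.scaleR_right)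
      finally show "A \<in> M" using M(2) by simp
    qed
  qed (use S M dim_S invertible_matrix_inv[OF m(1)] in auto)
  then show thesis using that[OF invertible_matrix_inv[OF m(1)]] M(1) by blast
qed

lemma inner_mat2: "mat2 a b c d \<bullet> mat2 a' b' c' d' = a * a' + b * b' + c * c' + d * d'"
  by (simp add: inner_vec_def sum_2)

text \<open>A two-dimensional \<Sigma> is the orthogonal complement in \<open>Sym\<close> of a
  single symmetric \<tau>; bringing \<tau> to normal form brings \<Sigma> to normal form by the
  contragredient congruence.\<close>

lemma dim_two_normal:
  fixes \<Sigma> :: "(real^2^2) set"
  assumes S: "subspace \<Sigma>" "\<Sigma> \<subseteq> Sym" "dim \<Sigma> = 2"
  obtains k where "invertible k" "act k \<Sigma> \<in> {S1p, Sdiag, S3p}"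
proof -
  \<comment> \<open>Orthogonality to the skew-symmetric generator forces \<tau> to be symmetric, and
    the dimension count still leaves a nonzero vector.\<close>
  have "dim (insert (mat2 0 1 (-1) 0) \<Sigma>) \<le> 3" using S(3) by (simp add: dim_insert)
  then have "dim (insert (mat2 0 1 (-1) 0) \<Sigma>) < DIM(real^2^2)" by simp
  then obtain \<tau> where \<tau>: "\<tau> \<noteq> 0" "\<And>y. y \<in> span (insert (mat2 0 1 (-1) 0) \<Sigma>) \<Longrightarrow> orthogonal \<tau> y"
    using orthogonal_to_subspace_exists by blast
  obtain p q q' r where t: "\<tau> = mat2 p q q' r" by (rule mat2_cases)
  have "orthogonal \<tau> (mat2 0 1 (-1) 0)" by (rule \<tau>(2)) (simp add: span_base)
  then have q': "q' = q" by (simp add: orthogonal_def t inner_mat2)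
  then have Sym: "\<tau> \<in> Sym" by (simp add: t Sym_mat2)
  have tr: "trace (\<sigma> ** \<tau>) = 0" if \<sigma>: "\<sigma> \<in> \<Sigma>" for \<sigma>
  proof -
    obtain a b b' d where s: "\<sigma> = mat2 a b b' d" by (rule mat2_cases)
    have "b' = b" using \<sigma> S(2) s Sym_mat2 by blast
    moreover have "orthogonal \<tau> \<sigma>" by (rule \<tau>(2)) (simp add: span_base \<sigma>)
    ultimately show ?thesis by (simp add: s t q' orthogonal_def inner_mat2 algebra_simps)
  qed
  obtain m0 u where m0: "invertible (m0 :: real^2^2)" "u \<noteq> 0"
    "transpose m0 ** \<tau> ** m0 \<in> {mat2 u 0 0 u, mat2 0 u u 0, mat2 u 0 0 0}"
    using quadratic_form_normal Sym \<tau>(1) by blast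
  \<comment> \<open>In the degenerate case the axes are swapped, because \<open>S3p\<close> has a
    vanishing lower right entry and is thus orthogonal to \<open>mat2 0 0 0 1\<close>.\<close>
  have "\<exists>m. invertible m \<and> transpose m ** \<tau> ** m \<in> {mat2 u 0 0 u, mat2 0 u u 0, mat2 0 0 0 u}"
  proof (cases "transpose m0 ** \<tau> ** m0 = mat2 u 0 0 0")
    case True
    have "transpose (m0 ** kSW) ** \<tau> ** (m0 ** kSW) = transpose kSW ** (transpose m0 ** \<tau> ** m0) ** kSW"
      by (simp add: matrix_transpose_mul matrix_mul_assoc)
    also have "\<dots> = mat2 0 0 0 u" unfolding True by (simp add: kSW_def)
    finally show ?thesis using m0(1) by (intro exI[of _ "m0 ** kSW"]) (simp add: invertible_mult kSW_def)
  qed (use m0 in blast)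
  then obtain m where m: "invertible m" "transpose m ** \<tau> ** m \<in> {mat2 u 0 0 u, mat2 0 u u 0, mat2 0 0 0 u}" by blast
  \<comment> \<open>The trace pairing between \<open>act k \<Sigma>\<close> and k \<tau> k^t is
    invariant, so the congruence by m that normalises \<tau> corresponds to k = m^t on
    \<Sigma>.\<close>
  define k where "k = transpose m"
  have k: "invertible k" using m(1) by (simp add: k_def invertible_det_nz)
  have tr': "trace (A ** (k ** \<tau> ** transpose k)) = 0" "A \<in> Sym" if A: "A \<in> act k \<Sigma>" for A
  proof -
    obtain \<sigma> where \<sigma>: "\<sigma> \<in> \<Sigma>" "A = sharp k ** \<sigma> ** matrix_inv k" using A unfolding act_def by blast
    have "A ** (k ** \<tau> ** transpose k) = sharp k ** (\<sigma> ** (matrix_inv k ** k) ** \<tau> ** transpose k)"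
      unfolding \<sigma> by (simp add: matrix_mul_assoc)
    then have "trace (A ** (k ** \<tau> ** transpose k)) = trace (\<sigma> ** \<tau> ** transpose k ** sharp k)"
      using trace_mul_sym matrix_inv[OF k] by simp
    also have "\<dots> = trace (\<sigma> ** \<tau>)" using sharp_eq(2)[OF k] by (simp flip: matrix_mul_assoc)
    finally show "trace (A ** (k ** \<tau> ** transpose k)) = 0" using tr \<sigma> by simp
    show "A \<in> Sym" using act_Sym[OF k S(2)] A by blast
  qed
  have k\<tau>: "k ** \<tau> ** transpose k \<in> {mat2 u 0 0 u, mat2 0 u u 0, mat2 0 0 0 u}"
    using m(2) by (simp add: k_def)
  have "\<exists>M\<in>{S1p, Sdiag, S3p}. act k \<Sigma> \<subseteq> M"
  proof -
    have el: "\<exists>a b d. A = mat2 a b b d \<and> trace (mat2 a b b d ** (k ** \<tau> ** transpose k)) = 0"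
      if A: "A \<in> act k \<Sigma>" for A
      using tr'[OF A] by (metis mat2_cases Sym_mat2)
    consider "k ** \<tau> ** transpose k = mat2 u 0 0 u" | "k ** \<tau> ** transpose k = mat2 0 u u 0"
      | "k ** \<tau> ** transpose k = mat2 0 0 0 u" using k\<tau> by blast
    then show ?thesis
    proof cases
      case 1
      have "A \<in> S1p" if A: "A \<in> act k \<Sigma>" for A
      proof -
        obtain a b d where A: "A = mat2 a b b d" "a * u + d * u = 0" using el[OF A] unfolding 1 by auto
        then have "(a + d) * u = 0" by (simp add: algebra_simps)
        then have "d = - a" using m0(2) by simp
        then show ?thesis using A(1) by (auto simp: S_defs)
      qed
      then show ?thesis by blast
    next
      case 2
      have "A \<in> Sdiag" if A: "A \<in> act k \<Sigma>" for A
        using el[OF A] m0(2) unfolding 2 by (auto simp: S_defs)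
      then show ?thesis by blast
    next
      case 3
      have "A \<in> S3p" if A: "A \<in> act k \<Sigma>" for A
        using el[OF A] m0(2) unfolding 3 by (auto simp: S_defs)
      then show ?thesis by blast
    qed
  qed
  then obtain M where M: "M \<in> {S1p, Sdiag, S3p}" "act k \<Sigma> \<subseteq> M" by blast
  have "act k \<Sigma> = M" by (rule act_eq_dim[OF k]) (use S M dim_S in auto)
  then show thesis using that k M(1) by blast
qed

text \<open>After the congruence six stabilisers remain, two inside each of the conformal, diagonal
  and triangular groups. Block diagonal conjugation keeps H connected in its own topology only
  implicitly, through the transported Lie data.\<close>

theorem class_E_pair_listed:
  assumes E: "class_E_pair \<Sigma> H" and dim: "1 \<le> dim \<Sigma>" "dim \<Sigma> \<le> 2"
  shows "listed (\<Sigma> \<rtimes> H)"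
proof -
  have S: "subspace \<Sigma>" "\<Sigma> \<subseteq> Sym" and H: "connected_lie_subgroup H" "H \<noteq> {mat 1}" "subgroup (\<Sigma> \<rtimes> H) GL"
    using E unfolding class_E_pair_def by auto
  obtain \<hh> where d: "lie_data H \<hh>" using connected_lie_subgroup_lie_data[OF H(1)] by blast
  note sub = lie_dataD(1)[OF d]
  have "dim \<Sigma> = 1 \<or> dim \<Sigma> = 2" using dim by linarith
  then obtain k where k: "invertible k" "act k \<Sigma> \<in> {S1, Soff, S3, S1p, Sdiag, S3p}"
    using dim_one_normal[OF S] dim_two_normal[OF S] by (metis insert_iff)
  have st: "stab (act k \<Sigma>) (conj_set k H)" by (rule stab_conj[OF k(1) stab_of_subgroup[OF sub S(1) H(3)]])
  have d': "lie_data (conj_set k H) (conj_set k \<hh>)" by (rule lie_data_conj[OF d k(1)])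
  have nt: "conj_set k H \<noteq> {mat 1}"
  proof
    assume "conj_set k H = {mat 1}"
    then have "conj_set (matrix_inv k) {mat 1} = H" using conj_set_inverse(1)[OF k(1), of H] by simp
    then show False using H(2) k(1) by (simp add: conj_set_def matrix_inv invertible_matrix_inv)
  qed
  have "listed (act k \<Sigma> \<rtimes> conj_set k H)"
    using k(2) listed_CO[OF d' nt _ st] listed_diag[OF d' nt _ st] listed_T0[OF d' nt _ st] by auto
  then show ?thesis by (rule listed_act[OF k(1) sub])
qed

theorem theorem2p1:
  shows "(\<forall>(\<Sigma> :: (real^2^2) set) H.
            class_E_pair \<Sigma> H \<and> 1 \<le> dim \<Sigma> \<and> dim \<Sigma> \<le> 2 \<longrightarrow>
            (\<exists>g\<in>Sp. \<exists>l. admissible l \<and> conj_set g (\<Sigma> \<rtimes> H) = grp l))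
       \<and> (\<forall>l. admissible l \<longrightarrow>
            grp l \<in> class_E \<and> (\<exists>T. lie_subgroup (grp_dim l) (grp l) T))
       \<and> (\<forall>l l'. admissible l \<and> admissible l' \<and> l \<noteq> l' \<longrightarrow>
            \<not> (\<exists>g\<in>Sp. conj_set g (grp l) = grp l'))"
proof (intro conjI allI impI)
  fix \<Sigma> :: "(real^2^2) set" and H
  assume "class_E_pair \<Sigma> H \<and> 1 \<le> dim \<Sigma> \<and> dim \<Sigma> \<le> 2"
  then show "\<exists>g\<in>Sp. \<exists>l. admissible l \<and> conj_set g (\<Sigma> \<rtimes> H) = grp l"
    using class_E_pair_listed unfolding listed_def by blast
next
  fix l assume "admissible l"
  then show "grp l \<in> class_E" "\<exists>T. lie_subgroup (grp_dim l) (grp l) T" using grp_class_E by blast+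
next
  fix l l' assume "admissible l \<and> admissible l' \<and> l \<noteq> l'"
  then show "\<not> (\<exists>g\<in>Sp. conj_set g (grp l) = grp l')" using grp_not_conj by blast
qed

end
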